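(* Under the standing assumptions (see context), let $u_1\in\Theta$ be an upper semicontinuous viscosity subsolution and $u_2\in\Theta$ a lower semicontinuous viscosity supersolution of equation (4.1). Then $u_1(t,x)\le u_2(t,x)$ for all $(t,x)\in[0,T]\times\mathbb R^n$. In particular, two continuous viscosity solutions of (4.1) belonging to $\Theta$ coincide.
   Context: Standing assumptions: $U,V$ compact metric spaces; $b:[0,T]\times\mathbb R^n\times U\times V\to\mathbb R^n$, $\sigma:\dots\to\mathbb R^{n\times d}$ continuous in $(t,u,v)$, Lipschitz in $x$ uniformly; $f:[0,T]\times\mathbb R^n\times\mathbb R\times\mathbb R^d\times U\times V\to\mathbb R$ continuous in $(t,u,v)$, Lipschitz in $(x,y,z)$ uniformly; $\Phi:\mathbb R^n\to\mathbb R$ Lipschitz; $h,h':[0,T]\times\mathbb R^n\to\mathbb R$ continuous in $t$, Lipschitz in $x$ uniformly, $h<h'$, $h(T,\cdot)\le\Phi\le h'(T,\cdot)$. $H^-(t,x,y,q,X)=\sup_{u\in U}\inf_{v\in V}\{\tfrac12\mathrm{tr}(\sigma\sigma^T(t,x,u,v)X)+q\cdot b(t,x,u,v)+f(t,x,y,q\sigma(t,x,u,v),u,v)\}$. Equation (4.1): $\min\{w-h,\max[-\partial_tw-H^-(t,x,w,Dw,D^2w),w-h']\}=0$, $w(T,\cdot)=\Phi$. An upper semicontinuous $w$ is a viscosity subsolution of (4.1) if $w(T,x)\le\Phi(x)$ and for every $\varphi\in C^3$ with bounded derivatives of orders 1–3 and $(t,x)\in[0,T)\times\mathbb R^n$ at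 which $w-\varphi$ has a local maximum, $\min\{w(t,x)-h(t,x),\max[-\partial_t\varphi(t,x)-H^-(t,x,w(t,x),D\varphi,D^2\varphi),w(t,x)-h'(t,x)]\}\le0$; a lower semicontinuous $w$ is a supersolution if $w(T,\cdot)\ge\Phi$ and at local minima of $w-\varphi$ the same expression is $\ge0$; a viscosity solution is a continuous function that is both. $\Theta$ is the class of functions $\varphi:[0,T]\times\mathbb R^n\to\mathbb R$ for which there is $\tilde A>0$ with $\lim_{|x|\to\infty}|\varphi(t,x)|\exp\{-\tilde A[\log((|x|^2+1)^{1/2})]^2\}=0$ uniformly in $t\in[0,T]$. *)

theory Defs
  imports "HOL-Analysis.Analysis"
begin

text \<open>State space R^n is real^'n, Brownian dimension d is 'd; sigma takes values in
  n x d matrices real^'d^'n; q sigma (row vector times matrix) is q v* sigma.\<close>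

definition mtrace :: "real^'n^'n \<Rightarrow> real" where
  "mtrace M = (\<Sum>i\<in>UNIV. M $ i $ i)"

definition standing_assumptions ::
  "real \<Rightarrow> 'u::metric_space set \<Rightarrow> 'v::metric_space set
   \<Rightarrow> (real \<Rightarrow> real^'n \<Rightarrow> 'u \<Rightarrow> 'v \<Rightarrow> real^'n)
   \<Rightarrow> (real \<Rightarrow> real^'n \<Rightarrow> 'u \<Rightarrow> 'v \<Rightarrow> real^'d^'n)
   \<Rightarrow> (real \<Rightarrow> real^'n \<Rightarrow> real \<Rightarrow> real^'d \<Rightarrow> 'u \<Rightarrow> 'v \<Rightarrow> real)
   \<Rightarrow> (real^'n \<Rightarrow> real)
   \<Rightarrow> (real \<Rightarrow> real^'n \<Rightarrow> real) \<Rightarrow> (real \<Rightarrow> real^'n \<Rightarrow> real) \<Rightarrow> bool" where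
  "standing_assumptions T U V b \<sigma> f \<Phi> h h' \<longleftrightarrow>
     0 < T \<and> compact U \<and> U \<noteq> {} \<and> compact V \<and> V \<noteq> {} \<and>
     (\<forall>x. continuous_on ({0..T} \<times> U \<times> V) (\<lambda>(t,u,v). b t x u v)) \<and>
     (\<forall>x. continuous_on ({0..T} \<times> U \<times> V) (\<lambda>(t,u,v). \<sigma> t x u v)) \<and>
     (\<exists>L. \<forall>t\<in>{0..T}. \<forall>u\<in>U. \<forall>v\<in>V. \<forall>x x'.
          norm (b t x u v - b t x' u v) \<le> L * dist x x' \<and>
          norm (\<sigma> t x u v - \<sigma> t x' u v) \<le> L * dist x x') \<and>
     (\<forall>x y z. continuous_on ({0..T} \<times> U \<times> V) (\<lambda>(t,u,v). f t x y z u v)) \<and>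
     (\<exists>L. \<forall>t\<in>{0..T}. \<forall>u\<in>U. \<forall>v\<in>V. \<forall>x x' y y' z z'.
          \<bar>f t x y z u v - f t x' y' z' u v\<bar> \<le> L * (dist x x' + dist y y' + dist z z')) \<and>
     (\<exists>L. \<forall>x x'. \<bar>\<Phi> x - \<Phi> x'\<bar> \<le> L * dist x x') \<and>
     (\<forall>x. continuous_on {0..T} (\<lambda>t. h t x)) \<and>
     (\<forall>x. continuous_on {0..T} (\<lambda>t. h' t x)) \<and>
     (\<exists>L. \<forall>t\<in>{0..T}. \<forall>x x'. \<bar>h t x - h t x'\<bar> \<le> L * dist x x' \<and>
                                \<bar>h' t x - h' t x'\<bar> \<le> L * dist x x') \<and>
     (\<forall>t\<in>{0..T}. \<forall>x. h t x < h' t x) \<and>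
     (\<forall>x. h T x \<le> \<Phi> x \<and> \<Phi> x \<le> h' T x)"

definition Hminus ::
  "'u set \<Rightarrow> 'v set
   \<Rightarrow> (real \<Rightarrow> real^'n \<Rightarrow> 'u \<Rightarrow> 'v \<Rightarrow> real^'n)
   \<Rightarrow> (real \<Rightarrow> real^'n \<Rightarrow> 'u \<Rightarrow> 'v \<Rightarrow> real^'d^'n)
   \<Rightarrow> (real \<Rightarrow> real^'n \<Rightarrow> real \<Rightarrow> real^'d \<Rightarrow> 'u \<Rightarrow> 'v \<Rightarrow> real)
   \<Rightarrow> real \<Rightarrow> real^'n \<Rightarrow> real \<Rightarrow> real^'n \<Rightarrow> real^'n^'n \<Rightarrow> real" where
  "Hminus U V b \<sigma> f t x y q X =
     (SUP u\<in>U. INF v\<in>V.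
        (1/2) * mtrace ((\<sigma> t x u v ** transpose (\<sigma> t x u v)) ** X)
        + q \<bullet> b t x u v + f t x y (q v* \<sigma> t x u v) u v)"

definition C3_bounded_derivs ::
  "(real \<times> (real^'n) \<Rightarrow> real)
   \<Rightarrow> (real \<times> (real^'n) \<Rightarrow> (real \<times> (real^'n)) \<Rightarrow>\<^sub>L real)
   \<Rightarrow> (real \<times> (real^'n) \<Rightarrow> (real \<times> (real^'n)) \<Rightarrow>\<^sub>L (real \<times> (real^'n)) \<Rightarrow>\<^sub>L real)
   \<Rightarrow> (real \<times> (real^'n) \<Rightarrow> (real \<times> (real^'n)) \<Rightarrow>\<^sub>L (real \<times> (real^'n)) \<Rightarrow>\<^sub>L (real \<times> (real^'n)) \<Rightarrow>\<^sub>L real)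
   \<Rightarrow> bool" where
  "C3_bounded_derivs \<phi> D1 D2 D3 \<longleftrightarrow>
     (\<forall>p. (\<phi> has_derivative blinfun_apply (D1 p)) (at p)) \<and>
     (\<forall>p. (D1 has_derivative blinfun_apply (D2 p)) (at p)) \<and>
     (\<forall>p. (D2 has_derivative blinfun_apply (D3 p)) (at p)) \<and>
     continuous_on UNIV D3 \<and>
     bounded (range D1) \<and> bounded (range D2) \<and> bounded (range D3)"

definition dt :: "(real \<times> (real^'n) \<Rightarrow> (real \<times> (real^'n)) \<Rightarrow>\<^sub>L real) \<Rightarrow> real \<times> (real^'n) \<Rightarrow> real" where
  "dt D1 p = blinfun_apply (D1 p) (1, 0)"

definition grad :: "(real \<times> (real^'n) \<Rightarrow> (real \<times> (real^'n)) \<Rightarrow>\<^sub>L real) \<Rightarrow> real \<times> (real^'n) \<Rightarrow> real^'n" where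
  "grad D1 p = (\<chi> i. blinfun_apply (D1 p) (0, axis i 1))"

definition hess :: "(real \<times> (real^'n) \<Rightarrow> (real \<times> (real^'n)) \<Rightarrow>\<^sub>L (real \<times> (real^'n)) \<Rightarrow>\<^sub>L real)
   \<Rightarrow> real \<times> (real^'n) \<Rightarrow> real^'n^'n" where
  "hess D2 p = (\<chi> i j. blinfun_apply (blinfun_apply (D2 p) (0, axis i 1)) (0, axis j 1))"

definition usc_on :: "real \<Rightarrow> (real \<Rightarrow> real^'n \<Rightarrow> real) \<Rightarrow> bool" where
  "usc_on T w \<longleftrightarrow> (\<forall>p\<in>{0..T} \<times> UNIV. \<forall>e>0. \<exists>\<delta>>0. \<forall>q\<in>{0..T} \<times> UNIV.
      dist q p < \<delta> \<longrightarrow> case_prod w q < case_prod w p + e)"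

definition lsc_on :: "real \<Rightarrow> (real \<Rightarrow> real^'n \<Rightarrow> real) \<Rightarrow> bool" where
  "lsc_on T w \<longleftrightarrow> (\<forall>p\<in>{0..T} \<times> UNIV. \<forall>e>0. \<exists>\<delta>>0. \<forall>q\<in>{0..T} \<times> UNIV.
      dist q p < \<delta> \<longrightarrow> case_prod w p - e < case_prod w q)"

definition eq41_expr where
  "eq41_expr U V b \<sigma> f h h' w D1 D2 t x =
     min (w t x - h t x)
         (max (- dt D1 (t,x) - Hminus U V b \<sigma> f t x (w t x) (grad D1 (t,x)) (hess D2 (t,x)))
              (w t x - h' t x))"

definition visc_subsolution where
  "visc_subsolution T U V b \<sigma> f \<Phi> h h' w \<longleftrightarrow>
     usc_on T w \<and> (\<forall>x. w T x \<le> \<Phi> x) \<and>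
     (\<forall>\<phi> D1 D2 D3 t x. C3_bounded_derivs \<phi> D1 D2 D3 \<longrightarrow> t \<in> {0..<T} \<longrightarrow>
        (\<exists>\<delta>>0. \<forall>s\<in>{0..T}. \<forall>y. dist (s,y) (t,x) < \<delta> \<longrightarrow>
             w s y - \<phi> (s,y) \<le> w t x - \<phi> (t,x)) \<longrightarrow>
        eq41_expr U V b \<sigma> f h h' w D1 D2 t x \<le> 0)"

definition visc_supersolution where
  "visc_supersolution T U V b \<sigma> f \<Phi> h h' w \<longleftrightarrow>
     lsc_on T w \<and> (\<forall>x. w T x \<ge> \<Phi> x) \<and>
     (\<forall>\<phi> D1 D2 D3 t x. C3_bounded_derivs \<phi> D1 D2 D3 \<longrightarrow> t \<in> {0..<T} \<longrightarrow>
        (\<exists>\<delta>>0. \<forall>s\<in>{0..T}. \<forall>y. dist (s,y) (t,x) < \<delta> \<longrightarrow>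
             w s y - \<phi> (s,y) \<ge> w t x - \<phi> (t,x)) \<longrightarrow>
        eq41_expr U V b \<sigma> f h h' w D1 D2 t x \<ge> 0)"

definition visc_solution where
  "visc_solution T U V b \<sigma> f \<Phi> h h' w \<longleftrightarrow>
     continuous_on ({0..T} \<times> UNIV) (\<lambda>(t,x). w t x) \<and>
     visc_subsolution T U V b \<sigma> f \<Phi> h h' w \<and> visc_supersolution T U V b \<sigma> f \<Phi> h h' w"

definition Theta :: "real \<Rightarrow> (real \<Rightarrow> real^'n \<Rightarrow> real) set" where
  "Theta T = {w. \<exists>A>0. \<forall>\<epsilon>>0. \<exists>R. \<forall>t\<in>{0..T}. \<forall>x. norm x \<ge> R \<longrightarrow>
      \<bar>w t x\<bar> * exp (- A * (ln (sqrt (norm x ^ 2 + 1)))^2) < \<epsilon>}"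

end

theory Submission
  imports Defs "HOL-Complex_Analysis.Great_Picard"
begin

text \<open>On a short time interval ending at \<open>s\<close>, where \<open>u1 \<le> u2\<close> is already known, scale the barrier
  \<open>exp (psi x / (c (t - t0)))\<close> so that it touches \<open>u1 - u2\<close> from above. Because it blows up at
  \<open>t0\<close> and outgrows every function of \<^term>\<open>Theta T\<close>, the touching points lie in a compact set away
  from \<open>t = s\<close>, and because it is a strict supersolution of the linearised equation, doubling
  the variables there contradicts the viscosity inequalities. Since \<open>s - t0\<close> depends on the data only,
  finitely many such steps reach \<open>t = 0\<close>.

  Doubling needs second-order jets at almost-maximal points of \<open>f p + g q - |L (p - q)|\<^sup>2 / 2\<close>. These are
  obtained without Alexandrov's or Rademacher's theorem: an energy estimate shows that the third difference
  quotients of a semiconvex function tend to zero in measure, the contact points near a strict maximum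
  are not negligible, and blowing up at a contact point with small third differences gives a
  quadratic approximation up to \<open>\<epsilon> \<rho>\<^sup>2\<close> at some scale \<open>\<rho>\<close>, which is all that test functions need.\<close>

section \<open>Semiconvex functions\<close>

text \<open>The growth class dictates the barrier. The coefficients grow linearly, so the
  second-order part applied to \<open>exp (a * psi x)\<close>, with \<open>psi\<close> of the order
  of the squared logarithm in the class, costs a multiple of \<open>a^2 * psi x\<close> times the
  barrier. An exponent with \<open>a' = - c * a^2\<close> pays for this, but it blows up in finite
  time: hence intervals of length \<open>1 / (c * A)\<close>, on which \<open>a\<close> stays above
  the growth rate \<open>A\<close> of both functions. The constant \<open>c\<close> adds up the
  costs of the linearised equation: \<open>7 * K^2\<close> for the second-order part,
  \<open>4 * K\<close> for the drift, \<open>4 * Lc * K\<close> for the dependence of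
  \<open>f\<close> on the gradient and \<open>Lc\<close> for that on the value, where
  \<open>f\<close> has no monotonicity. The obstacles drop out at a touching point because of the
  strict gap \<open>u1 > u2\<close>: the supersolution gives \<open>u2 \<ge> h\<close>, so
  \<open>u1 > h\<close>; then the subsolution gives \<open>u1 \<le> h'\<close>, so
  \<open>u2 < h'\<close>, and both differential inequalities remain.\<close>

definition semiconvex :: "real \<Rightarrow> ('a::real_normed_vector \<Rightarrow> real) \<Rightarrow> bool" where
  "semiconvex C W \<longleftrightarrow> (\<forall>x y t. 0 \<le> t \<longrightarrow> t \<le> 1 \<longrightarrow>
     W ((1 - t) *\<^sub>R x + t *\<^sub>R y) \<le> (1 - t) * W x + t * W y + C * t * (1 - t) * (norm (x - y))\<^sup>2)"

lemma semiconvexD: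
  assumes "semiconvex C W" "0 \<le> t" "t \<le> 1"
  shows "W ((1 - t) *\<^sub>R x + t *\<^sub>R y) \<le> (1 - t) * W x + t * W y + C * t * (1 - t) * (norm (x - y))\<^sup>2"
  using assms by (simp add: semiconvex_def)

lemma norm_sq_combination:
  fixes x y :: "'a::real_inner"
  shows "(norm ((1 - t) *\<^sub>R x + t *\<^sub>R y))\<^sup>2
    = (1 - t) * (norm x)\<^sup>2 + t * (norm y)\<^sup>2 - t * (1 - t) * (norm (x - y))\<^sup>2"
  unfolding power2_norm_eq_inner
  by (simp add: inner_add_left inner_add_right inner_diff_left inner_diff_right)
    (simp add: algebra_simps inner_commute)

lemma semiconvex_imp_convex:
  fixes W :: "'a::real_inner \<Rightarrow> real"
  assumes "semiconvex C W"
  shows "convex_on UNIV (\<lambda>z. W z + C * (norm z)\<^sup>2)"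
proof (rule convex_onI)
  fix t :: real and x y :: 'a
  assume t: "0 < t" "t < 1"
  have "W ((1 - t) *\<^sub>R x + t *\<^sub>R y) \<le> (1 - t) * W x + t * W y + C * t * (1 - t) * (norm (x - y))\<^sup>2"
    using semiconvexD[OF assms] t by simp
  then show "W ((1 - t) *\<^sub>R x + t *\<^sub>R y) + C * (norm ((1 - t) *\<^sub>R x + t *\<^sub>R y))\<^sup>2
      \<le> (1 - t) * (W x + C * (norm x)\<^sup>2) + t * (W y + C * (norm y)\<^sup>2)"
    unfolding norm_sq_combination by (simp add: algebra_simps)
qed auto

lemma semiconvex_continuous:
  fixes W :: "'a::euclidean_space \<Rightarrow> real"
  assumes "semiconvex C W"
  shows "continuous_on S W"
proof -
  have "continuous_on UNIV (\<lambda>z. W z + C * (norm z)\<^sup>2)"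
    using convex_on_continuous[OF open_UNIV semiconvex_imp_convex[OF assms]] .
  then have "continuous_on UNIV (\<lambda>z. (W z + C * (norm z)\<^sup>2) - C * (norm z)\<^sup>2)"
    by (rule continuous_on_diff) (intro continuous_intros)
  then have "continuous_on UNIV W" by (simp only: add_diff_cancel_right')
  then show ?thesis by (rule continuous_on_subset) simp
qed

section \<open>Second difference quotients and the decay of their increments\<close>

definition sdq :: "('a::real_vector \<Rightarrow> real) \<Rightarrow> 'a \<Rightarrow> real \<Rightarrow> 'a \<Rightarrow> real" where
  "sdq W v h x = (W (x + h *\<^sub>R v) - 2 * W x + W (x - h *\<^sub>R v)) / h\<^sup>2"

text \<open>Doubling the step averages the quotient with weights 1/4, 1/2, 1/4. Up to a small
  enlargement of the domain, integration does not see the shifts, so the integral of a convex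
  function of the quotient is monotone along dyadic steps.\<close>

lemma sdq_double:
  assumes "h \<noteq> 0"
  shows "sdq W v (2 * h) x
    = (sdq W v h (x + h *\<^sub>R v) + 2 * sdq W v h x + sdq W v h (x - h *\<^sub>R v)) / 4"
proof -
  have e: "x + h *\<^sub>R v + h *\<^sub>R v = x + (2 * h) *\<^sub>R v" "x - h *\<^sub>R v - h *\<^sub>R v = x - (2 * h) *\<^sub>R v"
    "x + h *\<^sub>R v - h *\<^sub>R v = x" "x - h *\<^sub>R v + h *\<^sub>R v = x"
    by (simp_all add: algebra_simps flip: scaleR_2)
  show ?thesis unfolding sdq_def e using assms by (simp add: field_simps)
qed

lemma sdq_lower:
  assumes "semiconvex C W" "h \<noteq> 0"
  shows "sdq W v h x \<ge> - (2 * C * (norm v)\<^sup>2)"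
proof -
  have e: "(1 - 1/2) *\<^sub>R (x + h *\<^sub>R v) + (1/2) *\<^sub>R (x - h *\<^sub>R v) = x"
    by (simp add: algebra_simps flip: scaleR_add_left)
  have n: "(norm (x + h *\<^sub>R v - (x - h *\<^sub>R v)))\<^sup>2 = 4 * h\<^sup>2 * (norm v)\<^sup>2"
    by (simp add: power_mult_distrib flip: scaleR_2)
  have "W x \<le> W (x + h *\<^sub>R v) / 2 + W (x - h *\<^sub>R v) / 2 + C * h\<^sup>2 * (norm v)\<^sup>2"
    using semiconvexD[OF assms(1), of "1/2" "x + h *\<^sub>R v" "x - h *\<^sub>R v"] unfolding e n by simp
  then have "W (x + h *\<^sub>R v) - 2 * W x + W (x - h *\<^sub>R v) \<ge> - (2 * C * (norm v)\<^sup>2) * h\<^sup>2"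
    by (simp add: algebra_simps)
  then show ?thesis unfolding sdq_def using assms(2) by (simp add: le_divide_eq)
qed

text \<open>Jensen's inequality for \<open>exp\<close> with a quantified deficit. Written with the
  half exponentials \<open>p\<close>, \<open>q\<close>, \<open>r\<close>, two estimates of the form
  \<open>2 * x * y \<le> x^2 + y^2\<close> leave the square of \<open>p - q\<close> to spare;
  \<open>a\<close> and \<open>b\<close> will be the quotients at two neighbouring points.\<close>

lemma exp_average_gap:
  fixes a b c :: real
  shows "exp (- ((a + 2 * b + c) / 4)) + (exp (- a / 2) - exp (- b / 2))\<^sup>2 / 4
    \<le> (exp (- a) + 2 * exp (- b) + exp (- c)) / 4"
proof -
  define p q r where "p = exp (- a / 2)" "q = exp (- b / 2)" "r = exp (- c / 2)"
  have sq: "exp (- a) = p\<^sup>2" "exp (- b) = q\<^sup>2" "exp (- c) = r\<^sup>2"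
    by (simp_all add: p_q_r_def power2_eq_square flip: exp_add)
  define s t where "s = exp (- (a + b) / 4)" "t = exp (- (b + c) / 4)"
  have st: "exp (- ((a + 2 * b + c) / 4)) = s * t" "s\<^sup>2 = p * q" "t\<^sup>2 = q * r"
    by (simp_all add: s_t_def p_q_r_def power2_eq_square field_simps flip: exp_add)
  have "2 * (s * t) \<le> p * q + q * r"
    using sum_squares_bound[of s t] st by simp
  moreover have "2 * (q * r) \<le> q\<^sup>2 + r\<^sup>2"
    using sum_squares_bound[of q r] by simp
  ultimately show ?thesis
    unfolding sq st(1) p_q_r_def[symmetric] by (simp add: power2_diff field_simps)
qed

text \<open>Translation invariance, paid for by enlarging the ball by the length of the shift. This
  is what forces the energy estimate onto growing balls.\<close>

lemma ball_integral_shift_le: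
  fixes g :: "'a::euclidean_space \<Rightarrow> real"
  assumes g: "continuous_on UNIV g" "\<And>x. 0 \<le> g x"
  shows "(LINT x|lborel. indicator (cball z R) x *\<^sub>R g (x + c))
       \<le> (LINT x|lborel. indicator (cball z (R + norm c)) x *\<^sub>R g x)"
proof -
  let ?F = "\<lambda>x. indicator (cball z R) (x - c) *\<^sub>R g x"
  have int: "integrable lborel (\<lambda>x. indicator S x *\<^sub>R g x)" if "compact S" for S
    using borel_integrable_compact[OF that] g continuous_on_subset by blast
  have F: "?F = (\<lambda>x. indicator (cball (z + c) R) x *\<^sub>R g x)"
    by (auto simp: indicator_def dist_norm algebra_simps fun_eq_iff)
  have "(LINT x|lborel. indicator (cball z R) x *\<^sub>R g (x + c)) = (LINT x|lborel. ?F (c + x))"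
    by (simp add: add.commute)
  also have "\<dots> = (LINT x|distr lborel borel ((+) c). ?F x)"
    by (subst integral_distr) (unfold F, auto intro!: borel_measurable_continuous_on_indicator[where 'b=real, unfolded real_scaleR_def] continuous_on_subset[OF g(1)])
  also have "\<dots> = (LINT x|lborel. ?F x)" by (simp add: lborel_distr_plus)
  also have "\<dots> \<le> (LINT x|lborel. indicator (cball z (R + norm c)) x *\<^sub>R g x)"
    unfolding F
  proof (rule integral_mono)
    fix x
    have "cball (z + c) R \<subseteq> cball z (R + norm c)"
      by (subst cball_subset_cball_iff) (simp add: dist_norm)
    then show "indicator (cball (z + c) R) x *\<^sub>R g x \<le> indicator (cball z (R + norm c)) x *\<^sub>R g x"
      using g(2)[of x] by (auto simp: indicator_def)
  qed (intro int compact_cball)+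
  finally show ?thesis .
qed

text \<open>The exponential makes a quantity that is only bounded below into one bounded on both
  sides. With the factor 1/2 its square is \<open>exp (- sdq W v h x)\<close>, so the deficit in
  \<open>exp_average_gap\<close> is the squared increment of \<open>mdq\<close>.\<close>

definition mdq :: "('a::real_vector \<Rightarrow> real) \<Rightarrow> 'a \<Rightarrow> real \<Rightarrow> 'a \<Rightarrow> real" where
  "mdq W v h x = exp (- sdq W v h x / 2)"

lemma continuous_sdq:
  fixes W :: "'a::euclidean_space \<Rightarrow> real"
  assumes "continuous_on UNIV W" "h \<noteq> 0"
  shows "continuous_on S (sdq W v h)"
  unfolding sdq_def
  by (intro continuous_intros continuous_on_compose2[OF assms(1)]) (use assms(2) in auto)

text \<open>The integrals of \<open>exp (- sdq W v (2^-j))\<close> over slowly growing balls increase with \<open>j\<close> and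
  stay bounded because \<open>sdq\<close> is bounded below; the strict convexity of \<open>exp\<close> turns this
  into decay of third differences.\<close>
lemma third_difference_energy:
  fixes W :: "'a::euclidean_space \<Rightarrow> real"
  assumes sc: "semiconvex C W" and "R \<ge> 0"
  shows "(\<lambda>j. LINT x|lborel. indicator (cball z R) x *\<^sub>R
           (mdq W v ((1/2)^j) (x + ((1/2)^j) *\<^sub>R v) - mdq W v ((1/2)^j) x)\<^sup>2) \<longlonglongrightarrow> 0"
proof -
  define h :: "nat \<Rightarrow> real" where "h j = (1/2)^j" for j
  define e where "e j x = exp (- sdq W v (h j) x)" for j x
  define m where "m j = mdq W v (h j)" for j
  define G where "G j x = (m j (x + h j *\<^sub>R v) - m j x)\<^sup>2" for j x
  define I where "I j = (\<lambda>r g. LINT x|lborel. indicator (cball z r) x *\<^sub>R (g x :: real))" for j :: nat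
  let ?I = "\<lambda>r g. LINT x|lborel. indicator (cball z r) x *\<^sub>R (g x :: real)"
  \<comment> \<open>Each radius exceeds the previous one by exactly the shift length
    \<open>h (Suc j) * norm v\<close>. The shifts form a geometric series, so all radii stay below
    \<open>R + norm v\<close>.\<close>
  define r where "r j = R + norm v * (1 - h j)" for j
  have hpos: "h j > 0" "h j \<le> 1" for j by (simp_all add: h_def power_le_one)
  have h2: "2 * h (Suc j) = h j" for j by (simp add: h_def)
  have W: "continuous_on UNIV W" using semiconvex_continuous[OF sc] .
  have cd: "continuous_on S (sdq W v (h j))" for S j by (rule continuous_sdq[OF W]) (simp add: h_def)
  have ce: "continuous_on S (e j)" for S j unfolding e_def by (intro continuous_intros cd)
  have cm: "continuous_on S (m j)" for S j unfolding m_def mdq_def by (intro continuous_intros cd) auto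
  have cG: "continuous_on S (G j)" for S j
    unfolding G_def by (intro continuous_intros cm continuous_on_compose2[OF cm[of UNIV]]) auto
  have int: "integrable lborel (\<lambda>x. indicator (cball z r) x *\<^sub>R g x)" if "continuous_on UNIV g"
    for r and g :: "'a \<Rightarrow> real"
    using borel_integrable_compact[OF compact_cball] that continuous_on_subset by blast
  have pt: "e j x + G (Suc j) x / 4
      \<le> (e (Suc j) (x + h (Suc j) *\<^sub>R v) + 2 * e (Suc j) x + e (Suc j) (x + (- h (Suc j)) *\<^sub>R v)) / 4" for j x
  proof -
    have "sdq W v (h j) x = (sdq W v (h (Suc j)) (x + h (Suc j) *\<^sub>R v) + 2 * sdq W v (h (Suc j)) x
        + sdq W v (h (Suc j)) (x - h (Suc j) *\<^sub>R v)) / 4"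
      using sdq_double[of "h (Suc j)" W v x] hpos[of "Suc j"] unfolding h2 by simp
    then show ?thesis
      using exp_average_gap[of "sdq W v (h (Suc j)) (x + h (Suc j) *\<^sub>R v)" "sdq W v (h (Suc j)) x"
          "sdq W v (h (Suc j)) (x - h (Suc j) *\<^sub>R v)"]
      by (simp only: e_def G_def m_def mdq_def scaleR_minus_left add_uminus_conv_diff)
  qed
  have epos: "e j x \<ge> 0" for j x by (simp add: e_def)
  have rs: "r (Suc j) = r j + norm (h (Suc j) *\<^sub>R v)" for j
    using hpos[of "Suc j"] h2[of j] by (simp add: r_def algebra_simps)
  have rpos: "R \<le> r j" "r j \<le> R + norm v" for j
    using hpos[of j] by (simp_all add: r_def mult_left_le)
  have Imono: "?I a g \<le> ?I b g" if "a \<le> b" "continuous_on UNIV g" "\<And>x. g x \<ge> 0" for a b g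
  proof (rule integral_mono)
    fix x
    show "indicator (cball z a) x *\<^sub>R g x \<le> indicator (cball z b) x *\<^sub>R g x"
      using that(1) that(3)[of x] by (auto simp: indicator_def)
  qed (intro int that)+
  have arith: "a + g / 4 \<le> i"
    if "g \<le> g'" "a + g' / 4 = m" "m \<le> m'" "m' = (s1 + 2 * s2 + s3) / 4" "s1 \<le> i" "s3 \<le> i" "s2 \<le> i"
    for a g g' m m' s1 s2 s3 i :: real
    using that by (simp add: field_simps)
  have step: "?I (r j) (e j) + ?I R (G (Suc j)) / 4 \<le> ?I (r (Suc j)) (e (Suc j))" for j
  proof -
    let ?e = "e (Suc j)" and ?h = "h (Suc j)"
    have ces: "continuous_on UNIV (\<lambda>x. ?e (x + c))" for c
      by (intro continuous_intros continuous_on_compose2[OF ce[of UNIV]]) auto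
    have "?I R (G (Suc j)) \<le> ?I (r j) (G (Suc j))"
      by (rule Imono[OF rpos(1) cG]) (simp add: G_def)
    moreover have "?I (r j) (e j) + ?I (r j) (G (Suc j)) / 4
       = ?I (r j) (\<lambda>x. e j x + G (Suc j) x / 4)"
      using int[OF ce[of UNIV j], of "r j"] int[OF cG[of UNIV "Suc j"], of "r j"]
      by (simp add: distrib_left)
    moreover have "\<dots> \<le> ?I (r j) (\<lambda>x. (?e (x + ?h *\<^sub>R v) + 2 * ?e x + ?e (x + (- ?h) *\<^sub>R v)) / 4)"
    proof (rule integral_mono)
      show "indicator (cball z (r j)) x *\<^sub>R (e j x + G (Suc j) x / 4)
        \<le> indicator (cball z (r j)) x *\<^sub>R ((?e (x + ?h *\<^sub>R v) + 2 * ?e x + ?e (x + (- ?h) *\<^sub>R v)) / 4)" for x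
        by (intro scaleR_left_mono pt) simp
    qed (intro int continuous_intros ce cG ces; simp)+
    moreover have "\<dots> = (?I (r j) (\<lambda>x. ?e (x + ?h *\<^sub>R v)) + 2 * ?I (r j) ?e
         + ?I (r j) (\<lambda>x. ?e (x + (- ?h) *\<^sub>R v))) / 4"
      using int[OF ce[of UNIV "Suc j"], of "r j"] int[OF ces, of "r j" "?h *\<^sub>R v"]
        int[OF ces, of "r j" "(- ?h) *\<^sub>R v"]
      by (simp add: distrib_left mult.left_commute)
    moreover have "?I (r j) (\<lambda>x. ?e (x + ?h *\<^sub>R v)) \<le> ?I (r (Suc j)) ?e"
      unfolding rs by (rule ball_integral_shift_le[OF ce epos])
    moreover have "?I (r j) (\<lambda>x. ?e (x + (- ?h) *\<^sub>R v)) \<le> ?I (r (Suc j)) ?e"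
      unfolding rs
      using ball_integral_shift_le[OF ce[of UNIV "Suc j"] epos[of "Suc j"], where R="r j" and c="(- ?h) *\<^sub>R v" and z=z]
      by (simp only: norm_scaleR abs_minus_cancel)
    moreover have "?I (r j) ?e \<le> ?I (r (Suc j)) ?e"
      by (rule Imono) (auto simp: rs ce epos)
    ultimately show ?thesis by (rule arith)
  qed
  have bd: "?I (r j) (e j) \<le> ?I (R + norm v) (\<lambda>x. exp (2 * C * (norm v)\<^sup>2))" (is "_ \<le> ?B") for j
  proof -
    have "?I (r j) (e j) \<le> ?I (R + norm v) (e j)"
      by (rule Imono[OF rpos(2)]) (auto simp: ce epos)
    also have "\<dots> \<le> ?B"
    proof (intro integral_mono int ce scaleR_left_mono continuous_on_const)
      fix x
      show "e j x \<le> exp (2 * C * (norm v)\<^sup>2)"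
        using sdq_lower[OF sc, of "h j" v x] hpos(1)[of j] by (simp add: e_def)
    qed simp
    finally show ?thesis .
  qed
  have Ge: "?I R (G j) \<ge> 0" for j by (rule Bochner_Integration.integral_nonneg) (auto simp: G_def)
  \<comment> \<open>The inequality \<open>step\<close> telescopes: the energies of all dyadic scales
    together are bounded by \<open>?B\<close>, so they are summable and tend to zero.\<close>
  have sum: "?I (r 0) (e 0) + (\<Sum>j<n. ?I R (G (Suc j)) / 4) \<le> ?I (r n) (e n)" for n
  proof (induction n)
    case (Suc n)
    then show ?case using step[of n] by simp
  qed simp
  have e0: "?I (r 0) (e 0) \<ge> 0" by (rule Bochner_Integration.integral_nonneg) (simp add: epos)
  have "(\<Sum>j<n. norm (?I R (G (Suc j)) / 4)) \<le> ?B" for n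
    using sum[of n] bd[of n] e0 Ge by (simp add: abs_of_nonneg)
  then have "summable (\<lambda>j. ?I R (G (Suc j)) / 4)"
    by (intro summableI_nonneg_bounded[where x="?B"]) (use Ge in auto)
  then have "(\<lambda>j. ?I R (G (Suc j)) / 4) \<longlonglongrightarrow> 0" by (rule summable_LIMSEQ_zero)
  then have "(\<lambda>j. 4 * (?I R (G (Suc j)) / 4)) \<longlonglongrightarrow> 4 * 0" by (intro tendsto_intros)
  then have "(\<lambda>j. ?I R (G (Suc j))) \<longlonglongrightarrow> 0" by simp
  then have "(\<lambda>j. ?I R (G j)) \<longlonglongrightarrow> 0" by (simp only: filterlim_sequentially_Suc[of "\<lambda>j. ?I R (G j)"])
  then show ?thesis unfolding G_def m_def h_def by simp
qed

section \<open>Contact with affine functions near a strict maximum\<close>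

lemma le_zero_if_le_small_mult:
  fixes X K :: real
  assumes "t0 > 0" "\<And>t. 0 < t \<Longrightarrow> t < t0 \<Longrightarrow> X \<le> t * K"
  shows "X \<le> 0"
proof (rule tendsto_lowerbound)
  show "((\<lambda>t. t * K) \<longlongrightarrow> 0) (at_right 0)"
    by (rule tendsto_mult_left_zero) (rule tendsto_ident_at)
  show "\<forall>\<^sub>F t in at_right 0. X \<le> t * K"
    using assms by (auto simp: eventually_at_right_field)
qed simp

text \<open>The upper bound is used on the far side of \<open>z\<close>: the point \<open>z\<close>
  lies between \<open>z - t *\<^sub>R v\<close> and \<open>y\<close>, with weight
  \<open>t / (1 + t)\<close> on \<open>y\<close>, so semiconvexity turns an upper bound at the
  former into a lower bound at the latter, and \<open>t\<close> tends to zero. A local bound from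
  above thus gives a global one from below.\<close>

lemma semiconvex_support:
  fixes W :: "'a::real_inner \<Rightarrow> real"
  assumes sc: "semiconvex C W" and "r > 0"
    and above: "\<And>y. dist z y < r \<Longrightarrow> W y \<le> W z + \<xi> \<bullet> (y - z)"
  shows "W y \<ge> W z + \<xi> \<bullet> (y - z) - C * (norm (y - z))\<^sup>2"
proof -
  define v where "v = y - z"
  have y: "y = z + v" by (simp add: v_def)
  have "W z + \<xi> \<bullet> v - C * (norm v)\<^sup>2 - W y \<le> 0"
  proof (rule le_zero_if_le_small_mult)
    show "r / (norm v + 1) > 0" using \<open>r > 0\<close> by (simp add: add_nonneg_pos)
    fix t assume t: "0 < t" "t < r / (norm v + 1)"
    define l where "l = t / (1 + t)"
    have l: "0 \<le> l" "l \<le> 1" "(1 + t) * l = t" "(1 + t) * (1 - l) = 1"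
      using t by (auto simp: l_def field_simps)
    have "t * (norm v + 1) < r" using t(2) by (simp add: less_divide_eq add_nonneg_pos)
    then have "t * norm v < r" using t(1) by (simp add: algebra_simps)
    then have a: "W (z - t *\<^sub>R v) \<le> W z - t * (\<xi> \<bullet> v)"
      using above[of "z - t *\<^sub>R v"] t(1) by (simp add: dist_norm)
    have "(1 + t) *\<^sub>R ((1 - l) *\<^sub>R (z - t *\<^sub>R v) + l *\<^sub>R y) = (1 + t) *\<^sub>R z"
      unfolding scaleR_add_right scaleR_scaleR l y by (simp add: algebra_simps)
    then have e: "(1 - l) *\<^sub>R (z - t *\<^sub>R v) + l *\<^sub>R y = z" using t by simp
    have "z - t *\<^sub>R v - y = - ((1 + t) *\<^sub>R v)" by (simp add: y algebra_simps)
    then have n: "(norm (z - t *\<^sub>R v - y))\<^sup>2 = ((1 + t) * norm v)\<^sup>2"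
      using t by (simp only: norm_minus_cancel norm_scaleR)
    have "W z \<le> (1 - l) * W (z - t *\<^sub>R v) + l * W y + C * l * (1 - l) * ((1 + t) * norm v)\<^sup>2"
      using semiconvexD[OF sc l(1,2), of "z - t *\<^sub>R v" y] unfolding e n .
    then have "(1 + t) * W z \<le> (1 + t) * ((1 - l) * W (z - t *\<^sub>R v) + l * W y + C * l * (1 - l) * ((1 + t) * norm v)\<^sup>2)"
      using t by (intro mult_left_mono) auto
    also have "\<dots> = ((1 + t) * (1 - l)) * W (z - t *\<^sub>R v) + ((1 + t) * l) * W y
         + C * ((1 + t) * l) * ((1 + t) * (1 - l)) * (1 + t) * (norm v)\<^sup>2"
      by (simp add: algebra_simps power2_eq_square)
    also have "\<dots> = W (z - t *\<^sub>R v) + t * W y + C * t * (1 + t) * (norm v)\<^sup>2"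
      unfolding l by simp
    finally have "t * (W z + \<xi> \<bullet> v - C * (norm v)\<^sup>2 - W y) \<le> t * (t * (C * (norm v)\<^sup>2))"
      using a by (simp add: algebra_simps)
    then show "W z + \<xi> \<bullet> v - C * (norm v)\<^sup>2 - W y \<le> t * (C * (norm v)\<^sup>2)"
      using t(1) by simp
  qed
  then show ?thesis by (simp add: v_def)
qed

text \<open>Equivalently, \<open>z\<close> maximises \<open>W y - \<xi> \<bullet> y\<close> over the
  closed ball and lies in its interior. These are the points of Jensen's lemma, with
  \<open>\<xi>\<close> as the tilt.\<close>

definition contact :: "('a::real_inner \<Rightarrow> real) \<Rightarrow> 'a \<Rightarrow> real \<Rightarrow> 'a \<Rightarrow> 'a \<Rightarrow> bool" where
  "contact W z0 r z \<xi> \<longleftrightarrow> dist z0 z < r \<and> (\<forall>y\<in>cball z0 r. W y \<le> W z + \<xi> \<bullet> (y - z))"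

lemma contact_support:
  assumes "semiconvex C W" "contact W z0 r z \<xi>"
  shows "W y \<ge> W z + \<xi> \<bullet> (y - z) - C * (norm (y - z))\<^sup>2"
proof (rule semiconvex_support[OF assms(1)])
  show "0 < r - dist z0 z" using assms(2) by (simp add: contact_def)
  fix y assume "dist z y < r - dist z0 z"
  then have "dist z0 y \<le> r" using dist_triangle[of z0 y z] by simp
  then show "W y \<le> W z + \<xi> \<bullet> (y - z)" using assms(2) by (simp add: contact_def)
qed

text \<open>Support from below at \<open>z2\<close> and contact from above at \<open>z1\<close> are
  compared at \<open>z2 + \<rho> *\<^sub>R e\<close>, where \<open>e\<close> is the direction of the
  slope difference. The radius \<open>\<rho>\<close> only has to dominate the distance of the
  points: for \<open>z1 = z2\<close> it may tend to zero, so a contact point has a single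
  slope.\<close>

lemma contact_slope_Lipschitz:
  assumes sc: "semiconvex C W" "C \<ge> 0"
    and c: "contact W z0 r z1 \<xi>1" "contact W z0 r z2 \<xi>2"
    and \<rho>: "\<rho> > 0" "norm (z1 - z2) \<le> \<rho>" "\<rho> + dist z0 z2 \<le> r"
  shows "norm (\<xi>2 - \<xi>1) \<le> 3 * C * \<rho>"
proof (cases "\<xi>1 = \<xi>2")
  case False
  define d where "d = \<xi>2 - \<xi>1"
  define e where "e = (1 / norm d) *\<^sub>R d"
  have ne: "norm e = 1" using False by (simp add: e_def d_def)
  have de: "d \<bullet> e = norm d"
    using False by (simp add: e_def d_def power2_eq_square flip: power2_norm_eq_inner)
  define y where "y = z2 + \<rho> *\<^sub>R e"
  have "dist z0 y \<le> dist z0 z2 + dist z2 y" by (rule dist_triangle)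
  then have y: "y \<in> cball z0 r" using \<rho> ne by (simp add: y_def dist_norm)
  have in12: "z1 \<in> cball z0 r" "z2 \<in> cball z0 r" using c by (auto simp: contact_def)
  have "W y \<ge> W z2 + \<rho> * (\<xi>2 \<bullet> e) - C * \<rho>\<^sup>2"
    using contact_support[OF sc(1) c(2), of y] \<rho> ne by (simp add: y_def)
  moreover have "W y \<le> W z1 + \<xi>1 \<bullet> (y - z1)" using c(1) y by (auto simp: contact_def)
  moreover have "\<xi>1 \<bullet> (y - z1) = \<xi>1 \<bullet> (z2 - z1) + \<rho> * (\<xi>1 \<bullet> e)"
    by (simp add: y_def inner_diff_right inner_add_right)
  moreover have "W z1 \<le> W z2 + \<xi>2 \<bullet> (z1 - z2)" using c(2) in12 by (auto simp: contact_def)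
  moreover have "W z2 \<ge> W z1 + \<xi>1 \<bullet> (z2 - z1) - C * (norm (z1 - z2))\<^sup>2"
    using contact_support[OF sc(1) c(1), of z2] by (simp add: norm_minus_commute)
  moreover have "W z1 \<ge> W z2 + \<xi>2 \<bullet> (z1 - z2) - C * (norm (z1 - z2))\<^sup>2"
    using contact_support[OF sc(1) c(2), of z1] by simp
  moreover have "C * (norm (z1 - z2))\<^sup>2 \<le> C * \<rho>\<^sup>2"
    using \<rho> sc(2) by (intro mult_left_mono power_mono) auto
  moreover have "norm d * \<rho> = \<rho> * (\<xi>2 \<bullet> e) - \<rho> * (\<xi>1 \<bullet> e)"
    unfolding de[symmetric] by (simp add: d_def inner_diff_left algebra_simps)
  ultimately have "norm d * \<rho> \<le> (3 * C * \<rho>) * \<rho>"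
    by (simp add: power2_eq_square algebra_simps inner_diff_right)
  then show ?thesis using \<rho>(1) by (simp add: d_def)
qed (use assms in auto)

text \<open>Every sufficiently small tilt is realised: quadratic decay away from \<open>z0\<close>
  with rate \<open>s\<close> beats a tilt of size \<open>s * r / 4\<close>, which keeps the
  maximiser of the tilted function within \<open>r / 4\<close>.\<close>

lemma contact_exists:
  fixes W :: "'a::euclidean_space \<Rightarrow> real"
  assumes W: "continuous_on UNIV W" and "r > 0" "s > 0"
    and strict: "\<And>z. z \<in> cball z0 r \<Longrightarrow> W z \<le> W z0 - s * (norm (z - z0))\<^sup>2"
    and \<xi>: "norm \<xi> \<le> s * r / 4"
  shows "\<exists>z\<in>cball z0 (r / 4). contact W z0 r z \<xi>"
proof -
  have "\<exists>z\<in>cball z0 r. \<forall>y\<in>cball z0 r. W y - \<xi> \<bullet> y \<le> W z - \<xi> \<bullet> z"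
    using \<open>r > 0\<close> by (intro continuous_attains_sup continuous_intros continuous_on_subset[OF W]) auto
  then obtain z where z: "z \<in> cball z0 r" "\<And>y. y \<in> cball z0 r \<Longrightarrow> W y - \<xi> \<bullet> y \<le> W z - \<xi> \<bullet> z"
    by blast
  have "W z0 - \<xi> \<bullet> z0 \<le> W z - \<xi> \<bullet> z" using z(2)[of z0] \<open>r > 0\<close> by simp
  with strict[OF z(1)] have "s * (norm (z - z0))\<^sup>2 \<le> \<xi> \<bullet> (z0 - z)"
    by (simp add: inner_diff_right)
  also have "\<dots> \<le> norm \<xi> * norm (z - z0)"
    using norm_cauchy_schwarz[of \<xi> "z0 - z"] by (simp add: norm_minus_commute)
  also have "\<dots> \<le> s * r / 4 * norm (z - z0)" using \<xi> by (rule mult_right_mono) simp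
  finally have "s * norm (z - z0) * norm (z - z0) \<le> s * r / 4 * norm (z - z0)"
    by (simp add: power2_eq_square)
  then have "norm (z - z0) \<le> r / 4"
    using \<open>r > 0\<close> \<open>s > 0\<close> by (cases "z = z0") auto
  then have d: "dist z0 z \<le> r / 4" by (simp add: dist_norm norm_minus_commute)
  have "W y \<le> W z + \<xi> \<bullet> (y - z)" if "y \<in> cball z0 r" for y
    using z(2)[OF that] by (simp add: inner_diff_right)
  then have "contact W z0 r z \<xi>" using d \<open>r > 0\<close> by (auto simp: contact_def)
  then show ?thesis using d by auto
qed

text \<open>The slope is a Lipschitz function of the contact point, and its image contains the whole
  ball of radius \<open>\<delta>\<close> by \<open>contact_exists\<close>. A Lipschitz image of a
  null set is null, so the contact set cannot be null.\<close>

lemma contact_set_not_negligible: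
  fixes W :: "'a::euclidean_space \<Rightarrow> real"
  assumes sc: "semiconvex C W" "C \<ge> 0" and "r > 0" "s > 0"
    and strict: "\<And>z. z \<in> cball z0 r \<Longrightarrow> W z \<le> W z0 - s * (norm (z - z0))\<^sup>2"
    and \<delta>: "\<delta> > 0" "\<delta> \<le> s * r / 4"
  shows "\<not> negligible {z \<in> cball z0 (r / 4). \<exists>\<xi>. norm \<xi> < \<delta> \<and> contact W z0 r z \<xi>}" (is "\<not> negligible ?K")
proof
  assume K: "negligible ?K"
  define g where "g z = (SOME \<xi>. norm \<xi> < \<delta> \<and> contact W z0 r z \<xi>)" for z
  have g: "norm (g z) < \<delta> \<and> contact W z0 r z (g z)" if "z \<in> ?K" for z
    using that someI_ex[of "\<lambda>\<xi>. norm \<xi> < \<delta> \<and> contact W z0 r z \<xi>"] by (auto simp: g_def)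
  have lip: "norm (\<xi>2 - \<xi>1) \<le> 3 * C * norm (z1 - z2)"
    if "z1 \<in> ?K" "z2 \<in> ?K" "contact W z0 r z1 \<xi>1" "contact W z0 r z2 \<xi>2" for z1 z2 \<xi>1 \<xi>2
  proof (cases "z1 = z2")
    case False
    have "norm (z1 - z2) \<le> dist z0 z1 + dist z0 z2"
      using dist_triangle[of z1 z2 z0] by (simp add: dist_norm norm_minus_commute)
    then show ?thesis using contact_slope_Lipschitz[OF sc that(3,4), of "norm (z1 - z2)"] False that(1,2) \<open>r > 0\<close>
      by simp
  next
    case True
    have "norm (\<xi>2 - \<xi>1) \<le> 0"
    proof (rule le_zero_if_le_small_mult)
      show "r / 2 > 0" using \<open>r > 0\<close> by simp
      fix t assume "0 < t" "t < r / 2"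
      then show "norm (\<xi>2 - \<xi>1) \<le> t * (3 * C)"
        using contact_slope_Lipschitz[OF sc that(3,4), of t] True that(2) \<open>r > 0\<close>
        by (simp add: mult.commute mult.left_commute)
    qed
    then show ?thesis using True by simp
  qed
  have "negligible (g ` ?K)"
  proof (rule negligible_locally_Lipschitz_image[OF le_refl K])
    fix x assume x: "x \<in> ?K"
    show "\<exists>T B. open T \<and> x \<in> T \<and> (\<forall>y\<in>?K \<inter> T. norm (g y - g x) \<le> B * norm (y - x))"
      using lip[OF x _ conjunct2[OF g[OF x]] conjunct2[OF g]]
      by (intro exI[of _ UNIV] exI[of _ "3 * C"]) (simp add: norm_minus_commute[of x])
  qed
  moreover have "ball 0 \<delta> \<subseteq> g ` ?K"
  proof
    fix \<xi> :: 'a assume \<xi>: "\<xi> \<in> ball 0 \<delta>"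
    then obtain z where z: "z \<in> cball z0 (r / 4)" "contact W z0 r z \<xi>"
      using contact_exists[OF semiconvex_continuous[OF sc(1)] \<open>r > 0\<close> \<open>s > 0\<close> strict, of \<xi>] \<delta> by auto
    with \<xi> have zK: "z \<in> ?K" by auto
    have "norm (\<xi> - g z) \<le> 0" using lip[OF zK zK conjunct2[OF g[OF zK]] z(2)] by simp
    then show "\<xi> \<in> g ` ?K" using zK by auto
  qed
  ultimately have "negligible (ball (0::'a) \<delta>)" by (rule negligible_subset)
  then show False using \<delta>(1) open_not_negligible[of "ball (0::'a) \<delta>"] by simp
qed

text \<open>Markov's inequality: if every point of \<open>K\<close> had a large increment at every
  scale \<open>j \<ge> J\<close>, then \<open>K\<close> would lie in the superlevel sets of
  \<open>\<Phi> j\<close>, whose measure tends to zero with the energies. By continuity of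
  \<open>\<Phi> j\<close> these sets are compact in the ball, so they serve as measurable covers of
  \<open>K\<close>. The finite set \<open>F\<close> lists base points and directions in units of the
  scale.\<close>

lemma small_third_differences:
  fixes W :: "'a::euclidean_space \<Rightarrow> real"
  assumes sc: "semiconvex C W" and K: "\<not> negligible K" "K \<subseteq> cball z0 R" and "R \<ge> 0"
    and F: "finite F" and "e > 0"
  shows "\<exists>z\<in>K. \<exists>j\<ge>J. \<forall>(y, v)\<in>F.
    (mdq W v ((1/2)^j) (z + ((1/2)^j) *\<^sub>R (y + v)) - mdq W v ((1/2)^j) (z + ((1/2)^j) *\<^sub>R y))\<^sup>2 < e"
proof (rule ccontr)
  assume neg: "\<not> ?thesis"
  define h :: "nat \<Rightarrow> real" where "h j = (1/2)^j" for j
  have h: "h j > 0" "h j \<le> 1" for j by (simp_all add: h_def power_le_one)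
  define G where "G v j x = (mdq W v (h j) (x + h j *\<^sub>R v) - mdq W v (h j) x)\<^sup>2" for v j x
  define \<Phi> where "\<Phi> j x = (\<Sum>p\<in>F. G (snd p) j (x + h j *\<^sub>R fst p))" for j x
  let ?I = "\<lambda>r g. LINT x|lborel. indicator (cball z0 r) x *\<^sub>R (g x :: real)"
  have W: "continuous_on UNIV W" using semiconvex_continuous[OF sc] .
  have cm: "continuous_on S (mdq W v (h j))" for S v j
    unfolding mdq_def using h(1)[of j] by (intro continuous_intros continuous_sdq[OF W]) auto
  have cG: "continuous_on S (G v j)" for S v j
    unfolding G_def by (intro continuous_intros cm continuous_on_compose2[OF cm[of UNIV]]) auto
  have cGs: "continuous_on S (\<lambda>x. G v j (x + c))" for S v j c
    by (intro continuous_intros continuous_on_compose2[OF cG[of UNIV]]) auto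
  have c\<Phi>: "continuous_on S (\<Phi> j)" for S j
    unfolding \<Phi>_def by (intro continuous_intros cGs)
  have int: "integrable lborel (\<lambda>x. indicator (cball z0 r) x *\<^sub>R g x)" if "continuous_on UNIV g"
    for r and g :: "'a \<Rightarrow> real"
    using borel_integrable_compact[OF compact_cball] that continuous_on_subset by blast
  have Gpos: "G v j x \<ge> 0" for v j x by (simp add: G_def)
  have \<Phi>pos: "\<Phi> j x \<ge> 0" for j x by (simp add: \<Phi>_def sum_nonneg Gpos)
  have big: "e \<le> \<Phi> j x" if x: "x \<in> K" and "j \<ge> J" for j x
  proof -
    have "\<exists>y v. (y, v) \<in> F \<and> e \<le> G v j (x + h j *\<^sub>R y)"
    proof -
      have "\<not> (\<forall>(y, v)\<in>F. (mdq W v (h j) (x + h j *\<^sub>R (y + v)) - mdq W v (h j) (x + h j *\<^sub>R y))\<^sup>2 < e)"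
        using neg x \<open>j \<ge> J\<close> unfolding h_def by blast
      then obtain y v where "(y, v) \<in> F"
        "\<not> (mdq W v (h j) (x + h j *\<^sub>R (y + v)) - mdq W v (h j) (x + h j *\<^sub>R y))\<^sup>2 < e" by blast
      then show ?thesis by (intro exI[of _ y] exI[of _ v]) (simp add: G_def not_less scaleR_add_right add.assoc)
    qed
    then obtain y v where yv: "(y, v) \<in> F" "e \<le> G v j (x + h j *\<^sub>R y)" by blast
    have "G v j (x + h j *\<^sub>R y) \<le> \<Phi> j x"
      unfolding \<Phi>_def using member_le_sum[OF yv(1), of "\<lambda>p. G (snd p) j (x + h j *\<^sub>R fst p)"] F Gpos by auto
    then show ?thesis using yv(2) by simp
  qed
  have lim: "(\<lambda>j. ?I R (\<Phi> j)) \<longlonglongrightarrow> 0"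
  proof (rule tendsto_sandwich)
    show "\<forall>\<^sub>F j in sequentially. 0 \<le> ?I R (\<Phi> j)"
      by (intro always_eventually allI Bochner_Integration.integral_nonneg) (simp add: \<Phi>pos)
    have "?I R (\<Phi> j) \<le> (\<Sum>p\<in>F. ?I (R + norm (fst p)) (G (snd p) j))" for j
    proof -
      have "?I R (\<Phi> j) = (\<Sum>p\<in>F. ?I R (\<lambda>x. G (snd p) j (x + h j *\<^sub>R fst p)))"
        using int[OF cGs] by (simp add: \<Phi>_def sum_distrib_left)
      also have "\<dots> \<le> (\<Sum>p\<in>F. ?I (R + norm (fst p)) (G (snd p) j))"
      proof (rule sum_mono)
        fix p
        have "?I R (\<lambda>x. G (snd p) j (x + h j *\<^sub>R fst p)) \<le> ?I (R + norm (h j *\<^sub>R fst p)) (G (snd p) j)"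
          by (rule ball_integral_shift_le[OF cG Gpos])
        also have "\<dots> \<le> ?I (R + norm (fst p)) (G (snd p) j)"
        proof (rule integral_mono)
          fix x
          have "norm (h j *\<^sub>R fst p) \<le> norm (fst p)" using h[of j] by (simp add: mult_left_le_one_le)
          then show "indicator (cball z0 (R + norm (h j *\<^sub>R fst p))) x *\<^sub>R G (snd p) j x
             \<le> indicator (cball z0 (R + norm (fst p))) x *\<^sub>R G (snd p) j x"
            using Gpos[of "snd p" j x] by (auto simp: indicator_def)
        qed (intro int cG)+
        finally show "?I R (\<lambda>x. G (snd p) j (x + h j *\<^sub>R fst p)) \<le> ?I (R + norm (fst p)) (G (snd p) j)" .
      qed
      finally show ?thesis .
    qed
    then show "\<forall>\<^sub>F j in sequentially. ?I R (\<Phi> j) \<le> (\<Sum>p\<in>F. ?I (R + norm (fst p)) (G (snd p) j))"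
      by (intro always_eventually allI)
    have "(\<lambda>j. \<Sum>p\<in>F. ?I (R + norm (fst p)) (G (snd p) j)) \<longlonglongrightarrow> (\<Sum>p\<in>F. 0)"
      unfolding G_def h_def by (intro tendsto_sum third_difference_energy[OF sc]) (use \<open>R \<ge> 0\<close> in simp)
    then show "(\<lambda>j. \<Sum>p\<in>F. ?I (R + norm (fst p)) (G (snd p) j)) \<longlonglongrightarrow> 0" by simp
  qed simp
  have "negligible K"
  proof (subst negligible_outer_le, intro allI impI)
    fix d :: real assume "d > 0"
    with \<open>e > 0\<close> have "d * e > 0" by simp
    then have "\<forall>\<^sub>F j in sequentially. ?I R (\<Phi> j) < d * e" using lim by (rule order_tendstoD(2)[rotated])
    then obtain j where j: "j \<ge> J" "?I R (\<Phi> j) < d * e"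
      unfolding eventually_sequentially by (metis nle_le)
    define T where "T = {x \<in> cball z0 R. e \<le> \<Phi> j x}"
    have cT: "compact T"
    proof -
      have "closed {x. e \<le> \<Phi> j x}" by (rule closed_Collect_le) (auto intro: c\<Phi>)
      then have "compact (cball z0 R \<inter> {x. e \<le> \<Phi> j x})" by (intro compact_Int_closed) auto
      then show ?thesis by (simp add: T_def Int_def)
    qed
    have "measure lborel T * e = (LINT x|lborel. indicator T x *\<^sub>R e)"
      using emeasure_compact_finite[OF cT] borel_compact[OF cT] by simp
    also have "\<dots> \<le> ?I R (\<Phi> j)"
    proof (rule integral_mono[OF borel_integrable_compact[OF cT continuous_on_const] int[OF c\<Phi>]])
      fix x show "indicator T x *\<^sub>R e \<le> indicator (cball z0 R) x *\<^sub>R \<Phi> j x"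
        using \<Phi>pos[of j x] by (auto simp: T_def indicator_def)
    qed
    finally have "measure lborel T * e < d * e" using j(2) by simp
    then have "measure lebesgue T \<le> d"
      using \<open>e > 0\<close> borel_compact[OF cT] by (simp add: measure_completion)
    moreover have "K \<subseteq> T" using K(2) big j(1) by (auto simp: T_def)
    ultimately show "\<exists>T. K \<subseteq> T \<and> T \<in> lmeasurable \<and> measure lebesgue T \<le> d"
      using lmeasurable_compact[OF cT] by blast
  qed
  with K(1) show False by simp
qed

section \<open>Rational vectors and functions with vanishing third differences\<close>

definition rat_vecs :: "'a::euclidean_space set" where
  "rat_vecs = {x. \<forall>i\<in>Basis. x \<bullet> i \<in> \<rat>}"

lemma rat_vecs_add: "x \<in> rat_vecs \<Longrightarrow> y \<in> rat_vecs \<Longrightarrow> x + y \<in> rat_vecs"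
  by (simp add: rat_vecs_def inner_add_left)

lemma rat_vecs_scaleR: "x \<in> rat_vecs \<Longrightarrow> q \<in> \<rat> \<Longrightarrow> q *\<^sub>R x \<in> rat_vecs"
  by (simp add: rat_vecs_def)

lemma rat_vecs_diff: "x \<in> rat_vecs \<Longrightarrow> y \<in> rat_vecs \<Longrightarrow> x - y \<in> rat_vecs"
  by (simp add: rat_vecs_def inner_diff_left)

lemma Basis_rat_vecs: "i \<in> Basis \<Longrightarrow> i \<in> rat_vecs"
  by (auto simp: rat_vecs_def inner_Basis)

lemma zero_rat_vecs: "0 \<in> rat_vecs"
  by (simp add: rat_vecs_def)

lemma countable_rat_vecs: "countable (rat_vecs :: 'a::euclidean_space set)"
proof -
  have "(rat_vecs :: 'a set) \<subseteq> (\<lambda>f. \<Sum>i\<in>Basis. f i *\<^sub>R i) ` (Basis \<rightarrow>\<^sub>E \<rat>)"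
  proof
    fix x :: 'a assume x: "x \<in> rat_vecs"
    have "x = (\<Sum>i\<in>Basis. (\<lambda>i\<in>Basis. x \<bullet> i) i *\<^sub>R i)"
      by (simp add: euclidean_representation cong: sum.cong)
    moreover have "(\<lambda>i\<in>Basis. x \<bullet> i) \<in> Basis \<rightarrow>\<^sub>E \<rat>" using x by (auto simp: rat_vecs_def)
    ultimately show "x \<in> (\<lambda>f. \<Sum>i\<in>Basis. f i *\<^sub>R i) ` (Basis \<rightarrow>\<^sub>E \<rat>)" by (rule image_eqI)
  qed
  moreover have "countable (Basis \<rightarrow>\<^sub>E \<rat> :: ('a \<Rightarrow> real) set)"
    by (intro countable_PiE) (auto simp: countable_rat)
  ultimately show ?thesis by (meson countable_image countable_subset)
qed

lemma rat_vecs_dense: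
  fixes x :: "'a::euclidean_space"
  assumes "e > 0"
  shows "\<exists>y\<in>rat_vecs. norm (x - y) < e"
proof -
  define d where "d = e / (2 * DIM('a))"
  have d: "d > 0" using assms by (simp add: d_def)
  have "\<forall>i. \<exists>q\<in>\<rat>. \<bar>x \<bullet> i - q\<bar> < d"
  proof
    fix i
    obtain q where "q \<in> \<rat>" "x \<bullet> i - d < q" "q < x \<bullet> i + d"
      using Rats_dense_in_real[of "x \<bullet> i - d" "x \<bullet> i + d"] d by auto
    then show "\<exists>q\<in>\<rat>. \<bar>x \<bullet> i - q\<bar> < d" by (intro bexI[of _ q]) auto
  qed
  then obtain q where q: "\<And>i. q i \<in> \<rat>" "\<And>i. \<bar>x \<bullet> i - q i\<bar> < d" by metis
  define y :: 'a where "y = (\<Sum>i\<in>Basis. q i *\<^sub>R i)"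
  have yi: "y \<bullet> i = q i" if "i \<in> Basis" for i using that by (simp add: y_def)
  have "norm (x - y) \<le> (\<Sum>i\<in>Basis. \<bar>(x - y) \<bullet> i\<bar>)" by (rule norm_le_l1)
  also have "\<dots> \<le> (\<Sum>i\<in>(Basis::'a set). d)"
    using q(2) by (intro sum_mono) (simp add: inner_diff_left yi less_imp_le)
  also have "\<dots> < e" using assms by (simp add: d_def)
  finally show ?thesis using q(1) by (intro bexI[of _ y]) (auto simp: rat_vecs_def yi)
qed

lemma additive_rational_homogeneous:
  fixes \<phi> :: "'a::euclidean_space \<Rightarrow> real"
  assumes add: "\<And>x y. x \<in> rat_vecs \<Longrightarrow> y \<in> rat_vecs \<Longrightarrow> \<phi> (x + y) = \<phi> x + \<phi> y"
    and x: "x \<in> rat_vecs" and q: "q \<in> \<rat>"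
  shows "\<phi> (q *\<^sub>R x) = q * \<phi> x"
proof -
  have z: "\<phi> 0 = 0" using add[of 0 0] by (simp add: zero_rat_vecs)
  have nat: "\<phi> (real n *\<^sub>R y) = real n * \<phi> y" if y: "y \<in> rat_vecs" for n y
  proof (induction n)
    case (Suc n)
    have "\<phi> (real (Suc n) *\<^sub>R y) = \<phi> (real n *\<^sub>R y + y)" by (simp add: scaleR_add_left add.commute)
    also have "\<dots> = \<phi> (real n *\<^sub>R y) + \<phi> y" using y by (intro add rat_vecs_scaleR) auto
    finally show ?case using Suc by (simp add: algebra_simps)
  qed (simp add: z)
  have int: "\<phi> (of_int m *\<^sub>R y) = of_int m * \<phi> y" if y: "y \<in> rat_vecs" for m y
  proof (cases "m \<ge> 0")
    case True
    then show ?thesis using nat[OF y, of "nat m"] by simp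
  next
    case False
    have "\<phi> (of_int m *\<^sub>R y + real (nat (- m)) *\<^sub>R y) = \<phi> (of_int m *\<^sub>R y) + \<phi> (real (nat (- m)) *\<^sub>R y)"
      using y by (intro add rat_vecs_scaleR) auto
    then show ?thesis using nat[OF y, of "nat (- m)"] False z by (simp flip: scaleR_add_left)
  qed
  obtain m n :: int where q: "q = of_int m / of_int n" "n \<noteq> 0" using q by (elim Rats_cases') auto
  have qx: "q *\<^sub>R x \<in> rat_vecs" using x assms(3) by (rule rat_vecs_scaleR)
  have "of_int n * \<phi> (q *\<^sub>R x) = \<phi> (of_int n *\<^sub>R q *\<^sub>R x)" by (rule int[OF qx, symmetric])
  also have "\<dots> = \<phi> (of_int m *\<^sub>R x)" using q by simp
  also have "\<dots> = of_int m * \<phi> x" by (rule int[OF x])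
  finally have "\<phi> (q *\<^sub>R x) = (of_int m / of_int n) * \<phi> x" using q(2) by (simp add: field_simps)
  then show ?thesis using q(1) by simp
qed

text \<open>Djokovic's identity writes the mixed third difference as a signed sum of eight pure ones.\<close>
lemma mixed_third_difference:
  fixes f :: "'a::euclidean_space \<Rightarrow> real"
  assumes third: "\<And>y v. y \<in> rat_vecs \<Longrightarrow> v \<in> rat_vecs \<Longrightarrow>
      f (y + 2 *\<^sub>R v) - 3 * f (y + v) + 3 * f y - f (y - v) = 0"
    and abc: "a \<in> rat_vecs" "b \<in> rat_vecs" "c \<in> rat_vecs"
  shows "f (a + b + c) - f (a + b) - f (a + c) - f (b + c) + f a + f b + f c - f 0 = 0"
proof -
  define N where "N i j k = f (of_int i *\<^sub>R a + (of_int j / 2) *\<^sub>R b + (of_int k / 3) *\<^sub>R c)" for i j k :: int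
  have N3: "N (i + 2 * p) (j + 2 * q) (k + 2 * r) - 3 * N (i + p) (j + q) (k + r) + 3 * N i j k
      - N (i - p) (j - q) (k - r) = 0" for i j k p q r
  proof -
    let ?y = "of_int i *\<^sub>R a + (of_int j / 2) *\<^sub>R b + (of_int k / 3) *\<^sub>R c"
    let ?v = "of_int p *\<^sub>R a + (of_int q / 2) *\<^sub>R b + (of_int r / 3) *\<^sub>R c"
    have "?y \<in> rat_vecs" "?v \<in> rat_vecs"
      using abc by (auto intro!: rat_vecs_add rat_vecs_scaleR)
    from third[OF this] show ?thesis
      by (simp add: N_def algebra_simps add_divide_distrib diff_divide_distrib)
  qed
  \<comment> \<open>One instance for each nonempty subset of the three directions, a slot outside
    the subset being held at 0; for the empty subset the difference is trivial. The four lattice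
    points have coordinates -2, -1, 0, 1 in the first slot, -1, 0, 1, 2 in the second and 0, 1, 2, 3
    in the third. In each of the first three places some slot takes its held value 0, so the
    alternating sum over subsets cancels in pairs; only the last place survives and gives the
    corners, and the factors 1/2 and 1/3 in \<open>N\<close> turn these into \<open>a\<close>,
    \<open>b\<close> and \<open>c\<close>.\<close>
  have "N 1 2 3 - N 1 2 0 - N 1 0 3 - N 0 2 3 + N 1 0 0 + N 0 2 0 + N 0 0 3 - N 0 0 0 = 0"
    using N3[of 0 0 0 0 2 "-1"]
      N3[of 0 0 1 "-1" 0 0]
      N3[of 0 0 1 "-1" 2 "-1"]
      N3[of 0 "-1" 0 0 0 0]
      N3[of 0 "-1" 0 0 2 "-1"]
      N3[of 0 "-1" 1 "-1" 0 0]
      N3[of 0 "-1" 1 "-1" 2 "-1"]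
    by simp
  then show ?thesis by (simp add: N_def)
qed

text \<open>The larger ball leaves room to prolong the segment from \<open>x\<close> to
  \<open>y\<close> by length 1 beyond \<open>y\<close>; convexity on the prolonged segment bounds
  the increment.\<close>

lemma convex_bounded_Lipschitz:
  fixes g :: "'a::real_inner \<Rightarrow> real"
  assumes g: "convex_on UNIV g" and M: "\<And>y. norm y \<le> 2 \<Longrightarrow> \<bar>g y\<bar> \<le> M"
    and xy: "norm x \<le> 1" "norm y \<le> 1"
  shows "\<bar>g x - g y\<bar> \<le> 2 * M * norm (x - y)"
proof -
  have *: "g y - g x \<le> 2 * M * norm (x - y)" if xy: "norm x \<le> 1" "norm y \<le> 1" for x y
  proof (cases "x = y")
    case False
    define d where "d = norm (x - y)"
    have d: "d > 0" using False by (simp add: d_def)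
    define z where "z = y + (1 / d) *\<^sub>R (y - x)"
    have "norm z \<le> norm y + norm ((1 / d) *\<^sub>R (y - x))" unfolding z_def by (rule norm_triangle_ineq)
    also have "\<dots> \<le> 2" using xy d by (simp add: d_def norm_minus_commute)
    finally have z: "norm z \<le> 2" .
    define l where "l = d / (1 + d)"
    have l: "0 \<le> l" "l \<le> 1" "l \<le> d" using d by (auto simp: l_def field_simps)
    have l1: "1 - l = 1 / (1 + d)" "l / d = 1 / (1 + d)"
      using d add_pos_pos[OF d mult_pos_pos[OF d d]] by (simp_all add: l_def field_simps)
    have "(1 - l) *\<^sub>R x + l *\<^sub>R z = (1 - l) *\<^sub>R x + l *\<^sub>R y + (l / d) *\<^sub>R (y - x)"
      by (simp add: z_def scaleR_add_right)
    also have "\<dots> = y" unfolding l1(2)[folded l1(1)] by (simp add: algebra_simps)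
    finally have e: "(1 - l) *\<^sub>R x + l *\<^sub>R z = y" .
    have "g y \<le> (1 - l) * g x + l * g z"
      using convex_onD[OF g l(1,2), of x z] unfolding e by simp
    then have "g y - g x \<le> l * (g z - g x)" by (simp add: algebra_simps)
    also have "\<dots> \<le> l * (2 * M)"
      using M[OF z] M[of x] xy l by (intro mult_left_mono) auto
    also have "\<dots> \<le> d * (2 * M)" using l M[of 0] by (intro mult_right_mono) auto
    finally show ?thesis by (simp add: d_def mult.commute)
  qed simp
  show ?thesis using *[OF xy] *[OF xy(2,1)] by (simp add: norm_minus_commute abs_le_iff)
qed

text \<open>Vanishing mixed third differences make the polarisation \<open>B\<close> biadditive. The
  remainder \<open>g\<close> is then additive, hence homogeneous over the rationals, and a bound of
  order \<open>(norm x)^2\<close> at small rational multiples of \<open>x\<close> forces it to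
  vanish. Everything stays on \<open>rat_vecs\<close> because blow-up limits will be available only
  on a countable set.\<close>

lemma quadratic_of_third_difference:
  fixes f :: "'a::euclidean_space \<Rightarrow> real"
  assumes third: "\<And>y v. y \<in> rat_vecs \<Longrightarrow> v \<in> rat_vecs \<Longrightarrow>
      f (y + 2 *\<^sub>R v) - 3 * f (y + v) + 3 * f y - f (y - v) = 0"
    and bd: "\<And>y. y \<in> rat_vecs \<Longrightarrow> \<bar>f y\<bar> \<le> C * (norm y)\<^sup>2"
  shows "\<exists>A. linear A \<and> (\<forall>y\<in>rat_vecs. f y = (y \<bullet> A y) / 2)"
proof -
  have f0: "f 0 = 0" using bd[OF zero_rat_vecs] by simp
  define B where "B u v = f (u + v) - f u - f v" for u v
  have B_add: "B (u + w) v = B u v + B w v" if "u \<in> rat_vecs" "w \<in> rat_vecs" "v \<in> rat_vecs" for u v w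
    using mixed_third_difference[OF third that] f0 by (simp add: B_def algebra_simps)
  have B_sym: "B u v = B v u" for u v by (simp add: B_def add.commute)
  define g where "g x = f x - B x x / 2" for x
  have g_add: "g (u + v) = g u + g v" if "u \<in> rat_vecs" "v \<in> rat_vecs" for u v
  proof -
    have "B (u + v) (u + v) = B u u + 2 * B u v + B v v"
      using that B_add[of u v "u + v"] B_add[of u v u] B_add[of u v v] B_sym[of "u + v" u]
        B_sym[of "u + v" v] B_sym[of u v] by (simp only: rat_vecs_add)
    then show ?thesis by (simp add: g_def B_def field_simps)
  qed
  have g_bd: "\<bar>g x\<bar> \<le> 4 * C * (norm x)\<^sup>2" if "x \<in> rat_vecs" for x
  proof -
    have "g x = 2 * f x - f (2 *\<^sub>R x) / 2" by (simp add: g_def B_def scaleR_2 field_simps)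
    moreover have "\<bar>f (2 *\<^sub>R x)\<bar> \<le> C * (4 * (norm x)\<^sup>2)"
      using bd[of "2 *\<^sub>R x"] that by (simp add: rat_vecs_scaleR power_mult_distrib)
    ultimately show ?thesis using bd[OF that] by linarith
  qed
  have g0: "g x = 0" if x: "x \<in> rat_vecs" for x
  proof -
    have "\<bar>g x\<bar> \<le> 0"
    proof (rule LIMSEQ_le_const)
      show "(\<lambda>n. (4 * C * (norm x)\<^sup>2) * inverse (real (Suc n))) \<longlonglongrightarrow> 0"
        by (rule tendsto_mult_right_zero[OF LIMSEQ_inverse_real_of_nat])
      show "\<exists>N. \<forall>n\<ge>N. \<bar>g x\<bar> \<le> 4 * C * (norm x)\<^sup>2 * inverse (real (Suc n))"
      proof (intro exI allI impI)
        fix n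
        define q where "q = inverse (real (Suc n))"
        have q: "q > 0" "q \<in> \<rat>" by (auto simp: q_def)
        have "q * \<bar>g x\<bar> = \<bar>g (q *\<^sub>R x)\<bar>"
          using additive_rational_homogeneous[OF g_add x q(2)] q(1) by (simp add: abs_mult)
        also have "\<dots> \<le> 4 * C * (norm (q *\<^sub>R x))\<^sup>2" by (rule g_bd[OF rat_vecs_scaleR[OF x q(2)]])
        also have "\<dots> = q * (4 * C * (norm x)\<^sup>2 * q)"
          by (simp add: power_mult_distrib power2_eq_square)
        finally have "\<bar>g x\<bar> \<le> 4 * C * (norm x)\<^sup>2 * q" using q(1) by simp
        then show "\<bar>g x\<bar> \<le> 4 * C * (norm x)\<^sup>2 * inverse (real (Suc n))" by (simp only: q_def)
      qed
    qed
    then show ?thesis by simp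
  qed
  define A where "A y = (\<Sum>i\<in>Basis. \<Sum>j\<in>Basis. ((y \<bullet> i) * B i j) *\<^sub>R j)" for y :: 'a
  have "linear A"
    by (rule linearI) (simp_all add: A_def inner_add_left distrib_right scaleR_add_left sum.distrib scaleR_sum_right mult.assoc)
  have sum_B: "B (\<Sum>i\<in>Basis. (x \<bullet> i) *\<^sub>R i) v = (\<Sum>i\<in>Basis. (x \<bullet> i) * B i v)"
    if x: "x \<in> rat_vecs" and v: "v \<in> rat_vecs" for x v
  proof -
    have "finite S \<Longrightarrow> S \<subseteq> Basis \<Longrightarrow> (\<Sum>i\<in>S. (x \<bullet> i) *\<^sub>R i) \<in> rat_vecs \<and>
       B (\<Sum>i\<in>S. (x \<bullet> i) *\<^sub>R i) v = (\<Sum>i\<in>S. (x \<bullet> i) * B i v)" for S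
    proof (induction S rule: finite_induct)
      case empty
      then show ?case by (simp add: B_def f0 zero_rat_vecs)
    next
      case (insert i S)
      have i: "i \<in> rat_vecs" "x \<bullet> i \<in> \<rat>" using insert.prems x by (auto intro: Basis_rat_vecs) (auto simp: rat_vecs_def)
      have "B ((x \<bullet> i) *\<^sub>R i) v = (x \<bullet> i) * B i v"
        by (rule additive_rational_homogeneous[where \<phi>="\<lambda>u. B u v", OF B_add i]) (use v in auto)
      then show ?case
        using insert i v by (simp add: B_add rat_vecs_add rat_vecs_scaleR)
    qed
    then show ?thesis by simp
  qed
  have "f y = (y \<bullet> A y) / 2" if y: "y \<in> rat_vecs" for y
  proof -
    have "B y y = B (\<Sum>i\<in>Basis. (y \<bullet> i) *\<^sub>R i) y" by (simp add: euclidean_representation)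
    also have "\<dots> = (\<Sum>i\<in>Basis. (y \<bullet> i) * B i y)" by (rule sum_B[OF y y])
    also have "\<dots> = (\<Sum>i\<in>Basis. (y \<bullet> i) * B (\<Sum>j\<in>Basis. (y \<bullet> j) *\<^sub>R j) i)"
      by (simp only: euclidean_representation B_sym[of y])
    also have "\<dots> = (\<Sum>i\<in>Basis. (y \<bullet> i) * (\<Sum>j\<in>Basis. (y \<bullet> j) * B j i))"
      using sum_B[OF y Basis_rat_vecs] by simp
    also have "\<dots> = y \<bullet> A y"
      by (simp add: A_def inner_sum_right sum_distrib_left B_sym mult_ac)
    finally show ?thesis using g0[OF y] by (simp add: g_def)
  qed
  then show ?thesis using \<open>linear A\<close> by blast
qed

text \<open>Quantitative replacement for the combination of Jensen's lemma with Alexandrov's theorem: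
  near a strict maximum, a semiconvex function is, at some contact point and at some small
  scale \<open>\<rho>\<close>, within \<open>\<epsilon> \<rho>\<^sup>2\<close> of a quadratic polynomial. Exact twice differentiability is
  never needed.\<close>
lemma semiconvex_max_quadratic_approx:
  fixes W :: "'a::euclidean_space \<Rightarrow> real"
  assumes sc: "semiconvex C W" "C \<ge> 0" and "r > 0" "s > 0" "\<epsilon> > 0"
    and strict: "\<And>z. z \<in> cball z0 r \<Longrightarrow> W z \<le> W z0 - s * (norm (z - z0))\<^sup>2"
  shows "\<exists>z \<xi> \<rho> A. dist z0 z < \<epsilon> \<and> norm \<xi> < \<epsilon> \<and> 0 < \<rho> \<and> \<rho> < \<epsilon> \<and> linear A \<and>
    (\<forall>y. norm y \<le> \<rho> \<longrightarrow> W (z + y) \<le> W z + \<xi> \<bullet> y \<and>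
       W (z + y) \<ge> W z + \<xi> \<bullet> y - C * (norm y)\<^sup>2 \<and>
       \<bar>W (z + y) - W z - \<xi> \<bullet> y - (y \<bullet> A y) / 2\<bar> \<le> \<epsilon> * \<rho>\<^sup>2)"
proof -
  define r' where "r' = min r \<epsilon>"
  have r': "r' > 0" "r' \<le> r" "r' \<le> \<epsilon>" using assms by (auto simp: r'_def)
  have strict': "W z \<le> W z0 - s * (norm (z - z0))\<^sup>2" if "z \<in> cball z0 r'" for z
    using strict that r' by auto
  define \<delta> where "\<delta> = min \<epsilon> (s * r' / 4)"
  have \<delta>: "\<delta> > 0" "\<delta> \<le> s * r' / 4" "\<delta> \<le> \<epsilon>" using assms r' by (auto simp: \<delta>_def)
  define K where "K = {z \<in> cball z0 (r' / 4). \<exists>\<xi>. norm \<xi> < \<delta> \<and> contact W z0 r' z \<xi>}"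
  have K: "\<not> negligible K" "K \<subseteq> cball z0 (r' / 4)"
    unfolding K_def using contact_set_not_negligible[OF sc r'(1) \<open>s > 0\<close> strict' \<delta>(1,2)] by auto
  define h :: "nat \<Rightarrow> real" where "h j = (1/2)^j" for j
  have h: "h j > 0" for j by (simp add: h_def)
  define P where "P = (rat_vecs :: 'a set) \<times> (rat_vecs :: 'a set)"
  have P: "countable P" "P \<noteq> {}" using countable_rat_vecs zero_rat_vecs by (auto simp: P_def)
  define q where "q = from_nat_into P"
  \<comment> \<open>A diagonal arrangement: stage \<open>k\<close> controls the first
    \<open>k + 1\<close> pairs of rational vectors with tolerance
    \<open>inverse (real (Suc k))\<close> at some scale index \<open>j \<ge> k\<close>. Each fixed
    pair is controlled from some stage on, with tolerance tending to zero.\<close>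
  define Q where "Q k z j \<longleftrightarrow> (\<forall>(y, v)\<in>q ` {..k}.
      (mdq W v (h j) (z + h j *\<^sub>R (y + v)) - mdq W v (h j) (z + h j *\<^sub>R y))\<^sup>2 < inverse (real (Suc k)))" for k z j
  have "\<forall>k. \<exists>z\<in>K. \<exists>j\<ge>k. Q k z j"
    unfolding h_def Q_def using r'(1) by (intro allI small_third_differences[OF sc(1) K]) auto
  then obtain zs js where zs: "\<And>k. zs k \<in> K" and js: "\<And>k. js k \<ge> k" and "\<And>k. Q k (zs k) (js k)"
    by metis
  then have small: "\<And>k y v. (y, v) \<in> q ` {..k} \<Longrightarrow>
      (mdq W v (h (js k)) (zs k + h (js k) *\<^sub>R (y + v)) - mdq W v (h (js k)) (zs k + h (js k) *\<^sub>R y))\<^sup>2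
        < inverse (real (Suc k))"
    unfolding Q_def by blast
  have "\<forall>k. \<exists>\<xi>. norm \<xi> < \<delta> \<and> contact W z0 r' (zs k) \<xi>"
    using zs unfolding K_def by blast
  then obtain \<xi>s where \<xi>s: "\<And>k. norm (\<xi>s k) < \<delta>" "\<And>k. contact W z0 r' (zs k) (\<xi>s k)"
    by metis
  define hs where "hs k = h (js k)" for k
  have hs: "hs k > 0" for k by (simp add: hs_def h)
  have hs0: "hs \<longlonglongrightarrow> 0"
  proof (rule tendsto_sandwich[where f="\<lambda>_. 0" and h="\<lambda>k. (1/2)^k"])
    show "\<forall>\<^sub>F k in sequentially. hs k \<le> (1/2)^k"
      using js by (intro always_eventually) (auto simp: hs_def h_def intro: power_decreasing)
    show "(\<lambda>k. (1/2)^k :: real) \<longlonglongrightarrow> 0" by (rule LIMSEQ_realpow_zero) auto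
  qed (use hs in \<open>auto intro: always_eventually less_imp_le\<close>)
  \<comment> \<open>Second-order blow-up at the contact point. Contact bounds it above by 0 as long
    as the argument stays in the ball, and \<open>contact_support\<close> bounds it below by
    \<open>- (C * (norm y)^2)\<close>; no convergence of second derivatives is involved.\<close>
  define U where "U k y = (W (zs k + hs k *\<^sub>R y) - W (zs k) - hs k * (\<xi>s k \<bullet> y)) / (hs k)\<^sup>2" for k y
  have U_mult: "(hs k)\<^sup>2 * U k y = W (zs k + hs k *\<^sub>R y) - W (zs k) - hs k * (\<xi>s k \<bullet> y)" for k y
    using hs[of k] by (simp add: U_def)
  have U_ge: "U k y \<ge> - (C * (norm y)\<^sup>2)" for k y
    using contact_support[OF sc(1) \<xi>s(2), of k "zs k + hs k *\<^sub>R y"] hs[of k]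
    by (simp add: U_def power_mult_distrib field_simps)
  have U_le: "U k y \<le> 0" if "hs k * norm y \<le> r' / 2" for k y
  proof -
    have "dist z0 (zs k + hs k *\<^sub>R y) \<le> dist z0 (zs k) + dist (zs k) (zs k + hs k *\<^sub>R y)"
      by (rule dist_triangle)
    also have "\<dots> \<le> r'" using zs[of k] that hs[of k] r' by (simp add: K_def dist_norm)
    finally have "zs k + hs k *\<^sub>R y \<in> cball z0 r'" by simp
    then have "W (zs k + hs k *\<^sub>R y) \<le> W (zs k) + \<xi>s k \<bullet> (zs k + hs k *\<^sub>R y - zs k)"
      using \<xi>s(2)[of k] unfolding contact_def by blast
    then show ?thesis using hs[of k] by (simp add: U_def divide_le_0_iff)
  qed
  have U_bd: "\<bar>U k y\<bar> \<le> C * (norm y)\<^sup>2" if "hs k * norm y \<le> r' / 2" for k y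
    using U_ge[of y k] U_le[OF that] by simp
  have ev: "\<forall>\<^sub>F k in sequentially. hs k * c \<le> r' / 2" for c
  proof -
    have "(\<lambda>k. hs k * c) \<longlonglongrightarrow> 0 * c" by (intro tendsto_intros hs0)
    then have "\<forall>\<^sub>F k in sequentially. hs k * c < r' / 2" by (rule order_tendstoD(2)) (use r' in simp)
    then show ?thesis by (rule eventually_mono) simp
  qed
  \<comment> \<open>A normalisation of \<open>U\<close> bounded by \<open>C\<close> uniformly in
    \<open>k\<close> and \<open>y\<close>, as the extraction of a pointwise convergent subsequence
    requires. The default 0 covers the arguments that are still too large for the scale
    \<open>hs k\<close>; for fixed \<open>y\<close> it is taken only finitely often.\<close>
  define V where "V k y = (if hs k * norm y \<le> r' / 2 then U k y / (1 + (norm y)\<^sup>2) else 0)" for k y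
  have V_bd: "norm (V k y) \<le> C" for k y
  proof (cases "hs k * norm y \<le> r' / 2")
    case True
    have "\<bar>U k y\<bar> \<le> C * (1 + (norm y)\<^sup>2)" using U_bd[OF True] sc(2) by (simp add: algebra_simps)
    then show ?thesis using True by (simp add: V_def divide_le_eq add_nonneg_pos add_pos_nonneg)
  qed (use sc in \<open>simp add: V_def\<close>)
  have "\<exists>\<kappa>::nat \<Rightarrow> nat. strict_mono \<kappa> \<and> (\<forall>y\<in>rat_vecs. \<exists>l. (\<lambda>n. V (\<kappa> n) y) \<longlonglongrightarrow> l)"
  proof (rule function_convergent_subsequence[OF countable_rat_vecs, of V C])
    show "norm (V n x) \<le> C" for n x by (rule V_bd)
  qed blast
  then obtain \<kappa> :: "nat \<Rightarrow> nat" where \<kappa>: "strict_mono \<kappa>"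
    "\<And>y. y \<in> rat_vecs \<Longrightarrow> \<exists>l. (\<lambda>n. V (\<kappa> n) y) \<longlonglongrightarrow> l"
    by blast
  have ev\<kappa>: "\<forall>\<^sub>F n in sequentially. Q (\<kappa> n)" if "\<forall>\<^sub>F k in sequentially. Q k" for Q
    using \<kappa>(1) that by (rule eventually_subseq)
  have "\<exists>l. (\<lambda>n. U (\<kappa> n) y) \<longlonglongrightarrow> l" if y: "y \<in> rat_vecs" for y
  proof -
    from \<kappa>(2)[OF y] obtain l where "(\<lambda>n. V (\<kappa> n) y) \<longlonglongrightarrow> l" by blast
    then have l: "(\<lambda>n. V (\<kappa> n) y * (1 + (norm y)\<^sup>2)) \<longlonglongrightarrow> l * (1 + (norm y)\<^sup>2)" by (intro tendsto_intros)
    have "\<forall>\<^sub>F n in sequentially. V (\<kappa> n) y * (1 + (norm y)\<^sup>2) = U (\<kappa> n) y"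
      using ev\<kappa>[OF ev[of "norm y"]]
    proof (rule eventually_mono)
      fix n assume "hs (\<kappa> n) * norm y \<le> r' / 2"
      moreover have "1 + (norm y)\<^sup>2 > 0" by (simp add: add_pos_nonneg)
      ultimately show "V (\<kappa> n) y * (1 + (norm y)\<^sup>2) = U (\<kappa> n) y" by (simp add: V_def)
    qed
    from Lim_transform_eventually[OF l this] show ?thesis by blast
  qed
  then obtain f where f: "\<And>y. y \<in> rat_vecs \<Longrightarrow> (\<lambda>n. U (\<kappa> n) y) \<longlonglongrightarrow> f y" by metis
  have f_bd: "\<bar>f y\<bar> \<le> C * (norm y)\<^sup>2" if y: "y \<in> rat_vecs" for y
  proof (rule tendsto_upperbound)
    show "(\<lambda>n. \<bar>U (\<kappa> n) y\<bar>) \<longlonglongrightarrow> \<bar>f y\<bar>" by (intro tendsto_intros f y)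
    show "\<forall>\<^sub>F n in sequentially. \<bar>U (\<kappa> n) y\<bar> \<le> C * (norm y)\<^sup>2"
      by (rule eventually_mono[OF ev\<kappa>[OF ev[of "norm y"]]]) (rule U_bd)
  qed simp
  define S where "S k y v = U k (y + v) - 2 * U k y + U k (y - v)" for k y v
  have S_sdq: "sdq W v (hs k) (zs k + hs k *\<^sub>R y) = S k y v" for k y v
    using hs[of k] by (simp add: sdq_def S_def U_def field_simps inner_add_right inner_diff_right)
  have third: "f (y + 2 *\<^sub>R v) - 3 * f (y + v) + 3 * f y - f (y - v) = 0"
    if y: "y \<in> rat_vecs" and v: "v \<in> rat_vecs" for y v
  proof -
    note mem = rat_vecs_add[OF y v] rat_vecs_add[OF rat_vecs_add[OF y v] v] rat_vecs_diff[OF y v] y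
    have e: "y + v + v = y + 2 *\<^sub>R v" "y + v - v = y" by (simp_all add: scaleR_2)
    have L1: "(\<lambda>n. S (\<kappa> n) (y + v) v) \<longlonglongrightarrow> f (y + 2 *\<^sub>R v) - 2 * f (y + v) + f y"
      unfolding S_def e by (intro tendsto_intros f mem mem(2)[unfolded e])
    have L2: "(\<lambda>n. S (\<kappa> n) y v) \<longlonglongrightarrow> f (y + v) - 2 * f y + f (y - v)"
      unfolding S_def by (intro tendsto_intros f mem)
    \<comment> \<open>By \<open>S_sdq\<close> these are the increments of \<open>mdq\<close> that
      were made small. Their limit is a difference of two exponentials, and injectivity of
      \<open>exp\<close> makes the two second differences of \<open>f\<close> equal.\<close>
    let ?d = "\<lambda>k. exp (- S k (y + v) v / 2) - exp (- S k y v / 2)"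
    have L: "(\<lambda>n. (?d (\<kappa> n))\<^sup>2) \<longlonglongrightarrow> (exp (- (f (y + 2 *\<^sub>R v) - 2 * f (y + v) + f y) / 2)
        - exp (- (f (y + v) - 2 * f y + f (y - v)) / 2))\<^sup>2"
      by (intro tendsto_intros L1 L2) auto
    have "(\<lambda>n. (?d (\<kappa> n))\<^sup>2) \<longlonglongrightarrow> 0"
    proof (rule tendsto_sandwich[where f="\<lambda>_. 0" and h="\<lambda>n. inverse (real (Suc (\<kappa> n)))"])
      obtain i where i: "q i = (y, v)"
        using from_nat_into_surj[OF P(1), of "(y, v)"] y v by (auto simp: P_def q_def)
      have "\<forall>\<^sub>F k in sequentially. (?d k)\<^sup>2 \<le> inverse (real (Suc k))"
        using eventually_ge_at_top[of i]
      proof (rule eventually_mono)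
        fix k assume "i \<le> k"
        then have "(y, v) \<in> q ` {..k}" using i by (metis atMost_iff imageI)
        from small[OF this] show "(?d k)\<^sup>2 \<le> inverse (real (Suc k))"
          unfolding mdq_def hs_def[symmetric] S_sdq by simp
      qed
      then show "\<forall>\<^sub>F n in sequentially. (?d (\<kappa> n))\<^sup>2 \<le> inverse (real (Suc (\<kappa> n)))" by (rule ev\<kappa>)
      show "(\<lambda>n. inverse (real (Suc (\<kappa> n)))) \<longlonglongrightarrow> 0"
        using LIMSEQ_subseq_LIMSEQ[OF LIMSEQ_inverse_real_of_nat \<kappa>(1)] by (simp add: o_def)
    qed auto
    from LIMSEQ_unique[OF this L] show ?thesis by simp
  qed
  obtain A where A: "linear A" "\<And>y. y \<in> rat_vecs \<Longrightarrow> f y = (y \<bullet> A y) / 2"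
    using quadratic_of_third_difference[OF third f_bd] by blast
  define g where "g k y = U k y + C * (norm y)\<^sup>2" for k y
  have g_conv: "convex_on UNIV (g k)" for k
  proof -
    have "semiconvex C (U k)"
      unfolding semiconvex_def
    proof (intro allI impI)
      fix x y :: 'a and t :: real assume t: "0 \<le> t" "t \<le> 1"
      let ?X = "zs k + hs k *\<^sub>R x" and ?Y = "zs k + hs k *\<^sub>R y"
      have e: "(1 - t) *\<^sub>R ?X + t *\<^sub>R ?Y = zs k + hs k *\<^sub>R ((1 - t) *\<^sub>R x + t *\<^sub>R y)"
        by (simp add: algebra_simps)
      have n: "(norm (?X - ?Y))\<^sup>2 = (hs k)\<^sup>2 * (norm (x - y))\<^sup>2"
        by (simp add: power_mult_distrib flip: scaleR_diff_right)
      have "W (zs k + hs k *\<^sub>R ((1 - t) *\<^sub>R x + t *\<^sub>R y))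
          \<le> (1 - t) * W ?X + t * W ?Y + C * t * (1 - t) * ((hs k)\<^sup>2 * (norm (x - y))\<^sup>2)"
        using semiconvexD[OF sc(1) t, of ?X ?Y] unfolding e n .
      then have "(hs k)\<^sup>2 * U k ((1 - t) *\<^sub>R x + t *\<^sub>R y)
          \<le> (1 - t) * ((hs k)\<^sup>2 * U k x) + t * ((hs k)\<^sup>2 * U k y) + C * t * (1 - t) * ((hs k)\<^sup>2 * (norm (x - y))\<^sup>2)"
        unfolding U_mult inner_add_right inner_scaleR_right by (simp add: algebra_simps)
      also have "\<dots> = (hs k)\<^sup>2 * ((1 - t) * U k x + t * U k y + C * t * (1 - t) * (norm (x - y))\<^sup>2)"
        by (simp add: algebra_simps)
      finally show "U k ((1 - t) *\<^sub>R x + t *\<^sub>R y)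
          \<le> (1 - t) * U k x + t * U k y + C * t * (1 - t) * (norm (x - y))\<^sup>2"
        using hs[of k] by simp
    qed
    then show ?thesis unfolding g_def by (rule semiconvex_imp_convex)
  qed
  have lin: "\<exists>M>0. \<forall>y. norm (A y) \<le> norm y * M"
    using bounded_linear.pos_bounded[OF linear_conv_bounded_linear[THEN iffD1, OF A(1)]] by blast
  then obtain M where M: "M > 0" "\<And>y. norm (A y) \<le> norm y * M" by blast
  \<comment> \<open>A Lipschitz constant on the unit ball: \<open>8 * C * 2\<close> for the convex
    function \<open>g k\<close>, bounded by \<open>8 * C\<close> on the ball of radius 2,
    \<open>2 * C\<close> for removing \<open>C * (norm y)^2\<close>, and \<open>2 * M\<close> for
    the quadratic form of \<open>A\<close>. The final 1 makes \<open>D\<close> positive.\<close>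
  define D where "D = 8 * C * 2 + 2 * C + 2 * M + 1"
  have D: "D > 0" using sc(2) M by (simp add: D_def)
  define \<eta> where "\<eta> = \<epsilon> / (2 * D)"
  have \<eta>: "\<eta> > 0" using D \<open>\<epsilon> > 0\<close> by (simp add: \<eta>_def)
  define E where "E k y = U k y - (y \<bullet> A y) / 2" for k y
  have E_lip: "\<bar>E k x - E k y\<bar> \<le> D * norm (x - y)"
    if k: "hs k * 2 \<le> r' / 2" and xy: "norm x \<le> 1" "norm y \<le> 1" for k x y
  proof -
    have bd: "\<bar>g k w\<bar> \<le> 8 * C" if "norm w \<le> 2" for w
    proof -
      have "hs k * norm w \<le> hs k * 2" using that hs[of k] by (intro mult_left_mono) auto
      then have "\<bar>U k w\<bar> \<le> C * (norm w)\<^sup>2" using k by (intro U_bd) simp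
      moreover have "C * (norm w)\<^sup>2 \<le> C * 2\<^sup>2" using that sc(2) by (intro mult_left_mono power_mono) auto
      moreover have "0 \<le> C * (norm w)\<^sup>2" using sc(2) by simp
      ultimately show ?thesis unfolding g_def by (simp add: abs_le_iff)
    qed
    have gl: "\<bar>g k x - g k y\<bar> \<le> 2 * (8 * C) * norm (x - y)"
      using convex_bounded_Lipschitz[OF g_conv bd xy] .
    have "(norm x)\<^sup>2 - (norm y)\<^sup>2 = (norm x - norm y) * (norm x + norm y)"
      by (simp add: power2_eq_square algebra_simps)
    then have "\<bar>(norm x)\<^sup>2 - (norm y)\<^sup>2\<bar> = \<bar>norm x - norm y\<bar> * (norm x + norm y)"
      by (simp add: abs_mult)
    also have "\<dots> \<le> norm (x - y) * 2"
      using xy norm_triangle_ineq3[of x y] by (intro mult_mono) auto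
    finally have n2: "C * \<bar>(norm x)\<^sup>2 - (norm y)\<^sup>2\<bar> \<le> C * (norm (x - y) * 2)"
      using sc(2) by (rule mult_left_mono)
    have "x \<bullet> A x - y \<bullet> A y = (x - y) \<bullet> A x + y \<bullet> A (x - y)"
      using A(1) by (simp add: linear_diff inner_diff_left inner_diff_right)
    also have "\<bar>\<dots>\<bar> \<le> \<bar>(x - y) \<bullet> A x\<bar> + \<bar>y \<bullet> A (x - y)\<bar>" by (rule abs_triangle_ineq)
    also have "\<dots> \<le> norm (x - y) * norm (A x) + norm y * norm (A (x - y))"
      by (intro add_mono Cauchy_Schwarz_ineq2)
    also have "\<dots> \<le> norm (x - y) * M + 1 * (norm (x - y) * M)"
      using M(2)[of x] M(2)[of "x - y"] xy M(1)
      by (intro add_mono mult_left_mono mult_mono order_trans[OF M(2)[of x]]) (auto simp: mult_left_le_one_le)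
    finally have a: "\<bar>x \<bullet> A x - y \<bullet> A y\<bar> \<le> 2 * M * norm (x - y)" by simp
    have "E k x - E k y = (g k x - g k y) - C * ((norm x)\<^sup>2 - (norm y)\<^sup>2) - (x \<bullet> A x - y \<bullet> A y) / 2"
      by (simp add: E_def g_def algebra_simps diff_divide_distrib)
    also have "\<bar>\<dots>\<bar> \<le> \<bar>g k x - g k y\<bar> + \<bar>C * ((norm x)\<^sup>2 - (norm y)\<^sup>2)\<bar> + \<bar>(x \<bullet> A x - y \<bullet> A y) / 2\<bar>"
      by linarith
    also have "\<dots> = \<bar>g k x - g k y\<bar> + C * \<bar>(norm x)\<^sup>2 - (norm y)\<^sup>2\<bar> + \<bar>x \<bullet> A x - y \<bullet> A y\<bar> / 2"
      using sc(2) by (simp add: abs_mult)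
    also have "\<dots> \<le> 2 * (8 * C) * norm (x - y) + C * (norm (x - y) * 2) + 2 * M * norm (x - y)"
    proof -
      have "\<bar>x \<bullet> A x - y \<bullet> A y\<bar> / 2 \<le> 2 * M * norm (x - y)" by (rule order_trans[OF _ a]) simp
      then show ?thesis by (rule add_mono[OF add_mono[OF gl n2]])
    qed
    also have "\<dots> \<le> D * norm (x - y)" by (simp add: D_def algebra_simps)
    finally show ?thesis .
  qed
  \<comment> \<open>Convergence is known at rational vectors only; the Lipschitz bound
    \<open>E_lip\<close>, uniform in \<open>k\<close>, extends smallness from a finite rational net
    to the whole unit ball.\<close>
  obtain N :: "'a set" where N: "finite N" "N \<subseteq> rat_vecs \<inter> cball 0 1" "\<And>y. norm y \<le> 1 \<Longrightarrow> \<exists>x\<in>N. norm (y - x) < \<eta>"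
  proof -
    have cov: "cball (0::'a) 1 \<subseteq> (\<Union>x\<in>rat_vecs \<inter> cball 0 1. ball x \<eta>)"
    proof
      fix y :: 'a assume y: "y \<in> cball 0 1"
      \<comment> \<open>The vector \<open>y\<close> is first shrunk by the factor
        \<open>1 - e\<close>, so that its rational approximation remains in the closed unit
        ball.\<close>
      define e where "e = min 1 (\<eta> / 3)"
      have e: "e > 0" "e \<le> 1" "3 * e \<le> \<eta>" using \<eta> by (auto simp: e_def)
      obtain x where x: "x \<in> rat_vecs" "norm ((1 - e) *\<^sub>R y - x) < e" using rat_vecs_dense[OF e(1)] by blast
      have y1: "norm ((1 - e) *\<^sub>R y) \<le> 1 - e" "norm (e *\<^sub>R y) \<le> e"
        using y e by (simp_all add: mult_left_le)
      have "norm x \<le> norm ((1 - e) *\<^sub>R y) + norm (x - (1 - e) *\<^sub>R y)" by (rule norm_triangle_sub)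
      then have n1: "norm x \<le> 1" using x(2) y1(1) by (simp add: norm_minus_commute)
      have "y - x = e *\<^sub>R y + ((1 - e) *\<^sub>R y - x)" by (simp add: algebra_simps)
      then have "norm (y - x) \<le> norm (e *\<^sub>R y) + norm ((1 - e) *\<^sub>R y - x)"
        by (metis norm_triangle_ineq)
      then have n2: "norm (y - x) < \<eta>" using x(2) y1(2) e by linarith
      have "x \<in> rat_vecs \<inter> cball 0 1" using x(1) n1 by simp
      moreover have "y \<in> ball x \<eta>" using n2 by (simp add: dist_norm norm_minus_commute)
      ultimately show "y \<in> (\<Union>x\<in>rat_vecs \<inter> cball 0 1. ball x \<eta>)" by (rule UN_I)
    qed
    obtain N where N: "N \<subseteq> rat_vecs \<inter> cball 0 1" "finite N" "cball (0::'a) 1 \<subseteq> (\<Union>x\<in>N. ball x \<eta>)"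
      by (rule compactE_image[of "cball 0 1" "rat_vecs \<inter> cball 0 1" "\<lambda>x. ball x \<eta>", OF compact_cball open_ball cov])
    have "\<exists>x\<in>N. norm (y - x) < \<eta>" if "norm y \<le> 1" for y
    proof -
      have "y \<in> (\<Union>x\<in>N. ball x \<eta>)" by (rule subsetD[OF N(3)]) (use that in simp)
      then show ?thesis by (auto simp: dist_norm norm_minus_commute)
    qed
    then show thesis using N by (intro that[of N]) auto
  qed
  have "\<forall>\<^sub>F n in sequentially. \<forall>x\<in>N. \<bar>E (\<kappa> n) x\<bar> < \<epsilon> / 2"
  proof (rule eventually_ball_finite[OF N(1)], rule ballI)
    fix x assume "x \<in> N"
    then have x: "x \<in> rat_vecs" using N by auto
    have "(\<lambda>n. \<bar>E (\<kappa> n) x\<bar>) \<longlonglongrightarrow> \<bar>f x - (x \<bullet> A x) / 2\<bar>" unfolding E_def by (intro tendsto_intros f x)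
    then show "\<forall>\<^sub>F n in sequentially. \<bar>E (\<kappa> n) x\<bar> < \<epsilon> / 2"
      by (rule order_tendstoD(2)) (use A(2)[OF x] \<open>\<epsilon> > 0\<close> in simp)
  qed
  moreover have "\<forall>\<^sub>F n in sequentially. hs (\<kappa> n) < \<epsilon>"
    by (rule ev\<kappa>) (rule order_tendstoD(2)[OF hs0 \<open>\<epsilon> > 0\<close>])
  ultimately have "\<forall>\<^sub>F n in sequentially. (\<forall>x\<in>N. \<bar>E (\<kappa> n) x\<bar> < \<epsilon> / 2) \<and> hs (\<kappa> n) < \<epsilon> \<and> hs (\<kappa> n) * 2 \<le> r' / 2"
    using ev\<kappa>[OF ev[of 2]] by eventually_elim auto
  then obtain n where n: "\<And>x. x \<in> N \<Longrightarrow> \<bar>E (\<kappa> n) x\<bar> < \<epsilon> / 2" "hs (\<kappa> n) < \<epsilon>" "hs (\<kappa> n) * 2 \<le> r' / 2"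
    using eventually_happens'[OF sequentially_bot] by blast
  define k where "k = \<kappa> n"
  note n = n[folded k_def]
  have E_small: "\<bar>E k y\<bar> \<le> \<epsilon>" if y: "norm y \<le> 1" for y
  proof -
    obtain x where x: "x \<in> N" "norm (y - x) < \<eta>" using N(3)[OF y] by blast
    have "\<bar>E k y - E k x\<bar> \<le> D * norm (y - x)" using N(2) x by (intro E_lip n y) auto
    also have "\<dots> \<le> D * \<eta>" using x D by (intro mult_left_mono) auto
    also have "\<dots> = \<epsilon> / 2" using D by (simp add: \<eta>_def)
    finally show ?thesis using n(1)[OF x(1)] by linarith
  qed
  show ?thesis
  proof (rule exI[of _ "zs k"], rule exI[of _ "\<xi>s k"], rule exI[of _ "hs k"], rule exI[of _ A], intro conjI allI impI)
    have "dist z0 (zs k) \<le> r' / 4" using zs[of k] by (simp add: K_def)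
    then show "dist z0 (zs k) < \<epsilon>" using r' \<open>\<epsilon> > 0\<close> by linarith
    show "norm (\<xi>s k) < \<epsilon>" using \<xi>s(1)[of k] \<delta> by linarith
    fix y :: 'a assume y: "norm y \<le> hs k"
    define u where "u = (1 / hs k) *\<^sub>R y"
    have u: "norm u \<le> 1" "y = hs k *\<^sub>R u" using y hs[of k] by (auto simp: u_def divide_le_eq)
    have Wu: "W (zs k + y) = W (zs k) + \<xi>s k \<bullet> y + (hs k)\<^sup>2 * U k u"
      using hs[of k] by (simp add: U_def u(2))
    have hu: "hs k * norm u \<le> r' / 2"
    proof -
      have "hs k * norm u \<le> hs k * 2" using u hs[of k] by (intro mult_left_mono) auto
      then show ?thesis using n(3) by simp
    qed
    show "W (zs k + y) \<le> W (zs k) + \<xi>s k \<bullet> y"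
      using U_le[OF hu] hs[of k] unfolding Wu by (simp add: mult_le_0_iff)
    show "W (zs k) + \<xi>s k \<bullet> y - C * (norm y)\<^sup>2 \<le> W (zs k + y)"
      using mult_left_mono[OF U_ge[of u k], of "(hs k)\<^sup>2"] hs[of k]
      unfolding Wu unfolding u(2) by (simp add: power_mult_distrib algebra_simps)
    have "W (zs k + y) - W (zs k) - \<xi>s k \<bullet> y - (y \<bullet> A y) / 2 = (hs k)\<^sup>2 * E k u"
      unfolding Wu E_def unfolding u(2) using linear_scale[OF A(1)] by (simp add: algebra_simps power2_eq_square)
    then show "\<bar>W (zs k + y) - W (zs k) - \<xi>s k \<bullet> y - (y \<bullet> A y) / 2\<bar> \<le> \<epsilon> * (hs k)\<^sup>2"
      using mult_left_mono[OF E_small[OF u(1)], of "(hs k)\<^sup>2"] by (simp add: abs_mult mult.commute)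
  qed (use hs n A in auto)
qed

section \<open>Theorem on sums\<close>

definition usc_set :: "'a::metric_space set \<Rightarrow> ('a \<Rightarrow> real) \<Rightarrow> bool" where
  "usc_set C f \<longleftrightarrow> (\<forall>p\<in>C. \<forall>e>0. \<exists>\<delta>>0. \<forall>q\<in>C. dist q p < \<delta> \<longrightarrow> f q < f p + e)"

lemma usc_setD:
  assumes "usc_set C f" "p \<in> C" "e > 0"
  obtains \<delta> where "\<delta> > 0" "\<And>q. q \<in> C \<Longrightarrow> dist q p < \<delta> \<Longrightarrow> f q < f p + e"
  using assms unfolding usc_set_def by blast

lemma usc_set_subset: "usc_set C f \<Longrightarrow> D \<subseteq> C \<Longrightarrow> usc_set D f"
  unfolding usc_set_def by (meson subset_iff)

lemma continuous_imp_usc_set: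
  assumes "continuous_on C f"
  shows "usc_set C f"
  unfolding usc_set_def
proof (intro ballI allI impI)
  fix p and e :: real assume p: "p \<in> C" "e > 0"
  obtain d where "d > 0" "\<And>q. q \<in> C \<Longrightarrow> dist q p < d \<Longrightarrow> dist (f q) (f p) < e"
    using assms p unfolding continuous_on_iff by metis
  then show "\<exists>\<delta>>0. \<forall>q\<in>C. dist q p < \<delta> \<longrightarrow> f q < f p + e"
    by (intro exI[of _ d]) (auto simp: dist_real_def abs_less_iff intro: diff_less_eq[THEN iffD1], force)
qed

lemma usc_set_add:
  assumes "usc_set C f" "usc_set C g"
  shows "usc_set C (\<lambda>x. f x + g x)"
  unfolding usc_set_def
proof (intro ballI allI impI)
  fix p and e :: real assume p: "p \<in> C" and e: "e > 0"
  then have e2: "e / 2 > 0" by simp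
  obtain d1 where d1: "d1 > 0" "\<And>q. q \<in> C \<Longrightarrow> dist q p < d1 \<Longrightarrow> f q < f p + e / 2"
    using usc_setD[OF assms(1) p e2] by blast
  obtain d2 where d2: "d2 > 0" "\<And>q. q \<in> C \<Longrightarrow> dist q p < d2 \<Longrightarrow> g q < g p + e / 2"
    using usc_setD[OF assms(2) p e2] by blast
  show "\<exists>\<delta>>0. \<forall>q\<in>C. dist q p < \<delta> \<longrightarrow> f q + g q < f p + g p + e"
  proof (intro exI[of _ "min d1 d2"] conjI ballI impI)
    fix q assume "q \<in> C" "dist q p < min d1 d2"
    then show "f q + g q < f p + g p + e" using d1(2)[of q] d2(2)[of q] by simp
  qed (use d1 d2 in auto)
qed

lemma usc_set_compose_Lipschitz:
  assumes "usc_set C f" "h ` D \<subseteq> C" "\<And>x y. dist (h x) (h y) \<le> dist x y"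
  shows "usc_set D (\<lambda>x. f (h x))"
  unfolding usc_set_def
proof (intro ballI allI impI)
  fix p and e :: real assume p: "p \<in> D" and e: "e > 0"
  then obtain d where d: "d > 0" "\<And>q. q \<in> C \<Longrightarrow> dist q (h p) < d \<Longrightarrow> f q < f (h p) + e"
    using usc_setD[OF assms(1) _ e, of "h p"] assms(2) by blast
  show "\<exists>\<delta>>0. \<forall>q\<in>D. dist q p < \<delta> \<longrightarrow> f (h q) < f (h p) + e"
  proof (intro exI[of _ d] conjI ballI impI)
    fix q assume "q \<in> D" "dist q p < d"
    then show "f (h q) < f (h p) + e"
      using d(2)[of "h q"] assms(2) assms(3)[of q p] by auto
  qed (use d in auto)
qed

text \<open>Without a maximiser each \<open>p\<close> has a better point \<open>s p\<close>, and
  near \<open>p\<close> the function stays below \<open>f (s p)\<close>. Among finitely many such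
  neighbourhoods that cover \<open>C\<close>, the largest value \<open>f (s p)\<close> would have to
  be exceeded by another one.\<close>

lemma usc_set_attains_sup:
  assumes "compact C" "C \<noteq> {}" "usc_set C f"
  shows "\<exists>p\<in>C. \<forall>q\<in>C. f q \<le> f p"
proof (rule ccontr)
  assume "\<not> ?thesis"
  then have "\<forall>p\<in>C. \<exists>q\<in>C. f p < f q" by (force simp: not_le)
  then obtain s where s: "\<And>p. p \<in> C \<Longrightarrow> s p \<in> C" "\<And>p. p \<in> C \<Longrightarrow> f p < f (s p)" by metis
  have "\<forall>p\<in>C. \<exists>d>0. \<forall>q\<in>C. dist q p < d \<longrightarrow> f q < f (s p)"
  proof
    fix p assume p: "p \<in> C"
    then have e: "f (s p) - f p > 0" using s by simp
    show "\<exists>d>0. \<forall>q\<in>C. dist q p < d \<longrightarrow> f q < f (s p)"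
      using usc_setD[OF assms(3) p e] by (metis add_diff_cancel_left' diff_add_cancel add.commute)
  qed
  then obtain d where d: "\<And>p. p \<in> C \<Longrightarrow> d p > 0"
    "\<And>p q. p \<in> C \<Longrightarrow> q \<in> C \<Longrightarrow> dist q p < d p \<Longrightarrow> f q < f (s p)" by metis
  have cov: "C \<subseteq> (\<Union>p\<in>C. ball p (d p))" using d(1) by force
  obtain N where N: "N \<subseteq> C" "finite N" "C \<subseteq> (\<Union>p\<in>N. ball p (d p))"
    by (rule compactE_image[of C C "\<lambda>p. ball p (d p)", OF assms(1) open_ball cov])
  have "N \<noteq> {}" using N assms(2) by auto
  then obtain p where p: "p \<in> N" "\<And>p'. p' \<in> N \<Longrightarrow> f (s p') \<le> f (s p)"
  proof -
    let ?M = "Max ((\<lambda>p. f (s p)) ` N)"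
    have "?M \<in> (\<lambda>p. f (s p)) ` N" using N(2) \<open>N \<noteq> {}\<close> by (intro Max_in) auto
    then obtain p where p: "p \<in> N" "?M = f (s p)" by blast
    have "f (s p') \<le> ?M" if "p' \<in> N" for p' using that N(2) by (intro Max_ge) auto
    then show thesis using p by (intro that[of p]) simp_all
  qed
  then have "s p \<in> C" using s N by auto
  then obtain p' where p': "p' \<in> N" "s p \<in> ball p' (d p')" using subsetD[OF N(3)] by blast
  then have "f (s p) < f (s p')" using d(2)[of p' "s p"] N(1) \<open>s p \<in> C\<close> by (auto simp: dist_commute)
  with p(2)[OF p'(1)] show False by simp
qed

text \<open>The convolution kernel is built from \<open>L\<close> itself, so that anisotropic
  penalties are covered. The factor 2 is matched to the penalty
  \<open>(norm (L (p - q)))^2 / 2\<close>: regularising both functions in this way turns it into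
  exactly \<open>(norm (L (p - q)))^2\<close>.\<close>

definition supconv :: "'a::real_normed_vector set \<Rightarrow> ('a \<Rightarrow> 'b::real_normed_vector) \<Rightarrow> ('a \<Rightarrow> real) \<Rightarrow> 'a \<Rightarrow> real" where
  "supconv C L f p = (SUP p'\<in>C. f p' - 2 * (norm (L (p - p')))\<^sup>2)"

lemma supconv_attained:
  fixes L :: "'a::euclidean_space \<Rightarrow> 'b::real_normed_vector"
  assumes "compact C" "C \<noteq> {}" "usc_set C f" "linear L"
  shows "\<exists>p'\<in>C. supconv C L f p = f p' - 2 * (norm (L (p - p')))\<^sup>2 \<and>
    (\<forall>q\<in>C. f q - 2 * (norm (L (p - q)))\<^sup>2 \<le> supconv C L f p)"
proof -
  have "continuous_on C (\<lambda>p'. - (2 * (norm (L (p - p')))\<^sup>2))"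
    by (intro continuous_intros linear_continuous_on_compose[OF _ assms(4)])
  from usc_set_attains_sup[OF assms(1,2) usc_set_add[OF assms(3) continuous_imp_usc_set[OF this]]]
  obtain p' where p': "p' \<in> C" "\<And>q. q \<in> C \<Longrightarrow> f q - 2 * (norm (L (p - q)))\<^sup>2 \<le> f p' - 2 * (norm (L (p - p')))\<^sup>2"
    by auto
  have "supconv C L f p = f p' - 2 * (norm (L (p - p')))\<^sup>2"
    unfolding supconv_def by (rule cSup_eq_maximum) (use p' in auto)
  then show ?thesis using p' by auto
qed

text \<open>The point of \<open>C\<close> that is optimal for the intermediate argument competes at
  both ends, and for a fixed point the quadratic kernel satisfies \<open>norm_sq_combination\<close>
  with equality.\<close>

lemma supconv_semiconvex:
  fixes L :: "'a::euclidean_space \<Rightarrow> 'b::real_inner"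
  assumes C: "compact C" "C \<noteq> {}" "usc_set C f" "linear L" and t: "0 \<le> t" "t \<le> 1"
  shows "supconv C L f ((1 - t) *\<^sub>R x + t *\<^sub>R y)
    \<le> (1 - t) * supconv C L f x + t * supconv C L f y + 2 * t * (1 - t) * (norm (L (x - y)))\<^sup>2"
proof -
  let ?w = "(1 - t) *\<^sub>R x + t *\<^sub>R y"
  obtain p' where p': "p' \<in> C" "supconv C L f ?w = f p' - 2 * (norm (L (?w - p')))\<^sup>2"
    using supconv_attained[OF C] by blast
  have x: "f p' - 2 * (norm (L (x - p')))\<^sup>2 \<le> supconv C L f x"
    and y: "f p' - 2 * (norm (L (y - p')))\<^sup>2 \<le> supconv C L f y"
    using supconv_attained[OF C] p'(1) by blast+
  have "?w - p' = (1 - t) *\<^sub>R (x - p') + t *\<^sub>R (y - p')" by (simp add: algebra_simps)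
  then have "L (?w - p') = (1 - t) *\<^sub>R L (x - p') + t *\<^sub>R L (y - p')"
    using C(4) by (simp only: linear_add linear_scale)
  moreover have "L (x - p') - L (y - p') = L (x - y)"
    using C(4) by (simp flip: linear_diff)
  ultimately have n: "(norm (L (?w - p')))\<^sup>2 = (1 - t) * (norm (L (x - p')))\<^sup>2 + t * (norm (L (y - p')))\<^sup>2
      - t * (1 - t) * (norm (L (x - y)))\<^sup>2"
    by (simp add: norm_sq_combination)
  have "(1 - t) * (f p' - 2 * (norm (L (x - p')))\<^sup>2) + t * (f p' - 2 * (norm (L (y - p')))\<^sup>2)
    \<le> (1 - t) * supconv C L f x + t * supconv C L f y"
    using t x y by (intro add_mono mult_left_mono) auto
  then show ?thesis unfolding p'(2) n by (simp add: algebra_simps)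
qed

text \<open>Polarisation and the parallelogram law; only the symmetric part of \<open>X\<close> is
  visible to its quadratic form, hence the symmetrised expression.\<close>

lemma quadratic_polarization_bound:
  fixes X :: "'a::real_inner \<Rightarrow> 'a"
  assumes X: "linear X" and c: "\<And>y. \<bar>y \<bullet> X y\<bar> \<le> c * (norm y)\<^sup>2"
  shows "\<bar>y \<bullet> X u + u \<bullet> X y\<bar> \<le> 2 * c * norm y * norm u"
proof -
  have *: "\<bar>y \<bullet> X u + u \<bullet> X y\<bar> \<le> 2 * c" if "norm y = 1" "norm u = 1" for y u
  proof -
    have "2 * (y \<bullet> X u + u \<bullet> X y) = (y + u) \<bullet> X (y + u) - (y - u) \<bullet> X (y - u)"
      using X by (simp add: linear_add linear_diff inner_add_left inner_add_right inner_diff_left inner_diff_right)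
    also have "\<bar>\<dots>\<bar> \<le> c * (norm (y + u))\<^sup>2 + c * (norm (y - u))\<^sup>2"
      using c[of "y + u"] c[of "y - u"] by linarith
    also have "\<dots> = c * ((norm (y + u))\<^sup>2 + (norm (y - u))\<^sup>2)" by (simp add: distrib_left)
    also have "(norm (y + u))\<^sup>2 + (norm (y - u))\<^sup>2 = 2 * (norm y)\<^sup>2 + 2 * (norm u)\<^sup>2"
      by (simp add: power2_norm_eq_inner inner_add_left inner_add_right inner_diff_left inner_diff_right)
    finally show ?thesis using that by simp
  qed
  show ?thesis
  proof (cases "y = 0 \<or> u = 0")
    case True
    then show ?thesis using linear_0[OF X] by auto
  next
    case False
    define y' u' where "y' = (1 / norm y) *\<^sub>R y" and "u' = (1 / norm u) *\<^sub>R u"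
    have yu: "y = norm y *\<^sub>R y'" "u = norm u *\<^sub>R u'" "norm y' = 1" "norm u' = 1"
      using False by (auto simp: y'_def u'_def)
    have "y \<bullet> X u + u \<bullet> X y = norm y * norm u * (y' \<bullet> X u' + u' \<bullet> X y')"
      by (subst (1 2) yu(1), subst (1 2) yu(2)) (simp add: linear_scale[OF X] algebra_simps)
    then have "\<bar>y \<bullet> X u + u \<bullet> X y\<bar> = norm y * norm u * \<bar>y' \<bullet> X u' + u' \<bullet> X y'\<bar>"
      by (simp add: abs_mult)
    also have "\<dots> \<le> norm y * norm u * (2 * c)" by (intro mult_left_mono *[OF yu(3,4)]) auto
    finally show ?thesis by (simp add: mult_ac)
  qed
qed

text \<open>An error \<open>e * \<rho>^2\<close> becomes exact touching at a nearby point: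
  subtracting \<open>2 * e * (norm y)^2\<close> costs \<open>2 * e * \<rho>^2\<close> on the sphere,
  more than the error allows, so the maximiser is interior. Re-expanding there moves the slope by at
  most \<open>(c + 4 * e) * \<rho>\<close> and adds \<open>4 * e\<close> to the quadratic
  part.\<close>

lemma touching_quadratic:
  fixes F :: "'a::euclidean_space \<Rightarrow> real"
  assumes F: "continuous_on UNIV F" and X: "linear X" and c: "\<And>y. \<bar>y \<bullet> X y\<bar> \<le> c * (norm y)\<^sup>2"
    and \<rho>: "\<rho> > 0" and e: "e > 0"
    and above: "\<And>y. norm y \<le> \<rho> \<Longrightarrow> F (p + y) \<le> F p + a \<bullet> y + (y \<bullet> X y) / 2 + e * \<rho>\<^sup>2"
  shows "\<exists>y a'. norm y < \<rho> \<and> (\<forall>\<eta>. \<bar>a' \<bullet> \<eta> - a \<bullet> \<eta>\<bar> \<le> (c + 4 * e) * \<rho> * norm \<eta>) \<and>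
    (\<forall>u. norm (y + u) \<le> \<rho> \<longrightarrow>
      F (p + y + u) \<le> F (p + y) + a' \<bullet> u + (u \<bullet> (X u + (4 * e) *\<^sub>R u)) / 2)"
proof -
  define G where "G y = F (p + y) - a \<bullet> y - (y \<bullet> X y) / 2 - 2 * e * (norm y)\<^sup>2" for y
  have "continuous_on (cball 0 \<rho>) G"
    unfolding G_def
    by (intro continuous_intros continuous_on_compose2[OF F] linear_continuous_on_compose[OF _ X]) auto
  then obtain y where y: "norm y \<le> \<rho>" "\<And>y'. norm y' \<le> \<rho> \<Longrightarrow> G y' \<le> G y"
    using continuous_attains_sup[of "cball 0 \<rho>" G] \<rho> by auto
  have "norm y \<noteq> \<rho>"
  proof
    assume n: "norm y = \<rho>"
    have "G y \<le> F p + e * \<rho>\<^sup>2 - 2 * e * \<rho>\<^sup>2" using above[OF y(1)] n by (simp add: G_def)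
    moreover have "G 0 = F p" using linear_0[OF X] by (simp add: G_def)
    moreover have "G 0 \<le> G y" using \<rho> by (intro y(2)) simp
    moreover have "e * \<rho>\<^sup>2 > 0" using e \<rho> by simp
    ultimately show False by linarith
  qed
  then have y1: "norm y < \<rho>" using y(1) by simp
  define a' where "a' = a + (1/2) *\<^sub>R (X y + adjoint X y) + (4 * e) *\<^sub>R y"
  have a': "a' \<bullet> \<eta> = a \<bullet> \<eta> + (y \<bullet> X \<eta> + \<eta> \<bullet> X y) / 2 + 4 * e * (y \<bullet> \<eta>)" for \<eta>
  proof -
    have "adjoint X y \<bullet> \<eta> = y \<bullet> X \<eta>" using adjoint_works[OF X, of \<eta> y] by (metis inner_commute)
    then show ?thesis by (simp add: a'_def inner_add_left inner_commute[of "X y"])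
  qed
  have c0: "c \<ge> 0"
  proof -
    obtain b :: 'a where "b \<in> Basis" using nonempty_Basis by blast
    then show ?thesis using c[of b] by (simp add: norm_Basis)
  qed
  have lip: "\<bar>a' \<bullet> \<eta> - a \<bullet> \<eta>\<bar> \<le> (c + 4 * e) * \<rho> * norm \<eta>" for \<eta>
  proof -
    define N where "N = norm y * norm \<eta>"
    have t1: "\<bar>y \<bullet> X \<eta> + \<eta> \<bullet> X y\<bar> \<le> 2 * (c * N)"
      using quadratic_polarization_bound[OF X c] by (simp add: N_def mult.assoc)
    have "\<bar>4 * e * (y \<bullet> \<eta>)\<bar> = 4 * (e * \<bar>y \<bullet> \<eta>\<bar>)" using e by (simp add: abs_mult)
    also have "\<dots> \<le> 4 * (e * N)"
      using e Cauchy_Schwarz_ineq2[of y \<eta>] by (simp add: N_def)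
    finally have t2: "\<bar>4 * e * (y \<bullet> \<eta>)\<bar> \<le> 4 * (e * N)" .
    have "2 * (a' \<bullet> \<eta> - a \<bullet> \<eta>) = (y \<bullet> X \<eta> + \<eta> \<bullet> X y) + 2 * (4 * e * (y \<bullet> \<eta>))"
      unfolding a' by simp
    then have "\<bar>2 * (a' \<bullet> \<eta> - a \<bullet> \<eta>)\<bar> \<le> \<bar>y \<bullet> X \<eta> + \<eta> \<bullet> X y\<bar> + 2 * \<bar>4 * e * (y \<bullet> \<eta>)\<bar>"
      using abs_triangle_ineq[of "y \<bullet> X \<eta> + \<eta> \<bullet> X y" "2 * (4 * e * (y \<bullet> \<eta>))"] by (simp add: abs_mult)
    then have "\<bar>a' \<bullet> \<eta> - a \<bullet> \<eta>\<bar> \<le> c * N + 4 * (e * N)" using t1 t2 by simp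
    also have "\<dots> = (c + 4 * e) * (norm y * norm \<eta>)" by (simp add: N_def algebra_simps)
    also have "\<dots> \<le> (c + 4 * e) * (\<rho> * norm \<eta>)"
      using c0 e y by (intro mult_left_mono mult_right_mono) auto
    finally show ?thesis by (simp add: mult.assoc)
  qed
  have touch: "F (p + y + u) \<le> F (p + y) + a' \<bullet> u + (u \<bullet> (X u + (4 * e) *\<^sub>R u)) / 2"
    if "norm (y + u) \<le> \<rho>" for u
  proof -
    have "(norm (y + u))\<^sup>2 = (norm y)\<^sup>2 + 2 * (y \<bullet> u) + u \<bullet> u"
      by (simp add: power2_norm_eq_inner inner_add_left inner_add_right inner_commute)
    moreover have "(y + u) \<bullet> X (y + u) = y \<bullet> X y + (y \<bullet> X u + u \<bullet> X y) + u \<bullet> X u"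
      using X by (simp add: linear_add inner_add_left inner_add_right)
    ultimately show ?thesis using y(2)[OF that] unfolding a' G_def
      by (simp add: inner_add_right algebra_simps add_divide_distrib)
  qed
  show ?thesis
  proof (rule exI[of _ y], rule exI[of _ a'], intro conjI allI impI)
    show "norm y < \<rho>" by (rule y1)
    show "\<bar>a' \<bullet> \<eta> - a \<bullet> \<eta>\<bar> \<le> (c + 4 * e) * \<rho> * norm \<eta>" for \<eta> by (rule lip)
    show "F (p + y + u) \<le> F (p + y) + a' \<bullet> u + (u \<bullet> (X u + (4 * e) *\<^sub>R u)) / 2"
      if "norm (y + u) \<le> \<rho>" for u using that by (rule touch)
  qed
qed

lemma quadratic_homogeneous_le:
  fixes Q :: "'a::real_normed_vector \<Rightarrow> real"
  assumes Q: "\<And>t y. Q (t *\<^sub>R y) = t\<^sup>2 * Q y" and \<rho>: "\<rho> > 0"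
    and le: "\<And>y. norm y = \<rho> \<Longrightarrow> Q y \<le> c * \<rho>\<^sup>2"
  shows "Q y \<le> c * (norm y)\<^sup>2"
proof (cases "y = 0")
  case True
  then show ?thesis using Q[of 0 0] by simp
next
  case False
  define t where "t = \<rho> / norm y"
  have t: "t > 0" "t * norm y = \<rho>" using False \<rho> by (simp_all add: t_def)
  have "t\<^sup>2 * Q y \<le> c * (t * norm y)\<^sup>2" using le[of "t *\<^sub>R y"] t by (simp add: Q)
  also have "\<dots> = t\<^sup>2 * (c * (norm y)\<^sup>2)" by (simp add: power_mult_distrib)
  finally show ?thesis using t(1) by simp
qed

text \<open>The expression on the left is nonnegative, which is the comparison of the two penalties.
  The remainder is kept exactly, because its smallness later identifies the slope at the transferred
  points.\<close>

lemma parallelogram_gap: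
  fixes a b v :: "'a::real_inner"
  shows "(norm v)\<^sup>2 + 2 * (norm a)\<^sup>2 + 2 * (norm b)\<^sup>2 - (norm (v - a + b))\<^sup>2 / 2
    = (norm (v + a - b))\<^sup>2 / 2 + (norm (a + b))\<^sup>2"
  unfolding power2_norm_eq_inner
  by (simp add: inner_add_left inner_add_right inner_diff_left inner_diff_right
      inner_commute[of a v] inner_commute[of b v] inner_commute[of b a] field_simps)

text \<open>An \<open>\<epsilon>\<close>-version of the Crandall--Ishii theorem on sums: the jets belong to points that
  are only almost maximal. For maximal \<open>(p1, q1)\<close> the sup-convolutions satisfy
  \<open>supconv C L f p + supconv C L g q \<le> M + (norm (L (p - q)))\<^sup>2\<close>, with equality at
  \<open>(p1 - d, q1 + d)\<close> for \<open>d = (p1 - q1) / 4\<close>; the quadratic approximation is taken there.\<close>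
lemma approx_theorem_on_sums:
  fixes f g :: "'e::euclidean_space \<Rightarrow> real" and L :: "'e \<Rightarrow> 'e"
  assumes C: "compact C" "C \<noteq> {}" and usc: "usc_set C f" "usc_set C g" and L: "linear L" and "\<epsilon> > 0"
    and pq: "p1 \<in> C" "q1 \<in> C" "f p1 + g q1 - (norm (L (p1 - q1)))\<^sup>2 / 2 = M"
    and M: "\<And>p q. p \<in> C \<Longrightarrow> q \<in> C \<Longrightarrow> f p + g q - (norm (L (p - q)))\<^sup>2 / 2 \<le> M"
  shows "\<exists>p\<in>C. \<exists>q\<in>C. \<exists>a b X Y. f p + g q - (norm (L (p - q)))\<^sup>2 / 2 \<ge> M - \<epsilon> \<and> linear X \<and> linear Y \<and>
     (\<forall>\<eta>. \<bar>a \<bullet> \<eta> - L (p - q) \<bullet> L \<eta>\<bar> \<le> \<epsilon> * norm \<eta>) \<and>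
     (\<forall>\<eta>. \<bar>b \<bullet> \<eta> + L (p - q) \<bullet> L \<eta>\<bar> \<le> \<epsilon> * norm \<eta>) \<and>
     (\<forall>\<xi> \<zeta>. \<xi> \<bullet> X \<xi> + \<zeta> \<bullet> Y \<zeta> \<le> 2 * (norm (L (\<xi> - \<zeta>)))\<^sup>2 + \<epsilon> * ((norm \<xi>)\<^sup>2 + (norm \<zeta>)\<^sup>2)) \<and>
     (\<exists>\<delta>>0. \<forall>p'\<in>C. dist p' p < \<delta> \<longrightarrow> f p' \<le> f p + a \<bullet> (p' - p) + ((p' - p) \<bullet> X (p' - p)) / 2) \<and>
     (\<exists>\<delta>>0. \<forall>q'\<in>C. dist q' q < \<delta> \<longrightarrow> g q' \<le> g q + b \<bullet> (q' - q) + ((q' - q) \<bullet> Y (q' - q)) / 2)"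
proof -
  define F G where "F = supconv C L f" and "G = supconv C L g"
  note Fat = supconv_attained[OF C usc(1) L, folded F_def] and Gat = supconv_attained[OF C usc(2) L, folded G_def]
  obtain K where K: "K > 0" "\<And>x. norm (L x) \<le> K * norm x"
    using bounded_linear.pos_bounded[OF linear_conv_bounded_linear[THEN iffD1, OF L]]
    by (auto simp: mult.commute)
  define \<epsilon>1 where "\<epsilon>1 = min \<epsilon> 1"
  have \<epsilon>1: "\<epsilon>1 > 0" "\<epsilon>1 \<le> 1" "\<epsilon>1 \<le> \<epsilon>" using \<open>\<epsilon> > 0\<close> by (auto simp: \<epsilon>1_def)
  \<comment> \<open>The strictness \<open>s\<close> and the scale \<open>e\<close> share one error
    budget: the inequality \<open>XY\<close> for the second-order parts needs
    \<open>2 * (s + 4 * e) + 4 * e \<le> \<epsilon>\<close>, which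
    \<open>24 * e \<le> \<epsilon>1\<close> leaves room for.\<close>
  define s where "s = \<epsilon>1 / 4"
  have s: "s > 0" "s \<le> 1" using \<epsilon>1 by (auto simp: s_def)
  define N where "N = (\<lambda>z. F (fst z) + G (snd z) - (norm (L (fst z - snd z)))\<^sup>2)"
  define d where "d = (1/4) *\<^sub>R (p1 - q1)"
  define z0 where "z0 = (p1 - d, q1 + d)"
  define W where "W z = N z - s * (norm (z - z0))\<^sup>2" for z
  define C0 where "C0 = 4 * K\<^sup>2 + s"
  have C0: "C0 \<ge> 0" using s by (simp add: C0_def)

  have Lsq: "(norm (L (u - v)))\<^sup>2 \<le> K\<^sup>2 * (2 * ((norm u)\<^sup>2 + (norm v)\<^sup>2))" for u v
  proof -
    have "(norm (L (u - v)))\<^sup>2 \<le> (K * norm (u - v))\<^sup>2" by (intro power_mono K) simp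
    also have "\<dots> = K\<^sup>2 * (norm (u - v))\<^sup>2" by (simp add: power_mult_distrib)
    also have "(norm (u - v))\<^sup>2 \<le> (norm (u - v))\<^sup>2 + (norm (u + v))\<^sup>2" by simp
    also have "\<dots> = 2 * ((norm u)\<^sup>2 + (norm v)\<^sup>2)"
      by (simp add: power2_norm_eq_inner inner_add_left inner_add_right inner_diff_left inner_diff_right)
    finally show ?thesis by (simp add: mult_left_mono)
  qed
  have Lsq1: "(norm (L u))\<^sup>2 \<le> K\<^sup>2 * (norm u)\<^sup>2" for u
    using power_mono[OF K(2)[of u], of 2] by (simp add: power_mult_distrib)
  have nsq: "(norm z)\<^sup>2 = (norm (fst z))\<^sup>2 + (norm (snd z))\<^sup>2" for z :: "'e \<times> 'e"
    by (cases z) (simp add: norm_Pair)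

  have nfst: "norm (fst z) \<le> norm z" and nsnd: "norm (snd z) \<le> norm z" for z :: "'e \<times> 'e"
    using norm_fst_le[of "fst z" "snd z"] norm_snd_le[of "snd z" "fst z"] by simp_all

  have sc: "semiconvex C0 W"
    unfolding semiconvex_def
  proof (intro allI impI)
    fix x y :: "'e \<times> 'e" and t :: real assume t: "0 \<le> t" "t \<le> 1"
    define w where "w = (1 - t) *\<^sub>R x + t *\<^sub>R y"
    have F1: "F (fst w) \<le> (1 - t) * F (fst x) + t * F (fst y) + 2 * t * (1 - t) * (norm (L (fst (x - y))))\<^sup>2"
      using supconv_semiconvex[OF C usc(1) L t, of "fst x" "fst y"] by (simp add: F_def w_def)
    have G1: "G (snd w) \<le> (1 - t) * G (snd x) + t * G (snd y) + 2 * t * (1 - t) * (norm (L (snd (x - y))))\<^sup>2"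
      using supconv_semiconvex[OF C usc(2) L t, of "snd x" "snd y"] by (simp add: G_def w_def)
    have "fst w - snd w = (1 - t) *\<^sub>R (fst x - snd x) + t *\<^sub>R (fst y - snd y)"
      by (simp add: w_def algebra_simps)
    then have "L (fst w - snd w) = (1 - t) *\<^sub>R L (fst x - snd x) + t *\<^sub>R L (fst y - snd y)"
      using L by (simp only: linear_add linear_scale)
    moreover have "L (fst x - snd x) - L (fst y - snd y) = L (fst (x - y) - snd (x - y))"
      using L by (simp flip: linear_diff add: algebra_simps)
    ultimately have L1: "(norm (L (fst w - snd w)))\<^sup>2 = (1 - t) * (norm (L (fst x - snd x)))\<^sup>2
      + t * (norm (L (fst y - snd y)))\<^sup>2 - t * (1 - t) * (norm (L (fst (x - y) - snd (x - y))))\<^sup>2"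
      by (simp add: norm_sq_combination)
    have "w - z0 = (1 - t) *\<^sub>R (x - z0) + t *\<^sub>R (y - z0)" by (simp add: w_def algebra_simps)
    then have z1: "(norm (w - z0))\<^sup>2 = (1 - t) * (norm (x - z0))\<^sup>2 + t * (norm (y - z0))\<^sup>2
      - t * (1 - t) * (norm (x - y))\<^sup>2"
      by (simp add: norm_sq_combination)
    let ?e = "x - y"
    have "2 * (norm (L (fst ?e)))\<^sup>2 + 2 * (norm (L (snd ?e)))\<^sup>2 + (norm (L (fst ?e - snd ?e)))\<^sup>2 + s * (norm ?e)\<^sup>2
      \<le> C0 * (norm ?e)\<^sup>2"
      using Lsq1[of "fst ?e"] Lsq1[of "snd ?e"] Lsq[of "fst ?e" "snd ?e"]
      unfolding nsq C0_def by (simp add: algebra_simps)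
    then have "(t * (1 - t)) * (2 * (norm (L (fst ?e)))\<^sup>2 + 2 * (norm (L (snd ?e)))\<^sup>2
        + (norm (L (fst ?e - snd ?e)))\<^sup>2 + s * (norm ?e)\<^sup>2) \<le> (t * (1 - t)) * (C0 * (norm ?e)\<^sup>2)"
      using t by (intro mult_left_mono) auto
    moreover have "W w \<le> (1 - t) * W x + t * W y + (t * (1 - t)) * (2 * (norm (L (fst ?e)))\<^sup>2
        + 2 * (norm (L (snd ?e)))\<^sup>2 + (norm (L (fst ?e - snd ?e)))\<^sup>2 + s * (norm ?e)\<^sup>2)"
      using F1 G1 unfolding W_def N_def L1 z1 by (simp add: algebra_simps)
    ultimately show "W ((1 - t) *\<^sub>R x + t *\<^sub>R y) \<le> (1 - t) * W x + t * W y + C0 * t * (1 - t) * (norm (x - y))\<^sup>2"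
      unfolding w_def[symmetric] by (simp add: mult_ac)
  qed
  have contW: "continuous_on UNIV W" by (rule semiconvex_continuous[OF sc])
  have contN: "continuous_on UNIV N"
  proof -
    have "continuous_on UNIV (\<lambda>z. W z + s * (norm (z - z0))\<^sup>2)" by (intro continuous_intros contW)
    then show ?thesis by (simp add: W_def)
  qed
  have contL: "continuous_on S (\<lambda>x. L (h x))" if "continuous_on S h" for S :: "'e set" and h :: "'e \<Rightarrow> 'e"
    by (rule linear_continuous_on_compose[OF that L])
  have contF: "continuous_on UNIV F"
  proof -
    have "continuous_on UNIV (\<lambda>p. N (p, 0) + (norm (L (p - 0)))\<^sup>2 - G 0)"
      by (intro continuous_intros continuous_on_compose2[OF contN] contL) auto
    then show ?thesis by (simp add: N_def)
  qed
  have contG: "continuous_on UNIV G"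
  proof -
    have "continuous_on UNIV (\<lambda>q. N (0, q) + (norm (L (0 - q)))\<^sup>2 - F 0)"
      by (intro continuous_intros continuous_on_compose2[OF contN] contL) auto
    then show ?thesis by (simp add: N_def)
  qed

  have gap: "f p' + g q' - (norm (L (p' - q')))\<^sup>2 / 2
      = F p + G q - (norm (L (p - q)))\<^sup>2 + (norm (2 *\<^sub>R L (p - q) - L (p' - q')))\<^sup>2 / 2
        + (norm (L (p - p') + L (q - q')))\<^sup>2"
    if "F p = f p' - 2 * (norm (L (p - p')))\<^sup>2" "G q = g q' - 2 * (norm (L (q - q')))\<^sup>2" for p q p' q'
  proof -
    have e: "L (p - q) - L (p - p') + L (q - q') = L (p' - q')"
      "L (p - q) + L (p - p') - L (q - q') = 2 *\<^sub>R L (p - q) - L (p' - q')"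
      using L by (simp_all add: linear_diff scaleR_2)
    show ?thesis using parallelogram_gap[of "L (p - q)" "L (p - p')" "L (q - q')"] that
      unfolding e by simp
  qed
  have N_le: "N z \<le> M" for z
  proof -
    obtain p' where p': "p' \<in> C" "F (fst z) = f p' - 2 * (norm (L (fst z - p')))\<^sup>2" using Fat by blast
    obtain q' where q': "q' \<in> C" "G (snd z) = g q' - 2 * (norm (L (snd z - q')))\<^sup>2" using Gat by blast
    have "0 \<le> (norm (2 *\<^sub>R L (fst z - snd z) - L (p' - q')))\<^sup>2 / 2 + (norm (L (fst z - p') + L (snd z - q')))\<^sup>2"
      by simp
    then show ?thesis using gap[OF p'(2) q'(2)] M[OF p'(1) q'(1)] unfolding N_def by linarith
  qed
  have N_z0: "N z0 = M"
  proof (rule antisym[OF N_le])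
    have "f p1 - 2 * (norm (L (p1 - d - p1)))\<^sup>2 \<le> F (p1 - d)" using Fat pq(1) by blast
    moreover have "g q1 - 2 * (norm (L (q1 + d - q1)))\<^sup>2 \<le> G (q1 + d)" using Gat pq(2) by blast
    moreover have "(norm (L (p1 - q1)))\<^sup>2 = 16 * (norm (L d))\<^sup>2"
      "(norm (L (p1 - d - (q1 + d))))\<^sup>2 = 4 * (norm (L d))\<^sup>2"
    proof -
    have "p1 - q1 = 4 *\<^sub>R d" by (simp add: d_def)
    then have e: "L (p1 - q1) = 4 *\<^sub>R L d" by (simp only: linear_scale[OF L])
    have "p1 - d - (q1 + d) = (p1 - q1) - 2 *\<^sub>R d" by (simp add: scaleR_2)
    also have "\<dots> = 2 *\<^sub>R d" unfolding \<open>p1 - q1 = 4 *\<^sub>R d\<close> by (simp flip: scaleR_diff_left)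
    finally have e2: "L (p1 - d - (q1 + d)) = 2 *\<^sub>R L d" by (simp only: linear_scale[OF L])
    show "(norm (L (p1 - q1)))\<^sup>2 = 16 * (norm (L d))\<^sup>2"
      "(norm (L (p1 - d - (q1 + d))))\<^sup>2 = 4 * (norm (L d))\<^sup>2"
      unfolding e e2 by (simp_all add: power_mult_distrib)
    qed
    moreover have "(norm (L (p1 - d - p1)))\<^sup>2 = (norm (L d))\<^sup>2" using L by (simp add: linear_neg)
    ultimately show "M \<le> N z0" using pq(3) by (simp add: N_def z0_def)
  qed
  have strict: "W z \<le> W z0 - s * (norm (z - z0))\<^sup>2" for z
    using N_le[of z] N_z0 by (simp add: W_def)

  \<comment> \<open>If \<open>N\<close> is within \<open>\<epsilon>N\<close> of its maximum, the
    remainder in \<open>gap\<close> bounds a squared slope error by \<open>2 * \<epsilon>N\<close>.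
    The second bound makes the slope error at most \<open>\<epsilon> / (4 * K)\<close>, which
    contributes \<open>\<epsilon> / 4\<close> after multiplication by \<open>K\<close>.\<close>
  define \<epsilon>N where "\<epsilon>N = min \<epsilon> ((\<epsilon> / (4 * K))\<^sup>2 / 2)"
  have \<epsilon>N: "\<epsilon>N > 0" "\<epsilon>N \<le> \<epsilon>" "2 * \<epsilon>N \<le> (\<epsilon> / (4 * K))\<^sup>2"
    using \<open>\<epsilon> > 0\<close> K by (auto simp: \<epsilon>N_def)
  obtain \<delta>N where \<delta>N: "\<delta>N > 0" "\<And>z. dist z z0 < \<delta>N \<Longrightarrow> dist (N z) (N z0) < \<epsilon>N"
    using contN \<epsilon>N(1) unfolding continuous_on_iff by (metis UNIV_I)
  define c where "c = 2 * (C0 + 1 + K\<^sup>2 + s)"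
  \<comment> \<open>The coefficient of \<open>e\<close> in the total slope error \<open>fin\<close>:
    \<open>c + 4\<close> from the touching points, 3 from \<open>\<xi>\<close> and the strictness
    term, and \<open>4 * K^2\<close> from the displacement by \<open>y1 - y2\<close>.\<close>
  define B where "B = c + 7 + 4 * K\<^sup>2"
  have B: "B \<ge> 1" using C0 s by (simp add: B_def c_def)
  define e where "e = min (min (\<epsilon>1 / 24) (\<epsilon> / (2 * B))) (\<delta>N / 3)"
  have e: "e > 0" "24 * e \<le> \<epsilon>1" "e * B \<le> \<epsilon> / 2" "3 * e \<le> \<delta>N"
  proof -
    show "e > 0" using \<epsilon>1 \<open>\<epsilon> > 0\<close> \<delta>N B by (simp add: e_def)
    show "24 * e \<le> \<epsilon>1" "3 * e \<le> \<delta>N" by (simp_all add: e_def)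
    have "e \<le> \<epsilon> / (2 * B)" by (simp add: e_def)
    then show "e * B \<le> \<epsilon> / 2" using B by (simp add: field_simps)
  qed
  obtain z \<xi> \<rho> A where z: "dist z0 z < e" and \<xi>: "norm \<xi> < e" and \<rho>: "0 < \<rho>" "\<rho> < e" and A: "linear A"
    and core: "\<And>y. norm y \<le> \<rho> \<Longrightarrow> W (z + y) \<le> W z + \<xi> \<bullet> y"
      "\<And>y. norm y \<le> \<rho> \<Longrightarrow> W (z + y) \<ge> W z + \<xi> \<bullet> y - C0 * (norm y)\<^sup>2"
      "\<And>y. norm y \<le> \<rho> \<Longrightarrow> \<bar>W (z + y) - W z - \<xi> \<bullet> y - (y \<bullet> A y) / 2\<bar> \<le> e * \<rho>\<^sup>2"
    using semiconvex_max_quadratic_approx[OF sc C0 zero_less_one s(1) e(1) strict] by blast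
  define p q where "p = fst z" and "q = snd z"
  have z_eq: "z = (p, q)" by (simp add: p_def q_def)
  define v where "v = L (p - q)"
  define J where "J = adjoint L v"
  have J: "J \<bullet> \<eta> = v \<bullet> L \<eta>" for \<eta> using adjoint_works[OF L, of \<eta> v] by (simp add: J_def inner_commute)
  define H where "H u = adjoint L (L u)" for u
  have H: "linear H" unfolding H_def
    using linear_compose[OF L adjoint_linear[OF L]] by (simp add: o_def)
  have H_quad: "u \<bullet> H u = (norm (L u))\<^sup>2" for u
    using adjoint_works[OF L, of u "L u"] by (simp add: H_def power2_norm_eq_inner)
  \<comment> \<open>The function \<open>W\<close> differs from \<open>F (fst z) + G (snd z)\<close>
    by two quadratic terms. Moving these to the other side makes \<open>(a0, b0)\<close> the slope
    of the sum and \<open>Q\<close> its quadratic part; \<open>X0\<close> and \<open>Y0\<close> are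
    the restrictions of \<open>2 * Q\<close> to the two factors.\<close>
  define a0 b0 where "a0 = fst \<xi> + (2 * s) *\<^sub>R (p - fst z0) + 2 *\<^sub>R J"
    and "b0 = snd \<xi> + (2 * s) *\<^sub>R (q - snd z0) - 2 *\<^sub>R J"
  define X0 Y0 where "X0 u = fst (A (u, 0)) + 2 *\<^sub>R H u + (2 * s) *\<^sub>R u"
    and "Y0 u = snd (A (0, u)) + 2 *\<^sub>R H u + (2 * s) *\<^sub>R u" for u
  have lin_fst: "linear (\<lambda>u. fst (A (u, 0)))" and lin_snd: "linear (\<lambda>u. snd (A (0, u)))"
  proof -
    have i: "linear (\<lambda>u::'e. (u, 0::'e))" "linear (\<lambda>u::'e. (0::'e, u))"
      by (auto intro!: linearI)
    show "linear (\<lambda>u. fst (A (u, 0)))" "linear (\<lambda>u. snd (A (0, u)))"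
      using linear_compose[OF linear_compose[OF i(1) A] linear_fst]
        linear_compose[OF linear_compose[OF i(2) A] linear_snd] by (simp_all add: o_def)
  qed
  have X0: "linear X0" and Y0: "linear Y0"
    unfolding X0_def Y0_def
    by (intro linear_compose_add lin_fst lin_snd linear_compose_scale_right H linear_ident)+
  define Q where "Q y = (y \<bullet> A y) / 2 + (norm (L (fst y - snd y)))\<^sup>2 + s * (norm y)\<^sup>2" for y
  have QX: "Q (u, 0) = (u \<bullet> X0 u) / 2" and QY: "Q (0, u) = (u \<bullet> Y0 u) / 2" for u
  proof -
    have n: "u \<bullet> u = (norm u)\<^sup>2" by (simp add: power2_norm_eq_inner)
    have "L (- u) = - L u" using L by (simp add: linear_neg)
    then show "Q (u, 0) = (u \<bullet> X0 u) / 2" "Q (0, u) = (u \<bullet> Y0 u) / 2"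
      by (simp_all add: Q_def X0_def Y0_def inner_add_right H_quad n inner_prod_def norm_Pair)
  qed
  have Q_hom: "Q (t *\<^sub>R y) = t\<^sup>2 * Q y" for t y
    using linear_scale[OF A] linear_scale[OF L]
    by (simp add: Q_def power_mult_distrib power2_eq_square algebra_simps flip: scaleR_diff_right)
  have A_hom: "(t *\<^sub>R y) \<bullet> A (t *\<^sub>R y) = t\<^sup>2 * (y \<bullet> A y)" for t y
    using linear_scale[OF A] by (simp add: power2_eq_square)
  have A_up: "y \<bullet> A y \<le> 2 * e * (norm y)\<^sup>2" for y
  proof (rule quadratic_homogeneous_le[OF A_hom \<rho>(1)])
    fix y :: "'e \<times> 'e" assume "norm y = \<rho>"
    then show "y \<bullet> A y \<le> 2 * e * \<rho>\<^sup>2" using core(1,3)[of y]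
      by (simp add: abs_le_iff)
  qed
  have A_lo: "- (y \<bullet> A y) \<le> 2 * (C0 + e) * (norm y)\<^sup>2" for y
  proof (rule quadratic_homogeneous_le[OF _ \<rho>(1)])
    show "- ((t *\<^sub>R y) \<bullet> A (t *\<^sub>R y)) = t\<^sup>2 * - (y \<bullet> A y)" for t y using A_hom by simp
    fix y :: "'e \<times> 'e" assume "norm y = \<rho>"
    then show "- (y \<bullet> A y) \<le> 2 * (C0 + e) * \<rho>\<^sup>2" using core(2,3)[of y]
      by (simp add: abs_le_iff algebra_simps)
  qed
  have S: "\<bar>F (p + fst y) + G (q + snd y) - (F p + G q) - a0 \<bullet> fst y - b0 \<bullet> snd y - Q y\<bar> \<le> e * \<rho>\<^sup>2"
    if "norm y \<le> \<rho>" for y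
  proof -
    have W_eq: "F (fst x) + G (snd x) = W x + (norm (L (fst x - snd x)))\<^sup>2 + s * (norm (x - z0))\<^sup>2" for x
      by (simp add: W_def N_def)
    have "L (fst (z + y) - snd (z + y)) = v + L (fst y - snd y)"
      using L by (simp add: z_eq v_def linear_add linear_diff)
    then have l: "(norm (L (fst (z + y) - snd (z + y))))\<^sup>2 = (norm v)\<^sup>2 + 2 * (v \<bullet> L (fst y - snd y)) + (norm (L (fst y - snd y)))\<^sup>2"
      by (simp add: power2_norm_eq_inner inner_add_left inner_add_right inner_commute)
    have "z + y - z0 = (z - z0) + y" by simp
    then have r: "(norm (z + y - z0))\<^sup>2 = (norm (z - z0))\<^sup>2 + 2 * ((z - z0) \<bullet> y) + (norm y)\<^sup>2"
      by (simp only: dot_norm) (simp add: field_simps)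
    have j: "v \<bullet> L (fst y - snd y) = J \<bullet> fst y - J \<bullet> snd y"
      unfolding J using L by (simp add: linear_diff inner_diff_right)
    have t1: "F (p + fst y) + G (q + snd y) = W (z + y)
        + ((norm v)\<^sup>2 + 2 * (J \<bullet> fst y - J \<bullet> snd y) + (norm (L (fst y - snd y)))\<^sup>2)
        + (s * (norm (z - z0))\<^sup>2 + 2 * (s * ((z - z0) \<bullet> y)) + s * (norm y)\<^sup>2)"
      using W_eq[of "z + y"] unfolding l r j by (simp add: z_eq algebra_simps)
    have t2: "F p + G q = W z + (norm v)\<^sup>2 + s * (norm (z - z0))\<^sup>2"
      using W_eq[of z] by (simp add: z_eq v_def)
    have t3: "a0 \<bullet> fst y = fst \<xi> \<bullet> fst y + 2 * (s * ((p - fst z0) \<bullet> fst y)) + 2 * (J \<bullet> fst y)"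
      by (simp add: a0_def inner_add_left)
    have t4: "b0 \<bullet> snd y = snd \<xi> \<bullet> snd y + 2 * (s * ((q - snd z0) \<bullet> snd y)) - 2 * (J \<bullet> snd y)"
      by (simp add: b0_def inner_add_left inner_diff_left)
    have t5: "\<xi> \<bullet> y = fst \<xi> \<bullet> fst y + snd \<xi> \<bullet> snd y" by (simp add: inner_prod_def)
    have "(z - z0) \<bullet> y = (p - fst z0) \<bullet> fst y + (q - snd z0) \<bullet> snd y" by (simp add: inner_prod_def z_eq)
    then have t6: "s * ((z - z0) \<bullet> y) = s * ((p - fst z0) \<bullet> fst y) + s * ((q - snd z0) \<bullet> snd y)"
      by (simp only: distrib_left)
    have "F (p + fst y) + G (q + snd y) - (F p + G q) - a0 \<bullet> fst y - b0 \<bullet> snd y - Q y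
       = W (z + y) - W z - \<xi> \<bullet> y - (y \<bullet> A y) / 2"
      unfolding t1 t2 t3 t4 t5 t6 Q_def by simp
    then show ?thesis using core(3)[OF that] by simp
  qed
  have F_approx: "\<bar>F (p + u) - F p - a0 \<bullet> u - (u \<bullet> X0 u) / 2\<bar> \<le> e * \<rho>\<^sup>2" if "norm u \<le> \<rho>" for u
    using S[of "(u, 0)"] that by (simp add: QX norm_Pair algebra_simps)
  have G_approx: "\<bar>G (q + u) - G q - b0 \<bullet> u - (u \<bullet> Y0 u) / 2\<bar> \<le> e * \<rho>\<^sup>2" if "norm u \<le> \<rho>" for u
    using S[of "(0, u)"] that by (simp add: QY norm_Pair algebra_simps)
  \<comment> \<open>\<open>F\<close> and \<open>G\<close> depend on separate variables, so the joint
    expansion \<open>S\<close> must agree with the sum of the two separate ones up to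
    \<open>3 * (e * \<rho>^2)\<close>. Together with \<open>A_up\<close>, which expresses contact
    from above, this yields the matrix inequality without ever exhibiting a Hessian.\<close>
  have Q_split: "Q (fst y, 0) + Q (0, snd y) - (norm (L (fst y - snd y)))\<^sup>2 \<le> (s + 4 * e) * (norm y)\<^sup>2" for y
  proof (rule quadratic_homogeneous_le[OF _ \<rho>(1)])
    show "Q (fst (t *\<^sub>R y), 0) + Q (0, snd (t *\<^sub>R y)) - (norm (L (fst (t *\<^sub>R y) - snd (t *\<^sub>R y))))\<^sup>2
      = t\<^sup>2 * (Q (fst y, 0) + Q (0, snd y) - (norm (L (fst y - snd y)))\<^sup>2)" for t y
      using Q_hom[of t "(fst y, 0)"] Q_hom[of t "(0, snd y)"] linear_scale[OF L]
      by (simp add: power_mult_distrib algebra_simps flip: scaleR_diff_right)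
    fix y :: "'e \<times> 'e" assume y: "norm y = \<rho>"
    have "norm (fst y) \<le> \<rho>" "norm (snd y) \<le> \<rho>" using y nfst[of y] nsnd[of y] by simp_all
    from F_approx[OF this(1)] G_approx[OF this(2)] S[of y]
    have "Q (fst y, 0) + Q (0, snd y) \<le> Q y + 3 * (e * \<rho>\<^sup>2)" using y by (simp add: QX QY abs_le_iff)
    moreover have "Q y \<le> e * \<rho>\<^sup>2 + (norm (L (fst y - snd y)))\<^sup>2 + s * \<rho>\<^sup>2"
      using A_up[of y] y by (simp add: Q_def)
    ultimately show "Q (fst y, 0) + Q (0, snd y) - (norm (L (fst y - snd y)))\<^sup>2 \<le> (s + 4 * e) * \<rho>\<^sup>2"
      by (simp add: algebra_simps)
  qed
  have e1: "e \<le> 1" using e(1,2) \<epsilon>1 by linarith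
  have Qb: "\<bar>2 * Q y\<bar> \<le> c * (norm y)\<^sup>2" if y: "(norm (L (fst y - snd y)))\<^sup>2 \<le> K\<^sup>2 * (norm y)\<^sup>2" for y
  proof -
    define n where "n = (norm y)\<^sup>2"
    have n: "n \<ge> 0" by (simp add: n_def)
    have "e * n \<le> 1 * n" by (rule mult_right_mono[OF e1 n])
    moreover have "s * n \<ge> 0" "C0 * n \<ge> 0" "K\<^sup>2 * n \<ge> 0" using n s C0 by simp_all
    moreover have "y \<bullet> A y \<le> 2 * (e * n)" "- (y \<bullet> A y) \<le> 2 * (C0 * n) + 2 * (e * n)"
      using A_up[of y] A_lo[of y] by (simp_all add: n_def algebra_simps)
    moreover have "2 * Q y = (y \<bullet> A y) + 2 * (norm (L (fst y - snd y)))\<^sup>2 + 2 * (s * n)"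
      by (simp add: Q_def n_def)
    moreover have "c * n = 2 * (C0 * n) + 2 * n + 2 * (K\<^sup>2 * n) + 2 * (s * n)" by (simp add: c_def algebra_simps)
    ultimately show ?thesis using y unfolding n_def[symmetric] abs_le_iff
      using zero_le_power2[of "norm (L (fst y - snd y))"] by linarith
  qed
  have cX: "\<bar>u \<bullet> X0 u\<bar> \<le> c * (norm u)\<^sup>2" and cY: "\<bar>u \<bullet> Y0 u\<bar> \<le> c * (norm u)\<^sup>2" for u
    using Qb[of "(u, 0)"] Qb[of "(0, u)"] Lsq1[of u] L by (simp_all add: QX QY norm_Pair linear_neg)
  obtain y1 a where y1: "norm y1 < \<rho>" "\<And>\<eta>. \<bar>a \<bullet> \<eta> - a0 \<bullet> \<eta>\<bar> \<le> (c + 4 * e) * \<rho> * norm \<eta>"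
    "\<And>u. norm (y1 + u) \<le> \<rho> \<Longrightarrow> F (p + y1 + u) \<le> F (p + y1) + a \<bullet> u + (u \<bullet> (X0 u + (4 * e) *\<^sub>R u)) / 2"
    using touching_quadratic[OF contF X0 cX \<rho>(1) e(1), of p a0] F_approx by (force simp: abs_le_iff)
  obtain y2 b where y2: "norm y2 < \<rho>" "\<And>\<eta>. \<bar>b \<bullet> \<eta> - b0 \<bullet> \<eta>\<bar> \<le> (c + 4 * e) * \<rho> * norm \<eta>"
    "\<And>u. norm (y2 + u) \<le> \<rho> \<Longrightarrow> G (q + y2 + u) \<le> G (q + y2) + b \<bullet> u + (u \<bullet> (Y0 u + (4 * e) *\<^sub>R u)) / 2"
    using touching_quadratic[OF contG Y0 cY \<rho>(1) e(1), of q b0] G_approx by (force simp: abs_le_iff)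
  define X Y where "X u = X0 u + (4 * e) *\<^sub>R u" and "Y u = Y0 u + (4 * e) *\<^sub>R u" for u
  obtain p' where p': "p' \<in> C" "F (p + y1) = f p' - 2 * (norm (L (p + y1 - p')))\<^sup>2" using Fat by blast
  obtain q' where q': "q' \<in> C" "G (q + y2) = g q' - 2 * (norm (L (q + y2 - q')))\<^sup>2" using Gat by blast
  define v1 v' where "v1 = L (p + y1 - (q + y2))" and "v' = L (p' - q')"
  have N1: "N (p + y1, q + y2) > M - \<epsilon>N"
  proof -
    have "dist (p + y1, q + y2) z0 = norm ((z - z0) + (y1, y2))"
      by (simp add: z_eq dist_norm algebra_simps)
    also have "\<dots> \<le> norm (z - z0) + norm (y1, y2)" by (rule norm_triangle_ineq)
    also have "\<dots> \<le> norm (z - z0) + (norm y1 + norm y2)" using norm_Pair_le[of y1 y2] by simp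
    also have "\<dots> < e + (e + e)" using z y1(1) y2(1) \<rho>(2) by (simp add: dist_norm norm_minus_commute)
    also have "\<dots> \<le> \<delta>N" using e by simp
    finally have "dist (N (p + y1, q + y2)) (N z0) < \<epsilon>N" by (rule \<delta>N(2))
    then show ?thesis by (simp add: N_z0 dist_real_def abs_less_iff)
  qed
  \<comment> \<open>The two squares do double duty: being nonnegative they make
    \<open>(p', q')\<close> almost maximal for the original functions, and being small they give
    \<open>v'\<close> close to \<open>2 *\<^sub>R v1\<close>, so that the slope of the regularised
    functions is the slope of the original penalty at \<open>(p', q')\<close>.\<close>
  have g': "f p' + g q' - (norm v')\<^sup>2 / 2
      = N (p + y1, q + y2) + (norm (2 *\<^sub>R v1 - v'))\<^sup>2 / 2 + (norm (L (p + y1 - p') + L (q + y2 - q')))\<^sup>2"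
    using gap[OF p'(2) q'(2)] by (simp add: N_def v1_def v'_def)
  have near: "f p' + g q' - (norm v')\<^sup>2 / 2 \<ge> M - \<epsilon>"
    using g' N1 \<epsilon>N(2) zero_le_power2[of "norm (2 *\<^sub>R v1 - v')"] zero_le_power2[of "norm (L (p + y1 - p') + L (q + y2 - q'))"]
    by linarith
  have "(norm (2 *\<^sub>R v1 - v'))\<^sup>2 \<le> (\<epsilon> / (4 * K))\<^sup>2"
    using g' N1 \<epsilon>N(3) M[OF p'(1) q'(1)] zero_le_power2[of "norm (L (p + y1 - p') + L (q + y2 - q'))"]
    unfolding v'_def[symmetric] by linarith
  then have vv: "norm (2 *\<^sub>R v1 - v') \<le> \<epsilon> / (4 * K)"
    by (rule power2_le_imp_le) (use K(1) \<open>\<epsilon> > 0\<close> in simp)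
  have main_bd: "\<bar>v' \<bullet> L \<eta> - 2 * (v \<bullet> L \<eta>)\<bar> \<le> (\<epsilon> / 4 + 4 * K\<^sup>2 * e) * norm \<eta>" for \<eta>
  proof -
    have "v' - 2 *\<^sub>R v = - (2 *\<^sub>R v1 - v') + 2 *\<^sub>R L (y1 - y2)"
    proof -
      have "v1 = v + L (y1 - y2)"
        unfolding v1_def v_def by (subst linear_add[OF L, symmetric]) (rule arg_cong[of _ _ L], simp)
      then show ?thesis by (simp add: scaleR_add_right)
    qed
    then have "norm (v' - 2 *\<^sub>R v) \<le> norm (- (2 *\<^sub>R v1 - v')) + norm (2 *\<^sub>R L (y1 - y2))"
      by (simp only: norm_triangle_ineq)
    also have "\<dots> = norm (2 *\<^sub>R v1 - v') + 2 * norm (L (y1 - y2))" by (simp only: norm_minus_cancel norm_scaleR)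
    also have "\<dots> \<le> \<epsilon> / (4 * K) + 2 * (K * (2 * e))"
    proof -
      have "norm (y1 - y2) \<le> 2 * e" using norm_triangle_ineq4[of y1 y2] y1(1) y2(1) \<rho>(2) by linarith
      then have "K * norm (y1 - y2) \<le> K * (2 * e)" using K(1) by simp
      then show ?thesis using vv K(2)[of "y1 - y2"] by linarith
    qed
    finally have n: "norm (v' - 2 *\<^sub>R v) \<le> \<epsilon> / (4 * K) + 2 * (K * (2 * e))" .
    have "\<bar>v' \<bullet> L \<eta> - 2 * (v \<bullet> L \<eta>)\<bar> = \<bar>(v' - 2 *\<^sub>R v) \<bullet> L \<eta>\<bar>" by (simp add: inner_diff_left)
    also have "\<dots> \<le> norm (v' - 2 *\<^sub>R v) * norm (L \<eta>)" by (rule Cauchy_Schwarz_ineq2)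
    also have "\<dots> \<le> (\<epsilon> / (4 * K) + 2 * (K * (2 * e))) * (K * norm \<eta>)"
      using K n e(1) \<open>\<epsilon> > 0\<close> by (intro mult_mono) auto
    also have "\<dots> = (\<epsilon> / 4 + 4 * K\<^sup>2 * e) * norm \<eta>"
      using K(1) by (simp add: field_simps power2_eq_square)
    finally show ?thesis .
  qed
  have zd: "norm (p - fst z0) \<le> e" "norm (q - snd z0) \<le> e"
    using z nfst[of "z - z0"] nsnd[of "z - z0"]
    by (simp_all add: p_def q_def dist_norm norm_minus_commute)
  have xd: "norm (fst \<xi>) \<le> e" "norm (snd \<xi>) \<le> e" using \<xi> nfst[of \<xi>] nsnd[of \<xi>] by simp_all
  have small: "\<bar>(x + (2 * s) *\<^sub>R w) \<bullet> \<eta>\<bar> \<le> 3 * e * norm \<eta>" if "norm x \<le> e" "norm w \<le> e" for x w \<eta> :: 'e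
  proof -
    have "norm (x + (2 * s) *\<^sub>R w) \<le> norm x + 2 * (s * norm w)"
      using norm_triangle_ineq[of x "(2 * s) *\<^sub>R w"] s by simp
    also have "\<dots> \<le> e + 2 * (1 * e)" using that s by (intro add_mono mult_left_mono mult_mono) auto
    finally have "norm (x + (2 * s) *\<^sub>R w) * norm \<eta> \<le> (3 * e) * norm \<eta>" by (intro mult_right_mono) auto
    then show ?thesis using Cauchy_Schwarz_ineq2[of "x + (2 * s) *\<^sub>R w" \<eta>] by linarith
  qed
  have fin: "(c + 4 * e) * \<rho> * n + 3 * e * n + (\<epsilon> / 4 + 4 * K\<^sup>2 * e) * n \<le> \<epsilon> * n" if "n \<ge> 0" for n
  proof -
    have "c \<ge> 0" using C0 s by (simp add: c_def)
    then have "(c + 4 * e) * \<rho> \<le> (c + 4) * e" using \<rho> e1 e(1) by (intro mult_mono) auto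
    then have "(c + 4 * e) * \<rho> + 3 * e + (\<epsilon> / 4 + 4 * K\<^sup>2 * e) \<le> e * B + \<epsilon> / 4"
      by (simp add: B_def algebra_simps)
    also have "\<dots> \<le> \<epsilon>" using e(3) \<open>\<epsilon> > 0\<close> by simp
    finally have "((c + 4 * e) * \<rho> + 3 * e + (\<epsilon> / 4 + 4 * K\<^sup>2 * e)) * n \<le> \<epsilon> * n"
      using that by (rule mult_right_mono)
    then show ?thesis by (simp add: algebra_simps)
  qed
  have a_bd: "\<bar>a \<bullet> \<eta> - L (p' - q') \<bullet> L \<eta>\<bar> \<le> \<epsilon> * norm \<eta>" for \<eta>
  proof -
    have "a0 \<bullet> \<eta> = (fst \<xi> + (2 * s) *\<^sub>R (p - fst z0)) \<bullet> \<eta> + 2 * (v \<bullet> L \<eta>)"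
      by (simp add: a0_def inner_add_left J)
    then have "\<bar>a \<bullet> \<eta> - v' \<bullet> L \<eta>\<bar> \<le> (c + 4 * e) * \<rho> * norm \<eta> + 3 * e * norm \<eta> + (\<epsilon> / 4 + 4 * K\<^sup>2 * e) * norm \<eta>"
      using y1(2)[of \<eta>] small[OF xd(1) zd(1), of \<eta>] main_bd[of \<eta>] by linarith
    then show ?thesis using fin[of "norm \<eta>"] unfolding v'_def by simp
  qed
  have b_bd: "\<bar>b \<bullet> \<eta> + L (p' - q') \<bullet> L \<eta>\<bar> \<le> \<epsilon> * norm \<eta>" for \<eta>
  proof -
    have "b0 \<bullet> \<eta> = (snd \<xi> + (2 * s) *\<^sub>R (q - snd z0)) \<bullet> \<eta> - 2 * (v \<bullet> L \<eta>)"
      by (simp add: b0_def inner_add_left inner_diff_left J)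
    then have "\<bar>b \<bullet> \<eta> + v' \<bullet> L \<eta>\<bar> \<le> (c + 4 * e) * \<rho> * norm \<eta> + 3 * e * norm \<eta> + (\<epsilon> / 4 + 4 * K\<^sup>2 * e) * norm \<eta>"
      using y2(2)[of \<eta>] small[OF xd(2) zd(2), of \<eta>] main_bd[of \<eta>] by linarith
    then show ?thesis using fin[of "norm \<eta>"] unfolding v'_def by simp
  qed
  have arith: "a \<le> 2 * l + t" if "a = 2 * q + 4 * i" "q - l \<le> m" "2 * m + 4 * i \<le> t" for a q l m i t :: real
    using that by simp
  have XY: "\<xi> \<bullet> X \<xi> + \<zeta> \<bullet> Y \<zeta> \<le> 2 * (norm (L (\<xi> - \<zeta>)))\<^sup>2 + \<epsilon> * ((norm \<xi>)\<^sup>2 + (norm \<zeta>)\<^sup>2)" for \<xi> \<zeta>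
  proof -
    define n where "n = (norm \<xi>)\<^sup>2 + (norm \<zeta>)\<^sup>2"
    define m where "m = (s + 4 * e) * n"
    have "\<xi> \<bullet> X \<xi> + \<zeta> \<bullet> Y \<zeta> = 2 * (Q (\<xi>, 0) + Q (0, \<zeta>)) + 4 * (e * n)"
      by (simp add: X_def Y_def QX QY inner_add_right power2_norm_eq_inner n_def algebra_simps)
    moreover have "Q (\<xi>, 0) + Q (0, \<zeta>) - (norm (L (\<xi> - \<zeta>)))\<^sup>2 \<le> m"
      using Q_split[of "(\<xi>, \<zeta>)"] by (simp add: nsq n_def m_def)
    moreover have "2 * m + 4 * (e * n) \<le> \<epsilon> * n"
    proof -
      have "2 * (s + 4 * e) + 4 * e \<le> \<epsilon>" using e(2) \<epsilon>1 by (simp add: s_def)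
      then have "(2 * (s + 4 * e) + 4 * e) * n \<le> \<epsilon> * n" by (rule mult_right_mono) (simp add: n_def)
      then show ?thesis by (simp add: m_def algebra_simps)
    qed
    ultimately have "\<xi> \<bullet> X \<xi> + \<zeta> \<bullet> Y \<zeta> \<le> 2 * (norm (L (\<xi> - \<zeta>)))\<^sup>2 + \<epsilon> * n" by (rule arith)
    then show ?thesis by (simp only: n_def)
  qed
  \<comment> \<open>The sup-convolution hands its jet on to the point \<open>p'\<close> where it is
    attained: for \<open>F\<close> at \<open>p + y1 + (p'' - p')\<close> the point
    \<open>p''\<close> is a competitor with the same kernel value, since the difference of the
    arguments does not change.\<close>
  have tp: "f p'' \<le> f p' + a \<bullet> (p'' - p') + ((p'' - p') \<bullet> X (p'' - p')) / 2"
    if "p'' \<in> C" "dist p'' p' < \<rho> - norm y1" for p''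
  proof -
    have "norm (y1 + (p'' - p')) \<le> \<rho>"
      using that(2) norm_triangle_ineq[of y1 "p'' - p'"] by (simp add: dist_norm)
    note y1(3)[OF this]
    moreover have "f p'' - 2 * (norm (L (p + y1 + (p'' - p') - p'')))\<^sup>2 \<le> F (p + y1 + (p'' - p'))"
      using Fat that(1) by blast
    moreover have "p + y1 + (p'' - p') - p'' = p + y1 - p'" by simp
    ultimately show ?thesis using p'(2) unfolding X_def by simp
  qed
  have tq: "g q'' \<le> g q' + b \<bullet> (q'' - q') + ((q'' - q') \<bullet> Y (q'' - q')) / 2"
    if "q'' \<in> C" "dist q'' q' < \<rho> - norm y2" for q''
  proof -
    have "norm (y2 + (q'' - q')) \<le> \<rho>"
      using that(2) norm_triangle_ineq[of y2 "q'' - q'"] by (simp add: dist_norm)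
    note y2(3)[OF this]
    moreover have "g q'' - 2 * (norm (L (q + y2 + (q'' - q') - q'')))\<^sup>2 \<le> G (q + y2 + (q'' - q'))"
      using Gat that(1) by blast
    moreover have "q + y2 + (q'' - q') - q'' = q + y2 - q'" by simp
    ultimately show ?thesis using q'(2) unfolding Y_def by simp
  qed
  have linX: "linear X" and linY: "linear Y"
    unfolding X_def Y_def by (intro linear_compose_add X0 Y0 linear_compose_scale_right linear_ident)+
  show ?thesis
  proof (rule bexI[OF _ p'(1)], rule bexI[OF _ q'(1)], rule exI[of _ a], rule exI[of _ b],
      rule exI[of _ X], rule exI[of _ Y], intro conjI allI)
    show "f p' + g q' - (norm (L (p' - q')))\<^sup>2 / 2 \<ge> M - \<epsilon>" using near by (simp add: v'_def)
    show "\<exists>\<delta>>0. \<forall>p''\<in>C. dist p'' p' < \<delta> \<longrightarrow> f p'' \<le> f p' + a \<bullet> (p'' - p') + ((p'' - p') \<bullet> X (p'' - p')) / 2"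
      using y1(1) tp by (intro exI[of _ "\<rho> - norm y1"]) simp
    show "\<exists>\<delta>>0. \<forall>q''\<in>C. dist q'' q' < \<delta> \<longrightarrow> g q'' \<le> g q' + b \<bullet> (q'' - q') + ((q'' - q') \<bullet> Y (q'' - q')) / 2"
      using y2(1) tq by (intro exI[of _ "\<rho> - norm y2"]) simp
  qed (fact linX linY a_bd b_bd XY)+
qed

section \<open>Jets and test functions\<close>

text \<open>Taylor's formula with Peano remainder: the mean value theorem along the segment reduces
  it to the first-order expansion of the derivative at the one point \<open>p\<close>.\<close>

lemma taylor2_remainder:
  fixes \<phi> :: "'a::real_normed_vector \<Rightarrow> real" and D1 :: "'a \<Rightarrow> 'a \<Rightarrow> real"
  assumes "r > 0" and d1: "\<And>q. dist q p < r \<Longrightarrow> (\<phi> has_derivative D1 q) (at q)"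
    and d2: "\<And>e. e > 0 \<Longrightarrow> \<exists>\<delta>>0. \<forall>w. norm w < \<delta> \<longrightarrow>
        (\<forall>y. \<bar>D1 (p + w) y - D1 p y - D2 w y\<bar> \<le> e * norm w * norm y)"
    and D2: "\<And>t y. D2 (t *\<^sub>R y) y = t * D2 y y" and "e > 0"
  shows "\<exists>\<delta>>0. \<forall>y. norm y < \<delta> \<longrightarrow> \<bar>\<phi> (p + y) - \<phi> p - D1 p y - D2 y y / 2\<bar> \<le> e * (norm y)\<^sup>2"
proof -
  obtain \<delta> where \<delta>: "\<delta> > 0" "\<And>w y. norm w < \<delta> \<Longrightarrow> \<bar>D1 (p + w) y - D1 p y - D2 w y\<bar> \<le> e * norm w * norm y"
    using d2[OF \<open>e > 0\<close>] by blast
  show ?thesis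
  proof (intro exI[of _ "min \<delta> r"] conjI allI impI)
    show "min \<delta> r > 0" using \<delta> \<open>r > 0\<close> by simp
    fix y :: 'a assume y: "norm y < min \<delta> r"
    define g where "g t = \<phi> (p + t *\<^sub>R y) - t * D1 p y - t\<^sup>2 * D2 y y / 2" for t :: real
    define g' where "g' t = D1 (p + t *\<^sub>R y) y - D1 p y - t * D2 y y" for t :: real
    have small: "norm (t *\<^sub>R y) \<le> norm y" if "0 \<le> t" "t \<le> 1" for t
      using that by (simp add: mult_left_le_one_le)
    have der: "(g has_real_derivative g' t) (at t)" if t: "0 \<le> t" "t \<le> 1" for t
    proof -
      have near: "dist (p + t *\<^sub>R y) p < r" using small[OF t] y by (simp add: dist_norm)
      have lin: "D1 (p + t *\<^sub>R y) (s *\<^sub>R y) = s * D1 (p + t *\<^sub>R y) y" for s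
        using linear_scale[OF has_derivative_linear[OF d1[OF near]]] by simp
      have "((\<lambda>t. p + t *\<^sub>R y) has_derivative (\<lambda>s. s *\<^sub>R y)) (at t)"
        by (auto intro!: derivative_eq_intros)
      from diff_chain_at[OF this d1[OF near]]
      have "((\<lambda>t. \<phi> (p + t *\<^sub>R y)) has_derivative (\<lambda>s. s * D1 (p + t *\<^sub>R y) y)) (at t)"
        by (simp add: o_def lin)
      then have "((\<lambda>t. \<phi> (p + t *\<^sub>R y)) has_real_derivative D1 (p + t *\<^sub>R y) y) (at t)"
        by (simp add: has_field_derivative_def mult.commute[of _ "D1 (p + t *\<^sub>R y) y"] )
      then show ?thesis
        unfolding g_def g'_def by (auto intro!: derivative_eq_intros)
    qed
    obtain t where t: "0 < t" "t < 1" "g 1 - g 0 = (1 - 0) * g' t"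
      using MVT2[of 0 1 g g'] der by auto
    have "g' t = D1 (p + t *\<^sub>R y) y - D1 p y - D2 (t *\<^sub>R y) y" by (simp add: g'_def D2)
    then have "\<bar>g' t\<bar> \<le> e * norm (t *\<^sub>R y) * norm y"
      using \<delta>(2)[of "t *\<^sub>R y" y] small[of t] t y by simp
    also have "\<dots> \<le> e * norm y * norm y"
      using small[of t] t \<open>e > 0\<close> by (intro mult_right_mono mult_left_mono) auto
    finally have "\<bar>g 1 - g 0\<bar> \<le> e * (norm y)\<^sup>2" using t by (simp add: power2_eq_square)
    then show "\<bar>\<phi> (p + y) - \<phi> p - D1 p y - D2 y y / 2\<bar> \<le> e * (norm y)\<^sup>2"
      by (simp add: g_def algebra_simps)
  qed
qed

lemma C3_bounded_derivs_add:
  assumes "C3_bounded_derivs \<phi> D1 D2 D3" "C3_bounded_derivs \<psi> E1 E2 E3"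
  shows "C3_bounded_derivs (\<lambda>p. \<phi> p + \<psi> p) (\<lambda>p. D1 p + E1 p) (\<lambda>p. D2 p + E2 p) (\<lambda>p. D3 p + E3 p)"
proof -
  have b: "bounded (range (\<lambda>p. F p + G p))" if "bounded (range F)" "bounded (range G)"
    for F G :: "real \<times> (real^'n) \<Rightarrow> 'c::real_normed_vector"
    using bounded_plus_comp[of F UNIV G] that by simp
  have s: "(\<lambda>v. blinfun_apply (A + B) v) = (\<lambda>v. blinfun_apply A v + blinfun_apply B v)"
    for A B :: "'c::real_normed_vector \<Rightarrow>\<^sub>L 'd::real_normed_vector"
    by (simp add: blinfun.add_left)
  show ?thesis
    using assms unfolding C3_bounded_derivs_def s
    by (auto intro!: b has_derivative_add continuous_on_add)
qed

lemma C3_bounded_derivs_scale: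
  assumes "C3_bounded_derivs \<phi> D1 D2 D3"
  shows "C3_bounded_derivs (\<lambda>p. c * \<phi> p) (\<lambda>p. c *\<^sub>R D1 p) (\<lambda>p. c *\<^sub>R D2 p) (\<lambda>p. c *\<^sub>R D3 p)"
proof -
  have b: "bounded (range (\<lambda>p. c *\<^sub>R F p))" if "bounded (range F)"
    for F :: "real \<times> (real^'n) \<Rightarrow> 'c::real_normed_vector"
    using bounded_scaling[OF that, of c] by (simp add: image_comp o_def)
  have s: "(\<lambda>v. blinfun_apply (c *\<^sub>R A) v) = (\<lambda>v. c *\<^sub>R blinfun_apply A v)"
    for A :: "'c::real_normed_vector \<Rightarrow>\<^sub>L 'd::real_normed_vector"
    by (simp add: blinfun.scaleR_left)
  show ?thesis
    using assms unfolding C3_bounded_derivs_def s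
    by (auto intro!: b has_derivative_scaleR_right has_derivative_mult_right continuous_intros)
qed

lemma C3_bounded_derivs_zero: "C3_bounded_derivs (\<lambda>p. 0) (\<lambda>p. 0) (\<lambda>p. 0) (\<lambda>p. 0)"
  by (auto simp: C3_bounded_derivs_def intro!: has_derivative_eq_rhs[OF has_derivative_const])

lemma C3_bounded_derivs_sum:
  assumes "finite I" "\<And>i. i \<in> I \<Longrightarrow> C3_bounded_derivs (\<phi> i) (D1 i) (D2 i) (D3 i)"
  shows "C3_bounded_derivs (\<lambda>p. \<Sum>i\<in>I. \<phi> i p) (\<lambda>p. \<Sum>i\<in>I. D1 i p) (\<lambda>p. \<Sum>i\<in>I. D2 i p) (\<lambda>p. \<Sum>i\<in>I. D3 i p)"
  using assms
proof (induction I rule: finite_induct)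
  case empty
  then show ?case by (simp add: C3_bounded_derivs_zero)
next
  case (insert i I)
  then show ?case
    using C3_bounded_derivs_add[of "\<phi> i" "D1 i" "D2 i" "D3 i"] by simp
qed

text \<open>The tensor \<open>c\<close> times \<open>c\<close>; with \<open>ridge3\<close> these
  are, up to scalar factors, the second and third derivatives of every function of
  \<open>c \<bullet> p\<close>.\<close>

definition ridge2 :: "'a::real_inner \<Rightarrow> 'a \<Rightarrow>\<^sub>L 'a \<Rightarrow>\<^sub>L real" where
  "ridge2 c = Blinfun (\<lambda>v. (c \<bullet> v) *\<^sub>R blinfun_inner_right c)"
definition ridge3 :: "'a::real_inner \<Rightarrow> 'a \<Rightarrow>\<^sub>L 'a \<Rightarrow>\<^sub>L 'a \<Rightarrow>\<^sub>L real" where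
  "ridge3 c = Blinfun (\<lambda>v. (c \<bullet> v) *\<^sub>R ridge2 c)"

lemma ridge_apply:
  "blinfun_apply (ridge2 c) v = (c \<bullet> v) *\<^sub>R blinfun_inner_right c"
  "blinfun_apply (ridge3 c) v = (c \<bullet> v) *\<^sub>R ridge2 c"
  unfolding ridge2_def[of c] ridge3_def[of c]
  by (subst bounded_linear_Blinfun_apply;
      auto intro!: bounded_linear_intros simp: bounded_linear_inner_right)+

lemma C3_bounded_derivs_ridge:
  fixes c p0 :: "real \<times> (real^'n)"
  shows "C3_bounded_derivs (\<lambda>p. sin (c \<bullet> (p - p0) + \<theta>)) (\<lambda>p. cos (c \<bullet> (p - p0) + \<theta>) *\<^sub>R blinfun_inner_right c)
     (\<lambda>p. (- sin (c \<bullet> (p - p0) + \<theta>)) *\<^sub>R ridge2 c) (\<lambda>p. (- cos (c \<bullet> (p - p0) + \<theta>)) *\<^sub>R ridge3 c)"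
  unfolding C3_bounded_derivs_def
proof (intro conjI allI)
  let ?g = "\<lambda>p. c \<bullet> (p - p0) + \<theta>"
  show "(((\<lambda>p. sin (?g p))) has_derivative blinfun_apply (cos (?g p) *\<^sub>R blinfun_inner_right c)) (at p)" for p
    by (auto intro!: derivative_eq_intros simp: blinfun.scaleR_left ridge_apply fun_eq_iff)
  show "((\<lambda>p. cos (?g p) *\<^sub>R blinfun_inner_right c) has_derivative blinfun_apply ((- sin (?g p)) *\<^sub>R ridge2 c)) (at p)" for p
    by (auto intro!: derivative_eq_intros simp: blinfun.scaleR_left blinfun.minus_left ridge_apply fun_eq_iff mult.commute)
  show "((\<lambda>p. (- sin (?g p)) *\<^sub>R ridge2 c) has_derivative blinfun_apply ((- cos (?g p)) *\<^sub>R ridge3 c)) (at p)" for p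
    by (auto intro!: derivative_eq_intros simp: blinfun.scaleR_left blinfun.minus_left ridge_apply fun_eq_iff mult.commute)
  show "continuous_on UNIV (\<lambda>p. (- cos (?g p)) *\<^sub>R ridge3 c)" by (intro continuous_intros)
  have bd: "bounded (range (\<lambda>p. k p *\<^sub>R R))" if "\<And>p. \<bar>k p\<bar> \<le> 1"
    for k :: "real \<times> (real^'n) \<Rightarrow> real" and R :: "'c::real_normed_vector"
    unfolding bounded_iff using that by (intro exI[of _ "norm R"]) (auto simp: mult_left_le_one_le)
  show "bounded (range (\<lambda>p. cos (?g p) *\<^sub>R blinfun_inner_right c))"
    "bounded (range (\<lambda>p. (- sin (?g p)) *\<^sub>R ridge2 c))"
    "bounded (range (\<lambda>p. (- cos (?g p)) *\<^sub>R ridge3 c))"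
    by (rule bd; simp)+
qed

lemma inner_Basis_double_sum:
  fixes X :: "'a::euclidean_space \<Rightarrow> 'a"
  assumes "linear X"
  shows "(\<Sum>i\<in>Basis. \<Sum>j\<in>Basis. (i \<bullet> X j) * ((i \<bullet> v) * (j \<bullet> w))) = v \<bullet> X w"
proof -
  have "X w = X (\<Sum>j\<in>Basis. (w \<bullet> j) *\<^sub>R j)" by (simp add: euclidean_representation)
  also have "\<dots> = (\<Sum>j\<in>Basis. (w \<bullet> j) *\<^sub>R X j)"
    using assms by (simp add: linear_sum linear_scale)
  finally have Xw: "X w = (\<Sum>j\<in>Basis. (w \<bullet> j) *\<^sub>R X j)" .
  have "v \<bullet> X w = (\<Sum>i\<in>Basis. (v \<bullet> i) * (X w \<bullet> i))" by (rule euclidean_inner)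
  also have "\<dots> = (\<Sum>i\<in>Basis. \<Sum>j\<in>Basis. (i \<bullet> X j) * ((i \<bullet> v) * (j \<bullet> w)))"
    unfolding Xw inner_sum_left sum_distrib_left
    by (intro sum.cong refl) (simp add: inner_commute)
  finally show ?thesis by simp
qed

text \<open>Only the 2-jet at one point matters, and trigonometric polynomials realise every 2-jet while
  having bounded derivatives of all orders, so no cutoff is needed.\<close>
lemma test_function_with_jet:
  fixes a p0 :: "real \<times> (real^'n)"
  assumes X: "linear X"
  obtains \<phi> D1 D2 D3 where "C3_bounded_derivs \<phi> D1 D2 D3"
    "\<And>v. blinfun_apply (D1 p0) v = a \<bullet> v"
    "\<And>v w. blinfun_apply (blinfun_apply (D2 p0) v) w = (v \<bullet> X w + w \<bullet> X v) / 2"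
proof -
  let ?B = "Basis :: (real \<times> (real^'n)) set"
  \<comment> \<open>With phase \<open>pi / 2\<close> the ridge functions become cosines, which have
    zero gradient at \<open>p0\<close>. The second derivative of
    \<open>cos ((i - j) \<bullet> v) - cos ((i + j) \<bullet> v)\<close> at 0 is twice the
    symmetrised product of the coordinates along \<open>i\<close> and \<open>j\<close>, hence the
    factor 1/4. The gradient comes from \<open>sin (a \<bullet> (p - p0))\<close>, whose second
    derivative vanishes at \<open>p0\<close>.\<close>
  define \<beta> where "\<beta> i j = (i \<bullet> X j) / 4" for i j
  let ?g = "\<lambda>c \<theta> p. c \<bullet> (p - p0) + \<theta>"
  let ?S = "\<lambda>c \<theta> p. sin (?g c \<theta> p)"
  let ?S1 = "\<lambda>c \<theta> p. cos (?g c \<theta> p) *\<^sub>R blinfun_inner_right c"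
  let ?S2 = "\<lambda>c \<theta> p. (- sin (?g c \<theta> p)) *\<^sub>R ridge2 c"
  let ?S3 = "\<lambda>c \<theta> p. (- cos (?g c \<theta> p)) *\<^sub>R ridge3 c"
  let ?q = "pi / 2"
  have "C3_bounded_derivs
     (\<lambda>p. ?S a 0 p + (\<Sum>i\<in>?B. \<Sum>j\<in>?B. \<beta> i j * (?S (i - j) ?q p + (- 1) * ?S (i + j) ?q p)))
     (\<lambda>p. ?S1 a 0 p + (\<Sum>i\<in>?B. \<Sum>j\<in>?B. \<beta> i j *\<^sub>R (?S1 (i - j) ?q p + (- 1) *\<^sub>R ?S1 (i + j) ?q p)))
     (\<lambda>p. ?S2 a 0 p + (\<Sum>i\<in>?B. \<Sum>j\<in>?B. \<beta> i j *\<^sub>R (?S2 (i - j) ?q p + (- 1) *\<^sub>R ?S2 (i + j) ?q p)))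
     (\<lambda>p. ?S3 a 0 p + (\<Sum>i\<in>?B. \<Sum>j\<in>?B. \<beta> i j *\<^sub>R (?S3 (i - j) ?q p + (- 1) *\<^sub>R ?S3 (i + j) ?q p)))"
    (is "C3_bounded_derivs ?\<phi> ?D1 ?D2 ?D3")
    by (intro C3_bounded_derivs_add C3_bounded_derivs_sum C3_bounded_derivs_scale
        C3_bounded_derivs_ridge finite_Basis)
  moreover have "blinfun_apply (?D1 p0) v = a \<bullet> v" for v
    by (simp add: blinfun.add_left blinfun.sum_left blinfun.scaleR_left ridge_apply)
  moreover have "blinfun_apply (blinfun_apply (?D2 p0) v) w = (v \<bullet> X w + w \<bullet> X v) / 2" for v w
  proof -
    have "blinfun_apply (blinfun_apply (?D2 p0) v) w
       = (\<Sum>i\<in>?B. \<Sum>j\<in>?B. \<beta> i j * (- (((i - j) \<bullet> v) * ((i - j) \<bullet> w)) + ((i + j) \<bullet> v) * ((i + j) \<bullet> w)))"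
      by (simp add: blinfun.add_left blinfun.diff_left blinfun.minus_left blinfun.sum_left blinfun.scaleR_left ridge_apply)
    also have "\<dots> = (\<Sum>i\<in>?B. \<Sum>j\<in>?B. ((i \<bullet> X j) * ((i \<bullet> v) * (j \<bullet> w)) + (i \<bullet> X j) * ((i \<bullet> w) * (j \<bullet> v))) / 2)"
      by (intro sum.cong refl) (simp add: \<beta>_def inner_diff_left inner_add_left field_simps)
    also have "\<dots> = (v \<bullet> X w + w \<bullet> X v) / 2"
      by (simp add: sum_divide_distrib[symmetric] sum.distrib inner_Basis_double_sum[OF X])
    finally show ?thesis .
  qed
  ultimately show thesis by (rule that)
qed

lemma hess_quadratic_form:
  fixes p0 :: "real \<times> (real^'n)"
  assumes D2: "\<And>v w. blinfun_apply (blinfun_apply (D2 p0) v) w = (v \<bullet> X w + w \<bullet> X v) / 2"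
  shows "\<xi> \<bullet> (hess D2 p0 *v \<xi>) = (0, \<xi>) \<bullet> X (0, \<xi>)"
proof -
  define b where "b v w = blinfun_apply (blinfun_apply (D2 p0) (0, v)) (0, w)" for v w
  have lin1: "linear (\<lambda>v. b v w)" and lin2: "linear (b v)" for v w
  proof -
    have P: "(0::real, u + u') = (0, u) + (0, u')" "(0::real, r *\<^sub>R u) = r *\<^sub>R (0, u)"
      for u u' :: "real^'n" and r by simp_all
    show "linear (\<lambda>v. b v w)" "linear (b v)"
      unfolding b_def by (rule linearI; simp only: P blinfun.add_right blinfun.add_left blinfun.scaleR_right blinfun.scaleR_left; simp)+
  qed
  have e: "\<xi> = (\<Sum>i\<in>UNIV. (\<xi> $ i) *\<^sub>R axis i 1)"
    using basis_expansion[of \<xi>] by (simp add: scalar_mult_eq_scaleR)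
  have "\<xi> \<bullet> (hess D2 p0 *v \<xi>) = (\<Sum>i\<in>UNIV. \<xi> $ i * (\<Sum>j\<in>UNIV. b (axis i 1) (axis j 1) * \<xi> $ j))"
    by (simp add: inner_vec_def matrix_vector_mult_def hess_def b_def)
  also have "\<dots> = (\<Sum>i\<in>UNIV. \<xi> $ i * b (axis i 1) \<xi>)"
  proof (intro sum.cong refl)
    fix i
    have "b (axis i 1) \<xi> = b (axis i 1) (\<Sum>j\<in>UNIV. (\<xi> $ j) *\<^sub>R axis j 1)" using e by simp
    also have "\<dots> = (\<Sum>j\<in>UNIV. b (axis i 1) (axis j 1) * \<xi> $ j)"
      by (simp add: linear_sum[OF lin2] linear_scale[OF lin2] mult.commute)
    finally show "\<xi> $ i * (\<Sum>j\<in>UNIV. b (axis i 1) (axis j 1) * \<xi> $ j) = \<xi> $ i * b (axis i 1) \<xi>" by simp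
  qed
  also have "\<dots> = b (\<Sum>i\<in>UNIV. (\<xi> $ i) *\<^sub>R axis i 1) \<xi>"
    by (simp add: linear_sum[OF lin1] linear_scale[OF lin1])
  also have "\<dots> = b \<xi> \<xi>" using e by simp
  finally show ?thesis by (simp add: b_def D2)
qed

lemma C3_taylor2:
  fixes p :: "real \<times> (real^'n)"
  assumes "C3_bounded_derivs \<phi> D1 D2 D3" "e > 0"
  shows "\<exists>\<delta>>0. \<forall>y. norm y < \<delta> \<longrightarrow>
    \<bar>\<phi> (p + y) - \<phi> p - blinfun_apply (D1 p) y - blinfun_apply (blinfun_apply (D2 p) y) y / 2\<bar> \<le> e * (norm y)\<^sup>2"
proof (rule taylor2_remainder[where r=1 and ?D1.0="\<lambda>p. blinfun_apply (D1 p)"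
      and ?D2.0="\<lambda>w. blinfun_apply (blinfun_apply (D2 p) w)"])
  show "(\<phi> has_derivative blinfun_apply (D1 q)) (at q)" for q
    using assms(1) unfolding C3_bounded_derivs_def by blast
  fix e' :: real assume "e' > 0"
  have "(D1 has_derivative blinfun_apply (D2 p)) (at p)" using assms(1) unfolding C3_bounded_derivs_def by blast
  then obtain d where d: "d > 0" "\<And>y. norm (y - p) < d \<Longrightarrow> norm (D1 y - D1 p - blinfun_apply (D2 p) (y - p)) \<le> e' * norm (y - p)"
    using \<open>e' > 0\<close> unfolding has_derivative_at_alt by blast
  show "\<exists>\<delta>>0. \<forall>w. norm w < \<delta> \<longrightarrow> (\<forall>y. \<bar>blinfun_apply (D1 (p + w)) y - blinfun_apply (D1 p) y
      - blinfun_apply (blinfun_apply (D2 p) w) y\<bar> \<le> e' * norm w * norm y)"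
  proof (intro exI[of _ d] conjI allI impI)
    fix w y :: "real \<times> (real^'n)" assume w: "norm w < d"
    let ?E = "D1 (p + w) - D1 p - blinfun_apply (D2 p) w"
    have "\<bar>blinfun_apply ?E y\<bar> \<le> norm ?E * norm y" using norm_blinfun[of ?E y] by simp
    also have "\<dots> \<le> (e' * norm w) * norm y" using d(2)[of "p + w"] w by (intro mult_right_mono) simp_all
    finally show "\<bar>blinfun_apply (D1 (p + w)) y - blinfun_apply (D1 p) y
      - blinfun_apply (blinfun_apply (D2 p) w) y\<bar> \<le> e' * norm w * norm y" by (simp add: blinfun.diff_left)
  qed (rule d(1))
qed (use assms(2) in \<open>simp_all add: blinfun.scaleR_right blinfun.scaleR_left\<close>)

text \<open>The extra \<open>\<eta>\<close> in the second-order part absorbs the Taylor error of the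
  test function, so that touching by a quadratic polynomial becomes a genuine local maximum. The
  Hessian matrix is described by its quadratic form, which is all that the trace against
  \<open>\<sigma> ** transpose \<sigma>\<close> sees.\<close>

lemma subsolution_jet:
  fixes X :: "real \<times> (real^'n) \<Rightarrow> real \<times> (real^'n)"
  assumes sub: "visc_subsolution T U V b \<sigma> f \<Phi> h h' w" and t: "0 \<le> t" "t < T"
    and X: "linear X" and "\<eta> > 0" and "\<delta> > 0"
    and above: "\<And>s y. 0 \<le> s \<Longrightarrow> s \<le> T \<Longrightarrow> dist (s, y) (t, x) < \<delta> \<Longrightarrow>
      w s y \<le> w t x + a \<bullet> ((s, y) - (t, x)) + (((s, y) - (t, x)) \<bullet> X ((s, y) - (t, x))) / 2"
  shows "\<exists>HX. (\<forall>\<xi>. \<xi> \<bullet> (HX *v \<xi>) = (0, \<xi>) \<bullet> X (0, \<xi>) + \<eta> * (norm \<xi>)\<^sup>2) \<and>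
    min (w t x - h t x) (max (- fst a - Hminus U V b \<sigma> f t x (w t x) (snd a) HX) (w t x - h' t x)) \<le> 0"
proof -
  let ?p = "(t, x)"
  define X' where "X' u = X u + \<eta> *\<^sub>R u" for u
  have X': "linear X'" unfolding X'_def by (intro linear_compose_add X linear_compose_scale_right linear_ident)
  obtain \<phi> D1 D2 D3 where \<phi>: "C3_bounded_derivs \<phi> D1 D2 D3"
    "\<And>v. blinfun_apply (D1 ?p) v = a \<bullet> v"
    "\<And>v w. blinfun_apply (blinfun_apply (D2 ?p) v) w = (v \<bullet> X' w + w \<bullet> X' v) / 2"
    using test_function_with_jet[OF X'] by blast
  obtain \<delta>1 where \<delta>1: "\<delta>1 > 0" "\<And>y. norm y < \<delta>1 \<Longrightarrow>
      \<bar>\<phi> (?p + y) - \<phi> ?p - a \<bullet> y - (y \<bullet> X' y) / 2\<bar> \<le> (\<eta> / 2) * (norm y)\<^sup>2"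
    using C3_taylor2[OF \<phi>(1), of "\<eta> / 2" ?p] \<open>\<eta> > 0\<close> by (auto simp: \<phi>(2,3))
  have "w s y - \<phi> (s, y) \<le> w t x - \<phi> ?p" if s: "s \<in> {0..T}" and d: "dist (s, y) ?p < min \<delta> \<delta>1" for s y
  proof -
    let ?d = "(s, y) - ?p"
    have "norm ?d < \<delta>1" using d by (simp only: dist_norm)
    from \<delta>1(2)[OF this]
    have "\<bar>\<phi> (s, y) - \<phi> ?p - a \<bullet> ?d - (?d \<bullet> X' ?d) / 2\<bar> \<le> (\<eta> / 2) * (norm ?d)\<^sup>2"
      by (simp only: add_diff_cancel_left' add.commute[of ?p] diff_add_cancel)
    moreover have "?d \<bullet> X' ?d = ?d \<bullet> X ?d + \<eta> * (norm ?d)\<^sup>2"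
      unfolding X'_def inner_add_right inner_scaleR_right by (simp only: power2_norm_eq_inner)
    moreover have "w s y \<le> w t x + a \<bullet> ?d + (?d \<bullet> X ?d) / 2" using above s d by simp
    ultimately show ?thesis by (simp only: abs_le_iff) (simp add: field_simps)
  qed
  then have "eq41_expr U V b \<sigma> f h h' w D1 D2 t x \<le> 0"
    using sub \<phi>(1) t \<open>\<delta> > 0\<close> \<delta>1(1) unfolding visc_subsolution_def
    by (metis atLeastLessThan_iff min_less_iff_conj)
  moreover have "dt D1 ?p = fst a" "grad D1 ?p = snd a"
    by (simp_all add: dt_def grad_def \<phi>(2) inner_prod_def inner_axis vec_eq_iff)
  ultimately have "min (w t x - h t x) (max (- fst a - Hminus U V b \<sigma> f t x (w t x) (snd a) (hess D2 ?p)) (w t x - h' t x)) \<le> 0"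
    by (simp add: eq41_expr_def)
  moreover have "\<xi> \<bullet> (hess D2 ?p *v \<xi>) = (0, \<xi>) \<bullet> X (0, \<xi>) + \<eta> * (norm \<xi>)\<^sup>2" for \<xi>
  proof -
    have n: "(0::real, \<xi>) \<bullet> (0, \<xi>) = (norm \<xi>)\<^sup>2" by (simp add: inner_prod_def power2_norm_eq_inner)
    then show ?thesis unfolding hess_quadratic_form[of D2 ?p X', OF \<phi>(3)]
      by (simp only: X'_def inner_add_right inner_scaleR_right inner_minus_right n mult_minus_left add_uminus_conv_diff)
  qed
  ultimately show ?thesis by blast
qed

text \<open>The signs are those of \<open>- w\<close> touched from above with slope \<open>a\<close>
  and second-order part \<open>X\<close>, because the doubling argument produces jets of
  \<open>- u2\<close>.\<close>

lemma supersolution_jet: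
  fixes X :: "real \<times> (real^'n) \<Rightarrow> real \<times> (real^'n)"
  assumes super: "visc_supersolution T U V b \<sigma> f \<Phi> h h' w" and t: "0 \<le> t" "t < T"
    and X: "linear X" and "\<eta> > 0" and "\<delta> > 0"
    and below: "\<And>s y. 0 \<le> s \<Longrightarrow> s \<le> T \<Longrightarrow> dist (s, y) (t, x) < \<delta> \<Longrightarrow>
      w s y \<ge> w t x - a \<bullet> ((s, y) - (t, x)) - (((s, y) - (t, x)) \<bullet> X ((s, y) - (t, x))) / 2"
  shows "\<exists>HX. (\<forall>\<xi>. \<xi> \<bullet> (HX *v \<xi>) = - ((0, \<xi>) \<bullet> X (0, \<xi>)) - \<eta> * (norm \<xi>)\<^sup>2) \<and>
    min (w t x - h t x) (max (fst a - Hminus U V b \<sigma> f t x (w t x) (- snd a) HX) (w t x - h' t x)) \<ge> 0"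
proof -
  let ?p = "(t, x)"
  define X' where "X' u = - X u + (- \<eta>) *\<^sub>R u" for u
  have X': "linear X'" unfolding X'_def
    by (intro linear_compose_add linear_compose_neg X linear_compose_scale_right linear_ident)
  obtain \<phi> D1 D2 D3 where \<phi>: "C3_bounded_derivs \<phi> D1 D2 D3"
    "\<And>v. blinfun_apply (D1 ?p) v = (- a) \<bullet> v"
    "\<And>v w. blinfun_apply (blinfun_apply (D2 ?p) v) w = (v \<bullet> X' w + w \<bullet> X' v) / 2"
    using test_function_with_jet[OF X'] by blast
  obtain \<delta>1 where \<delta>1: "\<delta>1 > 0" "\<And>y. norm y < \<delta>1 \<Longrightarrow>
      \<bar>\<phi> (?p + y) - \<phi> ?p - (- a) \<bullet> y - (y \<bullet> X' y) / 2\<bar> \<le> (\<eta> / 2) * (norm y)\<^sup>2"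
    using C3_taylor2[OF \<phi>(1), of "\<eta> / 2" ?p] \<open>\<eta> > 0\<close> by (auto simp: \<phi>(2,3))
  have "w s y - \<phi> (s, y) \<ge> w t x - \<phi> ?p" if s: "s \<in> {0..T}" and d: "dist (s, y) ?p < min \<delta> \<delta>1" for s y
  proof -
    let ?d = "(s, y) - ?p"
    have "norm ?d < \<delta>1" using d by (simp only: dist_norm)
    from \<delta>1(2)[OF this]
    have "\<bar>\<phi> (s, y) - \<phi> ?p - (- a) \<bullet> ?d - (?d \<bullet> X' ?d) / 2\<bar> \<le> (\<eta> / 2) * (norm ?d)\<^sup>2"
      by (simp only: add_diff_cancel_left' add.commute[of ?p] diff_add_cancel)
    moreover have "?d \<bullet> X' ?d = - (?d \<bullet> X ?d) - \<eta> * (norm ?d)\<^sup>2"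
      unfolding X'_def inner_add_right inner_scaleR_right inner_minus_right by (simp only: power2_norm_eq_inner mult_minus_left add_uminus_conv_diff)
    moreover have "w s y \<ge> w t x - a \<bullet> ?d - (?d \<bullet> X ?d) / 2" using below s d by simp
    ultimately show ?thesis by (simp only: abs_le_iff inner_minus_left) (simp add: field_simps)
  qed
  then have "eq41_expr U V b \<sigma> f h h' w D1 D2 t x \<ge> 0"
    using super \<phi>(1) t \<open>\<delta> > 0\<close> \<delta>1(1) unfolding visc_supersolution_def
    by (metis atLeastLessThan_iff min_less_iff_conj)
  moreover have "dt D1 ?p = - fst a" "grad D1 ?p = - snd a"
    by (simp_all add: dt_def grad_def \<phi>(2) inner_prod_def inner_axis vec_eq_iff)
  ultimately have "min (w t x - h t x) (max (fst a - Hminus U V b \<sigma> f t x (w t x) (- snd a) (hess D2 ?p)) (w t x - h' t x)) \<ge> 0"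
    by (simp add: eq41_expr_def)
  moreover have "\<xi> \<bullet> (hess D2 ?p *v \<xi>) = - ((0, \<xi>) \<bullet> X (0, \<xi>)) - \<eta> * (norm \<xi>)\<^sup>2" for \<xi>
  proof -
    have n: "(0::real, \<xi>) \<bullet> (0, \<xi>) = (norm \<xi>)\<^sup>2" by (simp add: inner_prod_def power2_norm_eq_inner)
    then show ?thesis unfolding hess_quadratic_form[of D2 ?p X', OF \<phi>(3)]
      by (simp only: X'_def inner_add_right inner_scaleR_right inner_minus_right n mult_minus_left add_uminus_conv_diff)
  qed
  ultimately show ?thesis by blast
qed

section \<open>Pointwise estimates for the Hamiltonian\<close>

lemma SUP_INF_diff_le:
  fixes F1 F2 :: "'u \<Rightarrow> 'v \<Rightarrow> real"
  assumes ne: "U \<noteq> {}" "V \<noteq> {}"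
    and bd: "\<And>u v. u \<in> U \<Longrightarrow> v \<in> V \<Longrightarrow> \<bar>F1 u v\<bar> \<le> B" "\<And>u v. u \<in> U \<Longrightarrow> v \<in> V \<Longrightarrow> \<bar>F2 u v\<bar> \<le> B"
    and le: "\<And>u v. u \<in> U \<Longrightarrow> v \<in> V \<Longrightarrow> F1 u v \<le> F2 u v + c"
  shows "(SUP u\<in>U. INF v\<in>V. F1 u v) \<le> (SUP u\<in>U. INF v\<in>V. F2 u v) + c"
proof (rule cSUP_least[OF ne(1)])
  fix u assume u: "u \<in> U"
  have bb1: "bdd_below (F1 u' ` V)" and bb2: "bdd_below (F2 u' ` V)" if "u' \<in> U" for u'
    using bd[OF that] by (auto intro!: bdd_belowI[of _ "- B"] simp: abs_le_iff minus_le_iff)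
  have "(INF v\<in>V. F1 u v) - c \<le> (INF v\<in>V. F2 u v)"
  proof (rule cINF_greatest[OF ne(2)])
    fix v assume v: "v \<in> V"
    have "(INF v\<in>V. F1 u v) \<le> F1 u v" by (rule cINF_lower[OF bb1[OF u] v])
    then show "(INF v\<in>V. F1 u v) - c \<le> F2 u v" using le[OF u v] by simp
  qed
  also have "\<dots> \<le> (SUP u\<in>U. INF v\<in>V. F2 u v)"
  proof (rule cSUP_upper[OF u])
    obtain v0 where v0: "v0 \<in> V" using ne(2) by blast
    show "bdd_above ((\<lambda>u. INF v\<in>V. F2 u v) ` U)"
    proof (rule bdd_aboveI2)
      fix u' assume u': "u' \<in> U"
      have "(INF v\<in>V. F2 u' v) \<le> F2 u' v0" by (rule cINF_lower[OF bb2[OF u'] v0])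
      then show "(INF v\<in>V. F2 u' v) \<le> B" using bd(2)[OF u' v0] by simp
    qed
  qed
  finally show "(INF v\<in>V. F1 u v) \<le> (SUP u\<in>U. INF v\<in>V. F2 u v) + c" by simp
qed

text \<open>Splitting the trace over the columns of \<open>S\<close> allows the inequality for the
  two second-order parts to be applied column by column, with the columns of \<open>\<sigma>\<close>
  at the two points as test vectors.\<close>

lemma mtrace_quadratic:
  fixes S :: "real^'d^'n" and X :: "real^'n^'n"
  shows "mtrace ((S ** transpose S) ** X) = (\<Sum>k\<in>UNIV. column k S \<bullet> (X *v column k S))"
proof -
  have "mtrace ((S ** transpose S) ** X) = (\<Sum>i\<in>UNIV. \<Sum>j\<in>UNIV. \<Sum>k\<in>UNIV. S $ i $ k * S $ j $ k * X $ j $ i)"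
    by (simp add: mtrace_def matrix_matrix_mult_def transpose_def sum_distrib_right)
  also have "\<dots> = (\<Sum>i\<in>UNIV. \<Sum>k\<in>UNIV. \<Sum>j\<in>UNIV. S $ i $ k * S $ j $ k * X $ j $ i)"
    by (intro sum.cong refl sum.swap)
  also have "\<dots> = (\<Sum>k\<in>UNIV. \<Sum>i\<in>UNIV. \<Sum>j\<in>UNIV. S $ i $ k * S $ j $ k * X $ j $ i)"
    by (rule sum.swap)
  also have "\<dots> = (\<Sum>k\<in>UNIV. \<Sum>j\<in>UNIV. \<Sum>i\<in>UNIV. S $ i $ k * S $ j $ k * X $ j $ i)"
    by (intro sum.cong refl sum.swap)
  also have "\<dots> = (\<Sum>k\<in>UNIV. column k S \<bullet> (X *v column k S))"
    by (simp add: inner_vec_def matrix_vector_mult_def column_def sum_distrib_left mult_ac)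
  finally show ?thesis .
qed

lemma sum_norm_column_sq:
  fixes S :: "real^'d^'n"
  shows "(\<Sum>k\<in>UNIV. (norm (column k S))\<^sup>2) = (norm S)\<^sup>2"
proof -
  have "(norm S)\<^sup>2 = (\<Sum>i\<in>UNIV. \<Sum>k\<in>UNIV. S $ i $ k * S $ i $ k)"
    by (simp add: power2_norm_eq_inner inner_vec_def)
  also have "\<dots> = (\<Sum>k\<in>UNIV. \<Sum>i\<in>UNIV. S $ i $ k * S $ i $ k)" by (rule sum.swap)
  finally show ?thesis by (simp add: power2_norm_eq_inner inner_vec_def column_def)
qed

lemma vector_matrix_component: "(q v* S) $ k = q \<bullet> column k S" for S :: "real^'d^'n"
  by (simp add: vector_matrix_mult_def inner_vec_def column_def mult.commute)

lemma norm_vector_matrix_le: "norm (q v* S) \<le> norm q * norm S" for S :: "real^'d^'n"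
proof (rule power2_le_imp_le)
  have "(norm (q v* S))\<^sup>2 = (\<Sum>k\<in>UNIV. (q \<bullet> column k S)\<^sup>2)"
  proof -
    have "x \<bullet> x = (\<Sum>k\<in>UNIV. (x $ k)\<^sup>2)" for x :: "real^'d" by (simp add: inner_vec_def power2_eq_square)
    then show ?thesis by (simp only: power2_norm_eq_inner vector_matrix_component)
  qed
  also have "\<dots> \<le> (\<Sum>k\<in>UNIV. (norm q)\<^sup>2 * (norm (column k S))\<^sup>2)"
  proof (rule sum_mono)
    fix k
    have "\<bar>q \<bullet> column k S\<bar>\<^sup>2 \<le> (norm q * norm (column k S))\<^sup>2"
      by (intro power_mono Cauchy_Schwarz_ineq2) simp
    then show "(q \<bullet> column k S)\<^sup>2 \<le> (norm q)\<^sup>2 * (norm (column k S))\<^sup>2" by (simp add: power_mult_distrib)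
  qed
  also have "\<dots> = (norm q * norm S)\<^sup>2"
    by (simp add: sum_norm_column_sq power_mult_distrib flip: sum_distrib_left)
  finally show "(norm (q v* S))\<^sup>2 \<le> (norm q * norm S)\<^sup>2" .
qed simp

lemma vector_matrix_linear:
  fixes S S' :: "real^'d^'n"
  shows "(q + q') v* S = q v* S + q' v* S" "(- q) v* S = - (q v* S)" "q v* (S - S') = q v* S - q v* S'"
proof -
  have c: "column k (S - S') = column k S - column k S'" for k by (simp add: vec_eq_iff column_def)
  show "(q + q') v* S = q v* S + q' v* S" "(- q) v* S = - (q v* S)" "q v* (S - S') = q v* S - q v* S'"
    unfolding vec_eq_iff vector_add_component vector_uminus_component vector_minus_component vector_matrix_component c
    by (simp_all add: inner_add_left inner_diff_right)
qed

section \<open>The barrier\<close>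

text \<open>The logarithm is \<open>ln (sqrt (1 + x \<bullet> x))\<close>, the one in
  \<open>Theta\<close>. The added 1 keeps \<open>psi\<close> and its square root at least 1, so that
  lower powers of the root are dominated by \<open>psi\<close>.\<close>

definition psi :: "real^'n \<Rightarrow> real" where
  "psi x = (1 + ln (1 + x \<bullet> x) / 2)\<^sup>2"

text \<open>The factor \<open>1 / (c * (fst p - t0))\<close> solves \<open>a' = - c * a^2\<close>
  and blows up as the time decreases to \<open>t0\<close>.\<close>

definition barrier :: "real \<Rightarrow> real \<Rightarrow> real \<times> (real^'n) \<Rightarrow> real" where
  "barrier c t0 p = exp (psi (snd p) / (c * (fst p - t0)))"

lemma inner_self_plus_one_pos: "0 < 1 + x \<bullet> (x::'a::real_inner)"
  using inner_ge_zero[of x] by linarith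

lemma psi_ge: "1 \<le> psi x" "1 + ln (1 + x \<bullet> x) / 2 \<le> psi x" "0 \<le> ln (1 + x \<bullet> x)"
proof -
  show l: "0 \<le> ln (1 + x \<bullet> x)" by simp
  then have 1: "1 \<le> 1 + ln (1 + x \<bullet> x) / 2" by simp
  show "1 \<le> psi x" unfolding psi_def using 1 by (simp add: one_le_power)
  show "1 + ln (1 + x \<bullet> x) / 2 \<le> psi x" unfolding psi_def using 1 by (simp add: self_le_power)
qed

lemma barrier_pos: "barrier c t0 p > 0"
  by (simp add: barrier_def)

lemma barrier_continuous:
  assumes "c > 0" "\<And>p. p \<in> S \<Longrightarrow> t0 < fst p"
  shows "continuous_on S (barrier c t0)"
proof -
  have "1 + snd p \<bullet> snd p \<noteq> 0" for p :: "real \<times> (real^'n)"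
    using inner_self_plus_one_pos[of "snd p"] by linarith
  then show ?thesis
    unfolding barrier_def psi_def using assms
    by (intro continuous_intros) (auto dest: assms(2))
qed

text \<open>The barrier is radial in space: its spatial gradient is this scalar times the position,
  so one scalar derivative determines the spatial Hessian.\<close>

definition bcoef :: "real \<Rightarrow> real \<Rightarrow> real \<times> (real^'n) \<Rightarrow> real" where
  "bcoef c t0 p = 2 * (1 / (c * (fst p - t0))) * (1 + ln (1 + snd p \<bullet> snd p) / 2) * barrier c t0 p / (1 + snd p \<bullet> snd p)"

lemma log_factor_derivative:
  fixes r :: real
  assumes "1 + r > 0"
  shows "((\<lambda>r. 1 + ln (1 + r) / 2) has_real_derivative 1 / (2 * (1 + r))) (at r)"
  using assms by (auto intro!: derivative_eq_intros simp: field_simps)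

lemma radial_has_derivative:
  fixes x :: "'a::real_inner"
  assumes "(F has_real_derivative D) (at (x \<bullet> x))"
  shows "((\<lambda>x. F (x \<bullet> x)) has_derivative (\<lambda>\<xi>. D * (2 * (x \<bullet> \<xi>)))) (at x)"
proof -
  have "((\<lambda>x. x \<bullet> x) has_derivative (\<lambda>\<xi>. 2 * (x \<bullet> \<xi>))) (at x)"
    by (auto intro!: derivative_eq_intros simp: inner_commute)
  from has_derivative_compose[OF this assms[unfolded has_field_derivative_def]]
  show ?thesis .
qed

lemma psi_has_derivative:
  "(psi has_derivative (\<lambda>\<xi>. 2 * (1 + ln (1 + x \<bullet> x) / 2) * (x \<bullet> \<xi>) / (1 + x \<bullet> x))) (at x)"
proof -
  have m: "1 + x \<bullet> x > 0" by (rule inner_self_plus_one_pos)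
  have "((\<lambda>r. (1 + ln (1 + r) / 2)\<^sup>2) has_real_derivative
      2 * (1 + ln (1 + x \<bullet> x) / 2) * (1 / (2 * (1 + x \<bullet> x)))) (at (x \<bullet> x))"
    by (rule derivative_eq_intros log_factor_derivative[OF m] refl)+ simp
  from radial_has_derivative[OF this] show ?thesis
    unfolding psi_def[abs_def] by (rule has_derivative_eq_rhs) (use m in \<open>simp add: fun_eq_iff field_simps\<close>)
qed

lemma barrier_has_derivative:
  assumes "c > 0" "t0 < fst p"
  shows "(barrier c t0 has_derivative
     (\<lambda>y. (- c * (1 / (c * (fst p - t0)))\<^sup>2 * psi (snd p) * barrier c t0 p, bcoef c t0 p *\<^sub>R snd p) \<bullet> y)) (at p)"
proof -
  define a where "a = 1 / (c * (fst p - t0))"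
  have h1: "((\<lambda>p. psi (snd p)) has_derivative
      (\<lambda>y. 2 * (1 + ln (1 + snd p \<bullet> snd p) / 2) * (snd p \<bullet> snd y) / (1 + snd p \<bullet> snd p))) (at p)"
    by (rule has_derivative_compose[OF has_derivative_snd[OF has_derivative_ident] psi_has_derivative])
  have "((\<lambda>t. 1 / (c * (t - t0))) has_real_derivative - c * a\<^sup>2) (at (fst p))"
    using assms by (auto intro!: derivative_eq_intros simp: a_def power2_eq_square)
  from has_derivative_compose[OF has_derivative_fst[OF has_derivative_ident] this[unfolded has_field_derivative_def]]
  have h2: "((\<lambda>p. 1 / (c * (fst p - t0))) has_derivative (\<lambda>y. - c * a\<^sup>2 * fst y)) (at p)" .
  have eq: "barrier c t0 = (\<lambda>p. exp (psi (snd p) * (1 / (c * (fst p - t0)))))"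
    by (simp add: barrier_def fun_eq_iff)
  have "(barrier c t0 has_derivative (\<lambda>y. exp (psi (snd p) * (1 / (c * (fst p - t0)))) *
     (psi (snd p) * (- c * a\<^sup>2 * fst y) + (2 * (1 + ln (1 + snd p \<bullet> snd p) / 2) * (snd p \<bullet> snd y) / (1 + snd p \<bullet> snd p)) * (1 / (c * (fst p - t0)))))) (at p)"
    unfolding eq by (rule has_derivative_eq_rhs[OF has_derivative_exp[OF has_derivative_mult[OF h1 h2]]])
      (simp add: fun_eq_iff mult.commute)
  moreover have "exp (psi (snd p) * (1 / (c * (fst p - t0)))) *
     (psi (snd p) * (- c * a\<^sup>2 * fst y) + (2 * (1 + ln (1 + snd p \<bullet> snd p) / 2) * (snd p \<bullet> snd y) / (1 + snd p \<bullet> snd p)) * (1 / (c * (fst p - t0))))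
    = (- c * (1 / (c * (fst p - t0)))\<^sup>2 * psi (snd p) * barrier c t0 p, bcoef c t0 p *\<^sub>R snd p) \<bullet> y" for y
  proof -
    have bv: "exp (psi (snd p) * (1 / (c * (fst p - t0)))) = barrier c t0 p" by (simp add: eq)
    show ?thesis
      unfolding bcoef_def inner_prod_def fst_conv snd_conv inner_scaleR_left inner_real_def
      unfolding bv unfolding a_def[symmetric]
      by (simp add: algebra_simps)
  qed
  ultimately show ?thesis by simp
qed

lemma bcoef_spatial_derivative:
  fixes x :: "real^'n"
  assumes "c > 0" "t0 < t"
  defines "a \<equiv> 1 / (c * (t - t0))" and "m \<equiv> 1 + x \<bullet> x" and "l \<equiv> 1 + ln (1 + x \<bullet> x) / 2"
  shows "((\<lambda>x. bcoef c t0 (t, x)) has_derivative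
     (\<lambda>\<xi>. (x \<bullet> \<xi>) * (2 * a * barrier c t0 (t, x) / m\<^sup>2) * (1 + 2 * a * l\<^sup>2 - 2 * l))) (at x)"
proof -
  have m: "m > 0" unfolding m_def by (rule inner_self_plus_one_pos)
  have e: "bcoef c t0 (t, x) = 2 * a * (1 + ln (1 + x \<bullet> x) / 2) * exp (a * (1 + ln (1 + x \<bullet> x) / 2)\<^sup>2) / (1 + x \<bullet> x)" for x
    by (simp add: bcoef_def barrier_def psi_def a_def)
  have b: "barrier c t0 (t, x) = exp (a * l\<^sup>2)" by (simp add: barrier_def psi_def a_def l_def)
  define F where "F r = 2 * a * (1 + ln (1 + r) / 2) * exp (a * (1 + ln (1 + r) / 2)\<^sup>2) / (1 + r)" for r :: real
  note L = log_factor_derivative[of "x \<bullet> x", folded m_def, OF m]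
  have E: "((\<lambda>r. exp (a * (1 + ln (1 + r) / 2)\<^sup>2)) has_real_derivative
      exp (a * l\<^sup>2) * (a * (2 * l * (1 / (2 * m))))) (at (x \<bullet> x))"
    by (rule derivative_eq_intros L refl)+ (simp add: l_def m_def)
  have "(F has_real_derivative ((2 * a * (1 / (2 * m)) * exp (a * l\<^sup>2) + (exp (a * l\<^sup>2) * (a * (2 * l * (1 / (2 * m))))) * (2 * a * l)) * m
      - 2 * a * l * exp (a * l\<^sup>2) * 1) / (m * m)) (at (x \<bullet> x))"
  proof -
    have d: "((\<lambda>r. 1 + r) has_real_derivative 1) (at (x \<bullet> x))" by (auto intro!: derivative_eq_intros)
    have n: "1 + x \<bullet> x \<noteq> 0" using m by (simp add: m_def)
    have lm: "1 + ln m / 2 = l" by (simp add: l_def m_def)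
    show ?thesis unfolding F_def[abs_def]
      using DERIV_divide[OF DERIV_mult[OF DERIV_cmult[OF L, of "2 * a"] E] d n]
      by (simp only: m_def[symmetric] lm)
  qed
  from radial_has_derivative[OF this]
  have "((\<lambda>x. F (x \<bullet> x)) has_derivative (\<lambda>\<xi>. ((2 * a * (1 / (2 * m)) * exp (a * l\<^sup>2) + (exp (a * l\<^sup>2) * (a * (2 * l * (1 / (2 * m))))) * (2 * a * l)) * m
      - 2 * a * l * exp (a * l\<^sup>2) * 1) / (m * m) * (2 * (x \<bullet> \<xi>)))) (at x)" .
  moreover have "((2 * a * (1 / (2 * m)) * E + (E * (a * (2 * l * (1 / (2 * m))))) * (2 * a * l)) * m
      - 2 * a * l * E * 1) / (m * m) * (2 * d) = d * (2 * a * E / m\<^sup>2) * (1 + 2 * a * l\<^sup>2 - 2 * l)" for d E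
    using m by (simp add: field_simps power2_eq_square)
  ultimately show ?thesis unfolding e b F_def by simp
qed

text \<open>Mere existence suffices here: only the spatial block of the second derivative is
  estimated sharply, and whatever the time and mixed entries are, they go into the slack
  \<open>\<nu>\<close> of \<open>barrier_jet\<close>.\<close>

lemma barrier_gradient_differentiable:
  assumes "c > 0" "t0 < fst p"
  shows "\<exists>G'. ((\<lambda>p. (- c * (1 / (c * (fst p - t0)))\<^sup>2 * psi (snd p) * barrier c t0 p, bcoef c t0 p *\<^sub>R snd p))
     has_derivative G') (at p)"
proof -
  have m: "1 + snd p \<bullet> snd p > 0" by (rule inner_self_plus_one_pos)
  note D = has_derivative_compose[OF has_derivative_snd[OF has_derivative_ident] psi_has_derivative]
  have "\<exists>D. ((\<lambda>p. - c * (1 / (c * (fst p - t0)))\<^sup>2) has_derivative D) (at p)"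
    using assms by (intro exI) (auto intro!: derivative_eq_intros)
  then obtain D1 where D1: "((\<lambda>p. - c * (1 / (c * (fst p - t0)))\<^sup>2) has_derivative D1) (at p)" by blast
  have "\<exists>D. ((\<lambda>p. 2 * (1 / (c * (fst p - t0))) * (1 + ln (1 + snd p \<bullet> snd p) / 2)) has_derivative D) (at p)"
    using assms m by (intro exI) (auto intro!: derivative_eq_intros)
  then obtain D2 where D2: "((\<lambda>p. 2 * (1 / (c * (fst p - t0))) * (1 + ln (1 + snd p \<bullet> snd p) / 2)) has_derivative D2) (at p)"
    by blast
  have "\<exists>D. ((\<lambda>p. 1 + snd p \<bullet> snd p) has_derivative D) (at p)"
    by (intro exI) (auto intro!: derivative_eq_intros)
  then obtain D3 where D3: "((\<lambda>p. 1 + snd p \<bullet> snd p) has_derivative D3) (at p)" by blast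
  note B = barrier_has_derivative[OF assms]
  have "\<exists>D. (bcoef c t0 has_derivative D) (at p)"
    unfolding bcoef_def
    by (rule exI, rule has_derivative_divide[OF has_derivative_mult[OF D2 B] D3]) (use m in simp)
  then obtain D4 where D4: "(bcoef c t0 has_derivative D4) (at p)" by blast
  show ?thesis
    by (rule exI, rule has_derivative_Pair[OF has_derivative_mult[OF has_derivative_mult[OF D1 D] B]
          has_derivative_scaleR[OF D4 has_derivative_snd[OF has_derivative_ident]]])
qed

text \<open>The barrier is an exact supersolution up to a quadratic slack in time: the spatial curvature is
  of order \<open>a\<^sup>2 psi\<close> with \<open>a = 1 / (c (t - t0))\<close>, and this is what \<open>- a' = c a\<^sup>2\<close> dominates.\<close>
lemma barrier_jet:
  fixes x :: "real^'n"
  assumes c: "c > 0" "t0 < t" and a1: "1 / (c * (t - t0)) \<ge> 1"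
  defines "B \<equiv> (1 / (c * (t - t0)))\<^sup>2 * psi x * barrier c t0 (t, x)" and "m \<equiv> 1 + x \<bullet> x"
  shows "\<exists>gx n \<nu> \<delta>. \<delta> > 0 \<and> \<nu> \<ge> 0 \<and> norm gx * sqrt m \<le> 2 * B \<and> n \<ge> 0 \<and> n * m = 7 * B \<and>
    (\<forall>y. norm y < \<delta> \<longrightarrow> barrier c t0 ((t, x) + y) \<le> barrier c t0 (t, x) - c * B * fst y + gx \<bullet> snd y
       + (n * (norm (snd y))\<^sup>2 + \<nu> * (fst y)\<^sup>2) / 2)"
proof -
  let ?p = "(t, x)"
  define a where "a = 1 / (c * (t - t0))"
  define l where "l = 1 + ln (1 + x \<bullet> x) / 2"
  define E where "E = barrier c t0 ?p"
  have a: "a \<ge> 1" using a1 by (simp add: a_def)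
  have l: "l \<ge> 1" "psi x = l\<^sup>2" using psi_ge(3)[of x] by (simp_all add: l_def psi_def)
  have B: "B = a\<^sup>2 * l\<^sup>2 * E" by (simp add: B_def a_def E_def l)
  have E: "E > 0" by (simp add: E_def barrier_pos)
  have Bpos: "B > 0" using a l E by (simp add: B)
  have m: "m \<ge> 1" "m > 0" using inner_ge_zero[of x] by (simp_all add: m_def add_pos_nonneg)
  define Gr where "Gr p = (- c * (1 / (c * (fst p - t0)))\<^sup>2 * psi (snd p) * barrier c t0 p, bcoef c t0 p *\<^sub>R snd p)"
    for p :: "real \<times> (real^'n)"
  have Gr_p: "Gr ?p = (- c * B, bcoef c t0 ?p *\<^sub>R x)" by (simp add: Gr_def B_def)
  have bc: "bcoef c t0 ?p = 2 * a * l * E / m" by (simp add: bcoef_def a_def l_def E_def m_def)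
  have la: "a * l \<le> a\<^sup>2 * l\<^sup>2"
    using self_le_power[of "a * l" 2] a l by (simp add: power_mult_distrib mult_ge1_I)
  have al: "a * l * E \<le> B" unfolding B using la E by (intro mult_right_mono) auto
  define gx where "gx = bcoef c t0 ?p *\<^sub>R x"
  have gx: "norm gx * sqrt m \<le> 2 * B"
  proof -
    have "norm x \<le> sqrt m" unfolding m_def by (rule real_le_rsqrt) (simp add: power2_norm_eq_inner)
    then have "norm x * sqrt m \<le> sqrt m * sqrt m" using m by (intro mult_right_mono) auto
    then have x: "norm x * sqrt m \<le> m" using m by simp
    have "norm gx * sqrt m = (2 * (a * l * E) / m) * (norm x * sqrt m)"
      using a l E m unfolding gx_def bc by (simp add: abs_mult)
    also have "\<dots> \<le> (2 * (a * l * E) / m) * m"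
      using a l E m by (intro mult_left_mono x) auto
    also have "\<dots> = 2 * (a * l * E)" using m by simp
    finally show ?thesis using al by simp
  qed
  obtain G' where G': "(Gr has_derivative G') (at ?p)"
    using barrier_gradient_differentiable[of c t0 ?p] c unfolding Gr_def by auto
  have linG: "linear G'" using G' by (rule has_derivative_linear)
  \<comment> \<open>The constant 6 is 2 for the multiple \<open>bcoef\<close> of the identity plus 4
    for the rank-one part. In the latter \<open>1 - 2 * l\<close> is negative because
    \<open>l \<ge> 1\<close>, which leaves \<open>2 * a * l^2\<close>.\<close>
  have G'_x: "G' (0, \<xi>) \<bullet> (0, \<xi>) \<le> 6 * B / m * (norm \<xi>)\<^sup>2" for \<xi>
  proof -
    have "((\<lambda>x. (t, x)) has_derivative (\<lambda>\<xi>. (0, \<xi>))) (at x)" by (auto intro!: derivative_eq_intros)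
    from has_derivative_snd[OF has_derivative_compose[OF this G']]
    have h1: "((\<lambda>x. bcoef c t0 (t, x) *\<^sub>R x) has_derivative (\<lambda>\<xi>. snd (G' (0, \<xi>)))) (at x)"
      by (simp add: Gr_def)
    define k where "k = 2 * a * E / m\<^sup>2 * (1 + 2 * a * l\<^sup>2 - 2 * l)"
    have "((\<lambda>x. bcoef c t0 (t, x)) has_derivative (\<lambda>\<xi>. (x \<bullet> \<xi>) * k)) (at x)"
      using bcoef_spatial_derivative[OF c, of x]
      by (simp add: k_def a_def E_def m_def l_def mult.assoc)
    from has_derivative_scaleR[OF this has_derivative_ident]
    have h2: "((\<lambda>x. bcoef c t0 (t, x) *\<^sub>R x) has_derivative (\<lambda>\<xi>. bcoef c t0 (t, x) *\<^sub>R \<xi> + ((x \<bullet> \<xi>) * k) *\<^sub>R x)) (at x)" .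
    have "snd (G' (0, \<xi>)) = bcoef c t0 (t, x) *\<^sub>R \<xi> + ((x \<bullet> \<xi>) * k) *\<^sub>R x"
      using has_derivative_unique[OF h1 h2] by metis
    then have "G' (0, \<xi>) \<bullet> (0, \<xi>) = bcoef c t0 (t, x) * (norm \<xi>)\<^sup>2 + (x \<bullet> \<xi>)\<^sup>2 * k"
      unfolding power2_norm_eq_inner by (simp add: inner_prod_def inner_add_left power2_eq_square)
    also have "\<dots> \<le> 2 * B / m * (norm \<xi>)\<^sup>2 + 4 * B / m * (norm \<xi>)\<^sup>2"
    proof (rule add_mono)
      have "bcoef c t0 (t, x) \<le> 2 * B / m" unfolding bc using al m by (simp add: divide_right_mono)
      then show "bcoef c t0 (t, x) * (norm \<xi>)\<^sup>2 \<le> 2 * B / m * (norm \<xi>)\<^sup>2" by (rule mult_right_mono) simp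
      have "(x \<bullet> \<xi>)\<^sup>2 \<le> (norm x * norm \<xi>)\<^sup>2"
        using power_mono[OF Cauchy_Schwarz_ineq2[of x \<xi>], of 2] by simp
      also have "\<dots> = (x \<bullet> x) * (norm \<xi>)\<^sup>2" by (simp add: power_mult_distrib power2_norm_eq_inner)
      also have "\<dots> \<le> m * (norm \<xi>)\<^sup>2" by (intro mult_right_mono) (simp_all add: m_def)
      finally have xx: "(x \<bullet> \<xi>)\<^sup>2 \<le> m * (norm \<xi>)\<^sup>2" .
      have "k \<le> 2 * a * E / m\<^sup>2 * (2 * a * l\<^sup>2)"
        unfolding k_def using a l E by (intro mult_left_mono) auto
      also have "\<dots> = 4 * B / m\<^sup>2" by (simp add: B power2_eq_square)
      finally have k: "k \<le> 4 * B / m\<^sup>2" .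
      have "(x \<bullet> \<xi>)\<^sup>2 * k \<le> (x \<bullet> \<xi>)\<^sup>2 * (4 * B / m\<^sup>2)" using k by (rule mult_left_mono) simp
      also have "\<dots> \<le> (m * (norm \<xi>)\<^sup>2) * (4 * B / m\<^sup>2)" using xx Bpos by (intro mult_right_mono) auto
      also have "\<dots> = 4 * B / m * (norm \<xi>)\<^sup>2" using m by (simp add: power2_eq_square)
      finally show "(x \<bullet> \<xi>)\<^sup>2 * k \<le> 4 * B / m * (norm \<xi>)\<^sup>2" .
    qed
    also have "\<dots> = 6 * B / m * (norm \<xi>)\<^sup>2" by (simp add: algebra_simps add_divide_distrib[symmetric])
    finally show ?thesis .
  qed
  \<comment> \<open>Two portions of \<open>e\<close> raise the constant from 6 to 7: one absorbs the
    mixed time-space entries by Young's inequality, the other the Taylor remainder. The price is the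
    uncontrolled but purely temporal coefficient \<open>\<nu>\<close>, which never enters the
    Hamiltonian.\<close>
  define e where "e = B / m / 2"
  have e: "e > 0" using Bpos m by (simp add: e_def)
  obtain M where M: "M > 0" "\<And>y. norm (G' y) \<le> norm y * M"
    using bounded_linear.pos_bounded[OF has_derivative_bounded_linear[OF G']] by blast
  define \<nu> where "\<nu> = M + M\<^sup>2 / e + e"
  have \<nu>: "\<nu> \<ge> 0" using M e by (simp add: \<nu>_def)
  define n where "n = 7 * B / m"
  have n: "n \<ge> 0" "n * m = 7 * B" using Bpos m by (simp_all add: n_def)
  have quad: "G' y \<bullet> y + e * (norm y)\<^sup>2 \<le> n * (norm (snd y))\<^sup>2 + \<nu> * (fst y)\<^sup>2" for y
  proof -
    define \<tau> u where "\<tau> = fst y" and "u = (0::real, snd y)"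
    have y: "y = \<tau> *\<^sub>R (1, 0) + u" by (simp add: \<tau>_def u_def prod_eq_iff)
    have nu: "norm u = norm (snd y)" by (simp add: u_def norm_Pair)
    let ?i = "(1::real, 0::real^'n)"
    have i: "norm ?i = 1" by (simp add: norm_Pair)
    have expand: "G' y \<bullet> y = \<tau>\<^sup>2 * (G' ?i \<bullet> ?i) + \<tau> * (G' ?i \<bullet> u) + \<tau> * (G' u \<bullet> ?i) + G' u \<bullet> u"
      by (subst (1 2) y) (simp only: linear_add[OF linG] linear_scale[OF linG] inner_add_left inner_add_right
          inner_scaleR_left inner_scaleR_right power2_eq_square distrib_left mult.assoc add.assoc)
    have bd: "\<bar>G' v \<bullet> w\<bar> \<le> M * norm v * norm w" for v w
    proof -
      have "\<bar>G' v \<bullet> w\<bar> \<le> norm (G' v) * norm w" by (rule Cauchy_Schwarz_ineq2)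
      also have "\<dots> \<le> (norm v * M) * norm w" using M(2)[of v] by (rule mult_right_mono) simp
      finally show ?thesis by (simp add: mult_ac)
    qed
    have t1: "\<tau>\<^sup>2 * (G' ?i \<bullet> ?i) \<le> \<tau>\<^sup>2 * M"
      using bd[of ?i ?i] i by (intro mult_left_mono) (simp_all add: abs_le_iff)
    have cross: "\<tau> * z \<le> \<bar>\<tau>\<bar> * (M * norm u)" if "\<bar>z\<bar> \<le> M * norm u" for z
    proof -
      have "\<tau> * z \<le> \<bar>\<tau>\<bar> * \<bar>z\<bar>" using abs_ge_self[of "\<tau> * z"] by (simp add: abs_mult)
      also have "\<dots> \<le> \<bar>\<tau>\<bar> * (M * norm u)" using that by (rule mult_left_mono) simp
      finally show ?thesis .
    qed
    have t2: "\<tau> * (G' ?i \<bullet> u) \<le> \<bar>\<tau>\<bar> * (M * norm u)" using bd[of ?i u] i by (intro cross) simp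
    have t3: "\<tau> * (G' u \<bullet> ?i) \<le> \<bar>\<tau>\<bar> * (M * norm u)" using bd[of u ?i] i by (intro cross) simp
    have t4: "G' u \<bullet> u \<le> 6 * B / m * (norm u)\<^sup>2" using G'_x[of "snd y"] unfolding nu by (simp add: u_def)
    have "0 \<le> (M * \<bar>\<tau>\<bar> - e * norm u)\<^sup>2 / e" using e by simp
    also have "\<dots> = M\<^sup>2 / e * \<tau>\<^sup>2 - 2 * (\<bar>\<tau>\<bar> * (M * norm u)) + e * (norm u)\<^sup>2"
      using e by (simp add: power2_diff power_mult_distrib field_simps power2_eq_square)
    finally have t5: "2 * (\<bar>\<tau>\<bar> * (M * norm u)) \<le> M\<^sup>2 / e * \<tau>\<^sup>2 + e * (norm u)\<^sup>2" by simp
    have ny: "(norm y)\<^sup>2 = \<tau>\<^sup>2 + (norm u)\<^sup>2" unfolding nu by (cases y) (simp add: norm_Pair \<tau>_def)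
    have "n * (norm u)\<^sup>2 = 6 * B / m * (norm u)\<^sup>2 + 2 * (e * (norm u)\<^sup>2)"
      by (simp add: n_def e_def algebra_simps add_divide_distrib[symmetric])
    moreover have "\<nu> * \<tau>\<^sup>2 = \<tau>\<^sup>2 * M + M\<^sup>2 / e * \<tau>\<^sup>2 + e * \<tau>\<^sup>2" by (simp add: \<nu>_def algebra_simps)
    ultimately show ?thesis
      using t1 t2 t3 t4 t5 unfolding expand ny \<tau>_def[symmetric] nu[symmetric] by (simp add: distrib_left)
  qed
  have "\<exists>\<delta>>0. \<forall>y. norm y < \<delta> \<longrightarrow> \<bar>barrier c t0 (?p + y) - barrier c t0 ?p - Gr ?p \<bullet> y - G' y \<bullet> y / 2\<bar> \<le> (e / 2) * (norm y)\<^sup>2"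
  proof (rule taylor2_remainder[where r="t - t0" and ?D1.0="\<lambda>p y. Gr p \<bullet> y" and ?D2.0="\<lambda>w y. G' w \<bullet> y"])
    show "t - t0 > 0" using c by simp
    show "(barrier c t0 has_derivative (\<lambda>y. Gr q \<bullet> y)) (at q)" if "dist q ?p < t - t0" for q
    proof -
      have "\<bar>fst q - t\<bar> < t - t0" using dist_fst_le[of q ?p] that by (simp add: dist_real_def)
      then show ?thesis using barrier_has_derivative[OF c(1), of t0 q] by (simp add: Gr_def)
    qed
    show "\<exists>\<delta>>0. \<forall>w. norm w < \<delta> \<longrightarrow> (\<forall>y. \<bar>Gr (?p + w) \<bullet> y - Gr ?p \<bullet> y - G' w \<bullet> y\<bar> \<le> e' * norm w * norm y)"
      if e': "e' > 0" for e'
    proof -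
      have "\<forall>e>0. \<exists>d>0. \<forall>y. norm (y - ?p) < d \<longrightarrow> norm (Gr y - Gr ?p - G' (y - ?p)) \<le> e * norm (y - ?p)"
        using G' unfolding has_derivative_at_alt by (rule conjunct2)
      then obtain d where d: "d > 0" "\<And>y. norm (y - ?p) < d \<Longrightarrow> norm (Gr y - Gr ?p - G' (y - ?p)) \<le> e' * norm (y - ?p)"
        using e' by meson
      show ?thesis
      proof (intro exI[of _ d] conjI allI impI)
        fix w y :: "real \<times> (real^'n)" assume w: "norm w < d"
        have "\<bar>(Gr (?p + w) - Gr ?p - G' w) \<bullet> y\<bar> \<le> norm (Gr (?p + w) - Gr ?p - G' w) * norm y"
          by (rule Cauchy_Schwarz_ineq2)
        also have "\<dots> \<le> (e' * norm w) * norm y"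
          using d(2)[of "?p + w"] w by (intro mult_right_mono) (simp_all only: add_diff_cancel_left' norm_ge_zero)
        finally show "\<bar>Gr (?p + w) \<bullet> y - Gr ?p \<bullet> y - G' w \<bullet> y\<bar> \<le> e' * norm w * norm y"
          by (simp only: inner_diff_left)
      qed (rule d(1))
    qed
    show "G' (s *\<^sub>R y) \<bullet> y = s * (G' y \<bullet> y)" for s y by (simp add: linear_scale[OF linG])
    show "e / 2 > 0" using e by simp
  qed
  then obtain \<delta> where \<delta>: "\<delta> > 0" "\<And>y. norm y < \<delta> \<Longrightarrow>
    \<bar>barrier c t0 (?p + y) - barrier c t0 ?p - Gr ?p \<bullet> y - G' y \<bullet> y / 2\<bar> \<le> (e / 2) * (norm y)\<^sup>2" by blast
  have "barrier c t0 (?p + y) \<le> barrier c t0 ?p - c * B * fst y + gx \<bullet> snd y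
       + (n * (norm (snd y))\<^sup>2 + \<nu> * (fst y)\<^sup>2) / 2" if "norm y < \<delta>" for y
  proof -
    have "Gr ?p \<bullet> y = - c * B * fst y + gx \<bullet> snd y" unfolding Gr_p by (simp add: inner_prod_def gx_def)
    then show ?thesis using \<delta>(2)[OF that] quad[of y] by (simp only: abs_le_iff) (simp add: field_simps)
  qed
  then show ?thesis using \<delta>(1) \<nu> gx n by blast
qed

section \<open>Doubling of variables\<close>

text \<open>Joint continuity is given for each fixed \<open>x\<close> only. A finite net in
  \<open>S\<close> reduces the claim to finitely many uniformly continuous functions, and the
  Lipschitz bound in \<open>x\<close> moves to the nearest net point and back, each move costing a
  third of \<open>e\<close>.\<close>

lemma time_modulus:
  fixes F :: "real \<Rightarrow> 'p::metric_space \<Rightarrow> 'u::metric_space \<Rightarrow> 'v::metric_space \<Rightarrow> 'r::metric_space"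
  assumes S: "compact S" and UV: "compact U" "compact V"
    and cont: "\<And>x. continuous_on ({0..T} \<times> U \<times> V) (\<lambda>(t, u, v). F t x u v)"
    and lip: "\<And>t u v x x'. t \<in> {0..T} \<Longrightarrow> u \<in> U \<Longrightarrow> v \<in> V \<Longrightarrow> dist (F t x u v) (F t x' u v) \<le> L * dist x x'"
    and "e > 0"
  shows "\<exists>\<delta>>0. \<forall>t\<in>{0..T}. \<forall>s\<in>{0..T}. \<bar>t - s\<bar> < \<delta> \<longrightarrow>
    (\<forall>x\<in>S. \<forall>u\<in>U. \<forall>v\<in>V. dist (F t x u v) (F s x u v) \<le> e)"
proof -
  define r where "r = e / (3 * (\<bar>L\<bar> + 1))"
  have r: "r > 0" "\<bar>L\<bar> * r \<le> e / 3"
    using \<open>e > 0\<close> by (auto simp: r_def field_simps)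
  have cov: "S \<subseteq> (\<Union>x\<in>S. ball x r)" using r(1) by force
  obtain N where N: "N \<subseteq> S" "finite N" "S \<subseteq> (\<Union>x\<in>N. ball x r)"
    by (rule compactE_image[of S S "\<lambda>x. ball x r", OF S open_ball cov])
  have "\<forall>x\<in>N. \<exists>\<delta>>0. \<forall>t\<in>{0..T}. \<forall>s\<in>{0..T}. \<bar>t - s\<bar> < \<delta> \<longrightarrow> (\<forall>u\<in>U. \<forall>v\<in>V. dist (F t x u v) (F s x u v) < e / 3)"
  proof
    fix x
    have "uniformly_continuous_on ({0..T} \<times> U \<times> V) (\<lambda>(t, u, v). F t x u v)"
      by (intro compact_uniformly_continuous cont compact_Times UV compact_Icc)
    moreover have "e / 3 > 0" using \<open>e > 0\<close> by simp
    ultimately obtain \<delta> where \<delta>: "\<delta> > 0" "\<And>p q. p \<in> {0..T} \<times> U \<times> V \<Longrightarrow> q \<in> {0..T} \<times> U \<times> V \<Longrightarrow> dist q p < \<delta> \<Longrightarrow>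
      dist ((\<lambda>(t, u, v). F t x u v) q) ((\<lambda>(t, u, v). F t x u v) p) < e / 3"
      unfolding uniformly_continuous_on_def by meson
    show "\<exists>\<delta>>0. \<forall>t\<in>{0..T}. \<forall>s\<in>{0..T}. \<bar>t - s\<bar> < \<delta> \<longrightarrow> (\<forall>u\<in>U. \<forall>v\<in>V. dist (F t x u v) (F s x u v) < e / 3)"
    proof (intro exI[of _ \<delta>] conjI ballI impI)
      fix t s u v assume "t \<in> {0..T}" "s \<in> {0..T}" "\<bar>t - s\<bar> < \<delta>" "u \<in> U" "v \<in> V"
      then show "dist (F t x u v) (F s x u v) < e / 3"
        using \<delta>(2)[of "(s, u, v)" "(t, u, v)"] by (simp add: dist_Pair_Pair dist_real_def)
    qed (rule \<delta>(1))
  qed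
  then obtain d where d: "\<And>x. x \<in> N \<Longrightarrow> d x > 0" "\<And>x t s u v. x \<in> N \<Longrightarrow> t \<in> {0..T} \<Longrightarrow> s \<in> {0..T} \<Longrightarrow> \<bar>t - s\<bar> < d x \<Longrightarrow>
     u \<in> U \<Longrightarrow> v \<in> V \<Longrightarrow> dist (F t x u v) (F s x u v) < e / 3" by metis
  define \<delta> where "\<delta> = Min (insert 1 (d ` N))"
  have \<delta>: "\<delta> > 0" unfolding \<delta>_def using d(1) N(2) by simp
  have \<delta>_le: "\<delta> \<le> d x" if "x \<in> N" for x unfolding \<delta>_def using that N(2) by simp
  show ?thesis
  proof (intro exI[of _ \<delta>] conjI ballI impI)
    fix t s x u v assume *: "t \<in> {0..T}" "s \<in> {0..T}" "\<bar>t - s\<bar> < \<delta>" "x \<in> S" "u \<in> U" "v \<in> V"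
    obtain x' where x': "x' \<in> N" "dist x' x < r" using subsetD[OF N(3) *(4)] by auto
    have near: "dist (F \<tau> x u v) (F \<tau> x' u v) \<le> e / 3" if "\<tau> \<in> {0..T}" for \<tau>
    proof -
      have "dist (F \<tau> x u v) (F \<tau> x' u v) \<le> L * dist x x'" by (rule lip[OF that *(5,6)])
      also have "\<dots> \<le> \<bar>L\<bar> * r" using x'(2) by (intro mult_mono) (auto simp: dist_commute)
      finally show ?thesis using r(2) by simp
    qed
    have "dist (F t x' u v) (F s x' u v) < e / 3"
      using * x'(1) \<delta>_le[OF x'(1)] by (intro d(2)) auto
    moreover have "dist (F t x u v) (F s x u v) \<le> dist (F t x u v) (F t x' u v) + dist (F t x' u v) (F s x' u v) + dist (F s x u v) (F s x' u v)"
      using dist_triangle[of "F t x u v" "F s x u v" "F t x' u v"] dist_triangle[of "F t x' u v" "F s x u v" "F s x' u v"]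
      by (simp add: dist_commute)
    ultimately show "dist (F t x u v) (F s x u v) \<le> e" using near[OF *(1)] near[OF *(2)] by simp
  qed (rule \<delta>)
qed

text \<open>The standing assumptions in the form used by the estimates: one growth constant
  \<open>K\<close>, one Lipschitz constant \<open>Lc\<close>, and one modulus in time for all
  coefficients on bounded sets. \<open>K\<close> and \<open>Lc\<close> alone determine how large
  \<open>c\<close> must be.\<close>

locale regular_coeffs =
  fixes T :: real and U :: "'u::metric_space set" and V :: "'v::metric_space set"
    and b :: "real \<Rightarrow> real^'n \<Rightarrow> 'u \<Rightarrow> 'v \<Rightarrow> real^'n"
    and \<sigma> :: "real \<Rightarrow> real^'n \<Rightarrow> 'u \<Rightarrow> 'v \<Rightarrow> real^'d^'n"
    and f :: "real \<Rightarrow> real^'n \<Rightarrow> real \<Rightarrow> real^'d \<Rightarrow> 'u \<Rightarrow> 'v \<Rightarrow> real"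
    and K Lc :: real
  assumes ne: "U \<noteq> {}" "V \<noteq> {}" and K: "K \<ge> 1" and Lc: "Lc \<ge> 0"
    and b_growth: "t \<in> {0..T} \<Longrightarrow> u \<in> U \<Longrightarrow> v \<in> V \<Longrightarrow> norm (b t x u v) \<le> K * (1 + norm x)"
    and \<sigma>_growth: "t \<in> {0..T} \<Longrightarrow> u \<in> U \<Longrightarrow> v \<in> V \<Longrightarrow> norm (\<sigma> t x u v) \<le> K * (1 + norm x)"
    and f_growth: "t \<in> {0..T} \<Longrightarrow> u \<in> U \<Longrightarrow> v \<in> V \<Longrightarrow> \<bar>f t x y z u v\<bar> \<le> K * (1 + norm x + \<bar>y\<bar> + norm z)"
    and b_lip: "t \<in> {0..T} \<Longrightarrow> u \<in> U \<Longrightarrow> v \<in> V \<Longrightarrow> norm (b t x u v - b t x' u v) \<le> Lc * norm (x - x')"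
    and \<sigma>_lip: "t \<in> {0..T} \<Longrightarrow> u \<in> U \<Longrightarrow> v \<in> V \<Longrightarrow> norm (\<sigma> t x u v - \<sigma> t x' u v) \<le> Lc * norm (x - x')"
    and f_lip: "t \<in> {0..T} \<Longrightarrow> u \<in> U \<Longrightarrow> v \<in> V \<Longrightarrow>
       \<bar>f t x y z u v - f t x' y' z' u v\<bar> \<le> Lc * (norm (x - x') + \<bar>y - y'\<bar> + norm (z - z'))"
    and modulus: "e > 0 \<Longrightarrow> \<exists>\<delta>>0. \<forall>t\<in>{0..T}. \<forall>s\<in>{0..T}. \<bar>t - s\<bar> < \<delta> \<longrightarrow>
       (\<forall>x y z. norm x \<le> R \<longrightarrow> \<bar>y\<bar> \<le> R \<longrightarrow> norm z \<le> R \<longrightarrow> (\<forall>u\<in>U. \<forall>v\<in>V.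
          norm (b t x u v - b s x u v) \<le> e \<and> norm (\<sigma> t x u v - \<sigma> s x u v) \<le> e \<and>
          \<bar>f t x y z u v - f s x y z u v\<bar> \<le> e))"
begin

lemma integrand_bounded:
  assumes t: "t \<in> {0..T}"
  shows "\<exists>B. \<forall>u\<in>U. \<forall>v\<in>V. \<bar>(1/2) * mtrace ((\<sigma> t x u v ** transpose (\<sigma> t x u v)) ** X)
        + q \<bullet> b t x u v + f t x y (q v* \<sigma> t x u v) u v\<bar> \<le> B"
proof -
  obtain M where M: "M > 0" "\<And>\<xi>. norm (X *v \<xi>) \<le> norm \<xi> * M"
    using bounded_linear.pos_bounded[OF matrix_vector_mul_bounded_linear[of X]] by blast
  define S where "S = K * (1 + norm x)"
  have S: "S \<ge> 0" using K by (simp add: S_def)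
  have "\<bar>(1/2) * mtrace ((\<sigma> t x u v ** transpose (\<sigma> t x u v)) ** X) + q \<bullet> b t x u v + f t x y (q v* \<sigma> t x u v) u v\<bar>
     \<le> M * S\<^sup>2 + norm q * S + K * (1 + norm x + \<bar>y\<bar> + norm q * S)" if u: "u \<in> U" and v: "v \<in> V" for u v
  proof -
    let ?S = "\<sigma> t x u v"
    have nS: "norm ?S \<le> S" using \<sigma>_growth[OF t u v] by (simp add: S_def)
    have "\<bar>mtrace ((?S ** transpose ?S) ** X)\<bar> \<le> (\<Sum>k\<in>UNIV. \<bar>column k ?S \<bullet> (X *v column k ?S)\<bar>)"
      unfolding mtrace_quadratic by (rule sum_abs)
    also have "\<dots> \<le> (\<Sum>k\<in>UNIV. (norm (column k ?S))\<^sup>2 * M)"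
    proof (rule sum_mono)
      fix k
      have "\<bar>column k ?S \<bullet> (X *v column k ?S)\<bar> \<le> norm (column k ?S) * norm (X *v column k ?S)"
        by (rule Cauchy_Schwarz_ineq2)
      also have "\<dots> \<le> norm (column k ?S) * (norm (column k ?S) * M)" by (intro mult_left_mono M) simp
      finally show "\<bar>column k ?S \<bullet> (X *v column k ?S)\<bar> \<le> (norm (column k ?S))\<^sup>2 * M"
        by (simp add: power2_eq_square mult.assoc)
    qed
    also have "\<dots> = (norm ?S)\<^sup>2 * M" by (simp add: sum_norm_column_sq flip: sum_distrib_right)
    also have "\<dots> \<le> S\<^sup>2 * M" using nS M by (intro mult_right_mono power_mono) auto
    finally have 1: "\<bar>mtrace ((?S ** transpose ?S) ** X)\<bar> \<le> M * S\<^sup>2" by (simp add: mult.commute)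
    have "\<bar>q \<bullet> b t x u v\<bar> \<le> norm q * norm (b t x u v)" by (rule Cauchy_Schwarz_ineq2)
    also have "\<dots> \<le> norm q * S" using b_growth[OF t u v] by (intro mult_left_mono) (auto simp: S_def)
    finally have 2: "\<bar>q \<bullet> b t x u v\<bar> \<le> norm q * S" .
    have "norm (q v* ?S) \<le> norm q * S"
      by (rule order_trans[OF norm_vector_matrix_le]) (intro mult_left_mono nS norm_ge_zero)
    then have "K * (1 + norm x + \<bar>y\<bar> + norm (q v* ?S)) \<le> K * (1 + norm x + \<bar>y\<bar> + norm q * S)"
      using K by (intro mult_left_mono) auto
    then have 3: "\<bar>f t x y (q v* ?S) u v\<bar> \<le> K * (1 + norm x + \<bar>y\<bar> + norm q * S)"
      using f_growth[OF t u v] order_trans by blast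
    have gen: "\<bar>(1/2) * m + i + j\<bar> \<le> m' + i' + j'" if "\<bar>m\<bar> \<le> m'" "\<bar>i\<bar> \<le> i'" "\<bar>j\<bar> \<le> j'" for m i j m' i' j' :: real
      using that by linarith
    show ?thesis by (rule gen[OF 1 2 3])
  qed
  then show ?thesis by blast
qed

text \<open>For fixed \<open>u\<close> and \<open>v\<close> the coefficients pass from
  \<open>(t, x)\<close> to \<open>(s, x)\<close> at cost \<open>\<omega>\<close> and then to
  \<open>(s, y)\<close> at cost \<open>Lc * r\<close>. The vectors \<open>e1\<close>,
  \<open>e2\<close> are errors, whereas \<open>g1\<close>, \<open>g2\<close> are barrier gradients,
  which do not become small and are to be absorbed by the barrier. The same quantity bounds the
  drift difference and the difference of the last real-vector arguments of \<open>f\<close>, hence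
  the factor \<open>1 + Lc\<close>.\<close>

lemma Hminus_difference:
  assumes t: "t \<in> {0..T}" and s: "s \<in> {0..T}" and \<alpha>: "\<alpha> \<ge> 0" and \<epsilon>: "\<epsilon> \<ge> 0" and \<omega>: "\<omega> \<ge> 0"
    and quad: "\<And>\<xi> \<zeta>. \<xi> \<bullet> (X *v \<xi>) - \<zeta> \<bullet> (Y *v \<zeta>) \<le> 2 * \<alpha> * (norm (\<xi> - \<zeta>))\<^sup>2 + N1 * (norm \<xi>)\<^sup>2 + N2 * (norm \<zeta>)\<^sup>2"
    and N: "N1 \<ge> 0" "N2 \<ge> 0"
    and q: "q1 = \<alpha> *\<^sub>R (x - y) + e1 + g1" "q2 = \<alpha> *\<^sub>R (x - y) - e2 - g2" and e: "norm e1 \<le> \<epsilon>" "norm e2 \<le> \<epsilon>"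
    and mb: "\<And>u v. u \<in> U \<Longrightarrow> v \<in> V \<Longrightarrow> norm (b t x u v - b s x u v) \<le> \<omega>"
    and m\<sigma>: "\<And>u v. u \<in> U \<Longrightarrow> v \<in> V \<Longrightarrow> norm (\<sigma> t x u v - \<sigma> s x u v) \<le> \<omega>"
    and mf: "\<And>u v. u \<in> U \<Longrightarrow> v \<in> V \<Longrightarrow>
       \<bar>f t x r1 (q1 v* \<sigma> t x u v) u v - f s x r1 (q1 v* \<sigma> t x u v) u v\<bar> \<le> \<omega>"
  defines "r \<equiv> norm (x - y)" and "S1 \<equiv> K * (1 + norm x)" and "S2 \<equiv> K * (1 + norm y)"
  shows "Hminus U V b \<sigma> f t x r1 q1 X \<le> Hminus U V b \<sigma> f s y r2 q2 Y +
    (\<alpha> * (\<omega> + Lc * r)\<^sup>2 + (N1 * S1\<^sup>2 + N2 * S2\<^sup>2) / 2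
     + (1 + Lc) * (\<alpha> * r * (\<omega> + Lc * r) + (\<epsilon> + norm g1) * S1 + (\<epsilon> + norm g2) * S2)
     + \<omega> + Lc * (r + \<bar>r1 - r2\<bar>))"
proof -
  obtain B1 where B1: "\<And>u v. u \<in> U \<Longrightarrow> v \<in> V \<Longrightarrow> \<bar>(1/2) * mtrace ((\<sigma> t x u v ** transpose (\<sigma> t x u v)) ** X)
        + q1 \<bullet> b t x u v + f t x r1 (q1 v* \<sigma> t x u v) u v\<bar> \<le> B1"
    using integrand_bounded[OF t] by blast
  obtain B2 where B2: "\<And>u v. u \<in> U \<Longrightarrow> v \<in> V \<Longrightarrow> \<bar>(1/2) * mtrace ((\<sigma> s y u v ** transpose (\<sigma> s y u v)) ** Y)
        + q2 \<bullet> b s y u v + f s y r2 (q2 v* \<sigma> s y u v) u v\<bar> \<le> B2"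
    using integrand_bounded[OF s] by blast
  have r: "r \<ge> 0" by (simp add: r_def)
  have S: "S1 \<ge> 0" "S2 \<ge> 0" using K by (simp_all add: S1_def S2_def)
  define d where "d = \<omega> + Lc * r"
  have d: "d \<ge> 0" using \<omega> Lc r by (simp add: d_def)
  define w where "w = \<alpha> *\<^sub>R (x - y)"
  have w: "norm w = \<alpha> * r" using \<alpha> by (simp add: w_def r_def)
  define P where "P = \<alpha> * r * d + (\<epsilon> + norm g1) * S1 + (\<epsilon> + norm g2) * S2"
  have n1: "norm (e1 + g1) \<le> \<epsilon> + norm g1" and n2: "norm (e2 + g2) \<le> \<epsilon> + norm g2"
    using norm_triangle_ineq[of e1 g1] norm_triangle_ineq[of e2 g2] e by linarith+
  show ?thesis
    unfolding Hminus_def d_def[symmetric] P_def[symmetric]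
  proof (rule SUP_INF_diff_le[OF ne, where B="max B1 B2"])
    fix u v assume u: "u \<in> U" and v: "v \<in> V"
    show "\<bar>(1/2) * mtrace ((\<sigma> t x u v ** transpose (\<sigma> t x u v)) ** X)
        + q1 \<bullet> b t x u v + f t x r1 (q1 v* \<sigma> t x u v) u v\<bar> \<le> max B1 B2"
      using B1[OF u v] by simp
    show "\<bar>(1/2) * mtrace ((\<sigma> s y u v ** transpose (\<sigma> s y u v)) ** Y)
        + q2 \<bullet> b s y u v + f s y r2 (q2 v* \<sigma> s y u v) u v\<bar> \<le> max B1 B2"
      using B2[OF u v] by simp
    let ?S = "\<sigma> t x u v" and ?S' = "\<sigma> s y u v" and ?b = "b t x u v" and ?b' = "b s y u v"
    have nS: "norm ?S \<le> S1" "norm ?S' \<le> S2" "norm ?b \<le> S1" "norm ?b' \<le> S2"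
      using \<sigma>_growth[OF t u v] \<sigma>_growth[OF s u v] b_growth[OF t u v] b_growth[OF s u v]
      by (simp_all add: S1_def S2_def)
    have db: "norm (?b - ?b') \<le> d"
      using norm_triangle_ineq[of "?b - b s x u v" "b s x u v - ?b'"] mb[OF u v] b_lip[OF s u v, of x y]
      by (simp add: d_def r_def)
    have dS: "norm (?S - ?S') \<le> d"
      using norm_triangle_ineq[of "?S - \<sigma> s x u v" "\<sigma> s x u v - ?S'"] m\<sigma>[OF u v] \<sigma>_lip[OF s u v, of x y]
      by (simp add: d_def r_def)
    have 1: "mtrace ((?S ** transpose ?S) ** X) - mtrace ((?S' ** transpose ?S') ** Y)
       \<le> 2 * (\<alpha> * d\<^sup>2) + N1 * S1\<^sup>2 + N2 * S2\<^sup>2"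
    proof -
      have c: "column k ?S - column k ?S' = column k (?S - ?S')" for k by (simp add: vec_eq_iff column_def)
      have "mtrace ((?S ** transpose ?S) ** X) - mtrace ((?S' ** transpose ?S') ** Y)
        = (\<Sum>k\<in>UNIV. column k ?S \<bullet> (X *v column k ?S) - column k ?S' \<bullet> (Y *v column k ?S'))"
        by (simp add: mtrace_quadratic sum_subtractf)
      also have "\<dots> \<le> (\<Sum>k\<in>UNIV. 2 * \<alpha> * (norm (column k (?S - ?S')))\<^sup>2 + N1 * (norm (column k ?S))\<^sup>2 + N2 * (norm (column k ?S'))\<^sup>2)"
        unfolding c[symmetric] by (intro sum_mono quad)
      also have "\<dots> = 2 * \<alpha> * (norm (?S - ?S'))\<^sup>2 + N1 * (norm ?S)\<^sup>2 + N2 * (norm ?S')\<^sup>2"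
        by (simp add: sum.distrib sum_norm_column_sq flip: sum_distrib_left)
      also have "\<dots> \<le> 2 * \<alpha> * d\<^sup>2 + N1 * S1\<^sup>2 + N2 * S2\<^sup>2"
        using \<alpha> N by (intro add_mono mult_left_mono power_mono dS nS) auto
      finally show ?thesis by simp
    qed
    have ip: "\<bar>g \<bullet> g'\<bar> \<le> m * m'" if "norm g \<le> m" "norm g' \<le> m'" for g g' :: "real^'n" and m m'
    proof -
      have "\<bar>g \<bullet> g'\<bar> \<le> norm g * norm g'" by (rule Cauchy_Schwarz_ineq2)
      also have "\<dots> \<le> m * m'" using that order_trans[OF norm_ge_zero that(1)] by (intro mult_mono) auto
      finally show ?thesis .
    qed
    have 2: "q1 \<bullet> ?b - q2 \<bullet> ?b' \<le> P"
    proof -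
      have "q1 \<bullet> ?b - q2 \<bullet> ?b' = w \<bullet> (?b - ?b') + (e1 + g1) \<bullet> ?b + (e2 + g2) \<bullet> ?b'"
        unfolding q w_def[symmetric] by (simp add: inner_add_left inner_diff_left inner_diff_right)
      moreover have "w \<bullet> (?b - ?b') \<le> \<alpha> * r * d" using ip[OF eq_refl[OF w] db] by linarith
      moreover have "(e1 + g1) \<bullet> ?b \<le> (\<epsilon> + norm g1) * S1" using ip[OF n1 nS(3)] by linarith
      moreover have "(e2 + g2) \<bullet> ?b' \<le> (\<epsilon> + norm g2) * S2" using ip[OF n2 nS(4)] by linarith
      ultimately show ?thesis unfolding P_def by linarith
    qed
    have vm: "norm (g v* M) \<le> m * m'" if "norm g \<le> m" "norm M \<le> m'" for g :: "real^'n" and M :: "real^'d^'n" and m m'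
    proof -
      have "norm (g v* M) \<le> norm g * norm M" by (rule norm_vector_matrix_le)
      also have "\<dots> \<le> m * m'" using that order_trans[OF norm_ge_zero that(1)] by (intro mult_mono) auto
      finally show ?thesis .
    qed
    have z: "norm (q1 v* ?S - q2 v* ?S') \<le> P"
    proof -
      have q2: "q2 = w + (- (e2 + g2))" by (simp add: q w_def)
      have q1: "q1 = w + (e1 + g1)" by (simp add: q w_def)
      have eq: "q1 v* ?S - q2 v* ?S' = w v* (?S - ?S') + (e1 + g1) v* ?S + (e2 + g2) v* ?S'"
        unfolding q1 q2 vector_matrix_linear(1)[of w "e1 + g1"] vector_matrix_linear(1)[of w "- (e2 + g2)"]
          vector_matrix_linear(2) vector_matrix_linear(3) by simp
      have "norm (q1 v* ?S - q2 v* ?S') \<le> norm (w v* (?S - ?S')) + norm ((e1 + g1) v* ?S) + norm ((e2 + g2) v* ?S')"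
        unfolding eq by (rule order_trans[OF norm_triangle_ineq add_right_mono[OF norm_triangle_ineq]])
      also have "\<dots> \<le> P"
        unfolding P_def by (intro add_mono vm eq_refl[OF w] dS n1 n2 nS)
      finally show ?thesis .
    qed
    have 3: "f t x r1 (q1 v* ?S) u v - f s y r2 (q2 v* ?S') u v \<le> \<omega> + Lc * (r + \<bar>r1 - r2\<bar> + P)"
    proof -
      have "\<bar>f s x r1 (q1 v* ?S) u v - f s y r2 (q2 v* ?S') u v\<bar> \<le> Lc * (norm (x - y) + \<bar>r1 - r2\<bar> + norm (q1 v* ?S - q2 v* ?S'))"
        by (rule f_lip[OF s u v])
      also have "\<dots> \<le> Lc * (r + \<bar>r1 - r2\<bar> + P)" using Lc z by (intro mult_left_mono) (auto simp: r_def)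
      finally show ?thesis using mf[OF u v] by linarith
    qed
    have gen: "(1/2) * m1 + i1 + j1 \<le> (1/2) * m2 + i2 + j2 + (A + (C + D) / 2 + (1 + Lc) * P + \<omega> + Lc * R)"
      if "m1 - m2 \<le> 2 * A + C + D" "i1 - i2 \<le> P" "j1 - j2 \<le> \<omega> + Lc * (R + P)" for m1 m2 i1 i2 j1 j2 A C D R :: real
      using that by (simp add: algebra_simps add_divide_distrib)
    show "(1/2) * mtrace ((?S ** transpose ?S) ** X) + q1 \<bullet> ?b + f t x r1 (q1 v* ?S) u v
       \<le> (1/2) * mtrace ((?S' ** transpose ?S') ** Y) + q2 \<bullet> ?b' + f s y r2 (q2 v* ?S') u v
        + (\<alpha> * d\<^sup>2 + (N1 * S1\<^sup>2 + N2 * S2\<^sup>2) / 2 + (1 + Lc) * P + \<omega> + Lc * (r + \<bar>r1 - r2\<bar>))"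
      by (rule gen[OF 1 2 3])
  qed
qed

end

lemma norm_le_of_functional:
  fixes x :: "'a::real_inner"
  assumes "\<And>\<eta>. \<bar>x \<bullet> \<eta>\<bar> \<le> e * norm \<eta>" "e \<ge> 0"
  shows "norm x \<le> e"
proof (cases "x = 0")
  case False
  have "\<bar>x \<bullet> x\<bar> = norm x * norm x" by (simp add: power2_eq_square flip: power2_norm_eq_inner)
  then have "norm x * norm x \<le> e * norm x" using assms(1)[of x] by simp
  then show ?thesis using False by simp
qed (use assms(2) in simp)

text \<open>\<open>2 \<kappa>\<close> is the least factor for which the barrier dominates \<open>u1 - u2\<close> on \<open>C\<close>; half of the barrier
  is subtracted from \<open>u1\<close> and half added to \<open>u2\<close>.\<close>
locale doubling = regular_coeffs T U V b \<sigma> f K Lc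
  for T :: real and U :: "'u::metric_space set" and V :: "'v::metric_space set"
    and b :: "real \<Rightarrow> real^'n \<Rightarrow> 'u \<Rightarrow> 'v \<Rightarrow> real^'n"
    and \<sigma> :: "real \<Rightarrow> real^'n \<Rightarrow> 'u \<Rightarrow> 'v \<Rightarrow> real^'d^'n"
    and f :: "real \<Rightarrow> real^'n \<Rightarrow> real \<Rightarrow> real^'d \<Rightarrow> 'u \<Rightarrow> 'v \<Rightarrow> real"
    and K Lc :: real +
  fixes \<Phi> :: "real^'n \<Rightarrow> real" and h h' u1 u2 :: "real \<Rightarrow> real^'n \<Rightarrow> real"
    and c t0 \<kappa> :: real and C :: "(real \<times> (real^'n)) set" and p0 :: "real \<times> (real^'n)"
  assumes sub: "visc_subsolution T U V b \<sigma> f \<Phi> h h' u1"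
    and super: "visc_supersolution T U V b \<sigma> f \<Phi> h h' u2"
    and C: "compact C" "C \<subseteq> {0..T} \<times> UNIV" and p0: "p0 \<in> C"
    and C_time: "p \<in> C \<Longrightarrow> t0 < fst p" "p \<in> C \<Longrightarrow> 1 \<le> 1 / (c * (fst p - t0))"
    and c: "c > 7 * K\<^sup>2 + 4 * K + 4 * Lc * K + Lc" and \<kappa>: "\<kappa> > 0"
    and below: "p \<in> C \<Longrightarrow> u1 (fst p) (snd p) - u2 (fst p) (snd p) \<le> 2 * \<kappa> * barrier c t0 p"
    and touch: "u1 (fst p0) (snd p0) - u2 (fst p0) (snd p0) = 2 * \<kappa> * barrier c t0 p0"
begin

definition F1 where "F1 p = u1 (fst p) (snd p) - \<kappa> * barrier c t0 p"
definition G1 where "G1 p = - u2 (fst p) (snd p) - \<kappa> * barrier c t0 p"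
text \<open>The quantity \<open>B\<close> of \<open>barrier_jet\<close>: \<open>c * Bf p\<close> is
  the gain from the time derivative of the barrier, and all its spatial derivatives, weighted by the
  growth of the coefficients, are bounded by multiples of \<open>Bf p\<close>.\<close>

definition Bf where "Bf p = (1 / (c * (fst p - t0)))\<^sup>2 * psi (snd p) * barrier c t0 p"
text \<open>Interior relative to the closed time strip. Points at time 0 can qualify, in accordance
  with the viscosity inequalities, which are imposed there too.\<close>

definition relint where "relint p \<longleftrightarrow> (\<exists>\<delta>>0. \<forall>p'. 0 \<le> fst p' \<longrightarrow> fst p' \<le> T \<longrightarrow> dist p' p < \<delta> \<longrightarrow> p' \<in> C)"

lemma c_pos: "c > 0"
proof -
  have "7 * K\<^sup>2 + 4 * K + 4 * Lc * K + Lc \<ge> 0" using K Lc by simp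
  then show ?thesis using c by linarith
qed

lemma barrier_cont: "continuous_on C (barrier c t0)"
  by (rule barrier_continuous[OF c_pos C_time(1)])

lemma Bf_cont: "continuous_on C Bf"
proof -
  have "1 + snd p \<bullet> snd p \<noteq> 0" for p :: "real \<times> (real^'n)"
    using inner_self_plus_one_pos[of "snd p"] by linarith
  then show ?thesis
    unfolding Bf_def psi_def using c_pos
    by (intro continuous_intros barrier_cont) (auto dest: C_time(1))
qed

lemma Bf_pos: "p \<in> C \<Longrightarrow> Bf p > 0"
proof -
  assume p: "p \<in> C"
  have "1 / (c * (fst p - t0)) > 0" using C_time(2)[OF p] by linarith
  then have "(1 / (c * (fst p - t0)))\<^sup>2 > 0" by (rule zero_less_power)
  moreover have "psi (snd p) > 0" using psi_ge(1)[of "snd p"] by linarith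
  ultimately show ?thesis unfolding Bf_def by (simp add: barrier_pos)
qed

lemma F1_usc: "usc_set C F1"
proof -
  have "usc_set C (\<lambda>p. u1 (fst p) (snd p))"
    unfolding usc_set_def
  proof (intro ballI allI impI)
    fix p and e :: real assume "p \<in> C" "e > 0"
    then obtain \<delta> where "\<delta> > 0" "\<And>q. q \<in> {0..T} \<times> UNIV \<Longrightarrow> dist q p < \<delta> \<Longrightarrow> case_prod u1 q < case_prod u1 p + e"
    proof -
      have "usc_on T u1" using sub unfolding visc_subsolution_def by blast
      moreover have "p \<in> {0..T} \<times> UNIV" using C(2) \<open>p \<in> C\<close> by blast
      ultimately show thesis using \<open>e > 0\<close> that unfolding usc_on_def by meson
    qed
    then show "\<exists>\<delta>>0. \<forall>q\<in>C. dist q p < \<delta> \<longrightarrow> u1 (fst q) (snd q) < u1 (fst p) (snd p) + e"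
      using C(2) by (intro exI[of _ \<delta>]) (auto simp: case_prod_beta)
  qed
  moreover have "usc_set C (\<lambda>p. - (\<kappa> * barrier c t0 p))"
    by (intro continuous_imp_usc_set continuous_intros barrier_cont)
  ultimately have "usc_set C (\<lambda>p. u1 (fst p) (snd p) + - (\<kappa> * barrier c t0 p))" by (rule usc_set_add)
  then show ?thesis by (simp add: F1_def[abs_def])
qed

lemma G1_usc: "usc_set C G1"
proof -
  have "usc_set C (\<lambda>p. - u2 (fst p) (snd p))"
    unfolding usc_set_def
  proof (intro ballI allI impI)
    fix p and e :: real assume "p \<in> C" "e > 0"
    then obtain \<delta> where d: "\<delta> > 0" "\<And>q. q \<in> {0..T} \<times> UNIV \<Longrightarrow> dist q p < \<delta> \<Longrightarrow> case_prod u2 p - e < case_prod u2 q"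
    proof -
      have "lsc_on T u2" using super unfolding visc_supersolution_def by blast
      moreover have "p \<in> {0..T} \<times> UNIV" using C(2) \<open>p \<in> C\<close> by blast
      ultimately show thesis using \<open>e > 0\<close> that unfolding lsc_on_def by meson
    qed
    show "\<exists>\<delta>>0. \<forall>q\<in>C. dist q p < \<delta> \<longrightarrow> - u2 (fst q) (snd q) < - u2 (fst p) (snd p) + e"
    proof (intro exI[of _ \<delta>] conjI ballI impI)
      fix q assume "q \<in> C" "dist q p < \<delta>"
      then show "- u2 (fst q) (snd q) < - u2 (fst p) (snd p) + e"
        using d(2)[of q] C(2) by (auto simp: case_prod_beta)
    qed (rule d(1))
  qed
  moreover have "usc_set C (\<lambda>p. - (\<kappa> * barrier c t0 p))"
    by (intro continuous_imp_usc_set continuous_intros barrier_cont)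
  ultimately have "usc_set C (\<lambda>p. - u2 (fst p) (snd p) + - (\<kappa> * barrier c t0 p))" by (rule usc_set_add)
  then show ?thesis by (simp add: G1_def[abs_def])
qed

text \<open>Its squared norm is the penalty with weight \<open>\<beta>\<close> on time and
  \<open>\<alpha>\<close> on space.\<close>

definition Lin :: "real \<Rightarrow> real \<Rightarrow> real \<times> (real^'n) \<Rightarrow> real \<times> (real^'n)" where
  "Lin \<beta> \<alpha> p = (sqrt \<beta> * fst p, sqrt \<alpha> *\<^sub>R snd p)"

lemma linear_Lin: "linear (Lin \<beta> \<alpha>)"
  by (rule linearI) (simp_all add: Lin_def algebra_simps)

lemma Lin_inner: "\<beta> \<ge> 0 \<Longrightarrow> \<alpha> \<ge> 0 \<Longrightarrow> Lin \<beta> \<alpha> p \<bullet> Lin \<beta> \<alpha> q = \<beta> * (fst p * fst q) + \<alpha> * (snd p \<bullet> snd q)"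
  by (simp add: Lin_def inner_prod_def mult.assoc[symmetric] real_sqrt_mult_self abs_of_nonneg)

lemma Lin_norm: "\<beta> \<ge> 0 \<Longrightarrow> \<alpha> \<ge> 0 \<Longrightarrow> (norm (Lin \<beta> \<alpha> p))\<^sup>2 = \<beta> * (fst p)\<^sup>2 + \<alpha> * (norm (snd p))\<^sup>2"
  by (simp add: power2_norm_eq_inner Lin_inner) (simp add: power2_eq_square)

text \<open>Adding \<open>\<kappa>\<close> times the jet of the barrier to the jets of
  \<open>F1\<close> and \<open>G1\<close> gives jets of \<open>u1\<close> and \<open>- u2\<close>;
  where neither obstacle is active, the two equations are subtracted. The hypothesis
  \<open>mod\<close> quantifies over \<open>g\<close> because the actual deviation of the slope from
  \<open>\<alpha> *\<^sub>R (snd p - snd q)\<close> depends on barrier and jet, of which only the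
  size is known beforehand.\<close>

lemma jet_inequality:
  fixes p q a b' :: "real \<times> (real^'n)"
  assumes p: "p \<in> C" "relint p" "fst p < T" and q: "q \<in> C" "relint q" "fst q < T"
    and \<alpha>: "\<alpha> \<ge> 0" "\<beta> \<ge> 0" and \<epsilon>: "\<epsilon> > 0" and \<omega>: "\<omega> \<ge> 0"
    and X: "linear X" and Y: "linear Y"
    and a: "\<And>\<eta>. \<bar>a \<bullet> \<eta> - Lin \<beta> \<alpha> (p - q) \<bullet> Lin \<beta> \<alpha> \<eta>\<bar> \<le> \<epsilon> * norm \<eta>"
    and b': "\<And>\<eta>. \<bar>b' \<bullet> \<eta> + Lin \<beta> \<alpha> (p - q) \<bullet> Lin \<beta> \<alpha> \<eta>\<bar> \<le> \<epsilon> * norm \<eta>"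
    and XY: "\<And>\<xi> \<zeta>. \<xi> \<bullet> X \<xi> + \<zeta> \<bullet> Y \<zeta> \<le> 2 * (norm (Lin \<beta> \<alpha> (\<xi> - \<zeta>)))\<^sup>2 + \<epsilon> * ((norm \<xi>)\<^sup>2 + (norm \<zeta>)\<^sup>2)"
    and tp: "\<exists>\<delta>>0. \<forall>p'\<in>C. dist p' p < \<delta> \<longrightarrow> F1 p' \<le> F1 p + a \<bullet> (p' - p) + ((p' - p) \<bullet> X (p' - p)) / 2"
    and tq: "\<exists>\<delta>>0. \<forall>q'\<in>C. dist q' q < \<delta> \<longrightarrow> G1 q' \<le> G1 q + b' \<bullet> (q' - q) + ((q' - q) \<bullet> Y (q' - q)) / 2"
    and mod: "\<And>g u v. norm g \<le> \<epsilon> + 2 * \<kappa> * Bf p \<Longrightarrow> u \<in> U \<Longrightarrow> v \<in> V \<Longrightarrow>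
      norm (b (fst p) (snd p) u v - b (fst q) (snd p) u v) \<le> \<omega> \<and>
      norm (\<sigma> (fst p) (snd p) u v - \<sigma> (fst q) (snd p) u v) \<le> \<omega> \<and>
      \<bar>f (fst p) (snd p) (u1 (fst p) (snd p)) ((\<alpha> *\<^sub>R (snd p - snd q) + g) v* \<sigma> (fst p) (snd p) u v) u v
       - f (fst q) (snd p) (u1 (fst p) (snd p)) ((\<alpha> *\<^sub>R (snd p - snd q) + g) v* \<sigma> (fst p) (snd p) u v) u v\<bar> \<le> \<omega>"
  defines "r \<equiv> norm (snd p - snd q)" and "S1 \<equiv> K * (1 + norm (snd p))" and "S2 \<equiv> K * (1 + norm (snd q))"
    and "v1 \<equiv> u1 (fst p) (snd p)" and "v2 \<equiv> u2 (fst q) (snd q)"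
  shows "v2 \<ge> h (fst q) (snd q) \<and> (v1 \<le> h (fst p) (snd p) \<or> (v1 \<le> h' (fst p) (snd p) \<and> (v2 \<ge> h' (fst q) (snd q) \<or>
     \<kappa> * (c - (7 * K\<^sup>2 + 4 * K + 4 * Lc * K)) * (Bf p + Bf q) \<le> Lc * \<bar>v1 - v2\<bar> +
       (2 * \<epsilon> + \<alpha> * (\<omega> + Lc * r)\<^sup>2 + \<epsilon> * (S1\<^sup>2 + S2\<^sup>2) + (1 + Lc) * (\<alpha> * r * (\<omega> + Lc * r) + \<epsilon> * (S1 + S2)) + \<omega> + Lc * r))))"
proof -
  obtain t x where p_eq: "p = (t, x)" by (cases p)
  obtain s y where q_eq: "q = (s, y)" by (cases q)
  have ts: "t \<in> {0..T}" "s \<in> {0..T}" "t < T" "s < T" using p q C(2) by (auto simp: p_eq q_eq)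
  obtain gx n \<nu> \<delta>p where gp: "\<delta>p > 0" "\<nu> \<ge> 0" "norm gx * sqrt (1 + x \<bullet> x) \<le> 2 * Bf p" "n \<ge> 0" "n * (1 + x \<bullet> x) = 7 * Bf p"
    "\<And>z. norm z < \<delta>p \<Longrightarrow> barrier c t0 ((t, x) + z) \<le> barrier c t0 (t, x) - c * Bf p * fst z + gx \<bullet> snd z
       + (n * (norm (snd z))\<^sup>2 + \<nu> * (fst z)\<^sup>2) / 2"
    using barrier_jet[OF c_pos, of t0 t x] C_time[OF p(1)] unfolding Bf_def p_eq by auto
  obtain gy n' \<nu>' \<delta>q where gq: "\<delta>q > 0" "\<nu>' \<ge> 0" "norm gy * sqrt (1 + y \<bullet> y) \<le> 2 * Bf q" "n' \<ge> 0" "n' * (1 + y \<bullet> y) = 7 * Bf q"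
    "\<And>z. norm z < \<delta>q \<Longrightarrow> barrier c t0 ((s, y) + z) \<le> barrier c t0 (s, y) - c * Bf q * fst z + gy \<bullet> snd z
       + (n' * (norm (snd z))\<^sup>2 + \<nu>' * (fst z)\<^sup>2) / 2"
    using barrier_jet[OF c_pos, of t0 s y] C_time[OF q(1)] unfolding Bf_def q_eq by auto
  define a1 where "a1 = a + \<kappa> *\<^sub>R (- c * Bf p, gx)"
  define b1 where "b1 = b' + \<kappa> *\<^sub>R (- c * Bf q, gy)"
  define X1 where "X1 z = X z + \<kappa> *\<^sub>R (\<nu> * fst z, n *\<^sub>R snd z)" for z
  define Y1 where "Y1 z = Y z + \<kappa> *\<^sub>R (\<nu>' * fst z, n' *\<^sub>R snd z)" for z
  have lin: "linear (\<lambda>z::real \<times> (real^'n). (l * fst z, k *\<^sub>R snd z))" for l k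
    by (rule linearI) (simp_all add: algebra_simps)
  have X1: "linear X1" and Y1: "linear Y1"
    unfolding X1_def Y1_def by (intro linear_compose_add X Y linear_compose_scale_right lin)+
  obtain \<delta>1 where \<delta>1: "\<delta>1 > 0" "\<And>p'. p' \<in> C \<Longrightarrow> dist p' p < \<delta>1 \<Longrightarrow> F1 p' \<le> F1 p + a \<bullet> (p' - p) + ((p' - p) \<bullet> X (p' - p)) / 2"
    using tp by blast
  obtain \<delta>2 where \<delta>2: "\<delta>2 > 0" "\<And>p'. 0 \<le> fst p' \<Longrightarrow> fst p' \<le> T \<Longrightarrow> dist p' p < \<delta>2 \<Longrightarrow> p' \<in> C"
    using p(2) unfolding relint_def by blast
  obtain \<delta>3 where \<delta>3: "\<delta>3 > 0" "\<And>q'. q' \<in> C \<Longrightarrow> dist q' q < \<delta>3 \<Longrightarrow> G1 q' \<le> G1 q + b' \<bullet> (q' - q) + ((q' - q) \<bullet> Y (q' - q)) / 2"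
    using tq by blast
  obtain \<delta>4 where \<delta>4: "\<delta>4 > 0" "\<And>q'. 0 \<le> fst q' \<Longrightarrow> fst q' \<le> T \<Longrightarrow> dist q' q < \<delta>4 \<Longrightarrow> q' \<in> C"
    using q(2) unfolding relint_def by blast
  have X1_quad: "z \<bullet> X1 z = z \<bullet> X z + \<kappa> * (n * (norm (snd z))\<^sup>2 + \<nu> * (fst z)\<^sup>2)" for z
    unfolding X1_def inner_add_right by (simp add: inner_prod_def power2_norm_eq_inner) (simp add: power2_eq_square algebra_simps)
  have Y1_quad: "z \<bullet> Y1 z = z \<bullet> Y z + \<kappa> * (n' * (norm (snd z))\<^sup>2 + \<nu>' * (fst z)\<^sup>2)" for z
    unfolding Y1_def inner_add_right by (simp add: inner_prod_def power2_norm_eq_inner) (simp add: power2_eq_square algebra_simps)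
  have a1_in: "a1 \<bullet> z = a \<bullet> z + \<kappa> * (- c * Bf p * fst z + gx \<bullet> snd z)" for z
    unfolding a1_def inner_add_left by (simp add: inner_prod_def algebra_simps)
  have b1_in: "b1 \<bullet> z = b' \<bullet> z + \<kappa> * (- c * Bf q * fst z + gy \<bullet> snd z)" for z
    unfolding b1_def inner_add_left by (simp add: inner_prod_def algebra_simps)
  have "\<exists>HX. (\<forall>\<xi>. \<xi> \<bullet> (HX *v \<xi>) = (0, \<xi>) \<bullet> X1 (0, \<xi>) + \<epsilon> * (norm \<xi>)\<^sup>2) \<and>
    min (u1 t x - h t x) (max (- fst a1 - Hminus U V b \<sigma> f t x (u1 t x) (snd a1) HX) (u1 t x - h' t x)) \<le> 0"
  proof (rule subsolution_jet[OF sub _ ts(3) X1 \<epsilon>, where \<delta>="min \<delta>1 (min \<delta>2 \<delta>p)"])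
    fix s' y' assume *: "0 \<le> s'" "s' \<le> T" "dist (s', y') (t, x) < min \<delta>1 (min \<delta>2 \<delta>p)"
    let ?z = "(s', y') - (t, x)"
    have "(s', y') \<in> C" using * by (intro \<delta>2(2)) (auto simp: p_eq)
    then have "F1 (s', y') \<le> F1 p + a \<bullet> ?z + (?z \<bullet> X ?z) / 2" using \<delta>1(2)[of "(s', y')"] * by (simp add: p_eq)
    then have "u1 s' y' \<le> u1 t x - \<kappa> * barrier c t0 (t, x) + \<kappa> * barrier c t0 (s', y') + a \<bullet> ?z + (?z \<bullet> X ?z) / 2"
      by (simp add: F1_def p_eq)
    moreover have "\<kappa> * barrier c t0 (s', y') \<le> \<kappa> * (barrier c t0 (t, x) - c * Bf p * fst ?z + gx \<bullet> snd ?z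
       + (n * (norm (snd ?z))\<^sup>2 + \<nu> * (fst ?z)\<^sup>2) / 2)"
    proof (rule mult_left_mono)
      have "norm ?z < \<delta>p" using * by (simp only: dist_norm)
      from gp(6)[OF this] show "barrier c t0 (s', y') \<le> barrier c t0 (t, x) - c * Bf p * fst ?z + gx \<bullet> snd ?z
       + (n * (norm (snd ?z))\<^sup>2 + \<nu> * (fst ?z)\<^sup>2) / 2" by simp
    qed (use \<kappa> in simp)
    ultimately show "u1 s' y' \<le> u1 t x + a1 \<bullet> ?z + (?z \<bullet> X1 ?z) / 2"
      unfolding a1_in X1_quad by (simp add: algebra_simps add_divide_distrib)
  qed (use ts \<delta>1 \<delta>2 gp in auto)
  then obtain HX where HX: "\<And>\<xi>. \<xi> \<bullet> (HX *v \<xi>) = (0, \<xi>) \<bullet> X1 (0, \<xi>) + \<epsilon> * (norm \<xi>)\<^sup>2"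
    "min (v1 - h t x) (max (- fst a1 - Hminus U V b \<sigma> f t x v1 (snd a1) HX) (v1 - h' t x)) \<le> 0"
    unfolding v1_def p_eq by auto
  have "\<exists>HY. (\<forall>\<xi>. \<xi> \<bullet> (HY *v \<xi>) = - ((0, \<xi>) \<bullet> Y1 (0, \<xi>)) - \<epsilon> * (norm \<xi>)\<^sup>2) \<and>
    min (u2 s y - h s y) (max (fst b1 - Hminus U V b \<sigma> f s y (u2 s y) (- snd b1) HY) (u2 s y - h' s y)) \<ge> 0"
  proof (rule supersolution_jet[OF super _ ts(4) Y1 \<epsilon>, where \<delta>="min \<delta>3 (min \<delta>4 \<delta>q)"])
    fix s' y' assume *: "0 \<le> s'" "s' \<le> T" "dist (s', y') (s, y) < min \<delta>3 (min \<delta>4 \<delta>q)"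
    let ?z = "(s', y') - (s, y)"
    have "(s', y') \<in> C" using * by (intro \<delta>4(2)) (auto simp: q_eq)
    then have "G1 (s', y') \<le> G1 q + b' \<bullet> ?z + (?z \<bullet> Y ?z) / 2" using \<delta>3(2)[of "(s', y')"] * by (simp add: q_eq)
    then have "- u2 s' y' \<le> - u2 s y - \<kappa> * barrier c t0 (s, y) + \<kappa> * barrier c t0 (s', y') + b' \<bullet> ?z + (?z \<bullet> Y ?z) / 2"
      by (simp add: G1_def q_eq)
    moreover have "\<kappa> * barrier c t0 (s', y') \<le> \<kappa> * (barrier c t0 (s, y) - c * Bf q * fst ?z + gy \<bullet> snd ?z
       + (n' * (norm (snd ?z))\<^sup>2 + \<nu>' * (fst ?z)\<^sup>2) / 2)"
    proof (rule mult_left_mono)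
      have "norm ?z < \<delta>q" using * by (simp only: dist_norm)
      from gq(6)[OF this] show "barrier c t0 (s', y') \<le> barrier c t0 (s, y) - c * Bf q * fst ?z + gy \<bullet> snd ?z
       + (n' * (norm (snd ?z))\<^sup>2 + \<nu>' * (fst ?z)\<^sup>2) / 2" by simp
    qed (use \<kappa> in simp)
    ultimately show "u2 s' y' \<ge> u2 s y - b1 \<bullet> ?z - (?z \<bullet> Y1 ?z) / 2"
      unfolding b1_in Y1_quad by (simp add: algebra_simps add_divide_distrib)
  qed (use ts \<delta>3 \<delta>4 gq in auto)
  then obtain HY where HY: "\<And>\<xi>. \<xi> \<bullet> (HY *v \<xi>) = - ((0, \<xi>) \<bullet> Y1 (0, \<xi>)) - \<epsilon> * (norm \<xi>)\<^sup>2"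
    "min (v2 - h s y) (max (fst b1 - Hminus U V b \<sigma> f s y v2 (- snd b1) HY) (v2 - h' s y)) \<ge> 0"
    unfolding v2_def q_eq by auto
  have main: "\<kappa> * (c - (7 * K\<^sup>2 + 4 * K + 4 * Lc * K)) * (Bf p + Bf q) \<le> Lc * \<bar>v1 - v2\<bar> +
       (2 * \<epsilon> + \<alpha> * (\<omega> + Lc * r)\<^sup>2 + \<epsilon> * (S1\<^sup>2 + S2\<^sup>2) + (1 + Lc) * (\<alpha> * r * (\<omega> + Lc * r) + \<epsilon> * (S1 + S2)) + \<omega> + Lc * r)"
    if "- fst a1 - Hminus U V b \<sigma> f t x v1 (snd a1) HX \<le> 0" "fst b1 - Hminus U V b \<sigma> f s y v2 (- snd b1) HY \<ge> 0"
  proof -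
    define w where "w = \<alpha> *\<^sub>R (x - y)"
    define e1 where "e1 = snd a - w"
    define e2 where "e2 = snd b' + w"
    have ne1: "norm e1 \<le> \<epsilon>"
    proof (rule norm_le_of_functional)
      fix \<eta> show "\<bar>e1 \<bullet> \<eta>\<bar> \<le> \<epsilon> * norm \<eta>"
      proof -
        have "a \<bullet> (0, \<eta>) = snd a \<bullet> \<eta>" by (simp add: inner_prod_def)
        then show ?thesis
          using a[of "(0, \<eta>)"] unfolding Lin_inner[OF \<alpha>(2,1)]
          by (simp add: p_eq q_eq e1_def w_def inner_diff_left norm_Pair)
      qed
    qed (use \<epsilon> in simp)
    have ne2: "norm e2 \<le> \<epsilon>"
    proof (rule norm_le_of_functional)
      fix \<eta> show "\<bar>e2 \<bullet> \<eta>\<bar> \<le> \<epsilon> * norm \<eta>"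
      proof -
        have "b' \<bullet> (0, \<eta>) = snd b' \<bullet> \<eta>" by (simp add: inner_prod_def)
        then show ?thesis
          using b'[of "(0, \<eta>)"] unfolding Lin_inner[OF \<alpha>(2,1)]
          by (simp add: p_eq q_eq e2_def w_def inner_diff_left inner_add_left norm_Pair)
      qed
    qed (use \<epsilon> in simp)
    have ft: "\<bar>fst a + fst b'\<bar> \<le> 2 * \<epsilon>"
      using a[of "(1, 0)"] b'[of "(1, 0)"] by (simp add: inner_prod_def norm_Pair abs_le_iff)
    have mx: "1 \<le> sqrt (1 + x \<bullet> x)" "norm x \<le> sqrt (1 + x \<bullet> x)" for x :: "real^'n"
      by (simp, rule real_le_rsqrt) (simp add: power2_norm_eq_inner)
    \<comment> \<open>This and \<open>nS\<close> are the origin of the constants in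
      \<open>c\<close>: \<open>1 + norm x\<close> is at most
      \<open>2 * sqrt (1 + x \<bullet> x)\<close> and its square at most
      \<open>2 * (1 + x \<bullet> x)\<close>, which turns the weighted bounds of
      \<open>barrier_jet\<close> into \<open>4 * K * B\<close> and \<open>14 * K^2 * B\<close>. The
      factor 1/2 in front of the trace halves the latter.\<close>
    have gS: "norm g * (K * (1 + norm x)) \<le> 4 * K * B" if "norm g * sqrt (1 + x \<bullet> x) \<le> 2 * B" for g x :: "real^'n" and B
    proof -
      have "1 + norm x \<le> 2 * sqrt (1 + x \<bullet> x)" using mx(1)[of x] mx(2)[of x] by linarith
      then have s: "norm g * (1 + norm x) \<le> norm g * (2 * sqrt (1 + x \<bullet> x))" by (rule mult_left_mono) simp
      have "norm g * (K * (1 + norm x)) = K * (norm g * (1 + norm x))" by simp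
      also have "\<dots> \<le> K * (norm g * (2 * sqrt (1 + x \<bullet> x)))"
        by (rule mult_left_mono[OF s]) (use K in simp)
      also have "\<dots> \<le> K * (2 * (2 * B))" using that K by (intro mult_left_mono) auto
      finally show ?thesis by simp
    qed
    have nS: "k * (K * (1 + norm x))\<^sup>2 \<le> 14 * K\<^sup>2 * B" if "k * (1 + x \<bullet> x) = 7 * B" "k \<ge> 0" for k x and B
    proof -
      have "(1 + norm x)\<^sup>2 \<le> 2 * (1 + x \<bullet> x)"
        using sum_squares_bound[of 1 "norm x"] by (simp add: power2_sum power2_norm_eq_inner[symmetric])
      then have "k * K\<^sup>2 * (1 + norm x)\<^sup>2 \<le> k * K\<^sup>2 * (2 * (1 + x \<bullet> x))" using that(2) by (intro mult_left_mono) auto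
      also have "\<dots> = 2 * K\<^sup>2 * (k * (1 + x \<bullet> x))" by simp
      finally show ?thesis unfolding that(1) by (simp add: power_mult_distrib mult_ac)
    qed
    have q1: "snd a1 = \<alpha> *\<^sub>R (x - y) + e1 + \<kappa> *\<^sub>R gx" by (simp add: a1_def e1_def w_def)
    have q2: "- snd b1 = \<alpha> *\<^sub>R (x - y) - e2 - \<kappa> *\<^sub>R gy" by (simp add: b1_def e2_def w_def)
    have Bpos: "Bf p > 0" "Bf q > 0" using Bf_pos p q by auto
    have gx_le: "norm gx \<le> 2 * Bf p"
    proof -
      have "norm gx * 1 \<le> norm gx * sqrt (1 + x \<bullet> x)" by (intro mult_left_mono mx) simp
      then show ?thesis using gp(3) by simp
    qed
    have "norm (e1 + \<kappa> *\<^sub>R gx) \<le> norm e1 + norm (\<kappa> *\<^sub>R gx)" by (rule norm_triangle_ineq)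
    also have "\<dots> \<le> \<epsilon> + \<kappa> * (2 * Bf p)" using ne1 gx_le \<kappa> by (intro add_mono) auto
    finally have mod': "norm (b t x u v - b s x u v) \<le> \<omega> \<and> norm (\<sigma> t x u v - \<sigma> s x u v) \<le> \<omega> \<and>
      \<bar>f t x v1 (snd a1 v* \<sigma> t x u v) u v - f s x v1 (snd a1 v* \<sigma> t x u v) u v\<bar> \<le> \<omega>" if "u \<in> U" "v \<in> V" for u v
      using mod[of "e1 + \<kappa> *\<^sub>R gx", OF _ that] unfolding q1 v1_def p_eq q_eq by (simp add: add.assoc mult_ac)
    have "Hminus U V b \<sigma> f t x v1 (snd a1) HX \<le> Hminus U V b \<sigma> f s y v2 (- snd b1) HY +
      (\<alpha> * (\<omega> + Lc * norm (x - y))\<^sup>2 + ((2 * \<epsilon> + \<kappa> * n) * (K * (1 + norm x))\<^sup>2 + (2 * \<epsilon> + \<kappa> * n') * (K * (1 + norm y))\<^sup>2) / 2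
       + (1 + Lc) * (\<alpha> * norm (x - y) * (\<omega> + Lc * norm (x - y)) + (\<epsilon> + norm (\<kappa> *\<^sub>R gx)) * (K * (1 + norm x))
           + (\<epsilon> + norm (\<kappa> *\<^sub>R gy)) * (K * (1 + norm y)))
       + \<omega> + Lc * (norm (x - y) + \<bar>v1 - v2\<bar>))"
    proof (rule Hminus_difference[OF ts(1,2) \<alpha>(1) _ \<omega> _ _ _ q1 q2 ne1 ne2])
      fix \<xi> \<zeta> :: "real^'n"
      have "(0, \<xi>) \<bullet> X (0, \<xi>) + (0, \<zeta>) \<bullet> Y (0, \<zeta>) \<le> 2 * \<alpha> * (norm (\<xi> - \<zeta>))\<^sup>2 + \<epsilon> * ((norm \<xi>)\<^sup>2 + (norm \<zeta>)\<^sup>2)"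
        using XY[of "(0, \<xi>)" "(0, \<zeta>)"] \<alpha> by (simp add: Lin_norm norm_Pair)
      then show "\<xi> \<bullet> (HX *v \<xi>) - \<zeta> \<bullet> (HY *v \<zeta>)
         \<le> 2 * \<alpha> * (norm (\<xi> - \<zeta>))\<^sup>2 + (2 * \<epsilon> + \<kappa> * n) * (norm \<xi>)\<^sup>2 + (2 * \<epsilon> + \<kappa> * n') * (norm \<zeta>)\<^sup>2"
        unfolding HX(1) HY(1) X1_quad Y1_quad by (simp add: algebra_simps)
    qed (use mod' \<epsilon> \<kappa> gp gq in auto)
    then have H: "Hminus U V b \<sigma> f t x v1 (snd a1) HX \<le> Hminus U V b \<sigma> f s y v2 (- snd b1) HY +
      (\<alpha> * (\<omega> + Lc * r)\<^sup>2 + ((2 * \<epsilon> + \<kappa> * n) * S1\<^sup>2 + (2 * \<epsilon> + \<kappa> * n') * S2\<^sup>2) / 2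
       + (1 + Lc) * (\<alpha> * r * (\<omega> + Lc * r) + (\<epsilon> + norm (\<kappa> *\<^sub>R gx)) * S1 + (\<epsilon> + norm (\<kappa> *\<^sub>R gy)) * S2)
       + \<omega> + Lc * (r + \<bar>v1 - v2\<bar>))"
      by (simp add: r_def S1_def S2_def p_eq q_eq)
    have n1: "\<kappa> * (n * S1\<^sup>2) \<le> \<kappa> * (14 * K\<^sup>2 * Bf p)" and n2: "\<kappa> * (n' * S2\<^sup>2) \<le> \<kappa> * (14 * K\<^sup>2 * Bf q)"
      using nS[OF gp(5,4)] nS[OF gq(5,4)] \<kappa> by (simp_all add: S1_def S2_def p_eq q_eq)
    have m1: "(1 + Lc) * (\<kappa> * (norm gx * S1)) \<le> (1 + Lc) * (\<kappa> * (4 * K * Bf p))"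
      and m2: "(1 + Lc) * (\<kappa> * (norm gy * S2)) \<le> (1 + Lc) * (\<kappa> * (4 * K * Bf q))"
      using gS[OF gp(3)] gS[OF gq(3)] \<kappa> Lc by (simp_all add: S1_def S2_def p_eq q_eq mult_left_mono)
    have fa: "fst a1 = fst a - \<kappa> * (c * Bf p)" and fb: "fst b1 = fst b' - \<kappa> * (c * Bf q)"
      by (simp_all add: a1_def b1_def)
    \<comment> \<open>The time slopes of the penalty are opposite at the two points and cancel up to
      \<open>2 * \<epsilon>\<close>; what remains is the decay of the two halves of the
      barrier.\<close>
    have "\<kappa> * (c * Bf p) + \<kappa> * (c * Bf q) - 2 * \<epsilon> \<le> - fst a1 - fst b1" using ft unfolding fa fb by (simp add: abs_le_iff)
    also have "\<dots> \<le> Hminus U V b \<sigma> f t x v1 (snd a1) HX - Hminus U V b \<sigma> f s y v2 (- snd b1) HY" using that by simp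
    also have "\<dots> \<le> \<alpha> * (\<omega> + Lc * r)\<^sup>2 + ((2 * \<epsilon> + \<kappa> * n) * S1\<^sup>2 + (2 * \<epsilon> + \<kappa> * n') * S2\<^sup>2) / 2
       + (1 + Lc) * (\<alpha> * r * (\<omega> + Lc * r) + (\<epsilon> + norm (\<kappa> *\<^sub>R gx)) * S1 + (\<epsilon> + norm (\<kappa> *\<^sub>R gy)) * S2)
       + \<omega> + Lc * (r + \<bar>v1 - v2\<bar>)" using H by simp
    also have "\<dots> = \<alpha> * (\<omega> + Lc * r)\<^sup>2 + \<epsilon> * (S1\<^sup>2 + S2\<^sup>2) + (\<kappa> * (n * S1\<^sup>2) + \<kappa> * (n' * S2\<^sup>2)) / 2
       + (1 + Lc) * (\<alpha> * r * (\<omega> + Lc * r) + \<epsilon> * (S1 + S2)) + (1 + Lc) * (\<kappa> * (norm gx * S1)) + (1 + Lc) * (\<kappa> * (norm gy * S2))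
       + \<omega> + Lc * r + Lc * \<bar>v1 - v2\<bar>" using \<kappa> by (simp add: algebra_simps add_divide_distrib)
    also have "\<dots> \<le> \<alpha> * (\<omega> + Lc * r)\<^sup>2 + \<epsilon> * (S1\<^sup>2 + S2\<^sup>2) + (\<kappa> * (14 * K\<^sup>2 * Bf p) + \<kappa> * (14 * K\<^sup>2 * Bf q)) / 2
       + (1 + Lc) * (\<alpha> * r * (\<omega> + Lc * r) + \<epsilon> * (S1 + S2)) + (1 + Lc) * (\<kappa> * (4 * K * Bf p)) + (1 + Lc) * (\<kappa> * (4 * K * Bf q))
       + \<omega> + Lc * r + Lc * \<bar>v1 - v2\<bar>"
      by (intro add_mono n1 n2 m1 m2 order_refl divide_right_mono) simp
    also have "(\<kappa> * (14 * K\<^sup>2 * Bf p) + \<kappa> * (14 * K\<^sup>2 * Bf q)) / 2 = \<kappa> * (7 * K\<^sup>2 * Bf p) + \<kappa> * (7 * K\<^sup>2 * Bf q)"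
      by simp
    finally show ?thesis by (simp add: algebra_simps)
  qed
  have "v2 \<ge> h s y" using HY(2) by simp
  moreover have "v1 \<le> h t x \<or> (v1 \<le> h' t x \<and> - fst a1 - Hminus U V b \<sigma> f t x v1 (snd a1) HX \<le> 0)"
    using HX(2) by (simp only: min_le_iff_disj max.bounded_iff) auto
  moreover have "v2 \<ge> h' s y \<or> fst b1 - Hminus U V b \<sigma> f s y v2 (- snd b1) HY \<ge> 0"
    using HY(2) by (simp only: min.bounded_iff le_max_iff_disj) auto
  ultimately show ?thesis using main unfolding p_eq q_eq fst_conv snd_conv by blast
qed

text \<open>The coefficients are merely continuous in time, without a rate, so the time penalisation \<open>\<beta>\<close>
  is chosen after the space penalisation \<open>\<alpha>\<close>.\<close>
lemma doubling_step:
  "\<exists>Q\<ge>0. \<forall>\<epsilon>. 0 < \<epsilon> \<longrightarrow> \<epsilon> \<le> 1 \<longrightarrow> (\<exists>p\<in>C. \<exists>q\<in>C. F1 p + G1 q \<ge> - \<epsilon> \<and> dist p q \<le> \<epsilon> \<and>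
    (relint p \<longrightarrow> fst p < T \<longrightarrow> relint q \<longrightarrow> fst q < T \<longrightarrow>
      u2 (fst q) (snd q) \<ge> h (fst q) (snd q) \<and> (u1 (fst p) (snd p) \<le> h (fst p) (snd p) \<or>
       (u1 (fst p) (snd p) \<le> h' (fst p) (snd p) \<and> (u2 (fst q) (snd q) \<ge> h' (fst q) (snd q) \<or>
        \<kappa> * (c - (7 * K\<^sup>2 + 4 * K + 4 * Lc * K)) * (Bf p + Bf q)
          \<le> Lc * \<bar>u1 (fst p) (snd p) - u2 (fst q) (snd q)\<bar> + Q * (\<epsilon> + (F1 p + G1 q + \<epsilon>)))))))"
proof -
  have Cne: "C \<noteq> {}" using p0 by auto
  obtain pm where "pm \<in> C" "\<And>p. p \<in> C \<Longrightarrow> F1 p \<le> F1 pm" using usc_set_attains_sup[OF C(1) Cne F1_usc] by blast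
  then obtain MF where MF: "\<And>p. p \<in> C \<Longrightarrow> F1 p \<le> MF" by blast
  obtain qm where "qm \<in> C" "\<And>p. p \<in> C \<Longrightarrow> G1 p \<le> G1 qm" using usc_set_attains_sup[OF C(1) Cne G1_usc] by blast
  then obtain MG where MG: "\<And>p. p \<in> C \<Longrightarrow> G1 p \<le> MG" by blast
  obtain R where R: "\<And>p. p \<in> C \<Longrightarrow> norm p \<le> R"
    using compact_imp_bounded[OF C(1)] by (auto simp: bounded_iff)
  have nsnd: "norm (snd p) \<le> R" if "p \<in> C" for p
    using R[OF that] norm_snd_le[of "snd p" "fst p"] by simp
  have R0: "R \<ge> 0" using nsnd[OF p0] norm_ge_zero order_trans by blast
  obtain Xm where Xm: "\<And>p. p \<in> C \<Longrightarrow> barrier c t0 p \<le> Xm"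
    using continuous_attains_sup[OF C(1) Cne barrier_cont] by blast
  obtain Bm where Bm: "\<And>p. p \<in> C \<Longrightarrow> Bf p \<le> Bm"
    using continuous_attains_sup[OF C(1) Cne Bf_cont] by blast
  have Xm0: "Xm \<ge> 0" using Xm[OF p0] barrier_pos[of c t0 p0] by linarith
  have Bm0: "Bm \<ge> 0" using Bm[OF p0] Bf_pos[OF p0] by linarith
  define M0 where "M0 = \<bar>MF\<bar> + \<bar>MG\<bar> + 1"
  have M0: "M0 \<ge> 1" by (simp add: M0_def)
  define Sm where "Sm = K * (1 + R)"
  have Sm: "Sm \<ge> 0" using K R0 by (simp add: Sm_def)
  \<comment> \<open>It depends on \<open>C\<close> and the data, not on \<open>\<epsilon>\<close>,
    \<open>\<alpha>\<close> or \<open>\<beta>\<close>, so the total error vanishes in the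
    limit.\<close>
  define Q where "Q = 5 + 2 * Sm\<^sup>2 + (1 + Lc) * (1 + 2 * Sm) + Lc + 4 * Lc\<^sup>2 + (1 + Lc) * (2 * Lc)"
  have Q0: "Q \<ge> 0" using Sm Lc by (simp add: Q_def)
  have FG0: "F1 p0 + G1 p0 = 0" using touch by (simp add: F1_def G1_def)
  show ?thesis
  proof (rule exI[of _ Q], intro conjI allI impI)
    show "Q \<ge> 0" by (rule Q0)
    fix \<epsilon> :: real assume \<epsilon>: "0 < \<epsilon>" "\<epsilon> \<le> 1"
    \<comment> \<open>At an almost maximal pair the penalty is at most \<open>M0\<close>, that is
      \<open>\<alpha> * r^2 \<le> 2 * M0\<close>; this choice then forces
      \<open>r \<le> \<epsilon> / 2\<close>. The same reasoning with \<open>d\<close> in place of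
      \<open>\<epsilon>\<close> gives \<open>\<beta>\<close> below.\<close>
    define \<alpha> where "\<alpha> = 1 + 8 * M0 / \<epsilon>\<^sup>2"
    have \<alpha>: "\<alpha> \<ge> 1" "8 * M0 \<le> \<alpha> * \<epsilon>\<^sup>2" using M0 \<epsilon> by (simp_all add: \<alpha>_def algebra_simps)
    \<comment> \<open>The modulus in time and the slope errors appear multiplied by
      \<open>\<alpha>\<close>, so the tolerance is chosen to make
      \<open>\<alpha> * \<epsilon>1\<close> equal to \<open>\<epsilon>\<close>.\<close>
    define \<epsilon>1 where "\<epsilon>1 = \<epsilon> / \<alpha>"
    have "\<epsilon> / \<alpha> \<le> \<epsilon> / 1" using \<alpha>(1) \<epsilon> by (intro divide_left_mono) auto
    then have \<epsilon>1: "0 < \<epsilon>1" "\<epsilon>1 \<le> \<epsilon>" "\<epsilon>1 \<le> 1" "\<alpha> * \<epsilon>1 = \<epsilon>" using \<epsilon> \<alpha>(1) by (simp_all add: \<epsilon>1_def)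
    \<comment> \<open>A common bound for all arguments at which the modulus is evaluated: position,
      value of \<open>u1\<close>, and gradient times \<open>\<sigma>\<close>. It involves
      \<open>\<alpha>\<close> but not \<open>\<beta>\<close>, so the tolerance in time can still be
      fixed before \<open>\<beta>\<close>.\<close>
    define Z where "Z = R + (M0 + \<kappa> * Xm) + (2 * \<alpha> * R + 1 + 2 * \<kappa> * Bm) * Sm"
    have Zpos: "0 \<le> M0 + \<kappa> * Xm" "0 \<le> (2 * \<alpha> * R + 1 + 2 * \<kappa> * Bm) * Sm"
      using M0 \<kappa> Xm0 \<alpha> R0 Bm0 Sm by simp_all
    obtain \<delta> where \<delta>: "\<delta> > 0" "\<And>t s x y z u v. t \<in> {0..T} \<Longrightarrow> s \<in> {0..T} \<Longrightarrow> \<bar>t - s\<bar> < \<delta> \<Longrightarrow>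
       norm x \<le> Z \<Longrightarrow> \<bar>y\<bar> \<le> Z \<Longrightarrow> norm z \<le> Z \<Longrightarrow> u \<in> U \<Longrightarrow> v \<in> V \<Longrightarrow>
          norm (b t x u v - b s x u v) \<le> \<epsilon>1 \<and> norm (\<sigma> t x u v - \<sigma> s x u v) \<le> \<epsilon>1 \<and>
          \<bar>f t x y z u v - f s x y z u v\<bar> \<le> \<epsilon>1"
      using modulus[OF \<epsilon>1(1), of Z] by blast
    define d where "d = min \<delta> \<epsilon>"
    have d: "d > 0" "d \<le> \<delta>" "d \<le> \<epsilon>" using \<delta>(1) \<epsilon> by (auto simp: d_def)
    define \<beta> where "\<beta> = 1 + 8 * M0 / d\<^sup>2"
    have \<beta>: "\<beta> \<ge> 1" "8 * M0 \<le> \<beta> * d\<^sup>2" using M0 d by (simp_all add: \<beta>_def algebra_simps)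
    let ?L = "Lin \<beta> \<alpha>"
    have LL: "(norm (?L p))\<^sup>2 = \<beta> * (fst p)\<^sup>2 + \<alpha> * (norm (snd p))\<^sup>2" for p
      using \<alpha>(1) \<beta>(1) by (intro Lin_norm) auto
    have usc1: "usc_set (C \<times> C) (\<lambda>z. F1 (fst z))"
      by (rule usc_set_compose_Lipschitz[OF F1_usc]) (auto simp: dist_fst_le)
    have usc2: "usc_set (C \<times> C) (\<lambda>z. G1 (snd z))"
      by (rule usc_set_compose_Lipschitz[OF G1_usc]) (auto simp: dist_snd_le)
    have "continuous_on (C \<times> C) (\<lambda>z. ?L (fst z - snd z))"
      by (rule linear_continuous_on_compose[OF _ linear_Lin]) (intro continuous_intros)
    then have "continuous_on (C \<times> C) (\<lambda>z. - ((norm (?L (fst z - snd z)))\<^sup>2 / 2))"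
      by (intro continuous_intros) auto
    from usc_set_add[OF usc_set_add[OF usc1 usc2] continuous_imp_usc_set[OF this]]
    have usc3: "usc_set (C \<times> C) (\<lambda>z. F1 (fst z) + G1 (snd z) + - ((norm (?L (fst z - snd z)))\<^sup>2 / 2))" .
    have "C \<times> C \<noteq> {}" "compact (C \<times> C)" using Cne C(1) by (auto intro: compact_Times)
    from usc_set_attains_sup[OF this(2,1) usc3]
    obtain z where z: "z \<in> C \<times> C" "\<And>z'. z' \<in> C \<times> C \<Longrightarrow> F1 (fst z') + G1 (snd z') + - ((norm (?L (fst z' - snd z')))\<^sup>2 / 2)
       \<le> F1 (fst z) + G1 (snd z) + - ((norm (?L (fst z - snd z)))\<^sup>2 / 2)" by blast
    define M where "M = F1 (fst z) + G1 (snd z) - (norm (?L (fst z - snd z)))\<^sup>2 / 2"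
    have Mle: "F1 p + G1 q - (norm (?L (p - q)))\<^sup>2 / 2 \<le> M" if "p \<in> C" "q \<in> C" for p q
      using z(2)[of "(p, q)"] that by (simp add: M_def)
    have M: "M \<ge> 0" using Mle[OF p0 p0] FG0 linear_0[OF linear_Lin] by simp
    have zC: "fst z \<in> C" "snd z \<in> C" using z(1) by auto
    obtain p q a b' X Y where pq: "p \<in> C" "q \<in> C" and near: "F1 p + G1 q - (norm (?L (p - q)))\<^sup>2 / 2 \<ge> M - \<epsilon>1"
      and lin: "linear X" "linear Y"
      and a: "\<And>\<eta>. \<bar>a \<bullet> \<eta> - ?L (p - q) \<bullet> ?L \<eta>\<bar> \<le> \<epsilon>1 * norm \<eta>"
      and b': "\<And>\<eta>. \<bar>b' \<bullet> \<eta> + ?L (p - q) \<bullet> ?L \<eta>\<bar> \<le> \<epsilon>1 * norm \<eta>"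
      and XY: "\<And>\<xi> \<zeta>. \<xi> \<bullet> X \<xi> + \<zeta> \<bullet> Y \<zeta> \<le> 2 * (norm (?L (\<xi> - \<zeta>)))\<^sup>2 + \<epsilon>1 * ((norm \<xi>)\<^sup>2 + (norm \<zeta>)\<^sup>2)"
      and tp: "\<exists>\<delta>>0. \<forall>p'\<in>C. dist p' p < \<delta> \<longrightarrow> F1 p' \<le> F1 p + a \<bullet> (p' - p) + ((p' - p) \<bullet> X (p' - p)) / 2"
      and tq: "\<exists>\<delta>>0. \<forall>q'\<in>C. dist q' q < \<delta> \<longrightarrow> G1 q' \<le> G1 q + b' \<bullet> (q' - q) + ((q' - q) \<bullet> Y (q' - q)) / 2"
      using approx_theorem_on_sums[OF C(1) Cne F1_usc G1_usc linear_Lin \<epsilon>1(1) zC M_def[symmetric] Mle] by blast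
    define \<tau> where "\<tau> = fst p - fst q"
    define r where "r = norm (snd p - snd q)"
    define E where "E = F1 p + G1 q + \<epsilon>"
    have r0: "r \<ge> 0" by (simp add: r_def)
    have L2: "\<beta> * \<tau>\<^sup>2 + \<alpha> * r\<^sup>2 \<le> 2 * (F1 p + G1 q + \<epsilon>1)"
    proof -
      have "(norm (?L (p - q)))\<^sup>2 = \<beta> * \<tau>\<^sup>2 + \<alpha> * r\<^sup>2" using LL[of "p - q"] by (simp add: \<tau>_def r_def)
      then show ?thesis using near M by argo
    qed
    have nn: "0 \<le> \<beta> * \<tau>\<^sup>2" "0 \<le> \<alpha> * r\<^sup>2" using \<beta>(1) \<alpha>(1) by simp_all
    have FGm: "F1 p + G1 q + \<epsilon>1 \<le> M0" using MF[OF pq(1)] MG[OF pq(2)] \<epsilon>1(3) unfolding M0_def by linarith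
    have FG: "F1 p + G1 q \<ge> - \<epsilon>1" using L2 nn by argo
    \<comment> \<open>The penalty is bounded by the excess \<open>E\<close> rather than by a
      constant. The excess tends to zero once the pairs converge to a touching point, which makes
      the terms with \<open>\<alpha> * r^2\<close> disappear.\<close>
    have E: "\<alpha> * r\<^sup>2 \<le> 2 * E" "E \<ge> 0" using L2 nn \<epsilon>1(2) FG unfolding E_def by argo+
    have r_small: "r \<le> \<epsilon> / 2"
    proof (rule power2_le_imp_le)
      have "\<alpha> * (4 * r\<^sup>2) \<le> \<alpha> * \<epsilon>\<^sup>2" using L2 nn FGm \<alpha>(2) by argo
      then have "4 * r\<^sup>2 \<le> \<epsilon>\<^sup>2" using \<alpha>(1) by simp
      then show "r\<^sup>2 \<le> (\<epsilon> / 2)\<^sup>2" by (simp add: power_divide)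
    qed (use \<epsilon> in simp)
    have \<tau>_small: "\<bar>\<tau>\<bar> \<le> d / 2"
    proof (rule power2_le_imp_le)
      have "\<beta> * (4 * \<tau>\<^sup>2) \<le> \<beta> * d\<^sup>2" using L2 nn FGm \<beta>(2) by argo
      then have "4 * \<tau>\<^sup>2 \<le> d\<^sup>2" using \<beta>(1) by simp
      then show "\<bar>\<tau>\<bar>\<^sup>2 \<le> (d / 2)\<^sup>2" by (simp add: power_divide)
    qed (use d in simp)
    show "\<exists>p\<in>C. \<exists>q\<in>C. F1 p + G1 q \<ge> - \<epsilon> \<and> dist p q \<le> \<epsilon> \<and>
    (relint p \<longrightarrow> fst p < T \<longrightarrow> relint q \<longrightarrow> fst q < T \<longrightarrow>
      u2 (fst q) (snd q) \<ge> h (fst q) (snd q) \<and> (u1 (fst p) (snd p) \<le> h (fst p) (snd p) \<or>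
       (u1 (fst p) (snd p) \<le> h' (fst p) (snd p) \<and> (u2 (fst q) (snd q) \<ge> h' (fst q) (snd q) \<or>
        \<kappa> * (c - (7 * K\<^sup>2 + 4 * K + 4 * Lc * K)) * (Bf p + Bf q)
          \<le> Lc * \<bar>u1 (fst p) (snd p) - u2 (fst q) (snd q)\<bar> + Q * (\<epsilon> + (F1 p + G1 q + \<epsilon>))))))"
    proof (rule bexI[OF _ pq(1)], rule bexI[OF _ pq(2)], intro conjI[of "F1 p + G1 q \<ge> - \<epsilon>"] conjI[of "dist p q \<le> \<epsilon>"] impI)
      show "F1 p + G1 q \<ge> - \<epsilon>" using FG \<epsilon>1 by simp
      have "dist p q \<le> \<bar>\<tau>\<bar> + r"
        using norm_Pair_le[of \<tau> "snd p - snd q"] by (simp add: dist_norm \<tau>_def r_def minus_prod_def)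
      then show "dist p q \<le> \<epsilon>" using r_small \<tau>_small d by linarith
      assume ri: "relint p" "fst p < T" "relint q" "fst q < T"
      let ?v1 = "u1 (fst p) (snd p)" and ?v2 = "u2 (fst q) (snd q)"
      define S1 where "S1 = K * (1 + norm (snd p))"
      define S2 where "S2 = K * (1 + norm (snd q))"
      have S: "0 \<le> S1" "S1 \<le> Sm" "0 \<le> S2" "S2 \<le> Sm"
        using K nsnd[OF pq(1)] nsnd[OF pq(2)] by (simp_all add: S1_def S2_def Sm_def)
      have pT: "fst p \<in> {0..T}" "fst q \<in> {0..T}" using pq C(2) by auto
      have mod: "norm (b (fst p) (snd p) u v - b (fst q) (snd p) u v) \<le> \<epsilon>1 \<and>
        norm (\<sigma> (fst p) (snd p) u v - \<sigma> (fst q) (snd p) u v) \<le> \<epsilon>1 \<and>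
        \<bar>f (fst p) (snd p) ?v1 ((\<alpha> *\<^sub>R (snd p - snd q) + g) v* \<sigma> (fst p) (snd p) u v) u v
         - f (fst q) (snd p) ?v1 ((\<alpha> *\<^sub>R (snd p - snd q) + g) v* \<sigma> (fst p) (snd p) u v) u v\<bar> \<le> \<epsilon>1"
        if g: "norm g \<le> \<epsilon>1 + 2 * \<kappa> * Bf p" and u: "u \<in> U" and v: "v \<in> V" for g u v
      proof (rule \<delta>(2)[OF pT _ _ _ _ u v])
        show "\<bar>fst p - fst q\<bar> < \<delta>" using \<tau>_small d by (simp add: \<tau>_def)
        show "norm (snd p) \<le> Z" using nsnd[OF pq(1)] Zpos unfolding Z_def by linarith
        have "F1 p \<ge> - M0" using FG MG[OF pq(2)] \<epsilon>1(3) unfolding M0_def by linarith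
        moreover have "F1 p \<le> M0" using MF[OF pq(1)] unfolding M0_def by linarith
        moreover have "0 \<le> \<kappa> * barrier c t0 p" "\<kappa> * barrier c t0 p \<le> \<kappa> * Xm"
          using \<kappa> Xm[OF pq(1)] barrier_pos[of c t0 p] by simp_all
        ultimately have "\<bar>?v1\<bar> \<le> M0 + \<kappa> * Xm" unfolding F1_def by linarith
        then show "\<bar>?v1\<bar> \<le> Z" using R0 Zpos unfolding Z_def by linarith
        have "norm (\<alpha> *\<^sub>R (snd p - snd q) + g) \<le> norm (\<alpha> *\<^sub>R (snd p - snd q)) + norm g" by (rule norm_triangle_ineq)
        also have "\<dots> \<le> \<alpha> * (2 * R) + (1 + 2 * \<kappa> * Bm)"
        proof (rule add_mono)
          have "norm (snd p - snd q) \<le> 2 * R"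
            using norm_triangle_ineq4[of "snd p" "snd q"] nsnd[OF pq(1)] nsnd[OF pq(2)] by linarith
          then show "norm (\<alpha> *\<^sub>R (snd p - snd q)) \<le> \<alpha> * (2 * R)" using \<alpha>(1) by simp
          have "2 * \<kappa> * Bf p \<le> 2 * \<kappa> * Bm" using \<kappa> Bm[OF pq(1)] by simp
          then show "norm g \<le> 1 + 2 * \<kappa> * Bm" using g \<epsilon>1(3) by linarith
        qed
        finally have q1: "norm (\<alpha> *\<^sub>R (snd p - snd q) + g) \<le> 2 * \<alpha> * R + 1 + 2 * \<kappa> * Bm" by simp
        have "norm (\<sigma> (fst p) (snd p) u v) \<le> S1" using \<sigma>_growth[OF pT(1) u v] by (simp add: S1_def)
        then have s1: "norm (\<sigma> (fst p) (snd p) u v) \<le> Sm" using S by linarith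
        have "norm ((\<alpha> *\<^sub>R (snd p - snd q) + g) v* \<sigma> (fst p) (snd p) u v)
           \<le> norm (\<alpha> *\<^sub>R (snd p - snd q) + g) * norm (\<sigma> (fst p) (snd p) u v)" by (rule norm_vector_matrix_le)
        also have "\<dots> \<le> (2 * \<alpha> * R + 1 + 2 * \<kappa> * Bm) * Sm"
          using q1 s1 by (intro mult_mono) (auto intro: order_trans[OF norm_ge_zero])
        finally show "norm ((\<alpha> *\<^sub>R (snd p - snd q) + g) v* \<sigma> (fst p) (snd p) u v) \<le> Z"
          using R0 Zpos unfolding Z_def by linarith
      qed
      have J: "?v2 \<ge> h (fst q) (snd q) \<and> (?v1 \<le> h (fst p) (snd p) \<or> (?v1 \<le> h' (fst p) (snd p) \<and> (?v2 \<ge> h' (fst q) (snd q) \<or>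
       \<kappa> * (c - (7 * K\<^sup>2 + 4 * K + 4 * Lc * K)) * (Bf p + Bf q) \<le> Lc * \<bar>?v1 - ?v2\<bar> +
       (2 * \<epsilon>1 + \<alpha> * (\<epsilon>1 + Lc * r)\<^sup>2 + \<epsilon>1 * (S1\<^sup>2 + S2\<^sup>2) + (1 + Lc) * (\<alpha> * r * (\<epsilon>1 + Lc * r) + \<epsilon>1 * (S1 + S2)) + \<epsilon>1 + Lc * r))))"
        unfolding r_def S1_def S2_def
        by (rule jet_inequality[OF pq(1) ri(1,2) pq(2) ri(3,4) _ _ \<epsilon>1(1) _ lin a b' XY tp tq mod])
          (use \<alpha>(1) \<beta>(1) \<epsilon>1(1) in simp_all)
      have err: "2 * \<epsilon>1 + \<alpha> * (\<epsilon>1 + Lc * r)\<^sup>2 + \<epsilon>1 * (S1\<^sup>2 + S2\<^sup>2) + (1 + Lc) * (\<alpha> * r * (\<epsilon>1 + Lc * r) + \<epsilon>1 * (S1 + S2)) + \<epsilon>1 + Lc * r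
        \<le> Q * (\<epsilon> + E)"
      proof -
        have "(\<epsilon>1 + Lc * r)\<^sup>2 \<le> 2 * \<epsilon>1\<^sup>2 + 2 * (Lc * r)\<^sup>2"
          using sum_squares_bound[of \<epsilon>1 "Lc * r"] by (simp add: power2_sum)
        then have "\<alpha> * (\<epsilon>1 + Lc * r)\<^sup>2 \<le> \<alpha> * (2 * \<epsilon>1\<^sup>2 + 2 * (Lc * r)\<^sup>2)" using \<alpha>(1) by (intro mult_left_mono) auto
        also have "\<dots> = 2 * ((\<alpha> * \<epsilon>1) * \<epsilon>1) + 2 * Lc\<^sup>2 * (\<alpha> * r\<^sup>2)" by (simp add: algebra_simps power2_eq_square)
        also have "\<dots> \<le> 2 * (\<epsilon> * 1) + 2 * Lc\<^sup>2 * (2 * E)"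
          unfolding \<epsilon>1(4) using \<epsilon> \<epsilon>1(3) E(1) by (intro add_mono mult_left_mono) auto
        finally have 1: "\<alpha> * (\<epsilon>1 + Lc * r)\<^sup>2 \<le> 2 * \<epsilon> + 4 * Lc\<^sup>2 * E" by simp
        have "\<epsilon>1 * (S1\<^sup>2 + S2\<^sup>2) \<le> \<epsilon> * (Sm\<^sup>2 + Sm\<^sup>2)"
          using \<epsilon>1 \<epsilon> S by (intro mult_mono add_mono power_mono) auto
        then have 2: "\<epsilon>1 * (S1\<^sup>2 + S2\<^sup>2) \<le> 2 * Sm\<^sup>2 * \<epsilon>" by (simp add: algebra_simps)
        have "\<alpha> * r * (\<epsilon>1 + Lc * r) = (\<alpha> * \<epsilon>1) * r + Lc * (\<alpha> * r\<^sup>2)" by (simp add: algebra_simps power2_eq_square)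
        also have "\<dots> \<le> \<epsilon> * 1 + Lc * (2 * E)"
          unfolding \<epsilon>1(4) using \<epsilon> r_small Lc E(1) by (intro add_mono mult_left_mono) auto
        finally have 3: "\<alpha> * r * (\<epsilon>1 + Lc * r) \<le> \<epsilon> + 2 * Lc * E" by simp
        have "\<epsilon>1 * (S1 + S2) \<le> \<epsilon> * (Sm + Sm)" using \<epsilon>1 \<epsilon> S by (intro mult_mono add_mono) auto
        then have "\<alpha> * r * (\<epsilon>1 + Lc * r) + \<epsilon>1 * (S1 + S2) \<le> \<epsilon> + 2 * Lc * E + 2 * Sm * \<epsilon>" using 3 by (simp add: algebra_simps)
        then have 4: "(1 + Lc) * (\<alpha> * r * (\<epsilon>1 + Lc * r) + \<epsilon>1 * (S1 + S2)) \<le> (1 + Lc) * (\<epsilon> + 2 * Lc * E + 2 * Sm * \<epsilon>)"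
          using Lc by (intro mult_left_mono) auto
        have 5: "Lc * r \<le> Lc * \<epsilon>" using Lc r_small \<epsilon> by (intro mult_left_mono) auto
        have "2 * \<epsilon>1 + \<alpha> * (\<epsilon>1 + Lc * r)\<^sup>2 + \<epsilon>1 * (S1\<^sup>2 + S2\<^sup>2) + (1 + Lc) * (\<alpha> * r * (\<epsilon>1 + Lc * r) + \<epsilon>1 * (S1 + S2)) + \<epsilon>1 + Lc * r
          \<le> 2 * \<epsilon> + (2 * \<epsilon> + 4 * Lc\<^sup>2 * E) + 2 * Sm\<^sup>2 * \<epsilon> + (1 + Lc) * (\<epsilon> + 2 * Lc * E + 2 * Sm * \<epsilon>) + \<epsilon> + Lc * \<epsilon>"
          using \<epsilon>1(2) by (intro add_mono 1 2 4 5) auto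
        also have "\<dots> = (5 + 2 * Sm\<^sup>2 + (1 + Lc) * (1 + 2 * Sm) + Lc) * \<epsilon> + (4 * Lc\<^sup>2 + (1 + Lc) * (2 * Lc)) * E"
          by (simp add: algebra_simps)
        also have "\<dots> \<le> Q * \<epsilon> + Q * E"
          using Sm Lc \<epsilon> E(2) by (intro add_mono mult_right_mono) (auto simp: Q_def)
        finally show ?thesis by (simp add: distrib_left)
      qed
      show "?v2 \<ge> h (fst q) (snd q) \<and> (?v1 \<le> h (fst p) (snd p) \<or> (?v1 \<le> h' (fst p) (snd p) \<and> (?v2 \<ge> h' (fst q) (snd q) \<or>
        \<kappa> * (c - (7 * K\<^sup>2 + 4 * K + 4 * Lc * K)) * (Bf p + Bf q) \<le> Lc * \<bar>?v1 - ?v2\<bar> + Q * (\<epsilon> + (F1 p + G1 q + \<epsilon>)))))"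
        using J err unfolding E_def by (meson add_left_mono order_trans)
    qed
  qed
qed

text \<open>Almost maximal pairs for tolerances tending to zero accumulate at one point
  \<open>l\<close>, where the barrier touches. By \<open>interior\<close> the viscosity inequalities
  are eventually available along the sequence, and the limit inequality contradicts the choice of
  \<open>c\<close>.\<close>

lemma doubling_contradiction:
  assumes hc: "continuous_on ({0..T} \<times> UNIV) (\<lambda>p. h (fst p) (snd p))"
    and hc': "continuous_on ({0..T} \<times> UNIV) (\<lambda>p. h' (fst p) (snd p))"
    and interior: "\<And>p. p \<in> C \<Longrightarrow> u1 (fst p) (snd p) - u2 (fst p) (snd p) = 2 * \<kappa> * barrier c t0 p \<Longrightarrow> fst p < T \<and> relint p"
  shows False
proof -
  let ?U1 = "\<lambda>p. u1 (fst p) (snd p)" and ?U2 = "\<lambda>p. u2 (fst p) (snd p)"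
  let ?H = "\<lambda>p. h (fst p) (snd p)" and ?H' = "\<lambda>p. h' (fst p) (snd p)"
  define c1 where "c1 = c - (7 * K\<^sup>2 + 4 * K + 4 * Lc * K)"
  obtain Q where Q: "Q \<ge> 0" "\<And>\<epsilon>. 0 < \<epsilon> \<Longrightarrow> \<epsilon> \<le> 1 \<Longrightarrow> \<exists>p\<in>C. \<exists>q\<in>C. F1 p + G1 q \<ge> - \<epsilon> \<and> dist p q \<le> \<epsilon> \<and>
    (relint p \<longrightarrow> fst p < T \<longrightarrow> relint q \<longrightarrow> fst q < T \<longrightarrow>
      ?U2 q \<ge> ?H q \<and> (?U1 p \<le> ?H p \<or> (?U1 p \<le> ?H' p \<and> (?U2 q \<ge> ?H' q \<or>
        \<kappa> * c1 * (Bf p + Bf q) \<le> Lc * \<bar>?U1 p - ?U2 q\<bar> + Q * (\<epsilon> + (F1 p + G1 q + \<epsilon>))))))"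
    using doubling_step unfolding c1_def by blast
  define good where "good \<epsilon> p q \<longleftrightarrow> p \<in> C \<and> q \<in> C \<and> F1 p + G1 q \<ge> - \<epsilon> \<and> dist p q \<le> \<epsilon> \<and>
    (relint p \<longrightarrow> fst p < T \<longrightarrow> relint q \<longrightarrow> fst q < T \<longrightarrow>
      ?U2 q \<ge> ?H q \<and> (?U1 p \<le> ?H p \<or> (?U1 p \<le> ?H' p \<and> (?U2 q \<ge> ?H' q \<or>
        \<kappa> * c1 * (Bf p + Bf q) \<le> Lc * \<bar>?U1 p - ?U2 q\<bar> + Q * (\<epsilon> + (F1 p + G1 q + \<epsilon>))))))" for \<epsilon> p q
  have "\<forall>k. \<exists>p q. good (inverse (real (Suc k))) p q"
  proof
    fix k
    have "0 < inverse (real (Suc k))" "inverse (real (Suc k)) \<le> 1" by (simp_all add: field_simps)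
    from Q(2)[OF this] show "\<exists>p q. good (inverse (real (Suc k))) p q" unfolding good_def by blast
  qed
  then obtain p q where good: "\<And>k. good (inverse (real (Suc k))) (p k) (q k)" by metis
  note pq = good[unfolded good_def]
  have "\<forall>k. p k \<in> C" using pq by blast
  then obtain l \<rho> where l: "l \<in> C" "strict_mono (\<rho> :: nat \<Rightarrow> nat)" "(p \<circ> \<rho>) \<longlonglongrightarrow> l"
    using C(1) unfolding compact_def by blast
  define P where "P k = p (\<rho> k)" for k
  define R where "R k = q (\<rho> k)" for k
  define e where "e k = inverse (real (Suc (\<rho> k)))" for k
  have e0: "e \<longlonglongrightarrow> 0"
    using LIMSEQ_subseq_LIMSEQ[OF LIMSEQ_inverse_real_of_nat l(2)] by (simp add: e_def[abs_def] o_def)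
  have PR: "P k \<in> C" "R k \<in> C" "F1 (P k) + G1 (R k) \<ge> - e k" "dist (P k) (R k) \<le> e k" for k
    using pq[of "\<rho> k"] by (simp_all add: P_def R_def e_def)
  have Plim: "P \<longlonglongrightarrow> l" using l(3) by (simp add: P_def[abs_def] o_def)
  have Rlim: "R \<longlonglongrightarrow> l"
  proof -
    have "(\<lambda>k. dist (P k) (R k)) \<longlonglongrightarrow> 0"
      by (rule tendsto_sandwich[OF _ _ tendsto_const e0]) (use PR(4) in auto)
    then have "(\<lambda>k. P k - R k) \<longlonglongrightarrow> 0" by (simp add: dist_norm tendsto_norm_zero_iff)
    from tendsto_diff[OF Plim this] show ?thesis by simp
  qed
  have usc_ev: "\<forall>\<^sub>F k in sequentially. g (S k) < g l + \<eta>" if "usc_set C g" "S \<longlonglongrightarrow> l" "\<And>k. S k \<in> C" "\<eta> > 0" for g S \<eta>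
  proof -
    note hyps = that
    obtain \<delta> where \<delta>: "\<delta> > 0" "\<And>q. q \<in> C \<Longrightarrow> dist q l < \<delta> \<Longrightarrow> g q < g l + \<eta>"
      using usc_setD[OF hyps(1) l(1) hyps(4)] by blast
    have "\<forall>\<^sub>F k in sequentially. dist (S k) l < \<delta>" using that(2) \<delta>(1) by (rule tendstoD)
    then show ?thesis by (rule eventually_mono) (use \<delta>(2) that(3) in blast)
  qed
  note Fev = usc_ev[OF F1_usc Plim PR(1)] and Gev = usc_ev[OF G1_usc Rlim PR(2)]
  have FGle: "F1 l + G1 l \<le> 0" using below[OF l(1)] by (simp add: F1_def G1_def)
  have e_ev: "\<forall>\<^sub>F k in sequentially. e k < \<eta>" if "\<eta> > 0" for \<eta> using e0 that by (rule order_tendstoD(2))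
  have FGge: "F1 l + G1 l \<ge> 0"
  proof (rule field_le_epsilon)
    fix \<eta> :: real assume "\<eta> > 0"
    then have 3: "\<eta> / 3 > 0" by simp
    have "\<forall>\<^sub>F k in sequentially. 0 \<le> F1 l + G1 l + \<eta>"
      using Fev[OF 3] Gev[OF 3] e_ev[OF 3]
    proof eventually_elim
      case (elim k)
      then show ?case using PR(3)[of k] by simp
    qed
    then show "0 \<le> F1 l + G1 l + \<eta>" by simp
  qed
  have FG: "F1 l + G1 l = 0" using FGle FGge by simp
  \<comment> \<open>Semicontinuity bounds \<open>F1 (P k)\<close> and \<open>G1 (R k)\<close> from
    above by values adding up to zero, while their sum is at least \<open>- e k\<close>. Hence each
    is squeezed from below too, and the merely semicontinuous \<open>u1\<close> and
    \<open>u2\<close> converge along the sequence.\<close>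
  have Flim: "(\<lambda>k. F1 (P k)) \<longlonglongrightarrow> F1 l"
  proof (rule tendstoI)
    fix \<eta> :: real assume "\<eta> > 0"
    then have 2: "\<eta> / 2 > 0" by simp
    show "\<forall>\<^sub>F k in sequentially. dist (F1 (P k)) (F1 l) < \<eta>"
      using Fev[OF 2] Gev[OF 2] e_ev[OF 2]
    proof eventually_elim
      case (elim k)
      then show ?case using PR(3)[of k] FG by (simp add: dist_real_def abs_less_iff)
    qed
  qed
  have Glim: "(\<lambda>k. G1 (R k)) \<longlonglongrightarrow> G1 l"
  proof (rule tendstoI)
    fix \<eta> :: real assume "\<eta> > 0"
    then have 2: "\<eta> / 2 > 0" by simp
    show "\<forall>\<^sub>F k in sequentially. dist (G1 (R k)) (G1 l) < \<eta>"
      using Fev[OF 2] Gev[OF 2] e_ev[OF 2]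
    proof eventually_elim
      case (elim k)
      then show ?case using PR(3)[of k] FG by (simp add: dist_real_def abs_less_iff)
    qed
  qed
  have clim: "(\<lambda>k. g (S k)) \<longlonglongrightarrow> g l" if "continuous_on D g" "S \<longlonglongrightarrow> l" "\<And>k. S k \<in> C" "C \<subseteq> D" for g :: "_ \<Rightarrow> real" and S D
    by (rule continuous_on_tendsto_compose[OF that(1,2)]) (use l(1) that(3,4) in \<open>auto intro!: always_eventually\<close>)
  note \<chi>P = clim[OF barrier_cont Plim PR(1) order_refl] and \<chi>R = clim[OF barrier_cont Rlim PR(2) order_refl]
  note BP = clim[OF Bf_cont Plim PR(1) order_refl] and BR = clim[OF Bf_cont Rlim PR(2) order_refl]
  note HP = clim[OF hc Plim PR(1) C(2)] and HR = clim[OF hc Rlim PR(2) C(2)]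
  note HP' = clim[OF hc' Plim PR(1) C(2)] and HR' = clim[OF hc' Rlim PR(2) C(2)]
  have U1lim: "(\<lambda>k. ?U1 (P k)) \<longlonglongrightarrow> ?U1 l"
  proof -
    have "(\<lambda>k. F1 (P k) + \<kappa> * barrier c t0 (P k)) \<longlonglongrightarrow> F1 l + \<kappa> * barrier c t0 l" by (intro tendsto_intros Flim \<chi>P)
    then show ?thesis by (simp add: F1_def)
  qed
  have U2lim: "(\<lambda>k. ?U2 (R k)) \<longlonglongrightarrow> ?U2 l"
  proof -
    have "(\<lambda>k. - G1 (R k) - \<kappa> * barrier c t0 (R k)) \<longlonglongrightarrow> - G1 l - \<kappa> * barrier c t0 l" by (intro tendsto_intros Glim \<chi>R)
    then show ?thesis by (simp add: G1_def)
  qed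
  have U12: "?U1 l - ?U2 l = 2 * \<kappa> * barrier c t0 l" using FG by (simp add: F1_def G1_def)
  have gap: "?U1 l > ?U2 l" using U12 mult_pos_pos[OF \<kappa> barrier_pos[of c t0 l]] by argo
  obtain int: "fst l < T" "relint l" using interior[OF l(1) U12] by blast
  obtain \<delta> where \<delta>: "\<delta> > 0" "\<And>p'. 0 \<le> fst p' \<Longrightarrow> fst p' \<le> T \<Longrightarrow> dist p' l < \<delta> \<Longrightarrow> p' \<in> C"
    using int(2) unfolding relint_def by blast
  have rel_ev: "\<forall>\<^sub>F k in sequentially. relint (S k) \<and> fst (S k) < T" if "S \<longlonglongrightarrow> l" for S
  proof -
    have 1: "\<forall>\<^sub>F k in sequentially. dist (S k) l < \<delta> / 2" using that \<delta>(1) by (intro tendstoD) auto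
    have 2: "\<forall>\<^sub>F k in sequentially. fst (S k) < T"
      using tendsto_fst[OF that] int(1) by (rule order_tendstoD(2))
    show ?thesis using 1 2
    proof eventually_elim
      case (elim k)
      have "p' \<in> C" if "0 \<le> fst p'" "fst p' \<le> T" "dist p' (S k) < \<delta> / 2" for p'
        using that elim dist_triangle[of p' l "S k"] by (intro \<delta>(2)) auto
      then have "relint (S k)" unfolding relint_def using \<delta>(1) by (intro exI[of _ "\<delta> / 2"]) auto
      then show ?case using elim by blast
    qed
  qed
  have ev1: "\<forall>\<^sub>F k in sequentially. ?U2 (R k) \<ge> ?H (R k) \<and> (?U1 (P k) \<le> ?H (P k) \<or> (?U1 (P k) \<le> ?H' (P k) \<and> (?U2 (R k) \<ge> ?H' (R k) \<or>
        \<kappa> * c1 * (Bf (P k) + Bf (R k)) \<le> Lc * \<bar>?U1 (P k) - ?U2 (R k)\<bar> + Q * (e k + (F1 (P k) + G1 (R k) + e k)))))"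
    using rel_ev[OF Plim] rel_ev[OF Rlim]
  proof eventually_elim
    case (elim k)
    then show ?case using pq[of "\<rho> k"] unfolding P_def R_def e_def by blast
  qed
  \<comment> \<open>The gap \<open>?U1 l > ?U2 l\<close> now removes the obstacle alternatives one
    after the other: strict inequalities in the limit hold eventually, and each of them selects the
    next branch of \<open>ev1\<close>.\<close>
  have "?H l \<le> ?U2 l"
    by (rule tendsto_le[OF sequentially_bot U2lim HR]) (use ev1 in eventually_elim, blast)
  then have "?H l < ?U1 l" using gap by simp
  then have "0 < ?U1 l - ?H l" by simp
  from order_tendstoD(1)[OF tendsto_diff[OF U1lim HP] this]
  have ev2: "\<forall>\<^sub>F k in sequentially. ?U1 (P k) > ?H (P k)" by (rule eventually_mono) simp
  have "?U1 l \<le> ?H' l"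
  proof (rule tendsto_le[OF sequentially_bot HP' U1lim])
    show "\<forall>\<^sub>F k in sequentially. ?U1 (P k) \<le> ?H' (P k)" using ev1 ev2 by eventually_elim auto
  qed
  then have "0 < ?H' l - ?U2 l" using gap by simp
  from order_tendstoD(1)[OF tendsto_diff[OF HR' U2lim] this]
  have ev3: "\<forall>\<^sub>F k in sequentially. ?U2 (R k) < ?H' (R k)" by (rule eventually_mono) simp
  have ev4: "\<forall>\<^sub>F k in sequentially. \<kappa> * c1 * (Bf (P k) + Bf (R k)) \<le> Lc * \<bar>?U1 (P k) - ?U2 (R k)\<bar> + Q * (e k + (F1 (P k) + G1 (R k) + e k))"
    using ev1 ev2 ev3 by eventually_elim auto
  have lim1: "(\<lambda>k. \<kappa> * c1 * (Bf (P k) + Bf (R k))) \<longlonglongrightarrow> \<kappa> * c1 * (Bf l + Bf l)"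
    by (intro tendsto_intros BP BR)
  have lim2: "(\<lambda>k. Lc * \<bar>?U1 (P k) - ?U2 (R k)\<bar> + Q * (e k + (F1 (P k) + G1 (R k) + e k)))
      \<longlonglongrightarrow> Lc * \<bar>?U1 l - ?U2 l\<bar> + Q * (0 + (F1 l + G1 l + 0))"
    by (intro tendsto_intros U1lim U2lim Flim Glim e0)
  have abs: "\<bar>?U1 l - ?U2 l\<bar> = 2 * \<kappa> * barrier c t0 l" using gap U12 by argo
  have "\<kappa> * c1 * (Bf l + Bf l) \<le> Lc * (2 * \<kappa> * barrier c t0 l)"
    using tendsto_le[OF sequentially_bot lim2 lim1 ev4] unfolding abs FG by simp
  then have "(2 * \<kappa>) * (c1 * Bf l) \<le> (2 * \<kappa>) * (Lc * barrier c t0 l)" by (simp only: algebra_simps)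
  then have le: "c1 * Bf l \<le> Lc * barrier c t0 l" by (rule mult_left_le_imp_le) (use \<kappa> in simp)
  \<comment> \<open>The zero-order term is of the size of the barrier itself; since both factors of
    \<open>Bf l\<close> in front of the barrier are at least 1, the margin \<open>c1 > Lc\<close>
    absorbs it.\<close>
  have "barrier c t0 l \<le> Bf l"
  proof -
    have "1 * 1 \<le> (1 / (c * (fst l - t0)))\<^sup>2 * psi (snd l)"
      using C_time(2)[OF l(1)] psi_ge(1)[of "snd l"] by (intro mult_mono one_le_power) auto
    then show ?thesis unfolding Bf_def using barrier_pos[of c t0 l] by (simp add: mult_le_cancel_right1)
  qed
  then have "Lc * barrier c t0 l \<le> Lc * Bf l" using Lc by (rule mult_left_mono)
  also have "\<dots> < c1 * Bf l" using Bf_pos[OF l(1)] c by (intro mult_strict_right_mono) (auto simp: c1_def)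
  finally show False using le by simp
qed

end

section \<open>Comparison\<close>

lemma continuous_on_time_Lipschitz:
  fixes g :: "real \<Rightarrow> 'a::metric_space \<Rightarrow> real"
  assumes cont: "\<And>x. continuous_on {0..T} (\<lambda>t. g t x)"
    and lip: "\<And>t x x'. t \<in> {0..T} \<Longrightarrow> \<bar>g t x - g t x'\<bar> \<le> L * dist x x'"
  shows "continuous_on ({0..T} \<times> UNIV) (\<lambda>p. g (fst p) (snd p))"
  unfolding continuous_on_iff
proof (intro ballI allI impI)
  fix p and e :: real assume p: "p \<in> {0..T} \<times> (UNIV :: 'a set)" and e: "e > 0"
  have t: "fst p \<in> {0..T}" using p by auto
  obtain d where d: "d > 0" "\<And>s. s \<in> {0..T} \<Longrightarrow> dist s (fst p) < d \<Longrightarrow> dist (g s (snd p)) (g (fst p) (snd p)) < e / 2"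
    using cont[of "snd p"] t half_gt_zero[OF e] unfolding continuous_on_iff by meson
  define r where "r = e / (2 * (\<bar>L\<bar> + 1))"
  have r: "r > 0" "\<bar>L\<bar> * r \<le> e / 2" using e by (auto simp: r_def field_simps)
  show "\<exists>d>0. \<forall>q\<in>{0..T} \<times> UNIV. dist q p < d \<longrightarrow> dist (g (fst q) (snd q)) (g (fst p) (snd p)) < e"
  proof (intro exI[of _ "min d r"] conjI ballI impI)
    fix q assume q: "q \<in> {0..T} \<times> (UNIV :: 'a set)" and near: "dist q p < min d r"
    have "dist (fst q) (fst p) < d" "dist (snd q) (snd p) \<le> r"
      using dist_fst_le[of q p] dist_snd_le[of q p] near by linarith+
    moreover have qt: "fst q \<in> {0..T}" using q by auto
    ultimately have 1: "dist (g (fst q) (snd p)) (g (fst p) (snd p)) < e / 2" using d(2) by blast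
    have "\<bar>g (fst q) (snd q) - g (fst q) (snd p)\<bar> \<le> L * dist (snd q) (snd p)" by (rule lip[OF qt])
    also have "\<dots> \<le> \<bar>L\<bar> * r" using \<open>dist (snd q) (snd p) \<le> r\<close> by (intro mult_mono) auto
    also have "\<dots> \<le> e / 2" by (rule r(2))
    finally show "dist (g (fst q) (snd q)) (g (fst p) (snd p)) < e"
      using 1 dist_triangle[of "g (fst q) (snd q)" "g (fst p) (snd p)" "g (fst q) (snd p)"]
      by (simp add: dist_real_def)
  qed (use d r in simp)
qed

lemma compact_continuous_bound:
  fixes F :: "'a::topological_space \<Rightarrow> 'b::real_normed_vector"
  assumes "compact S" "continuous_on S F"
  shows "\<exists>B\<ge>0. \<forall>p\<in>S. norm (F p) \<le> B"
proof -
  have "bounded (F ` S)" by (intro compact_imp_bounded compact_continuous_image assms)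
  then obtain B where "\<forall>p\<in>S. norm (F p) \<le> B" by (auto simp: bounded_iff)
  then show ?thesis by (intro exI[of _ "max B 0"]) (auto simp: le_max_iff_disj)
qed

lemma standing_regular:
  fixes b :: "real \<Rightarrow> real^'n \<Rightarrow> 'u::metric_space \<Rightarrow> 'v::metric_space \<Rightarrow> real^'n"
    and \<sigma> :: "real \<Rightarrow> real^'n \<Rightarrow> 'u \<Rightarrow> 'v \<Rightarrow> real^'d^'n"
    and f :: "real \<Rightarrow> real^'n \<Rightarrow> real \<Rightarrow> real^'d \<Rightarrow> 'u \<Rightarrow> 'v \<Rightarrow> real"
  assumes st: "standing_assumptions T U V b \<sigma> f \<Phi> h h'"
  shows "\<exists>K Lc. regular_coeffs T U V b \<sigma> f K Lc"
proof -
  have UV: "compact U" "compact V" "U \<noteq> {}" "V \<noteq> {}"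
    using st unfolding standing_assumptions_def by blast+
  have cb: "continuous_on ({0..T} \<times> U \<times> V) (\<lambda>(t,u,v). b t x u v)"
    and cs: "continuous_on ({0..T} \<times> U \<times> V) (\<lambda>(t,u,v). \<sigma> t x u v)"
    and cf: "continuous_on ({0..T} \<times> U \<times> V) (\<lambda>(t,u,v). f t x y z u v)" for x y z
    using st unfolding standing_assumptions_def by simp_all
  have "\<exists>L. \<forall>t\<in>{0..T}. \<forall>u\<in>U. \<forall>v\<in>V. \<forall>x x'.
          norm (b t x u v - b t x' u v) \<le> L * dist x x' \<and> norm (\<sigma> t x u v - \<sigma> t x' u v) \<le> L * dist x x'"
    using st unfolding standing_assumptions_def by blast
  then obtain L1 where L1: "\<And>t u v x x'. t \<in> {0..T} \<Longrightarrow> u \<in> U \<Longrightarrow> v \<in> V \<Longrightarrow> norm (b t x u v - b t x' u v) \<le> L1 * dist x x'"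
    "\<And>t u v x x'. t \<in> {0..T} \<Longrightarrow> u \<in> U \<Longrightarrow> v \<in> V \<Longrightarrow> norm (\<sigma> t x u v - \<sigma> t x' u v) \<le> L1 * dist x x'"
    by metis
  have "\<exists>L. \<forall>t\<in>{0..T}. \<forall>u\<in>U. \<forall>v\<in>V. \<forall>x x' y y' z z'.
          \<bar>f t x y z u v - f t x' y' z' u v\<bar> \<le> L * (dist x x' + dist y y' + dist z z')"
    using st unfolding standing_assumptions_def by blast
  then obtain L2 where L2: "\<And>t u v x x' y y' z z'. t \<in> {0..T} \<Longrightarrow> u \<in> U \<Longrightarrow> v \<in> V \<Longrightarrow>
       \<bar>f t x y z u v - f t x' y' z' u v\<bar> \<le> L2 * (dist x x' + dist y y' + dist z z')"
    by metis
  define Lc where "Lc = \<bar>L1\<bar> + \<bar>L2\<bar>"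
  have Lc: "Lc \<ge> 0" by (simp add: Lc_def)
  have up1: "L1 * k \<le> Lc * k" and up2: "L2 * k \<le> Lc * k" if "k \<ge> 0" for k
    using that by (auto intro!: mult_right_mono simp: Lc_def)
  have b_lip: "norm (b t x u v - b t x' u v) \<le> Lc * norm (x - x')"
    and s_lip: "norm (\<sigma> t x u v - \<sigma> t x' u v) \<le> Lc * norm (x - x')" if "t \<in> {0..T}" "u \<in> U" "v \<in> V" for t u v x x'
    using L1[OF that, of x x'] up1[of "dist x x'"] unfolding dist_norm by (auto intro: order_trans)
  have f_lip: "\<bar>f t x y z u v - f t x' y' z' u v\<bar> \<le> Lc * (norm (x - x') + \<bar>y - y'\<bar> + norm (z - z'))"
    if "t \<in> {0..T}" "u \<in> U" "v \<in> V" for t u v x x' y y' z z'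
    using order_trans[OF L2[OF that, of x y z x' y' z'] up2] by (simp add: dist_norm dist_real_def)
  have cpt: "compact ({0..T} \<times> U \<times> V)" by (intro compact_Times UV compact_Icc)
  obtain B1 where B1: "B1 \<ge> 0" "\<And>t u v. t \<in> {0..T} \<Longrightarrow> u \<in> U \<Longrightarrow> v \<in> V \<Longrightarrow> norm (b t 0 u v) \<le> B1"
    using compact_continuous_bound[OF cpt cb[of 0]] by auto
  obtain B2 where B2: "B2 \<ge> 0" "\<And>t u v. t \<in> {0..T} \<Longrightarrow> u \<in> U \<Longrightarrow> v \<in> V \<Longrightarrow> norm (\<sigma> t 0 u v) \<le> B2"
    using compact_continuous_bound[OF cpt cs[of 0]] by auto
  obtain B3 where B3: "B3 \<ge> 0" "\<And>t u v. t \<in> {0..T} \<Longrightarrow> u \<in> U \<Longrightarrow> v \<in> V \<Longrightarrow> norm (f t 0 0 0 u v) \<le> B3"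
    using compact_continuous_bound[OF cpt cf[of 0 0 0]] by auto
  define K where "K = 1 + B1 + B2 + B3 + Lc"
  have K: "K \<ge> 1" "B1 \<le> K" "B2 \<le> K" "B3 \<le> K" "Lc \<le> K" using B1(1) B2(1) B3(1) Lc by (simp_all add: K_def)
  have gr: "B + Lc * k \<le> K * (1 + k)" if "B \<le> K" "k \<ge> 0" for B k
  proof -
    have "Lc * k \<le> K * k" using K(5) that(2) by (rule mult_right_mono)
    then show ?thesis using that(1) by (simp add: algebra_simps)
  qed
  have "regular_coeffs T U V b \<sigma> f K Lc"
  proof (rule regular_coeffs.intro)
    show "U \<noteq> {}" "V \<noteq> {}" "K \<ge> 1" "Lc \<ge> 0" using UV K Lc by auto
    fix t u v x assume tuv: "t \<in> {0..T}" "u \<in> U" "v \<in> V"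
    show "norm (b t x u v) \<le> K * (1 + norm x)"
      using gr[OF K(2), of "norm x"] norm_triangle_sub[of "b t x u v" "b t 0 u v"] B1(2)[OF tuv] b_lip[OF tuv, of x 0] by simp
    show "norm (\<sigma> t x u v) \<le> K * (1 + norm x)"
      using gr[OF K(3), of "norm x"] norm_triangle_sub[of "\<sigma> t x u v" "\<sigma> t 0 u v"] B2(2)[OF tuv] s_lip[OF tuv, of x 0] by simp
    fix y z
    show "\<bar>f t x y z u v\<bar> \<le> K * (1 + norm x + \<bar>y\<bar> + norm z)"
      using gr[OF K(4), of "norm x + \<bar>y\<bar> + norm z"] norm_triangle_sub[of "f t x y z u v" "f t 0 0 0 u v"] B3(2)[OF tuv]
        f_lip[OF tuv, of x y z 0 0 0] by (simp add: add.assoc)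
  next
    fix e R :: real assume e: "e > 0"
    obtain d1 where d1: "d1 > 0" "\<forall>t\<in>{0..T}. \<forall>s\<in>{0..T}. \<bar>t - s\<bar> < d1 \<longrightarrow> (\<forall>x\<in>cball 0 R. \<forall>u\<in>U. \<forall>v\<in>V. dist (b t x u v) (b s x u v) \<le> e)"
      using time_modulus[OF compact_cball[of 0 R] UV(1,2) cb b_lip[folded dist_norm] e] by blast
    obtain d2 where d2: "d2 > 0" "\<forall>t\<in>{0..T}. \<forall>s\<in>{0..T}. \<bar>t - s\<bar> < d2 \<longrightarrow> (\<forall>x\<in>cball 0 R. \<forall>u\<in>U. \<forall>v\<in>V. dist (\<sigma> t x u v) (\<sigma> s x u v) \<le> e)"
      using time_modulus[OF compact_cball[of 0 R] UV(1,2) cs s_lip[folded dist_norm] e] by blast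
    \<comment> \<open>The three arguments \<open>x\<close>, \<open>y\<close>, \<open>z\<close> of
      \<open>f\<close> are bundled into one point so that \<open>time_modulus\<close> applies; each
      of the three distances is at most the product distance, hence the constant
      \<open>3 * Lc\<close>.\<close>
    let ?F = "\<lambda>t p u v. f t (fst p) (fst (snd p)) (snd (snd p)) u v"
    have "dist (?F t p u v) (?F t p' u v) \<le> 3 * Lc * dist p p'" if "t \<in> {0..T}" "u \<in> U" "v \<in> V" for t u v p p'
    proof -
      have "dist (fst p) (fst p') \<le> dist p p'" "dist (fst (snd p)) (fst (snd p')) \<le> dist p p'" "dist (snd (snd p)) (snd (snd p')) \<le> dist p p'"
        using dist_fst_le[of p p'] dist_snd_le[of p p'] dist_fst_le[of "snd p" "snd p'"] dist_snd_le[of "snd p" "snd p'"] by linarith+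
      then have "Lc * (dist (fst p) (fst p') + dist (fst (snd p)) (fst (snd p')) + dist (snd (snd p)) (snd (snd p'))) \<le> Lc * (3 * dist p p')"
        using Lc by (intro mult_left_mono) auto
      moreover have "dist (?F t p u v) (?F t p' u v) \<le> Lc * (dist (fst p) (fst p') + dist (fst (snd p)) (fst (snd p')) + dist (snd (snd p)) (snd (snd p')))"
        using f_lip[OF that, of "fst p" "fst (snd p)" "snd (snd p)" "fst p'" "fst (snd p')" "snd (snd p')"]
        by (simp add: dist_norm dist_real_def)
      ultimately show ?thesis by simp
    qed
    moreover have "compact (cball (0::real^'n) R \<times> cball (0::real) R \<times> cball (0::real^'d) R)" by (intro compact_Times compact_cball)
    ultimately obtain d3 where d3: "d3 > 0" "\<forall>t\<in>{0..T}. \<forall>s\<in>{0..T}. \<bar>t - s\<bar> < d3 \<longrightarrow>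
        (\<forall>p\<in>cball 0 R \<times> cball 0 R \<times> cball 0 R. \<forall>u\<in>U. \<forall>v\<in>V. dist (?F t p u v) (?F s p u v) \<le> e)"
      using time_modulus[of "cball 0 R \<times> cball 0 R \<times> cball 0 R" U V T ?F "3 * Lc" e] UV(1,2) cf e by blast
    show "\<exists>\<delta>>0. \<forall>t\<in>{0..T}. \<forall>s\<in>{0..T}. \<bar>t - s\<bar> < \<delta> \<longrightarrow>
       (\<forall>x y z. norm x \<le> R \<longrightarrow> \<bar>y\<bar> \<le> R \<longrightarrow> norm z \<le> R \<longrightarrow> (\<forall>u\<in>U. \<forall>v\<in>V.
          norm (b t x u v - b s x u v) \<le> e \<and> norm (\<sigma> t x u v - \<sigma> s x u v) \<le> e \<and>
          \<bar>f t x y z u v - f s x y z u v\<bar> \<le> e))"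
    proof (intro exI[of _ "min d1 (min d2 d3)"] conjI[of "_ > _"] ballI allI impI)
      show "min d1 (min d2 d3) > 0" using d1 d2 d3 by simp
      fix t s y u v and x :: "real^'n" and z :: "real^'d"
      assume a: "t \<in> {0..T}" "s \<in> {0..T}" "\<bar>t - s\<bar> < min d1 (min d2 d3)" "norm x \<le> R" "\<bar>y\<bar> \<le> R" "norm z \<le> R" "u \<in> U" "v \<in> V"
      then have "dist (b t x u v) (b s x u v) \<le> e" using d1(2) by (simp add: dist_norm)
      moreover have "dist (\<sigma> t x u v) (\<sigma> s x u v) \<le> e" using d2(2) a by (simp add: dist_norm)
      moreover have "dist (?F t (x, y, z) u v) (?F s (x, y, z) u v) \<le> e"
        using d3(2)[rule_format, OF a(1,2) _ _ a(7,8), of "(x, y, z)"] a by (simp add: dist_norm)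
      ultimately show "norm (b t x u v - b s x u v) \<le> e \<and> norm (\<sigma> t x u v - \<sigma> s x u v) \<le> e \<and>
          \<bar>f t x y z u v - f s x y z u v\<bar> \<le> e" by (simp add: dist_norm dist_real_def)
    qed
  qed (use b_lip s_lip f_lip in auto)
  then show ?thesis by blast
qed

text \<open>The growth condition of \<open>Theta\<close> expressed through the exponent of the
  barrier: smallness relative to \<open>exp (A * psi x)\<close> at infinity, uniformly in
  time.\<close>

definition subcritical :: "real \<Rightarrow> real \<Rightarrow> (real \<Rightarrow> real^'n \<Rightarrow> real) \<Rightarrow> bool" where
  "subcritical A T w \<longleftrightarrow> (\<forall>\<epsilon>>0. \<exists>R. \<forall>t\<in>{0..T}. \<forall>x. norm x \<ge> R \<longrightarrow> \<bar>w t x\<bar> \<le> \<epsilon> * exp (A * psi x))"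

lemma subcritical_mono:
  assumes "subcritical A T w" "A \<le> A'"
  shows "subcritical A' T w"
  unfolding subcritical_def
proof (intro allI impI)
  fix \<epsilon> :: real assume \<epsilon>: "\<epsilon> > 0"
  then obtain R where R: "\<And>t x. t \<in> {0..T} \<Longrightarrow> norm x \<ge> R \<Longrightarrow> \<bar>w t x\<bar> \<le> \<epsilon> * exp (A * psi x)"
    using assms(1) unfolding subcritical_def by blast
  have "\<epsilon> * exp (A * psi x) \<le> \<epsilon> * exp (A' * psi x)" for x
    using \<epsilon> assms(2) psi_ge(1)[of x] by (simp add: mult_right_mono)
  then show "\<exists>R. \<forall>t\<in>{0..T}. \<forall>x. norm x \<ge> R \<longrightarrow> \<bar>w t x\<bar> \<le> \<epsilon> * exp (A' * psi x)"
    using R order_trans by (intro exI[of _ R]) blast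
qed

text \<open>Since \<open>psi\<close> dominates the squared logarithm in \<open>Theta\<close>, the
  same constant \<open>A\<close> serves.\<close>

lemma Theta_subcritical:
  fixes w :: "real \<Rightarrow> real^'n \<Rightarrow> real"
  assumes "w \<in> Theta T"
  shows "\<exists>A>0. subcritical A T w"
proof -
  obtain A where A: "A > 0" "\<And>\<epsilon>. \<epsilon> > 0 \<Longrightarrow> \<exists>R. \<forall>t\<in>{0..T}. \<forall>x. norm x \<ge> R \<longrightarrow>
      \<bar>w t x\<bar> * exp (- A * (ln (sqrt (norm x ^ 2 + 1)))^2) < \<epsilon>"
    using assms unfolding Theta_def by blast
  have "subcritical A T w"
    unfolding subcritical_def
  proof (intro allI impI)
    fix \<epsilon> :: real assume \<epsilon>: "\<epsilon> > 0"
    then obtain R where R: "\<And>t x. t \<in> {0..T} \<Longrightarrow> norm x \<ge> R \<Longrightarrow>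
        \<bar>w t x\<bar> * exp (- A * (ln (sqrt (norm x ^ 2 + 1)))^2) < \<epsilon>" using A(2) by blast
    show "\<exists>R. \<forall>t\<in>{0..T}. \<forall>x. norm x \<ge> R \<longrightarrow> \<bar>w t x\<bar> \<le> \<epsilon> * exp (A * psi x)"
    proof (intro exI[of _ R] ballI allI impI)
      fix t and x :: "real^'n" assume tx: "t \<in> {0..T}" "norm x \<ge> R"
      define l where "l = (ln (sqrt (norm x ^ 2 + 1)))^2"
      have "ln (sqrt (norm x ^ 2 + 1)) = ln (1 + x \<bullet> x) / 2"
        by (subst ln_sqrt) (simp_all add: power2_norm_eq_inner add.commute add_nonneg_pos)
      then have l: "l \<le> psi x" unfolding l_def psi_def using psi_ge(3)[of x] by (intro power_mono) auto
      have "\<bar>w t x\<bar> = \<bar>w t x\<bar> * exp (- A * l) * exp (A * l)" by (simp add: mult.assoc flip: exp_add)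
      also have "\<dots> \<le> \<epsilon> * exp (A * psi x)"
        using R[OF tx] l A(1) \<epsilon> unfolding l_def[symmetric] by (intro mult_mono) auto
      finally show "\<bar>w t x\<bar> \<le> \<epsilon> * exp (A * psi x)" .
    qed
  qed
  then show ?thesis using A(1) by blast
qed

lemma usc_set_mult_pos:
  fixes f g :: "'a::metric_space \<Rightarrow> real"
  assumes f: "usc_set C f" and g: "continuous_on C g" "\<And>p. p \<in> C \<Longrightarrow> g p > 0"
  shows "usc_set C (\<lambda>p. f p * g p)"
  unfolding usc_set_def
proof (intro ballI allI impI)
  fix p and e :: real assume p: "p \<in> C" and e: "e > 0"
  define e' where "e' = e / (2 * g p)"
  have e': "e' > 0" "e' * g p = e / 2" using e g(2)[OF p] by (simp_all add: e'_def)
  obtain d1 where d1: "d1 > 0" "\<And>q. q \<in> C \<Longrightarrow> dist q p < d1 \<Longrightarrow> f q < f p + e'"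
    using usc_setD[OF f p e'(1)] by blast
  have "usc_set C (\<lambda>q. (f p + e') * g q)" by (intro continuous_imp_usc_set continuous_intros g(1))
  then obtain d2 where d2: "d2 > 0" "\<And>q. q \<in> C \<Longrightarrow> dist q p < d2 \<Longrightarrow> (f p + e') * g q < (f p + e') * g p + e / 2"
    using usc_setD[of C "\<lambda>q. (f p + e') * g q" p "e / 2"] p half_gt_zero[OF e] by blast
  show "\<exists>\<delta>>0. \<forall>q\<in>C. dist q p < \<delta> \<longrightarrow> f q * g q < f p * g p + e"
  proof (intro exI[of _ "min d1 d2"] conjI ballI impI)
    fix q assume q: "q \<in> C" "dist q p < min d1 d2"
    have "f q * g q < (f p + e') * g q" using d1(2)[of q] q g(2)[of q] by (intro mult_strict_right_mono) auto
    also have "\<dots> < (f p + e') * g p + e / 2" using d2(2) q by simp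
    also have "\<dots> = f p * g p + e" using e'(2) by (simp add: distrib_right)
    finally show "f q * g q < f p * g p + e" .
  qed (use d1 d2 in simp)
qed

lemma usc_difference:
  assumes "usc_on T u1" "lsc_on T u2"
  shows "usc_set ({0..T} \<times> UNIV) (\<lambda>p. u1 (fst p) (snd p) - u2 (fst p) (snd p))"
proof -
  have "usc_set ({0..T} \<times> UNIV) (\<lambda>p. u1 (fst p) (snd p))"
    using assms(1) unfolding usc_on_def usc_set_def case_prod_beta .
  moreover have "usc_set ({0..T} \<times> UNIV) (\<lambda>p. - u2 (fst p) (snd p))"
    unfolding usc_set_def
  proof (intro ballI allI impI)
    fix p and e :: real assume "p \<in> {0..T} \<times> (UNIV :: (real^'a) set)" "e > 0"
    then obtain \<delta> where d: "\<delta> > 0" "\<And>q. q \<in> {0..T} \<times> UNIV \<Longrightarrow> dist q p < \<delta> \<Longrightarrow> u2 (fst p) (snd p) - e < u2 (fst q) (snd q)"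
      using assms(2) unfolding lsc_on_def case_prod_beta by meson
    show "\<exists>\<delta>>0. \<forall>q\<in>{0..T} \<times> UNIV. dist q p < \<delta> \<longrightarrow> - u2 (fst q) (snd q) < - u2 (fst p) (snd p) + e"
    proof (intro exI[of _ \<delta>] conjI ballI impI)
      fix q assume "q \<in> {0..T} \<times> (UNIV :: (real^'a) set)" "dist q p < \<delta>"
      then show "- u2 (fst q) (snd q) < - u2 (fst p) (snd p) + e" using d(2)[of q] by simp
    qed (rule d(1))
  qed
  ultimately have "usc_set ({0..T} \<times> UNIV) (\<lambda>p. u1 (fst p) (snd p) + - u2 (fst p) (snd p))" by (rule usc_set_add)
  then show ?thesis by simp
qed

text \<open>A positive value of \<open>u1 - u2\<close> makes the ratio of \<open>u1 - u2\<close> to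
  the barrier positive somewhere. Near infinity the ratio is small by subcritical growth, near
  \<open>t0\<close> by the blow-up of the barrier, and at time \<open>s\<close> it is at most zero
  by \<open>end_le\<close>; so its maximum over a suitable compact set is attained only at
  relatively interior points, and \<open>doubling_contradiction\<close> applies.\<close>

lemma local_comparison:
  fixes u1 u2 :: "real \<Rightarrow> real^'n \<Rightarrow> real"
  assumes reg: "regular_coeffs T U V b \<sigma> f K Lc"
    and sub: "visc_subsolution T U V b \<sigma> f \<Phi> h h' u1" and super: "visc_supersolution T U V b \<sigma> f \<Phi> h h' u2"
    and hc: "continuous_on ({0..T} \<times> UNIV) (\<lambda>p. h (fst p) (snd p))"
    and hc': "continuous_on ({0..T} \<times> UNIV) (\<lambda>p. h' (fst p) (snd p))"
    and A: "A \<ge> 1" "subcritical A T u1" "subcritical A T u2"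
    and c: "c > 7 * K\<^sup>2 + 4 * K + 4 * Lc * K + Lc" and c0: "c > 0"
    and s: "0 < s" "s \<le> T" and end_le: "\<And>x. u1 s x \<le> u2 s x"
    and t1: "0 \<le> t1" "t1 \<le> s" "s - 1 / (c * A) < t1"
  shows "u1 t1 x1 \<le> u2 t1 x1"
proof (rule ccontr)
  assume neg: "\<not> u1 t1 x1 \<le> u2 t1 x1"
  \<comment> \<open>On the interval from \<open>t0\<close> to \<open>s\<close> the exponent
    \<open>1 / (c * (t - t0))\<close> is then at least \<open>A\<close>, with equality at
    \<open>s\<close>, so the barrier dominates \<open>exp (A * psi x)\<close> throughout.\<close>
  define t0 where "t0 = s - 1 / (c * A)"
  define dif where "dif p = u1 (fst p) (snd p) - u2 (fst p) (snd p)" for p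
  let ?\<chi> = "barrier c t0"
  define D where "D p \<longleftrightarrow> 0 \<le> fst p \<and> fst p \<le> s \<and> t0 < fst p" for p :: "real \<times> (real^'n)"
  have aA: "A \<le> 1 / (c * (fst p - t0))" if "D p" for p
  proof -
    have "c * (fst p - t0) \<le> c * (1 / (c * A))" using that c0 by (intro mult_left_mono) (auto simp: D_def t0_def)
    also have "\<dots> = 1 / A" using c0 A(1) by simp
    finally have "1 / (1 / A) \<le> 1 / (c * (fst p - t0))"
      using that c0 A(1) by (intro divide_left_mono) (auto simp: D_def)
    then show ?thesis by simp
  qed
  have \<chi>_ge: "exp (A * psi (snd p)) \<le> ?\<chi> p" if "D p" for p
  proof -
    have "A * psi (snd p) \<le> (1 / (c * (fst p - t0))) * psi (snd p)"
      using aA[OF that] psi_ge(1)[of "snd p"] by (intro mult_right_mono) auto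
    then show ?thesis by (simp add: barrier_def)
  qed
  have usc: "usc_set ({0..T} \<times> UNIV) dif"
    unfolding dif_def using sub super
    by (intro usc_difference) (auto simp: visc_subsolution_def visc_supersolution_def)
  have T0: "0 \<in> {0..T}" using s by simp
  obtain R0 where R0: "\<And>t x. t \<in> {0..T} \<Longrightarrow> norm x \<ge> R0 \<Longrightarrow> \<bar>u1 t x\<bar> \<le> 1 * exp (A * psi x) \<and> \<bar>u2 t x\<bar> \<le> 1 * exp (A * psi x)"
  proof -
    obtain Ra where Ra: "\<forall>t\<in>{0..T}. \<forall>x. norm x \<ge> Ra \<longrightarrow> \<bar>u1 t x\<bar> \<le> 1 * exp (A * psi x)"
      using A(2) unfolding subcritical_def by (meson zero_less_one)
    obtain Rb where Rb: "\<forall>t\<in>{0..T}. \<forall>x. norm x \<ge> Rb \<longrightarrow> \<bar>u2 t x\<bar> \<le> 1 * exp (A * psi x)"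
      using A(3) unfolding subcritical_def by (meson zero_less_one)
    show thesis by (rule that[of "max Ra Rb"]) (use Ra Rb in auto)
  qed
  have "compact ({0..T} \<times> cball (0::real^'n) (max R0 0))" "{0..T} \<times> cball (0::real^'n) (max R0 0) \<noteq> {}"
    using T0 by (auto intro!: compact_Times)
  from usc_set_attains_sup[OF this usc_set_subset[OF usc Sigma_mono]]
  obtain pm where pm: "\<And>p. p \<in> {0..T} \<times> cball 0 (max R0 0) \<Longrightarrow> dif p \<le> dif pm" by blast
  define M1 where "M1 = dif pm"
  have M1: "dif p \<le> M1" if "fst p \<in> {0..T}" "norm (snd p) \<le> max R0 0" for p
    using pm[of p] that by (simp add: mem_Times_iff M1_def)
  define M0 where "M0 = max 2 M1"
  have M0: "M0 > 0" by (simp add: M0_def)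
  have dif_le: "dif p \<le> M0 * exp (A * psi (snd p))" if "fst p \<in> {0..T}" for p
  proof (cases "norm (snd p) \<ge> R0")
    case True
    have "dif p \<le> 2 * exp (A * psi (snd p))"
      using R0[OF that True] unfolding dif_def by (simp add: abs_le_iff)
    also have "\<dots> \<le> M0 * exp (A * psi (snd p))" by (intro mult_right_mono) (auto simp: M0_def)
    finally show ?thesis .
  next
    case False
    then have "dif p \<le> M1" using M1[OF that] by simp
    also have "\<dots> \<le> M0 * 1" by (simp add: M0_def)
    also have "\<dots> \<le> M0 * exp (A * psi (snd p))"
      using M0 A(1) psi_ge(1)[of "snd p"] by (intro mult_left_mono) auto
    finally show ?thesis .
  qed
  have D1: "D (t1, x1)" using t1 by (simp add: D_def t0_def)
  \<comment> \<open>The ratio at the alleged counterexample. Regions where the ratio is at most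
    \<open>\<rho>1 / 4\<close> cannot contain a maximiser and are discarded.\<close>
  define \<rho>1 where "\<rho>1 = dif (t1, x1) / ?\<chi> (t1, x1)"
  have \<rho>1: "\<rho>1 > 0" using neg barrier_pos[of c t0 "(t1, x1)"] by (simp add: \<rho>1_def dif_def)
  obtain R where R: "\<And>p. D p \<Longrightarrow> norm (snd p) \<ge> R \<Longrightarrow> dif p \<le> \<rho>1 / 4 * ?\<chi> p"
  proof -
    have e: "\<rho>1 / 8 > 0" using \<rho>1 by simp
    obtain Ra where Ra: "\<forall>t\<in>{0..T}. \<forall>x. norm x \<ge> Ra \<longrightarrow> \<bar>u1 t x\<bar> \<le> \<rho>1 / 8 * exp (A * psi x)"
      using A(2) e unfolding subcritical_def by meson
    obtain Rb where Rb: "\<forall>t\<in>{0..T}. \<forall>x. norm x \<ge> Rb \<longrightarrow> \<bar>u2 t x\<bar> \<le> \<rho>1 / 8 * exp (A * psi x)"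
      using A(3) e unfolding subcritical_def by meson
    have far: "dif p \<le> \<rho>1 / 4 * ?\<chi> p" if "D p" "norm (snd p) \<ge> max Ra Rb" for p
    proof -
      have "fst p \<in> {0..T}" using that(1) s by (auto simp: D_def)
      then have "\<bar>u1 (fst p) (snd p)\<bar> \<le> \<rho>1 / 8 * exp (A * psi (snd p))" "\<bar>u2 (fst p) (snd p)\<bar> \<le> \<rho>1 / 8 * exp (A * psi (snd p))"
        using Ra Rb that(2) by auto
      then have "dif p \<le> \<rho>1 / 4 * exp (A * psi (snd p))" unfolding dif_def by (simp add: abs_le_iff)
      also have "\<dots> \<le> \<rho>1 / 4 * ?\<chi> p" using \<chi>_ge[OF that(1)] \<rho>1 by (intro mult_left_mono) auto
      finally show ?thesis .
    qed
    show thesis by (rule that[of "max Ra Rb"]) (rule far)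
  qed
  \<comment> \<open>Before time \<open>t0 + \<tau>\<close> the exponent is at least
    \<open>A + lnM\<close>. As \<open>psi\<close> is at least 1, the barrier then exceeds
    \<open>exp (A * psi x)\<close> by a factor of at least \<open>4 * M0 / \<rho>1\<close>, which
    pushes the ratio below \<open>\<rho>1 / 4\<close>; the absolute value keeps
    \<open>\<tau>\<close> positive.\<close>
  define lnM where "lnM = \<bar>ln (4 * M0 / \<rho>1)\<bar>"
  define \<tau> where "\<tau> = 1 / (c * (A + lnM))"
  have \<tau>: "\<tau> > 0" using c0 A(1) by (simp add: \<tau>_def lnM_def add_pos_nonneg)
  have early: "dif p \<le> \<rho>1 / 4 * ?\<chi> p" if Dp: "D p" and "fst p \<le> t0 + \<tau>" for p
  proof -
    define a where "a = 1 / (c * (fst p - t0))"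
    have "c * (fst p - t0) \<le> c * \<tau>" using that c0 by (intro mult_left_mono) auto
    also have "\<dots> = 1 / (A + lnM)" using c0 by (simp add: \<tau>_def)
    finally have "1 / (1 / (A + lnM)) \<le> a"
      unfolding a_def using Dp c0 A(1) by (intro divide_left_mono) (auto simp: D_def lnM_def add_pos_nonneg)
    then have a: "A + lnM \<le> a" by simp
    have "(A - a) * psi (snd p) \<le> (A - a) * 1"
      using a psi_ge(1)[of "snd p"] by (intro mult_left_mono_neg) (auto simp: lnM_def)
    also have "\<dots> \<le> - ln (4 * M0 / \<rho>1)" using a by (simp add: lnM_def)
    also have "\<dots> = ln (\<rho>1 / (4 * M0))" using M0 \<rho>1 by (simp add: ln_div)
    finally have "exp ((A - a) * psi (snd p)) \<le> \<rho>1 / (4 * M0)"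
      using M0 \<rho>1 by (simp add: ln_ge_iff[symmetric] ln_exp)
    then have "M0 * exp ((A - a) * psi (snd p)) \<le> \<rho>1 / 4" using M0 by (simp add: field_simps)
    moreover have "M0 * exp (A * psi (snd p)) = (M0 * exp ((A - a) * psi (snd p))) * ?\<chi> p"
      by (simp add: barrier_def a_def mult.assoc algebra_simps flip: exp_add)
    moreover have "dif p \<le> M0 * exp (A * psi (snd p))" using Dp s by (intro dif_le) (auto simp: D_def)
    moreover have "(M0 * exp ((A - a) * psi (snd p))) * ?\<chi> p \<le> \<rho>1 / 4 * ?\<chi> p"
      using calculation(1) barrier_pos[of c t0 p] by (intro mult_right_mono) auto
    ultimately show ?thesis by linarith
  qed
  have inner: "t0 + \<tau> < fst p \<and> norm (snd p) < R" if "D p" "dif p > \<rho>1 / 4 * ?\<chi> p" for p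
    using that early[OF that(1)] R[OF that(1)] by force
  \<comment> \<open>The set is larger than the region left by \<open>inner\<close>, by
    \<open>\<tau> / 2\<close> in time and by 1 in space. These margins, together with the exclusion
    of time \<open>s\<close>, make touching points relatively interior; the cut at time 0 is
    harmless because \<open>relint\<close> only tests times in \<open>{0..T}\<close>.\<close>
  define C where "C = {max 0 (t0 + \<tau> / 2)..s} \<times> cball (0::real^'n) (R + 1)"
  have C: "compact C" unfolding C_def by (intro compact_Times compact_Icc compact_cball)
  have CD: "D p" if "p \<in> C" for p using that \<tau> by (auto simp: C_def D_def)
  have CT: "C \<subseteq> {0..T} \<times> UNIV" using s by (auto simp: C_def)
  have "dif (t1, x1) = \<rho>1 * ?\<chi> (t1, x1)" using barrier_pos[of c t0 "(t1, x1)"] by (simp add: \<rho>1_def)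
  also have "\<dots> > \<rho>1 / 4 * ?\<chi> (t1, x1)" using \<rho>1 barrier_pos[of c t0 "(t1, x1)"] by (intro mult_strict_right_mono) auto
  finally have "t0 + \<tau> < t1 \<and> norm x1 < R" using inner[OF D1] by simp
  then have C1: "(t1, x1) \<in> C" using t1 \<tau> by (simp add: C_def)
  have \<chi>c: "continuous_on C ?\<chi>" by (rule barrier_continuous[OF c0]) (use CD in \<open>auto simp: D_def\<close>)
  have "usc_set C (\<lambda>p. dif p * inverse (?\<chi> p))"
    by (rule usc_set_mult_pos[OF usc_set_subset[OF usc CT]])
      (auto intro!: continuous_intros \<chi>c simp: barrier_pos less_imp_neq[OF barrier_pos, symmetric])
  from usc_set_attains_sup[OF C _ this] obtain p0 where p0: "p0 \<in> C" "\<And>p. p \<in> C \<Longrightarrow> dif p * inverse (?\<chi> p) \<le> dif p0 * inverse (?\<chi> p0)"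
    using C1 by blast
  define \<kappa> where "\<kappa> = dif p0 * inverse (?\<chi> p0) / 2"
  have \<kappa>2: "2 * \<kappa> = dif p0 * inverse (?\<chi> p0)" by (simp add: \<kappa>_def)
  have \<kappa>\<rho>: "2 * \<kappa> \<ge> \<rho>1" using p0(2)[OF C1] unfolding \<kappa>2 \<rho>1_def by (simp add: divide_inverse)
  have \<kappa>: "\<kappa> > 0" using \<kappa>\<rho> \<rho>1 by simp
  have below: "dif p \<le> 2 * \<kappa> * ?\<chi> p" if "p \<in> C" for p
  proof -
    have "dif p = (dif p * inverse (?\<chi> p)) * ?\<chi> p" using barrier_pos[of c t0 p] by simp
    also have "\<dots> \<le> (2 * \<kappa>) * ?\<chi> p" unfolding \<kappa>2 using p0(2)[OF that] barrier_pos[of c t0 p] by (intro mult_right_mono) auto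
    finally show ?thesis by simp
  qed
  have touch: "dif p0 = 2 * \<kappa> * ?\<chi> p0" unfolding \<kappa>2 using barrier_pos[of c t0 p0] by simp
  interpret doubling T U V b \<sigma> f K Lc \<Phi> h h' u1 u2 c t0 \<kappa> C p0
  proof (intro doubling.intro reg doubling_axioms.intro sub super C CT p0(1) c \<kappa>)
    show "t0 < fst p" if "p \<in> C" for p using CD[OF that] by (simp add: D_def)
    show "1 \<le> 1 / (c * (fst p - t0))" if "p \<in> C" for p using aA[OF CD[OF that]] A(1) by simp
    show "u1 (fst p) (snd p) - u2 (fst p) (snd p) \<le> 2 * \<kappa> * ?\<chi> p" if "p \<in> C" for p using below[OF that] by (simp add: dif_def)
    show "u1 (fst p0) (snd p0) - u2 (fst p0) (snd p0) = 2 * \<kappa> * ?\<chi> p0" using touch by (simp add: dif_def)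
  qed
  show False
  proof (rule doubling_contradiction[OF hc hc'])
    fix p assume p: "p \<in> C" and eq: "u1 (fst p) (snd p) - u2 (fst p) (snd p) = 2 * \<kappa> * ?\<chi> p"
    have pos: "?\<chi> p > 0" by (rule barrier_pos)
    have "dif p > \<rho>1 / 4 * ?\<chi> p"
    proof -
      have "\<rho>1 / 4 * ?\<chi> p < (2 * \<kappa>) * ?\<chi> p" using \<kappa>\<rho> \<rho>1 pos by (intro mult_strict_right_mono) auto
      then show ?thesis using eq by (simp add: dif_def)
    qed
    from inner[OF CD[OF p] this] have in1: "t0 + \<tau> < fst p" "norm (snd p) < R" by auto
    have "fst p \<noteq> s"
    proof
      assume "fst p = s"
      then have "2 * \<kappa> * ?\<chi> p \<le> 0" using eq end_le[of "snd p"] by simp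
      moreover have "2 * \<kappa> * ?\<chi> p > 0" using \<kappa> pos by simp
      ultimately show False by simp
    qed
    then have ps: "fst p < s" using CD[OF p] by (simp add: D_def)
    have "relint p"
      unfolding relint_def
    proof (intro exI[of _ "min 1 (min (\<tau> / 2) (s - fst p))"] conjI allI impI)
      show "min 1 (min (\<tau> / 2) (s - fst p)) > 0" using \<tau> ps by simp
      fix p' assume a: "0 \<le> fst p'" "fst p' \<le> T" "dist p' p < min 1 (min (\<tau> / 2) (s - fst p))"
      have d: "dist (fst p') (fst p) < min 1 (min (\<tau> / 2) (s - fst p))" "dist (snd p') (snd p) < 1"
        using a(3) dist_fst_le[of p' p] dist_snd_le[of p' p] by simp_all
      have "norm (snd p') \<le> norm (snd p) + norm (snd p' - snd p)" by (rule norm_triangle_sub)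
      then have "norm (snd p') \<le> R + 1" using d(2) in1(2) by (simp add: dist_norm)
      moreover have "\<bar>fst p' - fst p\<bar> < \<tau> / 2" "\<bar>fst p' - fst p\<bar> < s - fst p" using d(1) by (simp_all add: dist_real_def)
      then have "fst p' \<le> s" "t0 + \<tau> / 2 \<le> fst p'" using in1(1) by argo+
      ultimately show "p' \<in> C" using a(1) by (simp add: C_def mem_Times_iff)
    qed
    then show "fst p < T \<and> relint p" using ps s by simp
  qed
qed

text \<open>Backward induction from the terminal time. The constant \<open>c\<close> depends on the
  coefficients and \<open>A\<close> on the growth of the two functions, so the step length is the
  same at every stage and finitely many steps reach time 0.\<close>

lemma comparison:
  fixes u1 u2 :: "real \<Rightarrow> real^'n \<Rightarrow> real"
  assumes st: "standing_assumptions T U V b \<sigma> f \<Phi> h h'"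
    and u1: "u1 \<in> Theta T" and sub: "visc_subsolution T U V b \<sigma> f \<Phi> h h' u1"
    and u2: "u2 \<in> Theta T" and super: "visc_supersolution T U V b \<sigma> f \<Phi> h h' u2"
    and t: "t \<in> {0..T}"
  shows "u1 t x \<le> u2 t x"
proof -
  obtain K Lc where reg: "regular_coeffs T U V b \<sigma> f K Lc" using standing_regular[OF st] by blast
  have "\<exists>L. \<forall>t\<in>{0..T}. \<forall>x x'. \<bar>h t x - h t x'\<bar> \<le> L * dist x x' \<and> \<bar>h' t x - h' t x'\<bar> \<le> L * dist x x'"
    and hct: "\<And>x. continuous_on {0..T} (\<lambda>t. h t x)" "\<And>x. continuous_on {0..T} (\<lambda>t. h' t x)"
    using st unfolding standing_assumptions_def by blast+
  then obtain L where L: "\<And>t x x'. t \<in> {0..T} \<Longrightarrow> \<bar>h t x - h t x'\<bar> \<le> L * dist x x'"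
    "\<And>t x x'. t \<in> {0..T} \<Longrightarrow> \<bar>h' t x - h' t x'\<bar> \<le> L * dist x x'" by metis
  note hc = continuous_on_time_Lipschitz[OF hct(1) L(1)] continuous_on_time_Lipschitz[OF hct(2) L(2)]
  obtain A1 where A1: "A1 > 0" "subcritical A1 T u1" using Theta_subcritical[OF u1] by blast
  obtain A2 where A2: "A2 > 0" "subcritical A2 T u2" using Theta_subcritical[OF u2] by blast
  define A where "A = max 1 (max A1 A2)"
  have A: "A \<ge> 1" "subcritical A T u1" "subcritical A T u2"
    using subcritical_mono[OF A1(2), of A] subcritical_mono[OF A2(2), of A] by (auto simp: A_def)
  define c where "c = 7 * K\<^sup>2 + 4 * K + 4 * Lc * K + Lc + 1"
  have KL: "K \<ge> 1" "Lc \<ge> 0" using reg by (auto simp: regular_coeffs_def)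
  have c: "c > 7 * K\<^sup>2 + 4 * K + 4 * Lc * K + Lc" "c > 0"
    using KL by (simp_all add: c_def add_nonneg_pos)
  \<comment> \<open>Half of the admissible length, because \<open>local_comparison\<close> needs the
    strict inequality \<open>s - 1 / (c * A) < t1\<close>.\<close>
  define \<tau> where "\<tau> = 1 / (2 * (c * A))"
  have \<tau>: "\<tau> > 0" "2 * \<tau> = 1 / (c * A)" using c A(1) by (simp_all add: \<tau>_def)
  have terminal: "u1 T x \<le> u2 T x" for x
    using sub super unfolding visc_subsolution_def visc_supersolution_def by (meson order_trans)
  have "\<forall>t. 0 \<le> t \<longrightarrow> t \<le> T \<longrightarrow> T - real n * \<tau> \<le> t \<longrightarrow> (\<forall>x. u1 t x \<le> u2 t x)" for n
  proof (induction n)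
    case 0
    then show ?case using terminal by (auto dest: antisym)
  next
    case (Suc n)
    show ?case
    proof (intro allI impI)
      fix t x assume t: "0 \<le> t" "t \<le> T" "T - real (Suc n) * \<tau> \<le> t"
      define s where "s = T - real n * \<tau>"
      show "u1 t x \<le> u2 t x"
      proof (cases "s \<le> t")
        case True
        then show ?thesis using Suc t by (simp add: s_def)
      next
        case False
        have s: "0 < s" "s \<le> T" using False t \<tau> by (auto simp: s_def)
        have "u1 s y \<le> u2 s y" for y using Suc s by (simp add: s_def)
        moreover have "s - 1 / (c * A) < t" using t(3) \<tau> unfolding \<tau>(2)[symmetric] s_def by (simp add: algebra_simps)
        ultimately show ?thesis
          using local_comparison[OF reg sub super hc A c s _ t(1)] False by simp
      qed
    qed
  qed
  moreover obtain n :: nat where "T / \<tau> < real n" using reals_Archimedean2 by blast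
  then have "T - real n * \<tau> \<le> t" using \<tau> t by (simp add: divide_less_eq)
  ultimately show ?thesis using t by auto
qed

theorem theorem5p1:
  fixes T :: real and U :: "'u::metric_space set" and V :: "'v::metric_space set"
    and b :: "real \<Rightarrow> real^'n \<Rightarrow> 'u \<Rightarrow> 'v \<Rightarrow> real^'n"
    and \<sigma> :: "real \<Rightarrow> real^'n \<Rightarrow> 'u \<Rightarrow> 'v \<Rightarrow> real^'d^'n"
    and f :: "real \<Rightarrow> real^'n \<Rightarrow> real \<Rightarrow> real^'d \<Rightarrow> 'u \<Rightarrow> 'v \<Rightarrow> real"
    and \<Phi> :: "real^'n \<Rightarrow> real"
    and h h' u1 u2 :: "real \<Rightarrow> real^'n \<Rightarrow> real"
  assumes "standing_assumptions T U V b \<sigma> f \<Phi> h h'"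
    and "u1 \<in> Theta T" and "visc_subsolution T U V b \<sigma> f \<Phi> h h' u1"
    and "u2 \<in> Theta T" and "visc_supersolution T U V b \<sigma> f \<Phi> h h' u2"
  shows "(\<forall>t\<in>{0..T}. \<forall>x. u1 t x \<le> u2 t x) \<and>
         (\<forall>w1 w2. w1 \<in> Theta T \<and> w2 \<in> Theta T \<and>
            visc_solution T U V b \<sigma> f \<Phi> h h' w1 \<and> visc_solution T U V b \<sigma> f \<Phi> h h' w2
            \<longrightarrow> (\<forall>t\<in>{0..T}. \<forall>x. w1 t x = w2 t x))"
proof (intro conjI ballI allI impI)
  show "u1 t x \<le> u2 t x" if "t \<in> {0..T}" for t x
    using comparison[OF assms that] .
  fix w1 w2 :: "real \<Rightarrow> real^'n \<Rightarrow> real" and t x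
  assume w: "w1 \<in> Theta T \<and> w2 \<in> Theta T \<and>
    visc_solution T U V b \<sigma> f \<Phi> h h' w1 \<and> visc_solution T U V b \<sigma> f \<Phi> h h' w2" and t: "t \<in> {0..T}"
  show "w1 t x = w2 t x"
    using w comparison[OF assms(1) _ _ _ _ t, of w1 w2 x] comparison[OF assms(1) _ _ _ _ t, of w2 w1 x]
    by (auto simp: visc_solution_def intro: antisym)
qed

end
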